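(* Let $\psi_0\in H^1(\mathbb{R}^3)$ and let $\psi(t,x)=(U(t,0)\psi_0)(x)$ be the solution of the charge transfer model with initial data $\psi_0$. Then $$\sup_{t\in\mathbb{R}}\|U(t,0)\psi_0\|_{H^1}\le C\|\psi_0\|_{H^1},$$ with a finite constant $C$ independent of $\psi_0$.
   Context: Setting (charge transfer model with two potentials in $\mathbb{R}^3$). Let $\vec{e}_1=(1,0,0)$. Let $V_1,V_2:\mathbb{R}^3\to\mathbb{R}$ be real-valued, smooth, time-independent potentials that decay exponentially (or have compact support). Put $H_j=-\frac12\Delta+V_j$, $j=1,2$, and assume that $0$ is neither an eigenvalue nor a resonance of $H_1$ and of $H_2$. Here $\psi$ is a resonance at $0$ of $H_j$ if it is a distributional solution of $H_j\psi=0$ with $\langle x\rangle^{-\sigma}\psi\in L^2$ for every $\sigma>\frac12$, but not for $\sigma=0$; $\langle x\rangle=(1+|x|^2)^{1/2}$. The charge transfer model is the equation $$\frac1i\partial_t\psi-\frac12\Delta\psi+V_1\psi+V_2(\cdot-t\vec{e}_1)\psi=0 .$$ $U(t,\tau)$ denotes its evolution operator on $L^2(\mathbb{R}^3)$: $\psi(t)=U(t,\tau)\phi$ is the solution with $\psi(\tau)=\phi$. *)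

theory Defs
  imports "HOL-Analysis.Analysis"
begin

section \<open>Smooth functions and test functions\<close>

definition partial :: "3 \<Rightarrow> (real^3 \<Rightarrow> 'b::real_normed_vector) \<Rightarrow> real^3 \<Rightarrow> 'b" where
  "partial i f x = frechet_derivative f (at x) (axis i 1)"

primrec C_class :: "nat \<Rightarrow> (real^3 \<Rightarrow> 'b::real_normed_vector) \<Rightarrow> bool" where
  "C_class 0 f \<longleftrightarrow> continuous_on UNIV f"
| "C_class (Suc k) f \<longleftrightarrow> f differentiable_on UNIV \<and> (\<forall>i. C_class k (partial i f))"

definition smooth :: "(real^3 \<Rightarrow> 'b::real_normed_vector) \<Rightarrow> bool" where
  "smooth f \<longleftrightarrow> (\<forall>k. C_class k f)"

definition compact_support :: "(real^3 \<Rightarrow> 'b::real_normed_vector) \<Rightarrow> bool" where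
  "compact_support f \<longleftrightarrow> compact (closure {x. f x \<noteq> 0})"

definition test_function :: "(real^3 \<Rightarrow> complex) \<Rightarrow> bool" where
  "test_function \<phi> \<longleftrightarrow> smooth \<phi> \<and> compact_support \<phi>"

definition laplacian :: "(real^3 \<Rightarrow> complex) \<Rightarrow> real^3 \<Rightarrow> complex" where
  "laplacian \<phi> x = (\<Sum>i\<in>UNIV. partial i (partial i \<phi>) x)"

section \<open>Lebesgue and Sobolev spaces\<close>

text \<open>Elements of these spaces are represented by functions; all notions below are
  invariant under changes on Lebesgue null sets.\<close>

definition L2 :: "(real^3 \<Rightarrow> complex) set" where
  "L2 = {f. f \<in> borel_measurable lebesgue \<and> integrable lebesgue (\<lambda>x. (cmod (f x))\<^sup>2)}"

definition L2_norm :: "(real^3 \<Rightarrow> complex) \<Rightarrow> real" where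
  "L2_norm f = sqrt (LINT x|lebesgue. (cmod (f x))\<^sup>2)"

definition is_weak_partial ::
  "3 \<Rightarrow> (real^3 \<Rightarrow> complex) \<Rightarrow> (real^3 \<Rightarrow> complex) \<Rightarrow> bool" where
  "is_weak_partial i f g \<longleftrightarrow> (\<forall>\<phi>. test_function \<phi> \<longrightarrow>
     (LINT x|lebesgue. f x * partial i \<phi> x) = - (LINT x|lebesgue. g x * \<phi> x))"

text \<open>The choice below is unique up to Lebesgue null sets whenever it exists.\<close>

definition weak_partial :: "3 \<Rightarrow> (real^3 \<Rightarrow> complex) \<Rightarrow> real^3 \<Rightarrow> complex" where
  "weak_partial i f = (SOME g. g \<in> L2 \<and> is_weak_partial i f g)"

definition H1 :: "(real^3 \<Rightarrow> complex) set" where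
  "H1 = {f \<in> L2. \<forall>i. \<exists>g\<in>L2. is_weak_partial i f g}"

definition H1_norm :: "(real^3 \<Rightarrow> complex) \<Rightarrow> real" where
  "H1_norm f = sqrt ((L2_norm f)\<^sup>2 + (\<Sum>i\<in>UNIV. (L2_norm (weak_partial i f))\<^sup>2))"

definition H2 :: "(real^3 \<Rightarrow> complex) set" where
  "H2 = {f \<in> H1. \<forall>i. weak_partial i f \<in> H1}"

section \<open>Potentials, eigenvalues and resonances\<close>

definition exponentially_decaying :: "(real^3 \<Rightarrow> real) \<Rightarrow> bool" where
  "exponentially_decaying V \<longleftrightarrow> (\<exists>C. \<exists>c>0. \<forall>x. \<bar>V x\<bar> \<le> C * exp (- c * norm x))"

text \<open>The operator $-\frac12\Delta + V$ on its domain \<open>H2\<close>.\<close>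

definition schroedinger_op ::
  "(real^3 \<Rightarrow> real) \<Rightarrow> (real^3 \<Rightarrow> complex) \<Rightarrow> real^3 \<Rightarrow> complex" where
  "schroedinger_op V \<psi> x =
     - (1/2) * (\<Sum>i\<in>UNIV. weak_partial i (weak_partial i \<psi>) x) + of_real (V x) * \<psi> x"

definition is_eigenvalue :: "(real^3 \<Rightarrow> real) \<Rightarrow> complex \<Rightarrow> bool" where
  "is_eigenvalue V z \<longleftrightarrow> (\<exists>\<psi>\<in>H2. \<not> (AE x in lebesgue. \<psi> x = 0) \<and>
     (AE x in lebesgue. schroedinger_op V \<psi> x = z * \<psi> x))"

definition distributional_null_solution ::
  "(real^3 \<Rightarrow> real) \<Rightarrow> (real^3 \<Rightarrow> complex) \<Rightarrow> bool" where
  "distributional_null_solution V \<psi> \<longleftrightarrow>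
     (\<forall>K. compact K \<longrightarrow> set_integrable lebesgue K \<psi>) \<and>
     (\<forall>\<phi>. test_function \<phi> \<longrightarrow>
        (LINT x|lebesgue. \<psi> x * (- (1/2) * laplacian \<phi> x + of_real (V x) * \<phi> x)) = 0)"

definition japanese_bracket :: "real^3 \<Rightarrow> real" where
  "japanese_bracket x = (1 + (norm x)\<^sup>2) powr (1/2)"

definition is_zero_resonance :: "(real^3 \<Rightarrow> real) \<Rightarrow> (real^3 \<Rightarrow> complex) \<Rightarrow> bool" where
  "is_zero_resonance V \<psi> \<longleftrightarrow> distributional_null_solution V \<psi> \<and>
     (\<forall>\<sigma>>1/2. (\<lambda>x. of_real (japanese_bracket x powr (- \<sigma>)) * \<psi> x) \<in> L2) \<and>
     \<psi> \<notin> L2"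

section \<open>The charge transfer model\<close>

definition e1 :: "real^3" where
  "e1 = vector [1, 0, 0]"

text \<open>Solutions on \<open>L2\<close>: $\psi \in C(\mathbb{R}; L^2)$ and the equation holds in the sense of
  distributions in space, i.e. all spatial derivatives are moved to the test function and
  the pairing of $\psi(t)$ with each test function is differentiable in $t$. As $\psi$ is
  continuous in $t$, this is the same as the equation holding in the sense of distributions
  in space-time.\<close>

definition charge_transfer_solution ::
  "(real^3 \<Rightarrow> real) \<Rightarrow> (real^3 \<Rightarrow> real) \<Rightarrow> (real \<Rightarrow> real^3 \<Rightarrow> complex) \<Rightarrow> bool" where
  "charge_transfer_solution V1 V2 \<psi> \<longleftrightarrow>
     (\<forall>t. \<psi> t \<in> L2) \<and>
     (\<forall>t. ((\<lambda>s. L2_norm (\<lambda>x. \<psi> s x - \<psi> t x)) \<longlongrightarrow> 0) (at t)) \<and>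
     (\<forall>\<phi>. test_function \<phi> \<longrightarrow> (\<forall>t. \<exists>D.
        ((\<lambda>s. LINT x|lebesgue. \<psi> s x * \<phi> x) has_vector_derivative D) (at t) \<and>
        (1 / \<i>) * D
          - (1/2) * (LINT x|lebesgue. \<psi> t x * laplacian \<phi> x)
          + (LINT x|lebesgue. of_real (V1 x) * \<psi> t x * \<phi> x)
          + (LINT x|lebesgue. of_real (V2 (x - t *\<^sub>R e1)) * \<psi> t x * \<phi> x) = 0))"

text \<open>The evolution operator $U(t,\tau)$. For bounded potentials the solution exists and, for
  each \<open>t\<close>, is unique up to Lebesgue null sets.\<close>

definition evolution ::
  "(real^3 \<Rightarrow> real) \<Rightarrow> (real^3 \<Rightarrow> real) \<Rightarrow> real \<Rightarrow> real \<Rightarrow> (real^3 \<Rightarrow> complex) \<Rightarrow> real^3 \<Rightarrow> complex"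
  where
  "evolution V1 V2 t \<tau> \<phi> = (SOME \<psi>. charge_transfer_solution V1 V2 \<psi> \<and> \<psi> \<tau> = \<phi>) t"

end

theory Submission imports Defs begin

text \<open>
Why the \<open>H\<^sup>1\<close> norm stays bounded: there is an energy that controls it and is almost nonincreasing. The energy
\<open>H(t)\<close> of the system is not conserved, because the second potential moves. But a potential that moves
with velocity \<open>v\<close> conserves \<open>H - v p\<close>, where \<open>p = - \<i> \<partial>\<^sub>1\<close> is the momentum in the direction of motion; \<open>v\<close> has to
be 0 near the potential at rest and 1 near the moving one. At time \<open>t\<close> their distance is \<open>t\<close>, which leaves room
to let \<open>v\<close> be a slowly varying, nondecreasing function of \<open>z = x\<^sub>1 / (1 + t)\<close> that rises from 0 at \<open>z = 0\<close> to 1 at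
\<open>z = 1\<close>. With \<open>g' = z v'\<close> the quantity \<open>K\<close>, the expectation of

  \<open>H(t) - (v p + p v) / 2 + g\<close>,

has a derivative whose free part is

  \<open>- 1 / (1 + t) * \<langle>(p - z) v' (p - z)\<rangle> + O((1 + t)\<^sup>-\<^sup>2) \<le> O((1 + t)\<^sup>-\<^sup>2)\<close>,

because \<open>v\<close> is nondecreasing; the choice of \<open>g\<close> completes the square, which vanishes for free motion \<open>p = z\<close> from
the origin. The potentials enter through \<open>v V1\<close>, \<open>(1 - v) V2\<close> and \<open>v' V\<close> for both potentials. Since \<open>v\<close>, \<open>1 - v\<close> and \<open>v'\<close> vanish
quadratically at the respective ends and \<open>(1 + \<bar>x\<bar>)\<^sup>2 \<bar>V(x)\<bar>\<close> is bounded, all these are \<open>O((1 + t)\<^sup>-\<^sup>2)\<close> as well. This is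
integrable in time, the \<open>L\<^sup>2\<close> norm is conserved, and Gronwall's inequality gives the bound for positive times.
Reversing time together with the direction of motion gives it for negative times.

To make the computation legitimate for all data in \<open>H\<^sup>1\<close>, the potential \<open>V\<close> is replaced by \<open>R V R\<close>, where \<open>R\<close> averages over
translations of size at most \<open>h\<close>. As \<open>R\<close> commutes with derivatives and with the free evolution, the regularised
solution has all derivatives that occur, and the only new terms are commutators of \<open>R\<close> with \<open>v\<close>, \<open>v'\<close> and \<open>g\<close>. They are
\<open>O(h)\<close>, so over the time interval \<open>[0, t]\<close> they cost only a factor \<open>exp (O(h t))\<close>, which is harmless for
\<open>h \<le> 1 / t\<close>. This is \<open>regularised_energy_estimate\<close>, obtained from \<open>D_le\<close> and \<open>D_bound\<close>. For \<open>h \<longlongrightarrow> 0\<close> the regularised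
solutions converge in \<open>L\<^sup>2\<close> (\<open>regularised_convergence\<close>), and bounds on derivatives survive the limit by weak
compactness (\<open>gen_weak_limit\<close>).

Solutions are understood in the sense of distributions. That they are nevertheless unique, and
equal to the solution constructed in the interaction picture, is \<open>evolution_mild\<close>: a smoothed distributional
solution solves an equation with bounded operators (\<open>weak_imp_mild\<close>). The analysis rests on a Hilbert space of
classes of functions, on the translation groups, whose generators are the weak derivatives
(\<open>is_weak_partial_iff_gen\<close>), and on the free group, which is the limit of the groups generated by difference
Laplacians (\<open>U_derivative\<close>).
\<close>


section \<open>The Hilbert space of square-integrable functions\<close>

lemma L2_measurable: "f \<in> L2 \<Longrightarrow> f \<in> borel_measurable lebesgue"
  by (simp add: L2_def)

lemma L2_square_integrable: "f \<in> L2 \<Longrightarrow> integrable lebesgue (\<lambda>x. (cmod (f x))\<^sup>2)"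
  by (simp add: L2_def)

lemma L2_add: assumes "f \<in> L2" "g \<in> L2" shows "(\<lambda>x. f x + g x) \<in> L2"
proof -
  have [measurable]: "f \<in> borel_measurable lebesgue" "g \<in> borel_measurable lebesgue"
    using assms by (auto simp: L2_def)
  have "integrable lebesgue (\<lambda>x. (cmod (f x + g x))\<^sup>2)"
  proof (rule Bochner_Integration.integrable_bound)
    show "integrable lebesgue (\<lambda>x. 2 * (cmod (f x))\<^sup>2 + 2 * (cmod (g x))\<^sup>2)"
      using assms by (auto simp: L2_def)
    have "(cmod (f x + g x))\<^sup>2 \<le> 2 * (cmod (f x))\<^sup>2 + 2 * (cmod (g x))\<^sup>2" for x
    proof -
      have "(cmod (f x + g x))\<^sup>2 \<le> (cmod (f x) + cmod (g x))\<^sup>2"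
        by (intro power_mono norm_triangle_ineq) auto
      also have "\<dots> \<le> 2 * (cmod (f x))\<^sup>2 + 2 * (cmod (g x))\<^sup>2"
        using sum_squares_bound[of "cmod (f x)" "cmod (g x)"] by (simp add: power2_sum)
      finally show ?thesis .
    qed
    then show "AE x in lebesgue. norm ((cmod (f x + g x))\<^sup>2) \<le> norm (2 * (cmod (f x))\<^sup>2 + 2 * (cmod (g x))\<^sup>2)"
      by (auto simp: abs_of_nonneg)
  qed measurable
  then show ?thesis by (auto simp: L2_def)
qed

lemma L2_bounded_mult:
  assumes "f \<in> L2" "m \<in> borel_measurable lebesgue" "\<And>x. cmod (m x) \<le> B"
  shows "(\<lambda>x. m x * f x) \<in> L2"
proof -
  have [measurable]: "f \<in> borel_measurable lebesgue" "m \<in> borel_measurable lebesgue"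
    using assms by (auto simp: L2_def)
  have "integrable lebesgue (\<lambda>x. (cmod (m x * f x))\<^sup>2)"
  proof (rule Bochner_Integration.integrable_bound)
    show "integrable lebesgue (\<lambda>x. B\<^sup>2 * (cmod (f x))\<^sup>2)"
      using assms by (auto simp: L2_def)
    have "(cmod (m x * f x))\<^sup>2 \<le> B\<^sup>2 * (cmod (f x))\<^sup>2" for x
      unfolding norm_mult power_mult_distrib
      by (intro mult_right_mono power_mono assms) auto
    then show "AE x in lebesgue. norm ((cmod (m x * f x))\<^sup>2) \<le> norm (B\<^sup>2 * (cmod (f x))\<^sup>2)"
      by (auto simp: abs_of_nonneg)
  qed measurable
  then show ?thesis by (auto simp: L2_def)
qed

lemma L2_cmult: "f \<in> L2 \<Longrightarrow> (\<lambda>x. c * f x) \<in> L2"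
  by (rule L2_bounded_mult[where m = "\<lambda>_. c" and B = "cmod c"]) auto

lemma L2_zero: "(\<lambda>x. 0) \<in> L2"
  by (auto simp: L2_def)

lemma L2_diff: "f \<in> L2 \<Longrightarrow> g \<in> L2 \<Longrightarrow> (\<lambda>x. f x - g x) \<in> L2"
  using L2_add[of f "\<lambda>x. (-1) * g x"] L2_cmult[of g "-1"] by simp

lemma L2_cnj: "f \<in> L2 \<Longrightarrow> (\<lambda>x. cnj (f x)) \<in> L2"
  by (auto simp: L2_def intro!: borel_measurable_continuous_on[where f=cnj, OF continuous_on_cnj[OF continuous_on_id]])

lemma L2_mult_integrable:
  assumes "f \<in> L2" "g \<in> L2" shows "integrable lebesgue (\<lambda>x. f x * g x)"
proof (rule Bochner_Integration.integrable_bound)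
  have [measurable]: "f \<in> borel_measurable lebesgue" "g \<in> borel_measurable lebesgue"
    using assms by (auto simp: L2_def)
  show "(\<lambda>x. f x * g x) \<in> borel_measurable lebesgue" by measurable
  show "integrable lebesgue (\<lambda>x. (cmod (f x))\<^sup>2 + (cmod (g x))\<^sup>2)"
    using assms by (auto simp: L2_def)
  have "cmod (f x * g x) \<le> (cmod (f x))\<^sup>2 + (cmod (g x))\<^sup>2" for x
    using sum_squares_bound[of "cmod (f x)" "cmod (g x)"]
      mult_nonneg_nonneg[OF norm_ge_zero norm_ge_zero, of "f x" "g x"]
    unfolding norm_mult by linarith
  then show "AE x in lebesgue. norm (f x * g x) \<le> norm ((cmod (f x))\<^sup>2 + (cmod (g x))\<^sup>2)"
    by (auto simp: abs_of_nonneg)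
qed

text \<open>Two functions that agree almost everywhere satisfy the same specification and therefore receive the same
  representative. The space of classes is thus the set of functions fixed by this choice, and every class
  comes with an actual function \<open>fn\<close> on which pointwise operations can be performed.\<close>

definition ae_repr :: "(real^3 \<Rightarrow> complex) \<Rightarrow> real^3 \<Rightarrow> complex" where
  "ae_repr f = (SOME g. g \<in> L2 \<and> (AE x in lebesgue. g x = f x))"

lemma ae_repr:
  assumes "f \<in> L2"
  shows "ae_repr f \<in> L2" "AE x in lebesgue. ae_repr f x = f x"
proof -
  have "\<exists>g. g \<in> L2 \<and> (AE x in lebesgue. g x = f x)" using assms by auto
  from someI_ex[OF this] show "ae_repr f \<in> L2" "AE x in lebesgue. ae_repr f x = f x"
    by (auto simp: ae_repr_def)
qed

lemma ae_repr_cong: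
  assumes "AE x in lebesgue. f x = g x"
  shows "ae_repr f = ae_repr g"
proof -
  have "(AE x in lebesgue. h x = f x) \<longleftrightarrow> (AE x in lebesgue. h x = g x)" for h
    using assms by (metis (mono_tags, lifting) AE_mp AE_I2)
  then show ?thesis by (simp add: ae_repr_def)
qed

typedef l2 = "{f. f \<in> L2 \<and> ae_repr f = f}" morphisms fn mk_l2
proof -
  have "ae_repr (ae_repr (\<lambda>x. 0)) = ae_repr (\<lambda>x. 0)"
    by (rule ae_repr_cong) (rule ae_repr(2)[OF L2_zero])
  then show ?thesis using ae_repr(1)[OF L2_zero] by blast
qed

definition cls :: "(real^3 \<Rightarrow> complex) \<Rightarrow> l2" where
  "cls f = mk_l2 (ae_repr f)"

lemma fn_L2 [simp]: "fn x \<in> L2"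
  using fn[of x] by auto

lemma fn_measurable [measurable]: "fn x \<in> borel_measurable lebesgue"
  by (rule L2_measurable[OF fn_L2])

lemma fn_cls: assumes "f \<in> L2" shows "AE x in lebesgue. fn (cls f) x = f x"
proof -
  have "ae_repr (ae_repr f) = ae_repr f"
    by (rule ae_repr_cong) (rule ae_repr(2)[OF assms])
  then have "fn (cls f) = ae_repr f"
    using ae_repr(1)[OF assms] by (simp add: cls_def mk_l2_inverse)
  then show ?thesis using ae_repr(2)[OF assms] by simp
qed

lemma cls_fn [simp]: "cls (fn x) = x"
  using fn[of x] by (simp add: cls_def fn_inverse)

lemma cls_cong: "AE x in lebesgue. f x = g x \<Longrightarrow> cls f = cls g"
  by (simp add: cls_def ae_repr_cong)

lemma l2_eqI: "AE t in lebesgue. fn x t = fn y t \<Longrightarrow> x = y"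
  by (metis cls_cong cls_fn)

instantiation l2 :: real_vector
begin
definition "zero_l2 = cls (\<lambda>t. 0)"
definition "plus_l2 x y = cls (\<lambda>t. fn x t + fn y t)"
definition "uminus_l2 x = cls (\<lambda>t. - fn x t)"
definition "minus_l2 x y = cls (\<lambda>t. fn x t - fn y t)"
definition "scaleR_l2 r x = cls (\<lambda>t. of_real r * fn x t)"

lemma fn_zero: "AE t in lebesgue. fn 0 t = 0"
  unfolding zero_l2_def by (rule fn_cls[OF L2_zero])
lemma fn_plus: "AE t in lebesgue. fn (x + y) t = fn x t + fn y t"
  unfolding plus_l2_def by (rule fn_cls) (simp add: L2_add)
lemma fn_uminus: "AE t in lebesgue. fn (- x) t = - fn x t"
  unfolding uminus_l2_def by (rule fn_cls) (use L2_cmult[of "fn x" "-1"] in simp)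
lemma fn_minus: "AE t in lebesgue. fn (x - y) t = fn x t - fn y t"
  unfolding minus_l2_def by (rule fn_cls) (simp add: L2_diff)
lemma fn_scaleR: "AE t in lebesgue. fn (r *\<^sub>R x) t = of_real r * fn x t"
  unfolding scaleR_l2_def by (rule fn_cls) (simp add: L2_cmult)

instance
proof
  fix a b c x y :: l2 and r s :: real
  show "a + b + c = a + (b + c)"
    using fn_plus[of "a+b" c] fn_plus[of a b] fn_plus[of a "b+c"] fn_plus[of b c]
    by (intro l2_eqI, eventually_elim) simp
  show "a + b = b + a"
    using fn_plus[of a b] fn_plus[of b a] by (intro l2_eqI, eventually_elim) simp
  show "0 + a = a"
    using fn_plus[of 0 a] fn_zero by (intro l2_eqI, eventually_elim) simp
  show "- a + a = 0"
    using fn_plus[of "-a" a] fn_zero fn_uminus[of a] by (intro l2_eqI, eventually_elim) simp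
  show "a - b = a + - b"
    using fn_plus[of a "-b"] fn_minus[of a b] fn_uminus[of b] by (intro l2_eqI, eventually_elim) simp
  show "r *\<^sub>R (x + y) = r *\<^sub>R x + r *\<^sub>R y"
    using fn_plus[of "r *\<^sub>R x" "r *\<^sub>R y"] fn_plus[of x y] fn_scaleR[of r x] fn_scaleR[of r y] fn_scaleR[of r "x+y"]
    by (intro l2_eqI, eventually_elim) (simp add: algebra_simps)
  show "(r + s) *\<^sub>R x = r *\<^sub>R x + s *\<^sub>R x"
    using fn_plus[of "r *\<^sub>R x" "s *\<^sub>R x"] fn_scaleR[of r x] fn_scaleR[of s x] fn_scaleR[of "r+s" x]
    by (intro l2_eqI, eventually_elim) (simp add: algebra_simps)
  show "r *\<^sub>R s *\<^sub>R x = (r * s) *\<^sub>R x"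
    using fn_scaleR[of r "s *\<^sub>R x"] fn_scaleR[of s x] fn_scaleR[of "r * s" x]
    by (intro l2_eqI, eventually_elim) (simp add: algebra_simps)
  show "1 *\<^sub>R x = x"
    using fn_scaleR[of 1 x] by (intro l2_eqI, eventually_elim) simp
qed
end

lemma cls_add: "f \<in> L2 \<Longrightarrow> g \<in> L2 \<Longrightarrow> cls (\<lambda>t. f t + g t) = cls f + cls g"
  using fn_plus[of "cls f" "cls g"] fn_cls[of f] fn_cls[of g] fn_cls[of "\<lambda>t. f t + g t"] L2_add[of f g]
  by (intro l2_eqI) (auto elim: AE_mp)

lemma cls_diff: "f \<in> L2 \<Longrightarrow> g \<in> L2 \<Longrightarrow> cls (\<lambda>t. f t - g t) = cls f - cls g"
  using fn_minus[of "cls f" "cls g"] fn_cls[of f] fn_cls[of g] fn_cls[of "\<lambda>t. f t - g t"] L2_diff[of f g]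
  by (intro l2_eqI) (auto elim: AE_mp)

lemma L2_inner_integrable:
  assumes "f \<in> L2" "g \<in> L2" shows "integrable lebesgue (\<lambda>x. Re (f x * cnj (g x)))"
  using L2_mult_integrable[OF assms(1) L2_cnj[OF assms(2)]] by (rule integrable_Re)

instantiation l2 :: real_inner
begin
definition "inner_l2 x y = (LINT t|lebesgue. Re (fn x t * cnj (fn y t)))"
definition "norm_l2 (x::l2) = sqrt (inner x x)"
definition "sgn_l2 (x::l2) = x /\<^sub>R norm x"
definition "dist_l2 (x::l2) y = norm (x - y)"
definition "uniformity_l2 = (INF e\<in>{0<..}. principal {(x::l2, y). dist x y < e})"
definition "open_l2 (S::l2 set) = (\<forall>x\<in>S. \<forall>\<^sub>F (x', y) in uniformity. x' = x \<longrightarrow> y \<in> S)"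

instance
proof
  fix x y z :: l2 and r :: real and S :: "l2 set"
  show "dist x y = norm (x - y)" by (rule dist_l2_def)
  show "sgn x = x /\<^sub>R norm x" by (rule sgn_l2_def)
  show "uniformity = (INF e\<in>{0<..}. principal {(x::l2, y). dist x y < e})" by (rule uniformity_l2_def)
  show "open S = (\<forall>x\<in>S. \<forall>\<^sub>F (x', y) in uniformity. x' = x \<longrightarrow> y \<in> S)" by (rule open_l2_def)
  show "norm x = sqrt (inner x x)" by (rule norm_l2_def)
  show "inner x y = inner y x" by (simp add: inner_l2_def mult.commute)
  have i: "integrable lebesgue (\<lambda>t. Re (fn x t * cnj (fn y t)))" for x y
    by (rule L2_inner_integrable) auto
  have "inner (x + y) z = (LINT t|lebesgue. Re (fn x t * cnj (fn z t)) + Re (fn y t * cnj (fn z t)))"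
    unfolding inner_l2_def
    by (rule integral_cong_AE) (use fn_plus[of x y] in \<open>auto simp: algebra_simps elim: AE_mp\<close>)
  then show "inner (x + y) z = inner x z + inner y z"
    using i[of x z] i[of y z] by (simp add: inner_l2_def)
  have "inner (r *\<^sub>R x) y = (LINT t|lebesgue. r * Re (fn x t * cnj (fn y t)))"
    unfolding inner_l2_def
    by (rule integral_cong_AE) (use fn_scaleR[of r x] in \<open>auto simp: algebra_simps elim: AE_mp\<close>)
  then show "inner (r *\<^sub>R x) y = r * inner x y"
    by (simp add: inner_l2_def)
  show "0 \<le> inner x x"
    unfolding inner_l2_def by (intro integral_nonneg_AE) (auto simp: complex_mult_cnj)
  show "inner x x = 0 \<longleftrightarrow> x = 0"
  proof
    assume "inner x x = 0"
    then have "AE t in lebesgue. Re (fn x t * cnj (fn x t)) = 0"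
      unfolding inner_l2_def
      using integral_nonneg_eq_0_iff_AE[OF i[of x x]] by (auto simp: complex_mult_cnj)
    then show "x = 0"
      using fn_zero by (intro l2_eqI, eventually_elim) (auto simp: complex_eq_iff sum_power2_eq_zero_iff simp flip: power2_eq_square)
  next
    assume "x = 0"
    have "inner (0 *\<^sub>R 0) (0::l2) = 0 * inner 0 (0::l2)"
      unfolding inner_l2_def
      by (subst integral_cong_AE[where g = "\<lambda>t. 0"]) (use fn_zero in \<open>auto elim: AE_mp\<close>)
    with \<open>x = 0\<close> show "inner x x = 0" by simp
  qed
qed
end

lemma inner_cls:
  assumes "f \<in> L2" "g \<in> L2"
  shows "inner (cls f) (cls g) = (LINT t|lebesgue. Re (f t * cnj (g t)))"
proof -
  have [measurable]: "f \<in> borel_measurable lebesgue" "g \<in> borel_measurable lebesgue"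
    using assms by (auto simp: L2_def)
  have [measurable]: "(\<lambda>t. cnj (g t)) \<in> borel_measurable lebesgue"
    using L2_cnj[OF assms(2)] by (simp add: L2_def)
  show ?thesis unfolding inner_l2_def
    by (rule integral_cong_AE) (use fn_cls[OF assms(1)] fn_cls[OF assms(2)] in \<open>auto elim: AE_mp\<close>)
qed

lemma norm_cls: "f \<in> L2 \<Longrightarrow> norm (cls f) = L2_norm f"
  by (simp add: norm_l2_def inner_cls L2_norm_def complex_mult_cnj cmod_power2)

lemma norm_l2_nn_integral:
  "(\<integral>\<^sup>+ t. ennreal ((cmod (fn x t))\<^sup>2) \<partial>lebesgue) = ennreal ((norm x)\<^sup>2)"
proof -
  have "(norm x)\<^sup>2 = (LINT t|lebesgue. (cmod (fn x t))\<^sup>2)"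
    using norm_cls[of "fn x"] by (simp add: L2_norm_def)
  then show ?thesis
    by (subst nn_integral_eq_integral) (auto simp: L2_square_integrable)
qed


lemma norm_l2_square: "(norm x)\<^sup>2 = (LINT t|lebesgue. (cmod (fn x t))\<^sup>2)"
  using norm_cls[of "fn x"] by (simp add: L2_norm_def)

lemma L2_of_abs: "f \<in> L2 \<Longrightarrow> (\<lambda>t. complex_of_real (cmod (f t))) \<in> L2"
  by (auto simp: L2_def)

lemma L2_sum: "(\<And>k. k \<in> K \<Longrightarrow> f k \<in> L2) \<Longrightarrow> (\<lambda>t. \<Sum>k\<in>K. f k t) \<in> L2"
  by (induction K rule: infinite_finite_induct) (auto simp: L2_zero L2_add)

lemma cls_sum: "finite K \<Longrightarrow> (\<And>k. k \<in> K \<Longrightarrow> f k \<in> L2) \<Longrightarrow> cls (\<lambda>t. \<Sum>k\<in>K. f k t) = (\<Sum>k\<in>K. cls (f k))"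
  by (induction K rule: finite_induct) (auto simp: zero_l2_def cls_add L2_sum)

text \<open>Riesz and Fischer: a subsequence whose consecutive distances are at most \<open>(1/2)^n\<close> has a square-integrable
  majorant \<open>\<Sum>n. \<bar>d n\<bar>\<close>, so it converges almost everywhere, and the tail of the majorant bounds the distance to
  the pointwise limit.\<close>

lemma l2_Cauchy_convergent:
  assumes "Cauchy (X :: nat \<Rightarrow> l2)" shows "convergent X"
proof -
  have "\<exists>r. strict_mono r \<and> (\<forall>n. \<forall>p\<ge>r n. \<forall>q\<ge>r n. dist (X p) (X q) < (1/2)^n)"
  proof -
    have ex: "\<exists>N. \<forall>p\<ge>N. \<forall>q\<ge>N. dist (X p) (X q) < (1/2)^n" for n
      using metric_CauchyD[OF assms, of "(1/2)^n"] by auto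
    obtain f where f: "\<forall>p\<ge>f n. \<forall>q\<ge>f n. dist (X p) (X q) < (1/2)^n" for n
      using ex by metis
    define r where "r n = n + (\<Sum>k\<le>n. f k)" for n
    have "strict_mono r" by (rule strict_monoI_Suc) (simp add: r_def)
    moreover have "f n \<le> r n" for n
      unfolding r_def by (rule order_trans[OF member_le_sum[of n "{..n}" f]]) auto
    ultimately show ?thesis using f by (meson order_trans)
  qed
  then obtain r where r: "strict_mono r" "\<And>n p q. p \<ge> r n \<Longrightarrow> q \<ge> r n \<Longrightarrow> dist (X p) (X q) < (1/2)^n"
    by blast
  define Y where "Y n = X (r n)" for n
  have Yd: "norm (Y m - Y n) \<le> (1/2)^n" if "m \<ge> n" for m n
    using r(2)[of n "r m" "r n"] that strict_mono_less_eq[OF r(1)] by (auto simp: Y_def dist_norm)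
  define d where "d n = fn (Y (Suc n) - Y n)" for n
  have dL: "d n \<in> L2" for n by (simp add: d_def)
  have [measurable]: "d n \<in> borel_measurable lebesgue" for n by (simp add: d_def)
  define G where "G N t = (\<Sum>n<N. cmod (d n t))" for N t
  have [measurable]: "G N \<in> borel_measurable lebesgue" for N by (simp add: G_def[abs_def])
  have GL: "(\<lambda>t. complex_of_real (G N t)) \<in> L2" for N
    unfolding G_def of_real_sum by (intro L2_sum L2_of_abs dL)
  have Gn: "(\<integral>\<^sup>+ t. ennreal ((G N t)\<^sup>2) \<partial>lebesgue) \<le> 4" for N
  proof -
    have "cls (\<lambda>t. complex_of_real (G N t)) = (\<Sum>n<N. cls (\<lambda>t. complex_of_real (cmod (d n t))))"
      unfolding G_def of_real_sum by (rule cls_sum) (auto intro: L2_of_abs dL)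
    then have "norm (cls (\<lambda>t. complex_of_real (G N t))) \<le> (\<Sum>n<N. norm (cls (\<lambda>t. complex_of_real (cmod (d n t)))))"
      by (simp add: sum_norm_le)
    also have "\<dots> \<le> (\<Sum>n<N. (1/2)^n)"
    proof (rule sum_mono)
      fix n
      have "norm (cls (\<lambda>t. complex_of_real (cmod (d n t)))) = norm (cls (d n))"
        by (simp add: norm_cls L2_of_abs dL L2_norm_def)
      also have "\<dots> = norm (Y (Suc n) - Y n)" by (simp add: d_def)
      finally show "norm (cls (\<lambda>t. complex_of_real (cmod (d n t)))) \<le> (1/2)^n"
        using Yd[of n "Suc n"] by simp
    qed
    also have "\<dots> = ((1/2)^N - 1) / (1/2 - 1 :: real)" by (rule geometric_sum) simp
    also have "\<dots> = 2 - 2 * (1/2)^N" by (simp add: algebra_simps)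
    also have "\<dots> \<le> 2" by simp
    finally have *: "norm (cls (\<lambda>t. complex_of_real (G N t))) \<le> 2" .
    have "(\<integral>\<^sup>+ t. ennreal ((G N t)\<^sup>2) \<partial>lebesgue) = ennreal (LINT t|lebesgue. (G N t)\<^sup>2)"
      using L2_square_integrable[OF GL[of N]] by (subst nn_integral_eq_integral) auto
    also have "(LINT t|lebesgue. (G N t)\<^sup>2) = (norm (cls (\<lambda>t. complex_of_real (G N t))))\<^sup>2"
      by (simp add: norm_cls GL L2_norm_def)
    also have "\<dots> \<le> 2\<^sup>2" by (intro power_mono *) auto
    finally show ?thesis by (simp add: ennreal_leI flip: ennreal_numeral)
  qed
  have "(\<integral>\<^sup>+ t. (SUP N. ennreal ((G N t)\<^sup>2)) \<partial>lebesgue) \<le> 4"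
  proof (subst nn_integral_monotone_convergence_SUP)
    show "incseq (\<lambda>N t. ennreal ((G N t)\<^sup>2))"
      by (rule incseq_SucI) (auto simp: le_fun_def G_def intro!: ennreal_leI power_mono sum_nonneg)
    show "(SUP N. \<integral>\<^sup>+ t. ennreal ((G N t)\<^sup>2) \<partial>lebesgue) \<le> 4" by (rule SUP_least) (rule Gn)
  qed measurable
  then have "(\<integral>\<^sup>+ t. (SUP N. ennreal ((G N t)\<^sup>2)) \<partial>lebesgue) \<noteq> \<infinity>"
    by (auto simp: top_unique)
  from nn_integral_PInf_AE[OF _ this]
  have fin: "AE t in lebesgue. (SUP N. ennreal ((G N t)\<^sup>2)) \<noteq> \<infinity>" by simp
  have summ: "AE t in lebesgue. summable (\<lambda>n. d n t)"
    using fin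
  proof eventually_elim
    case (elim t)
    then obtain b where b: "(SUP N. ennreal ((G N t)\<^sup>2)) = ennreal b" "b \<ge> 0"
      by (cases "SUP N. ennreal ((G N t)\<^sup>2)") auto
    have "(G N t)\<^sup>2 \<le> b" for N
    proof -
      have "ennreal ((G N t)\<^sup>2) \<le> ennreal b" unfolding b(1)[symmetric] by (rule SUP_upper) simp
      then show ?thesis using b(2) by (simp add: ennreal_le_iff)
    qed
    then have "G N t \<le> sqrt b" for N by (simp add: real_le_rsqrt)
    then have "summable (\<lambda>n. cmod (d n t))"
      by (intro summableI_nonneg_bounded[where x = "sqrt b"]) (auto simp: G_def)
    then show ?case by (rule summable_norm_cancel)
  qed
  have "AE t in lebesgue. \<forall>n. d n t = fn (Y (Suc n)) t - fn (Y n) t"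
    unfolding d_def by (subst AE_all_countable) (auto intro: fn_minus)
  with summ have conv: "AE t in lebesgue. convergent (\<lambda>n. fn (Y n) t)"
  proof eventually_elim
    case (elim t)
    then have "summable (\<lambda>n. fn (Y (Suc n)) t - fn (Y n) t)" by simp
    then have "convergent (\<lambda>N. \<Sum>n<N. fn (Y (Suc n)) t - fn (Y n) t)"
      by (simp add: summable_iff_convergent)
    moreover have "(\<Sum>n<N. fn (Y (Suc n)) t - fn (Y n) t) = fn (Y N) t - fn (Y 0) t" for N
      by (induction N) auto
    ultimately have "convergent (\<lambda>N. fn (Y N) t - fn (Y 0) t)" by simp
    then show ?case using convergent_diff_const_right_iff[of "\<lambda>N. fn (Y N) t"] by blast
  qed
  define F where "F t = lim (\<lambda>n. fn (Y n) t)" for t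
  have [measurable]: "F \<in> borel_measurable lebesgue"
    unfolding F_def[abs_def] by measurable
  have lim: "AE t in lebesgue. (\<lambda>n. fn (Y n) t) \<longlonglongrightarrow> F t"
    using conv by eventually_elim (simp add: F_def convergent_LIMSEQ_iff)
  have est: "(\<integral>\<^sup>+ t. ennreal ((cmod (F t - fn (Y n) t))\<^sup>2) \<partial>lebesgue) \<le> ennreal (((1/2)^n)\<^sup>2)" for n
  proof -
    have "(\<integral>\<^sup>+ t. ennreal ((cmod (F t - fn (Y n) t))\<^sup>2) \<partial>lebesgue)
        = (\<integral>\<^sup>+ t. liminf (\<lambda>m. ennreal ((cmod (fn (Y m) t - fn (Y n) t))\<^sup>2)) \<partial>lebesgue)"
    proof (rule nn_integral_cong_AE)
      show "AE t in lebesgue. ennreal ((cmod (F t - fn (Y n) t))\<^sup>2) = liminf (\<lambda>m. ennreal ((cmod (fn (Y m) t - fn (Y n) t))\<^sup>2))"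
        using lim
      proof eventually_elim
        case (elim t)
        have "(\<lambda>m. ennreal ((cmod (fn (Y m) t - fn (Y n) t))\<^sup>2)) \<longlonglongrightarrow> ennreal ((cmod (F t - fn (Y n) t))\<^sup>2)"
          by (intro tendsto_intros elim)
        from lim_imp_Liminf[OF _ this] show ?case by simp
      qed
    qed
    also have "\<dots> \<le> liminf (\<lambda>m. \<integral>\<^sup>+ t. ennreal ((cmod (fn (Y m) t - fn (Y n) t))\<^sup>2) \<partial>lebesgue)"
      by (rule nn_integral_liminf) measurable
    also have "\<dots> = liminf (\<lambda>m. ennreal ((norm (Y m - Y n))\<^sup>2))"
    proof (intro arg_cong[where f = liminf] ext)
      fix m
      show "(\<integral>\<^sup>+ t. ennreal ((cmod (fn (Y m) t - fn (Y n) t))\<^sup>2) \<partial>lebesgue) = ennreal ((norm (Y m - Y n))\<^sup>2)"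
        unfolding norm_l2_nn_integral[symmetric]
        by (rule nn_integral_cong_AE, rule AE_mp[OF fn_minus[of "Y m" "Y n"]]) auto
    qed
    also have "\<dots> \<le> ennreal (((1/2)^n)\<^sup>2)"
    proof (rule Liminf_le)
      show "\<forall>\<^sub>F m in sequentially. ennreal ((norm (Y m - Y n))\<^sup>2) \<le> ennreal (((1/2)^n)\<^sup>2)"
        using eventually_ge_at_top[of n]
        by eventually_elim (intro ennreal_leI power_mono Yd, auto)
    qed simp
    finally show ?thesis .
  qed
  have FdL: "(\<lambda>t. F t - fn (Y n) t) \<in> L2" for n
  proof -
    have "integrable lebesgue (\<lambda>t. (cmod (F t - fn (Y n) t))\<^sup>2)"
    proof (rule integrableI_bounded)
      show "(\<integral>\<^sup>+ t. ennreal (norm ((cmod (F t - fn (Y n) t))\<^sup>2)) \<partial>lebesgue) < \<infinity>"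
        using est[of n] by (simp add: le_less_trans[OF _ ennreal_less_top])
    qed measurable
    then show ?thesis by (simp add: L2_def)
  qed
  have FL: "F \<in> L2" using L2_add[OF FdL[of 0] fn_L2[of "Y 0"]] by simp
  have "norm (Y n - cls F) \<le> (1/2)^n" for n
  proof -
    have "cls F - Y n = cls (\<lambda>t. F t - fn (Y n) t)"
      using cls_diff[OF FL fn_L2[of "Y n"]] by simp
    then have "(norm (cls F - Y n))\<^sup>2 = (LINT t|lebesgue. (cmod (F t - fn (Y n) t))\<^sup>2)"
      by (simp add: norm_cls FdL L2_norm_def)
    also have "ennreal \<dots> = (\<integral>\<^sup>+ t. ennreal ((cmod (F t - fn (Y n) t))\<^sup>2) \<partial>lebesgue)"
      using L2_square_integrable[OF FdL[of n]] by (subst nn_integral_eq_integral) auto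
    finally have "ennreal ((norm (cls F - Y n))\<^sup>2) \<le> ennreal (((1/2)^n)\<^sup>2)" using est[of n] by simp
    then have "(norm (cls F - Y n))\<^sup>2 \<le> ((1/2)^n)\<^sup>2" by (subst (asm) ennreal_le_iff) auto
    then have "norm (cls F - Y n) \<le> (1/2)^n" by (rule power2_le_imp_le) simp
    then show ?thesis by (simp add: norm_minus_commute)
  qed
  then have "(\<lambda>n. Y n - cls F) \<longlonglongrightarrow> 0"
    by (intro Lim_null_comparison[OF always_eventually LIMSEQ_realpow_zero[of "1/2"]]) auto
  then have "(X \<circ> r) \<longlonglongrightarrow> cls F"
    using Lim_null[of Y "cls F"] by (simp add: o_def Y_def[abs_def])
  from Cauchy_converges_subseq[OF assms r(1) this] show ?thesis by (auto simp: convergent_def)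
qed

instance l2 :: complete_space
  by standard (rule l2_Cauchy_convergent)
instance l2 :: banach ..

section \<open>Operators\<close>

text \<open>The space is treated as a real Hilbert space with a complex structure: \<open>J\<close> is multiplication by \<open>\<i>\<close>, and
  the inner product is the real part of the complex one. Symmetric operators commuting with \<open>J\<close> are the
  complex-linear symmetric ones. The predicate \<open>bounded_mult\<close> describes the real functions whose
  multiplication operator \<open>Mul\<close> has norm at most \<open>B\<close>.\<close>

definition J :: "l2 \<Rightarrow> l2" where "J x = cls (\<lambda>t. \<i> * fn x t)"
definition shift :: "real^3 \<Rightarrow> l2 \<Rightarrow> l2" where "shift a x = cls (\<lambda>t. fn x (t + a))"
definition bounded_mult :: "(real^3 \<Rightarrow> real) \<Rightarrow> real \<Rightarrow> bool" where
  "bounded_mult m B \<longleftrightarrow> m \<in> borel_measurable lebesgue \<and> (\<forall>x. \<bar>m x\<bar> \<le> B)"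
definition Mul :: "(real^3 \<Rightarrow> real) \<Rightarrow> l2 \<Rightarrow> l2" where "Mul m x = cls (\<lambda>t. of_real (m t) * fn x t)"

lemma measurable_add_lebesgue [measurable]: "(\<lambda>x::real^3. x + a) \<in> lebesgue \<rightarrow>\<^sub>M lebesgue"
proof -
  have "(\<lambda>x. a + (\<Sum>j\<in>Basis. (1 * (x \<bullet> j)) *\<^sub>R j)) = (\<lambda>x::real^3. x + a)"
    by (auto simp: euclidean_representation add.commute)
  then show ?thesis using lebesgue_affine_measurable[of "\<lambda>_::real^3. 1" a] by simp
qed

lemma distr_shift_lebesgue: "distr lebesgue lebesgue (\<lambda>x::real^3. x + a) = lebesgue"
proof -
  have e: "(\<lambda>x. a + (\<Sum>j\<in>Basis. (1 * (x \<bullet> j)) *\<^sub>R j)) = (\<lambda>x::real^3. x + a)"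
    by (auto simp: euclidean_representation add.commute)
  have "lebesgue = density (distr lebesgue lebesgue (\<lambda>x::real^3. x + a)) (\<lambda>_. 1)"
    using lebesgue_affine_euclidean[of "\<lambda>_::real^3. 1" a] unfolding e by simp
  then show ?thesis by (simp add: density_1)
qed

lemma AE_shift: "AE x::real^3 in lebesgue. P x \<Longrightarrow> AE x in lebesgue. P (x + a)"
  by (rule AE_distrD[OF measurable_add_lebesgue]) (simp only: distr_shift_lebesgue)

lemma integral_shift:
  fixes f :: "real^3 \<Rightarrow> 'b::{banach, second_countable_topology}"
  assumes "f \<in> borel_measurable lebesgue"
  shows "(LINT x|lebesgue. f (x + a)) = (LINT x|lebesgue. f x)"
  using integral_distr[OF measurable_add_lebesgue assms, of a] by (simp add: distr_shift_lebesgue)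

lemma L2_shift: assumes "f \<in> L2" shows "(\<lambda>x. f (x + a)) \<in> L2"
proof -
  have [measurable]: "f \<in> borel_measurable lebesgue" by (rule L2_measurable[OF assms])
  have "integrable (distr lebesgue lebesgue (\<lambda>x::real^3. x + a)) (\<lambda>x. (cmod (f x))\<^sup>2)"
    unfolding distr_shift_lebesgue using assms by (simp add: L2_def)
  then have "integrable lebesgue (\<lambda>x. (cmod (f (x + a)))\<^sup>2)"
    by (rule integrable_distr[OF measurable_add_lebesgue])
  then show ?thesis by (auto simp: L2_def)
qed

lemma measurable_shift_lebesgue:
  assumes [measurable]: "m \<in> borel_measurable lebesgue"
  shows "(\<lambda>t::real^3. m (t + a)) \<in> borel_measurable lebesgue"
  by measurable

lemma bounded_mult_L2: "bounded_mult m B \<Longrightarrow> f \<in> L2 \<Longrightarrow> (\<lambda>t. of_real (m t) * f t) \<in> L2"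
  by (rule L2_bounded_mult[where B = B]) (auto simp: bounded_mult_def)

lemma fn_J: "AE t in lebesgue. fn (J x) t = \<i> * fn x t"
  unfolding J_def by (rule fn_cls) (simp add: L2_cmult)
lemma fn_shift: "AE t in lebesgue. fn (shift a x) t = fn x (t + a)"
  unfolding shift_def by (rule fn_cls) (simp add: L2_shift)
lemma fn_Mul: "bounded_mult m B \<Longrightarrow> AE t in lebesgue. fn (Mul m x) t = of_real (m t) * fn x t"
  unfolding Mul_def by (rule fn_cls) (simp add: bounded_mult_L2)

lemma J_cls: "f \<in> L2 \<Longrightarrow> J (cls f) = cls (\<lambda>t. \<i> * f t)"
  unfolding J_def by (rule cls_cong, rule AE_mp[OF fn_cls]) auto
lemma shift_cls: "f \<in> L2 \<Longrightarrow> shift a (cls f) = cls (\<lambda>t. f (t + a))"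
  unfolding shift_def by (intro cls_cong AE_shift fn_cls)
lemma Mul_cls: "f \<in> L2 \<Longrightarrow> Mul m (cls f) = cls (\<lambda>t. of_real (m t) * f t)"
  unfolding Mul_def by (rule cls_cong, rule AE_mp[OF fn_cls]) auto

lemma J_add: "J (x + y) = J x + J y"
  using fn_J[of "x+y"] fn_J[of x] fn_J[of y] fn_plus[of x y] fn_plus[of "J x" "J y"]
  by (intro l2_eqI, eventually_elim) (simp add: algebra_simps)
lemma J_scaleR: "J (r *\<^sub>R x) = r *\<^sub>R J x"
  using fn_J[of "r *\<^sub>R x"] fn_J[of x] fn_scaleR[of r x] fn_scaleR[of r "J x"]
  by (intro l2_eqI, eventually_elim) (simp add: algebra_simps)
lemma J_J [simp]: "J (J x) = - x"
  using fn_J[of "J x"] fn_J[of x] fn_uminus[of x]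
  by (intro l2_eqI, eventually_elim) (simp add: algebra_simps)

lemma inner_J_J [simp]: "inner (J x) (J y) = inner x y"
proof -
  have "inner (J x) (J y) = (LINT t|lebesgue. Re ((\<i> * fn x t) * cnj (\<i> * fn y t)))"
    unfolding J_def by (intro inner_cls L2_cmult) auto
  then show ?thesis by (simp add: inner_l2_def)
qed

lemma norm_J [simp]: "norm (J x) = norm x" by (simp add: norm_eq_sqrt_inner)
lemma inner_J_left: "inner (J x) y = - inner x (J y)"
  using inner_J_J[of x "J y"] by (simp add: inner_minus_right)
lemma inner_J_self [simp]: "inner (J x) x = 0" "inner x (J x) = 0"
  using inner_J_left[of x x] by (simp_all add: inner_commute)

lemma bounded_linear_J: "bounded_linear J"
  by (rule bounded_linear_intro[where K = 1]) (auto simp: J_add J_scaleR)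

lemma shift_add: "shift a (x + y) = shift a x + shift a y"
  using fn_shift[of a "x+y"] fn_shift[of a x] fn_shift[of a y] AE_shift[OF fn_plus[of x y], of a] fn_plus[of "shift a x" "shift a y"]
  by (intro l2_eqI, eventually_elim) (simp add: algebra_simps)
lemma shift_scaleR: "shift a (r *\<^sub>R x) = r *\<^sub>R shift a x"
  using fn_shift[of a "r *\<^sub>R x"] fn_shift[of a x] AE_shift[OF fn_scaleR[of r x], of a] fn_scaleR[of r "shift a x"]
  by (intro l2_eqI, eventually_elim) (simp add: algebra_simps)
lemma shift_shift: "shift a (shift b x) = shift (a + b) x"
  using fn_shift[of a "shift b x"] AE_shift[OF fn_shift[of b x], of a] fn_shift[of "a + b" x]
  by (intro l2_eqI, eventually_elim) (simp add: algebra_simps)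
lemma shift_0 [simp]: "shift 0 x = x"
  using fn_shift[of 0 x] by (intro l2_eqI) simp
lemma shift_J: "shift a (J x) = J (shift a x)"
  using fn_shift[of a "J x"] fn_shift[of a x] AE_shift[OF fn_J[of x], of a] fn_J[of "shift a x"]
  by (intro l2_eqI, eventually_elim) simp

lemma inner_shift_shift [simp]: "inner (shift a x) (shift a y) = inner x y"
proof -
  have "inner (shift a x) (shift a y) = (LINT t|lebesgue. Re (fn x (t + a) * cnj (fn y (t + a))))"
    using inner_cls[OF L2_shift[OF fn_L2[of x]] L2_shift[OF fn_L2[of y]]]
    by (simp add: shift_def)
  also have "\<dots> = (LINT t|lebesgue. Re (fn x t * cnj (fn y t)))"
    by (rule integral_shift) (rule borel_measurable_integrable, rule L2_inner_integrable, auto)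
  finally show ?thesis by (simp add: inner_l2_def)
qed

lemma norm_shift [simp]: "norm (shift a x) = norm x" by (simp add: norm_eq_sqrt_inner)
lemma inner_shift_left: "inner (shift a x) y = inner x (shift (- a) y)"
  using inner_shift_shift[of a x "shift (-a) y"] by (simp add: shift_shift)

lemma bounded_linear_shift: "bounded_linear (shift a)"
  by (rule bounded_linear_intro[where K = 1]) (auto simp: shift_add shift_scaleR)

lemma bounded_mult_bound_nonneg: "bounded_mult m B \<Longrightarrow> 0 \<le> B"
  unfolding bounded_mult_def by (meson abs_ge_zero order_trans)

lemma Mul_add: assumes "bounded_mult m B" shows "Mul m (x + y) = Mul m x + Mul m y"
  using fn_Mul[OF assms, of "x+y"] fn_Mul[OF assms, of x] fn_Mul[OF assms, of y] fn_plus[of x y] fn_plus[of "Mul m x" "Mul m y"]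
  by (intro l2_eqI, eventually_elim) (simp add: algebra_simps)
lemma Mul_scaleR: assumes "bounded_mult m B" shows "Mul m (r *\<^sub>R x) = r *\<^sub>R Mul m x"
  using fn_Mul[OF assms, of "r *\<^sub>R x"] fn_Mul[OF assms, of x] fn_scaleR[of r x] fn_scaleR[of r "Mul m x"]
  by (intro l2_eqI, eventually_elim) (simp add: algebra_simps)
lemma Mul_J: assumes "bounded_mult m B" shows "Mul m (J x) = J (Mul m x)"
  using fn_Mul[OF assms, of "J x"] fn_Mul[OF assms, of x] fn_J[of x] fn_J[of "Mul m x"]
  by (intro l2_eqI, eventually_elim) (simp add: algebra_simps)
lemma shift_Mul: assumes "bounded_mult m B" shows "shift a (Mul m x) = Mul (\<lambda>t. m (t + a)) (shift a x)"
proof (rule l2_eqI)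
  have "(\<lambda>t. m (t + a)) \<in> borel_measurable lebesgue"
    using assms unfolding bounded_mult_def by (intro measurable_shift_lebesgue) blast
  then have b: "bounded_mult (\<lambda>t. m (t + a)) B" using assms by (auto simp: bounded_mult_def)
  show "AE t in lebesgue. fn (shift a (Mul m x)) t = fn (Mul (\<lambda>t. m (t + a)) (shift a x)) t"
    using fn_shift[of a "Mul m x"] AE_shift[OF fn_Mul[OF assms, of x], of a] fn_Mul[OF b, of "shift a x"] fn_shift[of a x]
    by eventually_elim simp
qed
lemma bounded_mult_shift: assumes "bounded_mult m B" shows "bounded_mult (\<lambda>t. m (t + a)) B"
  using assms unfolding bounded_mult_def by (auto intro: measurable_shift_lebesgue)
lemma bounded_mult_mult: assumes "bounded_mult m B" "bounded_mult n C" shows "bounded_mult (\<lambda>t. m t * n t) (B * C)"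
  using assms bounded_mult_bound_nonneg[OF assms(1)] by (auto simp: bounded_mult_def abs_mult intro!: mult_mono)
lemma bounded_mult_diff: assumes "bounded_mult m B" "bounded_mult n C" shows "bounded_mult (\<lambda>t. m t - n t) (B + C)"
  using assms unfolding bounded_mult_def by (metis abs_triangle_ineq4 add_mono order_trans borel_measurable_diff)
lemma bounded_mult_cmult: assumes "bounded_mult m B" shows "bounded_mult (\<lambda>t. c * m t) (\<bar>c\<bar> * B)"
  using assms by (auto simp: bounded_mult_def abs_mult intro!: mult_left_mono)
lemma Mul_Mul: assumes "bounded_mult m B" "bounded_mult n C" shows "Mul m (Mul n x) = Mul (\<lambda>t. m t * n t) x"
  using fn_Mul[OF assms(1), of "Mul n x"] fn_Mul[OF assms(2), of x] fn_Mul[OF bounded_mult_mult[OF assms], of x]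
  by (intro l2_eqI, eventually_elim) simp
lemma Mul_minus: assumes "bounded_mult m B" "bounded_mult n C" shows "Mul (\<lambda>t. m t - n t) x = Mul m x - Mul n x"
  using fn_Mul[OF assms(1), of x] fn_Mul[OF assms(2), of x] fn_Mul[OF bounded_mult_diff[OF assms], of x] fn_minus[of "Mul m x" "Mul n x"]
  by (intro l2_eqI, eventually_elim) (simp only: of_real_diff left_diff_distrib)
lemma Mul_cmult: assumes "bounded_mult m B" shows "Mul (\<lambda>t. c * m t) x = c *\<^sub>R Mul m x"
  using fn_Mul[OF assms(1), of x] fn_Mul[OF bounded_mult_cmult[OF assms], of c x] fn_scaleR[of c "Mul m x"]
  by (intro l2_eqI, eventually_elim) (simp add: algebra_simps)

lemma norm_Mul_square:
  assumes "bounded_mult m B" shows "(norm (Mul m x))\<^sup>2 = (LINT t|lebesgue. (m t)\<^sup>2 * (cmod (fn x t))\<^sup>2)"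
  by (simp add: Mul_def norm_cls bounded_mult_L2[OF assms] L2_norm_def norm_mult power_mult_distrib)

lemma norm_Mul: assumes "bounded_mult m B" shows "norm (Mul m x) \<le> B * norm x"
proof -
  have [measurable]: "m \<in> borel_measurable lebesgue" using assms by (simp add: bounded_mult_def)
  have "(norm (Mul m x))\<^sup>2 \<le> (LINT t|lebesgue. B\<^sup>2 * (cmod (fn x t))\<^sup>2)"
    unfolding norm_Mul_square[OF assms]
  proof (rule integral_mono)
    show "integrable lebesgue (\<lambda>t. (m t)\<^sup>2 * (cmod (fn x t))\<^sup>2)"
      using L2_square_integrable[OF bounded_mult_L2[OF assms fn_L2[of x]]] by (simp add: norm_mult power_mult_distrib)
    show "integrable lebesgue (\<lambda>t. B\<^sup>2 * (cmod (fn x t))\<^sup>2)" using L2_square_integrable[OF fn_L2[of x]] by simp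
    show "(m t)\<^sup>2 * (cmod (fn x t))\<^sup>2 \<le> B\<^sup>2 * (cmod (fn x t))\<^sup>2" for t
    proof (rule mult_right_mono)
      have "\<bar>m t\<bar> \<le> \<bar>B\<bar>" using assms bounded_mult_bound_nonneg[OF assms] by (simp add: bounded_mult_def)
      then show "(m t)\<^sup>2 \<le> B\<^sup>2" by (simp only: abs_le_square_iff)
    qed simp
  qed
  also have "\<dots> = (B * norm x)\<^sup>2" by (simp add: norm_l2_square power_mult_distrib)
  finally show ?thesis
    by (rule power2_le_imp_le) (simp add: bounded_mult_bound_nonneg[OF assms])
qed

lemma bounded_linear_Mul: assumes "bounded_mult m B" shows "bounded_linear (Mul m)"
  by (rule bounded_linear_intro[where K = B]) (auto simp: Mul_add[OF assms] Mul_scaleR[OF assms] norm_Mul[OF assms] mult.commute)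

lemma inner_Mul_left: assumes "bounded_mult m B" shows "inner (Mul m x) y = inner x (Mul m y)"
  using inner_cls[OF bounded_mult_L2[OF assms fn_L2[of x]] fn_L2[of y]]
    inner_cls[OF fn_L2[of x] bounded_mult_L2[OF assms fn_L2[of y]]]
  by (simp add: Mul_def mult_ac)

lemma inner_Mul_nonneg: assumes "bounded_mult m B" "\<And>t. 0 \<le> m t" shows "0 \<le> inner (Mul m x) x"
proof -
  have "0 \<le> (LINT t|lebesgue. m t * (cmod (fn x t))\<^sup>2)"
    by (intro integral_nonneg_AE) (auto simp: assms(2))
  also have "\<dots> = inner (Mul m x) x"
    using inner_cls[OF bounded_mult_L2[OF assms(1) fn_L2[of x]] fn_L2[of x]]
    by (simp add: Mul_def mult.assoc complex_mult_cnj cmod_power2)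
  finally show ?thesis .
qed

text \<open>Pointwise convergence of bounded multipliers gives strong convergence of the operators, which is the notion of
  continuity and differentiability in time used throughout.\<close>

lemma Mul_dominated_convergence:
  assumes "\<And>k. bounded_mult (m k) B" "bounded_mult m0 B" "\<And>t. (\<lambda>k. m k t) \<longlonglongrightarrow> m0 t"
  shows "(\<lambda>k. Mul (m k) x) \<longlonglongrightarrow> Mul m0 x"
proof -
  have [measurable]: "m k \<in> borel_measurable lebesgue" "m0 \<in> borel_measurable lebesgue" for k
    using assms by (auto simp: bounded_mult_def)
  have "(\<lambda>k. LINT t|lebesgue. (m k t - m0 t)\<^sup>2 * (cmod (fn x t))\<^sup>2) \<longlonglongrightarrow> (LINT t|(lebesgue::(real^3) measure). 0)"
  proof (rule integral_dominated_convergence[where w = "\<lambda>t. (B + B)\<^sup>2 * (cmod (fn x t))\<^sup>2"])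
    show "integrable lebesgue (\<lambda>t. (B + B)\<^sup>2 * (cmod (fn x t))\<^sup>2)"
      using L2_square_integrable[OF fn_L2[of x]] by simp
    have "(\<lambda>k. (m k t - m0 t)\<^sup>2 * (cmod (fn x t))\<^sup>2) \<longlonglongrightarrow> (m0 t - m0 t)\<^sup>2 * (cmod (fn x t))\<^sup>2" for t
      by (intro tendsto_intros assms)
    then show "AE t in lebesgue. (\<lambda>k. (m k t - m0 t)\<^sup>2 * (cmod (fn x t))\<^sup>2) \<longlonglongrightarrow> 0" by simp
    show "AE t in lebesgue. norm ((m k t - m0 t)\<^sup>2 * (cmod (fn x t))\<^sup>2) \<le> (B + B)\<^sup>2 * (cmod (fn x t))\<^sup>2" for k
    proof (rule AE_I2)
      fix t
      have "\<bar>m k t - m0 t\<bar> \<le> B + B" using bounded_mult_diff[OF assms(1)[of k] assms(2)] unfolding bounded_mult_def by blast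
      then have "(m k t - m0 t)\<^sup>2 \<le> (B + B)\<^sup>2"
        using abs_le_square_iff[of "m k t - m0 t" "B + B"] by linarith
      then show "norm ((m k t - m0 t)\<^sup>2 * (cmod (fn x t))\<^sup>2) \<le> (B + B)\<^sup>2 * (cmod (fn x t))\<^sup>2"
        by (auto intro!: mult_right_mono)
    qed
  qed measurable
  also have "(\<lambda>k. LINT t|lebesgue. (m k t - m0 t)\<^sup>2 * (cmod (fn x t))\<^sup>2) = (\<lambda>k. (norm (Mul (m k) x - Mul m0 x))\<^sup>2)"
    by (auto simp: norm_Mul_square[OF bounded_mult_diff[OF assms(1) assms(2)]] simp flip: Mul_minus[OF assms(1) assms(2)])
  finally have "(\<lambda>k. (norm (Mul (m k) x - Mul m0 x))\<^sup>2) \<longlonglongrightarrow> 0" by simp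
  from tendsto_real_sqrt[OF this] have "(\<lambda>k. norm (Mul (m k) x - Mul m0 x)) \<longlonglongrightarrow> 0" by simp
  then show ?thesis using Lim_null tendsto_norm_zero_iff by blast
qed

lemma Mul_tendsto_at:
  fixes s :: real
  assumes "\<And>r. bounded_mult (m r) B" "bounded_mult m0 B" "\<And>t. ((\<lambda>r. m r t) \<longlongrightarrow> m0 t) (at s)"
  shows "((\<lambda>r. Mul (m r) x) \<longlongrightarrow> Mul m0 x) (at s)"
  unfolding tendsto_at_iff_sequentially o_def
proof (intro allI impI)
  fix X :: "nat \<Rightarrow> real" assume X: "\<forall>i. X i \<in> UNIV - {s}" "X \<longlonglongrightarrow> s"
  show "(\<lambda>k. Mul (m (X k)) x) \<longlonglongrightarrow> Mul m0 x"
    using assms(3) X by (intro Mul_dominated_convergence[where B = B] assms) (auto simp: tendsto_at_iff_sequentially o_def)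
qed


section \<open>Hilbert spaces\<close>

text \<open>The midpoint of \<open>x\<close> and \<open>y\<close> lies in \<open>C\<close>, so its norm is at least \<open>d\<close>; the parallelogram identity turns this
  into closeness of \<open>x\<close> and \<open>y\<close> when both almost attain the distance.\<close>

lemma parallelogram_minimal:
  fixes x y :: "'a::real_inner"
  assumes "convex C" "x \<in> C" "y \<in> C" "0 \<le> d" "\<And>z. z \<in> C \<Longrightarrow> d \<le> norm z"
  shows "(norm (x - y))\<^sup>2 \<le> 2 * (norm x)\<^sup>2 + 2 * (norm y)\<^sup>2 - 4 * d\<^sup>2"
proof -
  have "(1/2) *\<^sub>R x + (1/2) *\<^sub>R y \<in> C" using assms(1-3) by (intro convexD) auto
  then have "d \<le> norm ((1/2) *\<^sub>R (x + y))" using assms(5) by (auto simp: scaleR_add_right)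
  then have "2 * d \<le> norm (x + y)" by simp
  then have "(2 * d)\<^sup>2 \<le> (norm (x + y))\<^sup>2" using assms(4) by (intro power_mono) auto
  moreover have "(norm (x - y))\<^sup>2 + (norm (x + y))\<^sup>2 = 2 * (norm x)\<^sup>2 + 2 * (norm y)\<^sup>2"
    by (simp add: power2_norm_eq_inner inner_simps inner_commute)
  ultimately show ?thesis by (simp add: power_mult_distrib)
qed

lemma closed_convex_min_norm:
  fixes C :: "'a::{real_inner,complete_space} set"
  assumes "closed C" "convex C" "C \<noteq> {}"
  shows "\<exists>c\<in>C. \<forall>x\<in>C. norm c \<le> norm x"
proof -
  define d where "d = Inf (norm ` C)"
  have bdd: "bdd_below (norm ` C)" by (rule bdd_belowI[of _ 0]) auto
  have d: "d \<le> norm z" if "z \<in> C" for z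
    unfolding d_def by (rule cInf_lower) (use that bdd in auto)
  have d0: "0 \<le> d" unfolding d_def by (rule cInf_greatest) (use assms(3) in auto)
  have "\<exists>z\<in>C. norm z < d + 1 / Suc n" for n
    using cInf_lessD[of "norm ` C" "d + 1 / Suc n"] assms(3) by (auto simp: d_def)
  then obtain x where x: "\<And>n. x n \<in> C" "\<And>n. norm (x n) < d + 1 / Suc n" by metis
  have lim: "(\<lambda>n. norm (x n)) \<longlonglongrightarrow> d"
  proof (rule real_tendsto_sandwich)
    show "\<forall>\<^sub>F n in sequentially. d \<le> norm (x n)" using d x by auto
    show "\<forall>\<^sub>F n in sequentially. norm (x n) \<le> d + 1 / Suc n" using x(2) by (intro always_eventually allI less_imp_le) auto
    show "(\<lambda>n. d + 1 / Suc n) \<longlonglongrightarrow> d" using tendsto_add[OF tendsto_const LIMSEQ_Suc[OF lim_1_over_n], of d] by simp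
  qed simp
  have "Cauchy x"
  proof (rule metric_CauchyI)
    fix e :: real assume e: "0 < e"
    have "(\<lambda>n. (norm (x n))\<^sup>2) \<longlonglongrightarrow> d\<^sup>2" by (intro tendsto_intros lim)
    then have "\<forall>\<^sub>F n in sequentially. (norm (x n))\<^sup>2 < d\<^sup>2 + e\<^sup>2 / 4"
      by (rule order_tendstoD) (use e in simp)
    then obtain N where N: "\<And>n. n \<ge> N \<Longrightarrow> (norm (x n))\<^sup>2 < d\<^sup>2 + e\<^sup>2 / 4"
      by (auto simp: eventually_sequentially)
    have "dist (x m) (x n) < e" if "m \<ge> N" "n \<ge> N" for m n
    proof -
      have "(norm (x m - x n))\<^sup>2 < e\<^sup>2"
        using parallelogram_minimal[OF assms(2) x(1)[of m] x(1)[of n] d0 d] N[OF that(1)] N[OF that(2)] by linarith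
      then show ?thesis using e by (simp add: dist_norm power_less_imp_less_base)
    qed
    then show "\<exists>M. \<forall>m\<ge>M. \<forall>n\<ge>M. dist (x m) (x n) < e" by blast
  qed
  then obtain c where c: "x \<longlonglongrightarrow> c" using Cauchy_convergent convergent_def by blast
  have "c \<in> C" using closed_sequentially[OF assms(1) x(1) c] .
  moreover have "norm c = d" using tendsto_norm[OF c] lim LIMSEQ_unique by blast
  ultimately show ?thesis using d by auto
qed

text \<open>The projection theorem as a density criterion: the element of \<open>x - S\<close> of least norm is orthogonal to \<open>S\<close>.\<close>

lemma closed_subspace_eq_UNIV:
  fixes S :: "'a::{real_inner,complete_space} set"
  assumes "closed S" "subspace S" "\<And>z. (\<And>s. s \<in> S \<Longrightarrow> inner z s = 0) \<Longrightarrow> z = 0"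
  shows "x \<in> S"
proof -
  define C where "C = (\<lambda>s. x - s) ` S"
  have "convex S" using assms(2) by (rule subspace_imp_convex)
  have "C = (\<lambda>s. x + s) ` (uminus ` S)" by (auto simp: C_def image_image)
  then have "closed C" "convex C" "C \<noteq> {}"
    using assms(1) \<open>convex S\<close> subspace_0[OF assms(2)]
    by (auto intro!: closed_translation closed_negations convex_translation convex_negations)
  then obtain c where c: "c \<in> C" "\<And>z. z \<in> C \<Longrightarrow> norm c \<le> norm z"
    using closed_convex_min_norm[of C] by blast
  then obtain s0 where s0: "s0 \<in> S" "c = x - s0" by (auto simp: C_def)
  have "inner c s = 0" if s: "s \<in> S" for s
  proof (cases "s = 0")
    case False
    define r where "r = inner c s / inner s s"
    have "s0 + r *\<^sub>R s \<in> S" using s0 s assms(2) by (simp add: subspace_add subspace_scale)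
    then have "x - (s0 + r *\<^sub>R s) \<in> C" by (auto simp: C_def)
    then have "c - r *\<^sub>R s \<in> C" by (simp add: s0 algebra_simps)
    then have "(norm c)\<^sup>2 \<le> (norm (c - r *\<^sub>R s))\<^sup>2" using c by (intro power_mono) auto
    also have "(norm (c - r *\<^sub>R s))\<^sup>2 = (norm c)\<^sup>2 - 2 * r * inner c s + r\<^sup>2 * inner s s"
      unfolding power2_norm_eq_inner inner_diff_left inner_diff_right inner_scaleR_left inner_scaleR_right
      by (simp add: inner_commute[of s c] power2_eq_square algebra_simps)
    also have "\<dots> = (norm c)\<^sup>2 - (inner c s)\<^sup>2 / inner s s"
      using False by (simp add: r_def power2_eq_square field_simps)
    finally have "(inner c s)\<^sup>2 / inner s s \<le> 0" by simp
    moreover have "0 < inner s s" using False by simp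
    ultimately show ?thesis by (simp add: divide_le_0_iff)
  qed simp
  then have "c = 0" by (rule assms(3))
  then show ?thesis using s0 by simp
qed

text \<open>A form of weak compactness that avoids subsequences and separability. The elements of least norm in the
  closed convex hulls of the tails have increasing bounded norms, hence form a Cauchy sequence by the
  parallelogram identity; their limit lies in every half-space that contains a tail, so it has the right
  inner product with every vector against which the given sequence converges.\<close>

lemma bounded_sequence_weak_limit:
  fixes g :: "nat \<Rightarrow> 'a::{real_inner,complete_space}"
  assumes M: "\<And>n. norm (g n) \<le> M"
  shows "\<exists>c. norm c \<le> M \<and> (\<forall>\<phi> L. (\<lambda>n. inner (g n) \<phi>) \<longlonglongrightarrow> L \<longrightarrow> inner c \<phi> = L)"
proof -
  define C where "C n = closure (convex hull (g ` {n..}))" for n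
  have C: "closed (C n)" "convex (C n)" "C n \<noteq> {}" for n
    by (auto simp: C_def intro!: convex_closure)
  have gC: "g n \<in> C n" for n
    unfolding C_def by (rule subsetD[OF closure_subset], rule hull_inc) simp
  have mono: "C m \<subseteq> C n" if "m \<ge> n" for m n
    unfolding C_def by (intro closure_mono hull_mono) (use that in auto)
  have "\<exists>c. \<forall>n. c n \<in> C n \<and> (\<forall>x\<in>C n. norm (c n) \<le> norm x)"
    by (rule choice) (use closed_convex_min_norm[OF C] in blast)
  then obtain c where c: "\<And>n. c n \<in> C n" "\<And>n x. x \<in> C n \<Longrightarrow> norm (c n) \<le> norm x" by blast
  have cM: "norm (c n) \<le> M" for n using c(2)[OF gC[of n]] M[of n] by simp
  have inc: "incseq (\<lambda>n. (norm (c n))\<^sup>2)"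
  proof (rule incseq_SucI)
    fix n
    have "c (Suc n) \<in> C n" using mono[of n "Suc n"] c(1)[of "Suc n"] by auto
    then show "(norm (c n))\<^sup>2 \<le> (norm (c (Suc n)))\<^sup>2" by (intro power_mono c(2)) auto
  qed
  have "\<exists>L. (\<lambda>n. (norm (c n))\<^sup>2) \<longlonglongrightarrow> L"
  proof -
    have "(norm (c n))\<^sup>2 \<le> M\<^sup>2" for n by (intro power_mono cM) auto
    then show ?thesis by (metis incseq_convergent[OF inc])
  qed
  then have Cn: "Cauchy (\<lambda>n. (norm (c n))\<^sup>2)" using LIMSEQ_imp_Cauchy by blast
  have "Cauchy c"
  proof (rule metric_CauchyI)
    fix e :: real assume e: "0 < e"
    then have "0 < e\<^sup>2 / 2" by simp
    from metric_CauchyD[OF Cn this] obtain N where N: "\<And>m n. m \<ge> N \<Longrightarrow> n \<ge> N \<Longrightarrow> dist ((norm (c m))\<^sup>2) ((norm (c n))\<^sup>2) < e\<^sup>2 / 2"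
      by blast
    have *: "dist (c m) (c n) < e" if "m \<ge> n" "n \<ge> N" for m n
    proof -
      have "(norm (c m - c n))\<^sup>2 \<le> 2 * (norm (c m))\<^sup>2 + 2 * (norm (c n))\<^sup>2 - 4 * (norm (c n))\<^sup>2"
        by (rule parallelogram_minimal[OF C(2)[of n]]) (use c mono[OF that(1)] in auto)
      also have "\<dots> < e\<^sup>2" using N[of m n] that by (simp add: dist_real_def abs_if split: if_splits)
      finally show ?thesis using e by (simp add: dist_norm power_less_imp_less_base)
    qed
    show "\<exists>M. \<forall>m\<ge>M. \<forall>n\<ge>M. dist (c m) (c n) < e"
    proof (intro exI allI impI)
      fix m n assume "N \<le> m" "N \<le> n"
      then show "dist (c m) (c n) < e" using *[of n m] *[of m n] by (cases "m \<ge> n") (auto simp: dist_commute)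
    qed
  qed
  then obtain c0 where c0: "c \<longlonglongrightarrow> c0" using Cauchy_convergent convergent_def by blast
  have "norm c0 \<le> M" by (rule Lim_norm_ubound[OF _ c0]) (use cM in auto)
  moreover have "inner c0 \<phi> = L" if L: "(\<lambda>n. inner (g n) \<phi>) \<longlonglongrightarrow> L" for \<phi> L
  proof -
    have "\<bar>inner c0 \<phi> - L\<bar> \<le> e" if e: "0 < e" for e
    proof -
      define D where "D = {z. \<bar>inner z \<phi> - L\<bar> \<le> e}"
      have D: "D = {z. inner \<phi> z \<le> L + e} \<inter> {z. inner \<phi> z \<ge> L - e}"
        by (auto simp: D_def inner_commute)
      have "closed D" "convex D"
        unfolding D by (auto intro!: closed_Int closed_halfspace_le closed_halfspace_ge convex_Int convex_halfspace_le convex_halfspace_ge)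
      obtain N where N: "\<And>n. n \<ge> N \<Longrightarrow> \<bar>inner (g n) \<phi> - L\<bar> < e"
        using L e by (auto simp: LIMSEQ_iff)
      have "g ` {N..} \<subseteq> D" using N by (auto simp: D_def less_imp_le)
      then have "C N \<subseteq> D" unfolding C_def
        by (intro closure_minimal hull_minimal \<open>closed D\<close> \<open>convex D\<close>)
      then have "\<forall>\<^sub>F n in sequentially. c n \<in> D"
        unfolding eventually_sequentially using c(1) mono by blast
      then have "c0 \<in> D" using Lim_in_closed_set[OF \<open>closed D\<close> _ _ c0] by simp
      then show ?thesis by (simp add: D_def)
    qed
    then have "\<bar>inner c0 \<phi> - L\<bar> \<le> 0" by (rule field_le_epsilon) simp
    then show ?thesis by simp
  qed
  ultimately show ?thesis by blast
qed

section \<open>Calculus in Banach spaces\<close>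

lemma vector_derivative_at_iff_tendsto:
  "(f has_vector_derivative d) (at t) \<longleftrightarrow> ((\<lambda>s. (f s - f t) /\<^sub>R (s - t)) \<longlongrightarrow> d) (at t)"
  for f :: "real \<Rightarrow> 'a::real_normed_vector"
proof -
  have "(f has_vector_derivative d) (at t) \<longleftrightarrow> ((\<lambda>s. ((f s - f t) - (s - t) *\<^sub>R d) /\<^sub>R norm (s - t)) \<longlongrightarrow> 0) (at t)"
    by (simp add: has_vector_derivative_def has_derivative_at_within bounded_linear_scaleR_left diff_diff_eq)
  also have "\<dots> \<longleftrightarrow> ((\<lambda>s. norm (((f s - f t) - (s - t) *\<^sub>R d) /\<^sub>R norm (s - t))) \<longlongrightarrow> 0) (at t)"
    by (simp only: tendsto_norm_zero_iff)
  also have "\<dots> \<longleftrightarrow> ((\<lambda>s. norm ((f s - f t) /\<^sub>R (s - t) - d)) \<longlongrightarrow> 0) (at t)"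
  proof (rule tendsto_cong)
    show "\<forall>\<^sub>F s in at t. norm (((f s - f t) - (s - t) *\<^sub>R d) /\<^sub>R norm (s - t)) = norm ((f s - f t) /\<^sub>R (s - t) - d)"
      unfolding eventually_at_filter
    proof (intro always_eventually allI impI)
      fix s assume "s \<noteq> t"
      then have "(f s - f t) /\<^sub>R (s - t) - d = ((f s - f t) - (s - t) *\<^sub>R d) /\<^sub>R (s - t)"
        by (simp add: scaleR_diff_right)
      then show "norm (((f s - f t) - (s - t) *\<^sub>R d) /\<^sub>R norm (s - t)) = norm ((f s - f t) /\<^sub>R (s - t) - d)"
        by simp
    qed
  qed
  also have "\<dots> \<longleftrightarrow> ((\<lambda>s. (f s - f t) /\<^sub>R (s - t)) \<longlongrightarrow> d) (at t)"
    by (simp only: tendsto_norm_zero_iff LIM_zero_iff)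
  finally show ?thesis .
qed

lemma ex_antiderivative:
  fixes f :: "real \<Rightarrow> 'a::banach"
  assumes "continuous_on UNIV f"
  shows "\<exists>F. F 0 = 0 \<and> (\<forall>t. (F has_vector_derivative f t) (at t))"
proof -
  define F where "F t = integral {0..t} f - integral {t..0} f" for t
  have int: "f integrable_on {a..b}" for a b
    by (rule integrable_continuous_real) (use assms continuous_on_subset in blast)
  have F: "F t = integral {-a..t} f - integral {-a..0} f" if "-a < t" "t < a" for a t
  proof (cases "0 \<le> t")
    case True
    have "integral {-a..0} f + integral {0..t} f = integral {-a..t} f"
      by (rule Henstock_Kurzweil_Integration.integral_combine) (use True that int in auto)
    moreover have "integral {t..0} f = 0" using True by (cases "t = 0") auto
    ultimately show ?thesis by (simp add: F_def algebra_simps)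
  next
    case False
    have "integral {-a..t} f + integral {t..0} f = integral {-a..0} f"
      by (rule Henstock_Kurzweil_Integration.integral_combine) (use False that int in auto)
    then show ?thesis using False by (simp add: F_def algebra_simps)
  qed
  have "(F has_vector_derivative f t) (at t)" for t
  proof -
    define a where "a = \<bar>t\<bar> + 1"
    have a: "-a < t" "t < a" by (auto simp: a_def)
    have "((\<lambda>u. integral {-a..u} f) has_vector_derivative f t) (at t within {-a..a})"
      by (rule integral_has_vector_derivative) (use a assms continuous_on_subset in auto)
    then have "((\<lambda>u. integral {-a..u} f) has_vector_derivative f t) (at t)"
      using a by (simp add: at_within_Icc_at)
    then have "((\<lambda>u. integral {-a..u} f - integral {-a..0} f) has_vector_derivative f t) (at t)"
      using has_vector_derivative_diff_const by fastforce
    then show ?thesis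
      by (rule has_vector_derivative_transform_within_open[where S = "{-a<..<a}"]) (use a F in auto)
  qed
  then show ?thesis by (intro exI[of _ F]) (simp add: F_def)
qed

text \<open>An integral from 0 to \<open>t\<close> with the usual orientation for negative \<open>t\<close>, so that identities along the whole time
  axis can be proved by differentiation.\<close>

definition antiderivative :: "(real \<Rightarrow> 'a::banach) \<Rightarrow> real \<Rightarrow> 'a" where
  "antiderivative f = (SOME F. F 0 = 0 \<and> (\<forall>t. (F has_vector_derivative f t) (at t)))"

lemma antiderivative:
  assumes "continuous_on UNIV f"
  shows "antiderivative f 0 = 0" "(antiderivative f has_vector_derivative f t) (at t)"
  using someI_ex[OF ex_antiderivative[OF assms]] by (auto simp: antiderivative_def)

lemma has_vector_derivative_imp_continuous_on:
  assumes "\<And>t. (f has_vector_derivative f' t) (at t)"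
  shows "continuous_on A f"
  using assms by (meson continuous_at_imp_continuous_on has_vector_derivative_continuous)

text \<open>The majorant \<open>B\<close> depends on \<open>\<bar>s\<bar>\<close>, so the same estimate serves both time directions; the side condition
  \<open>0 \<le> s * t\<close> restricts \<open>s\<close> to the segment between 0 and \<open>t\<close>.\<close>

lemma derivative_bound:
  fixes F :: "real \<Rightarrow> 'a::real_normed_vector"
  assumes F: "\<And>s. (F has_vector_derivative f s) (at s)"
    and B: "\<And>r. (B has_real_derivative b r) (at r)"
    and le: "\<And>s. \<bar>s\<bar> \<le> \<bar>t\<bar> \<Longrightarrow> 0 \<le> s * t \<Longrightarrow> norm (f s) \<le> b \<bar>s\<bar>"
  shows "norm (F t - F 0) \<le> B \<bar>t\<bar> - B 0"
proof -
  have Bv: "(B has_vector_derivative b r) (at r)" for r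
    using B has_real_derivative_iff_has_vector_derivative by blast
  consider "t > 0" | "t = 0" | "t < 0" by linarith
  then show ?thesis
  proof cases
    case 1
    have "norm (F t - F 0) \<le> B t - B 0"
    proof (rule differentiable_bound_general[where f' = f and \<phi>' = b])
      show "norm (f x) \<le> b x" if "0 < x" "x < t" for x
        using le[of x] that by simp
    qed (use 1 F Bv has_vector_derivative_imp_continuous_on[OF F] has_vector_derivative_imp_continuous_on[OF Bv] in auto)
    then show ?thesis using 1 by simp
  next
    case 3
    have G: "((\<lambda>s. F (- s)) has_vector_derivative - f (- s)) (at s)" for s
    proof -
      have "(uminus has_vector_derivative -1) (at s)" by (auto intro!: derivative_eq_intros)
      from vector_diff_chain_at[OF this F] show ?thesis by (simp add: o_def)
    qed
    have "norm (F (- (- t)) - F (- 0)) \<le> B (- t) - B 0"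
    proof (rule differentiable_bound_general[where f = "\<lambda>s. F (- s)" and f' = "\<lambda>s. - f (- s)" and \<phi> = B and \<phi>' = b])
      show "norm (- f (- x)) \<le> b x" if "0 < x" "x < - t" for x
        using le[of "- x"] that 3 by (simp add: mult_nonpos_nonpos mult_le_0_iff)
    qed (use 3 G Bv has_vector_derivative_imp_continuous_on[OF G] has_vector_derivative_imp_continuous_on[OF Bv] in auto)
    then show ?thesis using 3 by simp
  qed simp
qed

lemma derivative_bound_const:
  fixes F :: "real \<Rightarrow> 'a::real_normed_vector"
  assumes "\<And>s. (F has_vector_derivative f s) (at s)" "\<And>s. \<bar>s\<bar> \<le> \<bar>t\<bar> \<Longrightarrow> norm (f s) \<le> b"
  shows "norm (F t - F 0) \<le> b * \<bar>t\<bar>"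
proof -
  have "norm (F t - F 0) \<le> b * \<bar>t\<bar> - b * 0"
    by (rule derivative_bound[where b = "\<lambda>_. b"]) (use assms in \<open>auto intro!: derivative_eq_intros\<close>)
  then show ?thesis by simp
qed

lemma antiderivative_unique:
  fixes F G :: "real \<Rightarrow> 'a::real_normed_vector"
  assumes "\<And>s. (F has_vector_derivative f s) (at s)" "\<And>s. (G has_vector_derivative f s) (at s)" "F 0 = G 0"
  shows "F t = G t"
proof -
  have "((\<lambda>s. F s - G s) has_vector_derivative 0) (at s)" for s
    using has_vector_derivative_diff[OF assms(1,2)] by simp
  from derivative_bound_const[OF this, of t 0] show ?thesis using assms(3) by simp
qed

lemma strongly_continuous_compose:
  fixes A :: "'i \<Rightarrow> 'a::real_normed_vector \<Rightarrow> 'b::real_normed_vector"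
  assumes lin: "\<And>r. linear (A r)" and bd: "\<And>r x. norm (A r x) \<le> C * norm x"
    and A: "((\<lambda>r. A r u0) \<longlongrightarrow> a) F" and u: "(u \<longlongrightarrow> u0) F"
  shows "((\<lambda>r. A r (u r)) \<longlongrightarrow> a) F"
proof -
  have "((\<lambda>r. A r (u r - u0)) \<longlongrightarrow> 0) F"
  proof (rule Lim_null_comparison)
    show "\<forall>\<^sub>F r in F. norm (A r (u r - u0)) \<le> C * norm (u r - u0)" using bd by auto
    have "((\<lambda>r. C * norm (u r - u0)) \<longlongrightarrow> C * norm (u0 - u0)) F" by (intro tendsto_intros u)
    then show "((\<lambda>r. C * norm (u r - u0)) \<longlongrightarrow> 0) F" by simp
  qed
  from tendsto_add[OF this A] show ?thesis by (simp add: linear_diff[OF lin])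
qed

text \<open>The family \<open>A\<close> is differentiable only on the single vector \<open>u t\<close> and strongly continuous on \<open>u'\<close>. This is the
  situation of a unitary group with unbounded generator applied to a moving vector; the uniform bound on \<open>A\<close>
  makes up for the missing norm continuity.\<close>

lemma strong_product_rule:
  fixes A :: "real \<Rightarrow> 'a::real_normed_vector \<Rightarrow> 'b::real_normed_vector"
  assumes lin: "\<And>r. linear (A r)" and bd: "\<And>r x. norm (A r x) \<le> C * norm x"
    and A: "((\<lambda>r. A r (u t)) has_vector_derivative a) (at t)"
    and cont: "((\<lambda>r. A r u') \<longlongrightarrow> A t u') (at t)"
    and u: "(u has_vector_derivative u') (at t)"
  shows "((\<lambda>r. A r (u r)) has_vector_derivative a + A t u') (at t)"
proof -
  have "((\<lambda>s. A s ((u s - u t) /\<^sub>R (s - t))) \<longlongrightarrow> A t u') (at t)"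
    by (rule strongly_continuous_compose[OF lin bd cont]) (use u in \<open>simp add: vector_derivative_at_iff_tendsto\<close>)
  with A have "((\<lambda>s. (A s (u t) - A t (u t)) /\<^sub>R (s - t) + A s ((u s - u t) /\<^sub>R (s - t))) \<longlongrightarrow> a + A t u') (at t)"
    unfolding vector_derivative_at_iff_tendsto by (rule tendsto_add)
  moreover have "(A s (u t) - A t (u t)) /\<^sub>R (s - t) + A s ((u s - u t) /\<^sub>R (s - t)) = (A s (u s) - A t (u t)) /\<^sub>R (s - t)" for s
    by (simp add: linear_cmul[OF lin] linear_diff[OF lin] algebra_simps)
  ultimately show ?thesis by (simp add: vector_derivative_at_iff_tendsto)
qed

section \<open>Linear evolution equations with bounded generator\<close>

text \<open>Picard iteration on the whole real line at once. The generator is only strongly continuous in time, so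
  existence theorems for norm-continuous right-hand sides do not apply directly.\<close>

lemma linear_ode_exists:
  fixes C :: "real \<Rightarrow> 'a::banach \<Rightarrow> 'a"
  assumes lin: "\<And>t. linear (C t)" and M: "0 < M" and bd: "\<And>t x. norm (C t x) \<le> M * norm x"
    and cont: "\<And>x. continuous_on UNIV (\<lambda>t. C t x)"
  shows "\<exists>y. y 0 = x0 \<and> (\<forall>t. (y has_vector_derivative C t (y t)) (at t))"
proof -
  have cc: "continuous_on UNIV (\<lambda>t. C t (y t))" if "continuous_on UNIV y" for y
  proof -
    have "((\<lambda>r. C r (y r)) \<longlongrightarrow> C t (y t)) (at t)" for t
      by (rule strongly_continuous_compose[OF lin bd])
        (use cont[of "y t"] that in \<open>auto simp: continuous_on_def\<close>)
    then show ?thesis by (auto simp: continuous_on_def)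
  qed
  \<comment> \<open>the unknown is \<open>w = y / e\<close>; integrating \<open>M * exp (2 * M * s)\<close> gains the factor 1/2, which makes \<open>P\<close> a
    contraction of the bounded continuous functions on the line\<close>
  define e where "e t = exp (2 * M * \<bar>t\<bar>)" for t
  have econt: "continuous_on UNIV e" unfolding e_def by (intro continuous_intros)
  have e1: "1 \<le> e t" and e0: "0 < e t" for t using M by (auto simp: e_def)
  define P where "P w t = (1 / e t) *\<^sub>R (x0 + antiderivative (\<lambda>s. C s (e s *\<^sub>R w s)) t)" for w t
  have fc: "continuous_on UNIV (\<lambda>s. C s (e s *\<^sub>R w s))" if "continuous_on UNIV w" for w
    by (rule cc) (intro continuous_intros econt that)
  have Pc: "continuous_on UNIV (P w)" if "continuous_on UNIV w" for w
    unfolding P_def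
    by (intro continuous_intros econt has_vector_derivative_imp_continuous_on[OF antiderivative(2)[OF fc[OF that]]])
       (metis e0 less_irrefl)
  have diff: "norm (antiderivative (\<lambda>s. C s (e s *\<^sub>R w s)) t - antiderivative (\<lambda>s. C s (e s *\<^sub>R v s)) t) \<le> 1/2 * D * e t"
    if w: "continuous_on UNIV w" and v: "continuous_on UNIV v" and D: "\<And>s. norm (w s - v s) \<le> D" for w v D t
  proof -
    have D0: "0 \<le> D" using D[of 0] norm_ge_zero order_trans by blast
    let ?F = "\<lambda>t. antiderivative (\<lambda>s. C s (e s *\<^sub>R w s)) t - antiderivative (\<lambda>s. C s (e s *\<^sub>R v s)) t"
    have "norm (?F t - ?F 0) \<le> 1/2 * D * exp (2 * M * \<bar>t\<bar>) - 1/2 * D * exp (2 * M * 0)"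
    proof (rule derivative_bound[where f = "\<lambda>s. C s (e s *\<^sub>R w s) - C s (e s *\<^sub>R v s)" and b = "\<lambda>r. M * (exp (2 * M * r) * D)"])
      show "(?F has_vector_derivative C s (e s *\<^sub>R w s) - C s (e s *\<^sub>R v s)) (at s)" for s
        by (intro has_vector_derivative_diff antiderivative fc w v)
      show "((\<lambda>r. 1/2 * D * exp (2 * M * r)) has_real_derivative M * (exp (2 * M * r) * D)) (at r)" for r
        by (auto intro!: derivative_eq_intros)
      fix s
      have "norm (C s (e s *\<^sub>R w s) - C s (e s *\<^sub>R v s)) = norm (C s (e s *\<^sub>R (w s - v s)))"
        by (simp add: linear_diff[OF lin] scaleR_diff_right)
      also have "\<dots> \<le> M * norm (e s *\<^sub>R (w s - v s))" by (rule bd)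
      also have "\<dots> \<le> M * (exp (2 * M * \<bar>s\<bar>) * D)"
        using M D[of s] by (simp add: e_def)
      finally show "norm (C s (e s *\<^sub>R w s) - C s (e s *\<^sub>R v s)) \<le> M * (exp (2 * M * \<bar>s\<bar>) * D)" .
    qed
    then show ?thesis using D0 fc[OF w] fc[OF v] by (simp add: antiderivative e_def)
  qed
  have Pdiff: "norm (P w t - P v t) \<le> 1/2 * D"
    if "continuous_on UNIV w" "continuous_on UNIV v" "\<And>s. norm (w s - v s) \<le> D" for w v D t
  proof -
    have "P w t - P v t = (1 / e t) *\<^sub>R (antiderivative (\<lambda>s. C s (e s *\<^sub>R w s)) t - antiderivative (\<lambda>s. C s (e s *\<^sub>R v s)) t)"
      by (simp add: P_def algebra_simps)
    then have "norm (P w t - P v t) \<le> (1 / e t) * (1/2 * D * e t)"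
      using mult_left_mono[OF diff[OF that, of t], of "1 / e t"] e0[of t] by simp
    then show ?thesis using e0[of t] by simp
  qed
  have P0: "norm (P (\<lambda>_. 0) t) \<le> norm x0" for t
  proof -
    have "antiderivative (\<lambda>s. C s (e s *\<^sub>R 0)) t = (\<lambda>_. 0) t"
    proof (rule antiderivative_unique)
      have c0: "continuous_on UNIV (\<lambda>s. C s (e s *\<^sub>R 0))" by (rule fc) simp
      show "(antiderivative (\<lambda>s. C s (e s *\<^sub>R 0)) has_vector_derivative 0) (at s)" for s
        using antiderivative(2)[OF c0, of s] by (simp add: linear_0[OF lin])
      show "antiderivative (\<lambda>s. C s (e s *\<^sub>R 0)) 0 = 0" by (rule antiderivative(1)[OF c0])
    qed auto
    then show ?thesis using e1[of t] e0[of t] by (simp add: P_def field_simps mult_le_cancel_left1)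
  qed
  define \<Phi> where "\<Phi> w = Bcontfun (P (apply_bcontfun w))" for w :: "real \<Rightarrow>\<^sub>C 'a"
  have Pb: "P (apply_bcontfun w) \<in> bcontfun" for w :: "real \<Rightarrow>\<^sub>C 'a"
  proof (rule bcontfun_normI)
    show "continuous_on UNIV (P (apply_bcontfun w))" by (rule Pc) simp
    show "norm (P (apply_bcontfun w) t) \<le> norm x0 + 1/2 * norm w" for t
    proof -
      have "norm (P (apply_bcontfun w) t - P (\<lambda>_. 0) t) \<le> 1/2 * norm w"
        by (rule Pdiff) (auto simp: norm_bounded)
      then show ?thesis using P0[of t] norm_triangle_ineq2[of "P (apply_bcontfun w) t" "P (\<lambda>_. 0) t"] by linarith
    qed
  qed
  have "\<exists>!w. \<Phi> w = w"
  proof (rule banach_fix_type)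
    show "\<forall>w v. dist (\<Phi> w) (\<Phi> v) \<le> 1/2 * dist w v"
    proof (intro allI dist_bound)
      fix w v :: "real \<Rightarrow>\<^sub>C 'a" and t
      have "norm (P (apply_bcontfun w) t - P (apply_bcontfun v) t) \<le> 1/2 * dist w v"
        by (rule Pdiff) (auto simp: dist_norm[symmetric] dist_bounded)
      then show "dist (apply_bcontfun (\<Phi> w) t) (apply_bcontfun (\<Phi> v) t) \<le> 1/2 * dist w v"
        by (simp add: \<Phi>_def Bcontfun_inverse[OF Pb] dist_norm)
    qed
  qed auto
  then obtain w where w: "\<Phi> w = w" by blast
  define y where "y t = e t *\<^sub>R apply_bcontfun w t" for t
  have wc: "continuous_on UNIV (apply_bcontfun w)" by simp
  have y: "y t = x0 + antiderivative (\<lambda>s. C s (y s)) t" for t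
  proof -
    have "apply_bcontfun w t = P (apply_bcontfun w) t"
      using w Bcontfun_inverse[OF Pb, of w] by (simp add: \<Phi>_def)
    then show ?thesis using e0[of t] unfolding y_def P_def by simp
  qed
  have yc: "continuous_on UNIV (\<lambda>s. C s (y s))" unfolding y_def by (rule fc[OF wc])
  have "y 0 = x0" using y[of 0] antiderivative(1)[OF yc] by simp
  moreover have "(y has_vector_derivative C t (y t)) (at t)" for t
  proof -
    have "((\<lambda>t. x0 + antiderivative (\<lambda>s. C s (y s)) t) has_vector_derivative 0 + C t (y t)) (at t)"
      by (intro has_vector_derivative_add antiderivative yc) auto
    moreover have "(\<lambda>t. x0 + antiderivative (\<lambda>s. C s (y s)) t) = y" by (rule ext, rule y[symmetric])
    ultimately show ?thesis by simp
  qed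
  ultimately show ?thesis by blast
qed

lemma has_real_derivative_inner:
  assumes "(f has_vector_derivative f') (at t)" "(g has_vector_derivative g') (at t)"
  shows "((\<lambda>s. inner (f s) (g s)) has_real_derivative inner (f t) g' + inner f' (g t)) (at t)"
proof -
  have "((\<lambda>s. inner (f s) (g s)) has_derivative (\<lambda>h. inner (f t) (h *\<^sub>R g') + inner (h *\<^sub>R f') (g t))) (at t)"
    using assms unfolding has_vector_derivative_def by (rule has_derivative_inner)
  moreover have "(\<lambda>h. inner (f t) (h *\<^sub>R g') + inner (h *\<^sub>R f') (g t)) = (*) (inner (f t) g' + inner f' (g t))"
    by (auto simp: algebra_simps)
  ultimately show ?thesis by (simp add: has_field_derivative_def)
qed

lemma skew_norm_constant:
  fixes y :: "real \<Rightarrow> 'a::real_inner"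
  assumes "\<And>t. (y has_vector_derivative y' t) (at t)" "\<And>t. inner (y t) (y' t) = 0"
  shows "norm (y t) = norm (y 0)"
proof -
  have "((\<lambda>s. inner (y s) (y s)) has_real_derivative 0) (at t)" for t
    using has_real_derivative_inner[OF assms(1)[of t] assms(1)[of t]] assms(2)[of t] by (simp add: inner_commute)
  then have "inner (y t) (y t) = inner (y 0) (y 0)" using DERIV_isconst_all by blast
  then show ?thesis by (simp add: norm_eq_sqrt_inner)
qed


section \<open>Test functions\<close>

lemma partial_eq:
  assumes "(f has_derivative f') (at x)" shows "partial i f x = f' (axis i 1)"
  using frechet_derivative_at[OF assms] by (simp add: partial_def)

lemma differentiable_on_UNIV: "f differentiable_on UNIV \<longleftrightarrow> (\<forall>x. f differentiable (at x))"
  by (simp add: differentiable_on_def)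

lemma partial_add:
  assumes "f differentiable_on UNIV" "g differentiable_on UNIV"
  shows "partial i (\<lambda>x. f x + g x) = (\<lambda>x. partial i f x + partial i g x)"
proof
  fix x
  have "(f has_derivative frechet_derivative f (at x)) (at x)" "(g has_derivative frechet_derivative g (at x)) (at x)"
    using assms by (auto simp: differentiable_on_UNIV frechet_derivative_works)
  from has_derivative_add[OF this] show "partial i (\<lambda>x. f x + g x) x = partial i f x + partial i g x"
    by (subst partial_eq) (auto simp: partial_def)
qed

lemma partial_mult:
  fixes f g :: "real^3 \<Rightarrow> complex"
  assumes "f differentiable_on UNIV" "g differentiable_on UNIV"
  shows "partial i (\<lambda>x. f x * g x) = (\<lambda>x. f x * partial i g x + partial i f x * g x)"
proof
  fix x
  have "(f has_derivative frechet_derivative f (at x)) (at x)" "(g has_derivative frechet_derivative g (at x)) (at x)"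
    using assms by (auto simp: differentiable_on_UNIV frechet_derivative_works)
  from has_derivative_mult[OF this] show "partial i (\<lambda>x. f x * g x) x = f x * partial i g x + partial i f x * g x"
    by (subst partial_eq) (auto simp: partial_def)
qed

lemma partial_const: "partial i (\<lambda>x. c) = (\<lambda>x. 0)"
  by (rule ext, subst partial_eq[where f' = "\<lambda>_. 0"]) auto

lemma C_class_const: "C_class n (\<lambda>x. c)"
  by (induction n arbitrary: c) (auto simp: partial_const)

lemma C_class_Suc: "C_class (Suc n) f \<Longrightarrow> C_class n f"
  by (induction n arbitrary: f) (auto intro: differentiable_imp_continuous_on)

lemma C_class_add: "C_class n f \<Longrightarrow> C_class n g \<Longrightarrow> C_class n (\<lambda>x. f x + g x)"
proof (induction n arbitrary: f g)
  case (Suc n)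
  then show ?case by (simp add: partial_add differentiable_on_add)
qed (simp add: continuous_on_add)

lemma C_class_mult:
  fixes f g :: "real^3 \<Rightarrow> complex"
  shows "C_class n f \<Longrightarrow> C_class n g \<Longrightarrow> C_class n (\<lambda>x. f x * g x)"
proof (induction n arbitrary: f g)
  case (Suc n)
  then show ?case
    using C_class_Suc[OF Suc.prems(1)] C_class_Suc[OF Suc.prems(2)]
    by (simp add: partial_mult differentiable_on_mult C_class_add)
qed (simp add: continuous_on_mult)

lemma C_class_prod:
  fixes f :: "'k \<Rightarrow> real^3 \<Rightarrow> complex"
  shows "(\<And>k. k \<in> K \<Longrightarrow> C_class n (f k)) \<Longrightarrow> C_class n (\<lambda>x. \<Prod>k\<in>K. f k x)"
  by (induction K rule: infinite_finite_induct) (auto simp: C_class_const C_class_mult)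

text \<open>The family \<open>x^-k exp (-1/x)\<close>, extended by 0, is closed under differentiation, so smoothness of all its
  members follows by one induction.\<close>

definition flat :: "nat \<Rightarrow> real \<Rightarrow> real" where
  "flat k x = (if x > 0 then (1/x)^k * exp (- (1/x)) else 0)"

lemma flat_tendsto_0: "(flat k \<longlongrightarrow> 0) (at 0)"
proof (rule filterlim_split_at)
  show "(flat k \<longlongrightarrow> 0) (at_left 0)"
    by (rule tendsto_eventually) (auto simp: flat_def eventually_at_filter)
  have "((\<lambda>x. inverse x ^ k / exp (inverse x)) \<longlongrightarrow> (0::real)) (at_right 0)"
    by (rule filterlim_compose[OF tendsto_power_div_exp_0 filterlim_inverse_at_top_right])
  moreover have "\<forall>\<^sub>F x in at_right 0. inverse x ^ k / exp (inverse x) = flat k x"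
    by (auto simp: flat_def eventually_at_filter exp_minus field_simps)
  ultimately show "(flat k \<longlongrightarrow> 0) (at_right 0)"
    by (simp add: tendsto_cong)
qed

lemma flat_derivative:
  "(flat k has_real_derivative - real k * flat (k + 1) x + flat (k + 2) x) (at x)"
proof -
  consider "x > 0" | "x = 0" | "x < 0" by linarith
  then show ?thesis
  proof cases
    case 1
    have "((\<lambda>x. (1/x)^k * exp (- (1/x))) has_real_derivative
        (1/x)^k * (exp (- (1/x)) * (1/x\<^sup>2)) + (real k * (1/x)^(k - 1) * (- 1/x\<^sup>2)) * exp (- (1/x))) (at x)"
    proof -
      have d1: "((\<lambda>x. 1/x) has_real_derivative - 1/x\<^sup>2) (at x)"
        using 1 by (auto intro!: derivative_eq_intros simp: power2_eq_square)
      have d2: "((\<lambda>x. (1/x)^k) has_real_derivative real k * (1/x)^(k - 1) * (- 1/x\<^sup>2)) (at x)"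
        using DERIV_power[OF d1, of k] by (simp add: mult_ac)
      have d3: "((\<lambda>x. exp (- (1/x))) has_real_derivative exp (- (1/x)) * (1/x\<^sup>2)) (at x)"
        using DERIV_fun_exp[OF DERIV_minus[OF d1]] by simp
      show ?thesis using DERIV_mult[OF d2 d3] by (simp add: algebra_simps)
    qed
    moreover have "(1/x)^k * (exp (- (1/x)) * (1/x\<^sup>2)) + (real k * (1/x)^(k - 1) * (- 1/x\<^sup>2)) * exp (- (1/x))
        = - real k * flat (k + 1) x + flat (k + 2) x"
      using 1 by (cases k) (simp_all add: flat_def power2_eq_square field_simps)
    ultimately have "((\<lambda>x. (1/x)^k * exp (- (1/x))) has_real_derivative - real k * flat (k + 1) x + flat (k + 2) x) (at x)"
      by simp
    then show ?thesis
      by (rule has_field_derivative_transform_within_open[where S = "{0<..}"]) (use 1 in \<open>auto simp: flat_def\<close>)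
  next
    case 2
    have "((\<lambda>h. (flat k (0 + h) - flat k 0) / h) \<longlongrightarrow> 0) (at 0)"
    proof (rule Lim_transform_eventually[OF flat_tendsto_0[of "k + 1"]])
      show "\<forall>\<^sub>F h in at 0. flat (k + 1) h = (flat k (0 + h) - flat k 0) / h"
        by (auto simp: flat_def eventually_at_filter)
    qed
    then show ?thesis using 2 by (simp add: DERIV_def flat_def)
  next
    case 3
    have "((\<lambda>x. 0) has_real_derivative 0) (at x)" by simp
    then have "(flat k has_real_derivative 0) (at x)"
      by (rule has_field_derivative_transform_within_open[where S = "{..<0}"]) (use 3 in \<open>auto simp: flat_def\<close>)
    then show ?thesis using 3 by (simp add: flat_def)
  qed
qed

text \<open>Derivatives of a function of a single affine coordinate stay in the linear span of such functions.\<close>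

lemma C_class_flat: "C_class n (\<lambda>x::real^3. complex_of_real (flat k (\<alpha> * x $ i + \<beta>)))"
proof -
  have der: "((\<lambda>x::real^3. complex_of_real (flat k (\<alpha> * x $ i + \<beta>))) has_derivative
     (\<lambda>h. complex_of_real ((- real k * flat (k + 1) (\<alpha> * x $ i + \<beta>) + flat (k + 2) (\<alpha> * x $ i + \<beta>)) * (\<alpha> * h $ i)))) (at x)" for k x
  proof -
    have "((\<lambda>x::real^3. \<alpha> * x $ i + \<beta>) has_derivative (\<lambda>h. \<alpha> * h $ i)) (at x)"
      by (auto intro!: derivative_eq_intros bounded_linear_imp_has_derivative bounded_linear_vec_nth)
    moreover have "(flat k has_derivative (*) (- real k * flat (k + 1) (\<alpha> * x $ i + \<beta>) + flat (k + 2) (\<alpha> * x $ i + \<beta>))) (at (\<alpha> * x $ i + \<beta>))"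
      using flat_derivative[of k "\<alpha> * x $ i + \<beta>"] by (simp add: has_field_derivative_def)
    ultimately have "((\<lambda>x::real^3. flat k (\<alpha> * x $ i + \<beta>)) has_derivative
     (\<lambda>h. (- real k * flat (k + 1) (\<alpha> * x $ i + \<beta>) + flat (k + 2) (\<alpha> * x $ i + \<beta>)) * (\<alpha> * h $ i))) (at x)"
      by (rule has_derivative_compose)
    then show ?thesis by (rule has_derivative_of_real)
  qed
  show ?thesis
  proof (induction n arbitrary: k)
    case 0
    have "continuous_on UNIV (\<lambda>x::real^3. complex_of_real (flat k (\<alpha> * x $ i + \<beta>)))"
      by (intro continuous_at_imp_continuous_on ballI has_derivative_continuous[OF der])
    then show ?case by (simp only: C_class.simps)
  next
    case (Suc n)
    have p: "partial j (\<lambda>x::real^3. complex_of_real (flat k (\<alpha> * x $ i + \<beta>)))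
      = (\<lambda>x. complex_of_real (- real k * \<alpha> * axis j 1 $ i) * complex_of_real (flat (k + 1) (\<alpha> * x $ i + \<beta>))
           + complex_of_real (\<alpha> * axis j 1 $ i) * complex_of_real (flat (k + 2) (\<alpha> * x $ i + \<beta>)))" for j
      by (rule ext, subst partial_eq[OF der]) (simp add: algebra_simps)
    have "C_class n (partial j (\<lambda>x::real^3. complex_of_real (flat k (\<alpha> * x $ i + \<beta>))))" for j
      unfolding p by (intro C_class_add C_class_mult C_class_const Suc.IH)
    moreover have "(\<lambda>x::real^3. complex_of_real (flat k (\<alpha> * x $ i + \<beta>))) differentiable_on UNIV"
      using der unfolding differentiable_on_UNIV differentiable_def by blast
    ultimately show ?case by (simp only: C_class.simps simp_thms)
  qed
qed

text \<open>A product of functions of one coordinate supported on the box. The factor \<open>n\<close> pushes every exponential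
  towards 1 inside the box, so that the bumps tend to the indicator function.\<close>

definition box_bump :: "real^3 \<Rightarrow> real^3 \<Rightarrow> nat \<Rightarrow> real^3 \<Rightarrow> real" where
  "box_bump a b n x = (\<Prod>i\<in>UNIV. flat 0 (real n * (x $ i - a $ i)) * flat 0 (real n * (b $ i - x $ i)))"

lemma flat_0_bounds: "0 \<le> flat 0 x" "flat 0 x \<le> 1" "x \<le> 0 \<Longrightarrow> flat 0 x = 0"
  by (auto simp: flat_def)

lemma mem_box_vec: "x \<in> box a b \<longleftrightarrow> (\<forall>i. a $ i < x $ i \<and> x $ i < b $ i)" for x :: "real^3"
  by (auto simp: mem_box_cart)

lemma box_bump_outside: assumes "x \<notin> box a b" shows "box_bump a b n x = 0"
proof -
  obtain i where "x $ i - a $ i \<le> 0 \<or> b $ i - x $ i \<le> 0"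
    using assms by (auto simp: mem_box_vec not_less)
  then have "flat 0 (real n * (x $ i - a $ i)) = 0 \<or> flat 0 (real n * (b $ i - x $ i)) = 0"
    using flat_0_bounds(3) mult_nonneg_nonpos[OF of_nat_0_le_iff] by blast
  then show ?thesis unfolding box_bump_def by (intro prod_zero) auto
qed

lemma box_bump_bounds: "0 \<le> box_bump a b n x" "box_bump a b n x \<le> 1"
  unfolding box_bump_def
  by (auto intro!: prod_nonneg prod_le_1 mult_le_one flat_0_bounds mult_nonneg_nonneg)

lemma box_bump_tendsto: "(\<lambda>n. box_bump a b n x) \<longlonglongrightarrow> indicator (box a b) x"
proof (cases "x \<in> box a b")
  case True
  have fl: "(\<lambda>n. flat 0 (real n * c)) \<longlonglongrightarrow> 1" if "c > 0" for c
  proof -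
    have "(\<lambda>n. exp (- (1/c) * (1 / real n))) \<longlonglongrightarrow> exp (- (1/c) * 0)"
      by (intro tendsto_intros lim_1_over_n)
    moreover have "\<forall>\<^sub>F n in sequentially. exp (- (1/c) * (1 / real n)) = flat 0 (real n * c)"
      using eventually_gt_at_top[of 0]
      by eventually_elim (use that in \<open>auto simp: flat_def mult.commute\<close>)
    ultimately show ?thesis using Lim_transform_eventually by fastforce
  qed
  have "(\<lambda>n. box_bump a b n x) \<longlonglongrightarrow> (\<Prod>i::3\<in>UNIV. 1 * 1)"
    unfolding box_bump_def using True by (intro tendsto_prod tendsto_mult fl) (auto simp: mem_box_vec)
  then show ?thesis using True by simp
qed (simp add: box_bump_outside)

lemma test_function_box_bump: "test_function (\<lambda>x. complex_of_real (box_bump a b n x))"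
proof -
  have "C_class k (\<lambda>x. complex_of_real (box_bump a b n x))" for k
  proof -
    have "C_class k (\<lambda>x. \<Prod>i\<in>UNIV. complex_of_real (flat 0 (real n * x $ i + (- real n * a $ i))) * complex_of_real (flat 0 ((- real n) * x $ i + real n * b $ i)))"
      by (intro C_class_prod C_class_mult C_class_flat)
    then show ?thesis by (simp add: box_bump_def algebra_simps)
  qed
  moreover have "compact_support (\<lambda>x. complex_of_real (box_bump a b n x))"
  proof -
    have "closure {x. complex_of_real (box_bump a b n x) \<noteq> 0} \<subseteq> cbox a b"
      by (rule closure_minimal) (use box_bump_outside[of _ a b n] box_subset_cbox[of a b] in auto)
    then show ?thesis unfolding compact_support_def
      using compact_Int_closed[OF compact_cbox[of a b] closed_closure] by (metis Int_absorb1)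
  qed
  ultimately show ?thesis by (simp add: test_function_def smooth_def)
qed

lemma test_C_class: "test_function \<phi> \<Longrightarrow> C_class n \<phi>"
  by (simp add: test_function_def smooth_def)

lemma test_continuous: "test_function \<phi> \<Longrightarrow> continuous_on UNIV \<phi>"
  using test_C_class[of \<phi> 0] by simp

lemma test_has_derivative: "test_function \<phi> \<Longrightarrow> (\<phi> has_derivative frechet_derivative \<phi> (at x)) (at x)"
  using test_C_class[of \<phi> 1] by (simp add: differentiable_on_UNIV frechet_derivative_works)

lemma test_support:
  assumes "test_function \<phi>"
  obtains K where "compact K" "\<And>x. x \<notin> K \<Longrightarrow> \<phi> x = 0" "\<And>x i. x \<notin> K \<Longrightarrow> partial i \<phi> x = 0"
proof
  let ?K = "closure {x. \<phi> x \<noteq> 0}"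
  show "compact ?K" using assms by (simp add: test_function_def compact_support_def)
  show z: "\<phi> x = 0" if "x \<notin> ?K" for x using that closure_subset[of "{x. \<phi> x \<noteq> 0}"] by auto
  show "partial i \<phi> x = 0" if "x \<notin> ?K" for x i
  proof -
    have "((\<lambda>x. 0) has_derivative (\<lambda>h. 0)) (at x)" by simp
    then have "(\<phi> has_derivative (\<lambda>h. 0)) (at x)"
    proof (rule has_derivative_transform_within_open)
      show "open (- ?K)" by (simp add: open_Compl)
      show "x \<in> - ?K" using that by simp
      show "0 = \<phi> y" if "y \<in> - ?K" for y using z[of y] that by simp
    qed
    then show ?thesis by (simp add: partial_eq)
  qed
qed

lemma test_partial: assumes "test_function \<phi>" shows "test_function (partial i \<phi>)"
proof -
  have "C_class n (partial i \<phi>)" for n using test_C_class[OF assms, of "Suc n"] by simp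
  moreover have "compact_support (partial i \<phi>)"
  proof -
    obtain K where K: "compact K" "\<And>x. x \<notin> K \<Longrightarrow> partial i \<phi> x = 0"
      using test_support[OF assms] by metis
    have "closure {x. partial i \<phi> x \<noteq> 0} \<subseteq> K"
      by (rule closure_minimal) (use K compact_imp_closed in auto)
    then show ?thesis unfolding compact_support_def
      using compact_Int_closed[OF K(1) closed_closure] by (metis Int_absorb1)
  qed
  ultimately show ?thesis by (simp add: test_function_def smooth_def)
qed

lemma test_bounded:
  assumes "test_function \<phi>" obtains B where "\<And>x. cmod (\<phi> x) \<le> B"
proof -
  obtain K where K: "compact K" "\<And>x. x \<notin> K \<Longrightarrow> \<phi> x = 0"
    using test_support[OF assms] by metis
  have "bounded (\<phi> ` K)"
    using K(1) test_continuous[OF assms] by (intro compact_imp_bounded compact_continuous_image) (auto intro: continuous_on_subset)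
  then obtain B where "\<And>x. x \<in> K \<Longrightarrow> cmod (\<phi> x) \<le> B" by (auto simp: bounded_iff)
  then have "cmod (\<phi> x) \<le> max B 0" for x using K(2)[of x] by (cases "x \<in> K") (auto intro: max.coboundedI1)
  then show ?thesis using that by blast
qed

lemma continuous_measurable_lebesgue:
  "continuous_on UNIV f \<Longrightarrow> f \<in> borel_measurable (lebesgue :: (real^3) measure)"
  for f :: "real^3 \<Rightarrow> 'b::{second_countable_topology, metric_space}"
  by (intro measurable_completion) (simp add: borel_measurable_continuous_onI)

lemma L2_bounded_compact:
  assumes "f \<in> borel_measurable lebesgue" "compact K" "\<And>x. x \<notin> K \<Longrightarrow> f x = 0" "\<And>x. cmod (f x) \<le> B"
  shows "f \<in> L2"
proof -
  have [measurable]: "K \<in> sets lebesgue" using assms(2) by (simp add: compact_imp_closed borel_closed)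
  have fin: "emeasure lebesgue K < \<infinity>"
    using emeasure_compact_finite[OF assms(2)] assms(2) by (simp add: compact_imp_closed borel_closed)
  have "integrable lebesgue (indicator K :: real^3 \<Rightarrow> real)"
    using fin by (simp add: integrable_indicator_iff)
  then have "(\<lambda>x. complex_of_real (indicator K x)) \<in> L2"
  proof -
    have "(cmod (complex_of_real (indicator K x)))\<^sup>2 = indicator K x" for x
      by (auto simp: indicator_def)
    then show ?thesis using \<open>integrable lebesgue (indicator K :: real^3 \<Rightarrow> real)\<close> by (simp add: L2_def)
  qed
  from L2_bounded_mult[OF this assms(1) assms(4)] have "(\<lambda>x. f x * complex_of_real (indicator K x)) \<in> L2" .
  also have "(\<lambda>x. f x * complex_of_real (indicator K x)) = f"
    using assms(3) by (intro ext) (auto simp: indicator_def)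
  finally show ?thesis .
qed

lemma test_L2: assumes "test_function \<phi>" shows "\<phi> \<in> L2"
proof -
  obtain K where "compact K" "\<And>x. x \<notin> K \<Longrightarrow> \<phi> x = 0"
    using test_support[OF assms] by metis
  moreover obtain B where "\<And>x. cmod (\<phi> x) \<le> B" using test_bounded[OF assms] by metis
  ultimately show ?thesis
    using L2_bounded_compact continuous_measurable_lebesgue[OF test_continuous[OF assms]] by metis
qed

lemma translate_has_derivative:
  fixes \<phi> :: "real^3 \<Rightarrow> 'b::real_normed_vector"
  assumes "(\<phi> has_derivative D) (at (x + a))" shows "((\<lambda>x. \<phi> (x + a)) has_derivative D) (at x)"
proof -
  have "((\<lambda>x. x + a) has_derivative (\<lambda>h. h)) (at x)" by (auto intro!: derivative_eq_intros)
  from has_derivative_compose[OF this assms] show ?thesis .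
qed

lemma partial_translate:
  assumes "\<phi> differentiable_on UNIV" shows "partial i (\<lambda>x. \<phi> (x + a)) x = partial i \<phi> (x + a)"
proof -
  have "(\<phi> has_derivative frechet_derivative \<phi> (at (x + a))) (at (x + a))"
    using assms by (auto simp: differentiable_on_UNIV frechet_derivative_works)
  then have "((\<lambda>x. \<phi> (x + a)) has_derivative frechet_derivative \<phi> (at (x + a))) (at x)"
    by (rule translate_has_derivative)
  then show ?thesis by (subst partial_eq) (auto simp: partial_def)
qed

lemma C_class_translate: "C_class n \<phi> \<Longrightarrow> C_class n (\<lambda>x. \<phi> (x + a))"
proof (induction n arbitrary: \<phi>)
  case 0
  then show ?case
    using continuous_on_compose2[of UNIV \<phi> UNIV "\<lambda>x. x + a"]
    by (simp add: continuous_on_add continuous_on_id continuous_on_const)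
next
  case (Suc n)
  have "(\<lambda>x. \<phi> (x + a)) differentiable_on UNIV"
    unfolding differentiable_on_UNIV
  proof
    fix x
    have "(\<phi> has_derivative frechet_derivative \<phi> (at (x + a))) (at (x + a))"
      using Suc.prems by (simp add: differentiable_on_UNIV frechet_derivative_works)
    from translate_has_derivative[OF this] show "(\<lambda>x. \<phi> (x + a)) differentiable (at x)"
      unfolding differentiable_def by blast
  qed
  moreover have "partial i (\<lambda>x. \<phi> (x + a)) = (\<lambda>x. partial i \<phi> (x + a))" for i
    using partial_translate[of \<phi> i a] Suc.prems by (intro ext) simp
  ultimately show ?case using Suc by auto
qed

lemma test_translate: assumes "test_function \<phi>" shows "test_function (\<lambda>x. \<phi> (x + a))"
proof -
  obtain K where K: "compact K" "\<And>x. x \<notin> K \<Longrightarrow> \<phi> x = 0"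
    using test_support[OF assms] by metis
  have K': "compact ((\<lambda>x. x - a) ` K)" using K(1) by (intro compact_continuous_image continuous_intros)
  have "closure {x. \<phi> (x + a) \<noteq> 0} \<subseteq> (\<lambda>x. x - a) ` K"
  proof (rule closure_minimal)
    show "{x. \<phi> (x + a) \<noteq> 0} \<subseteq> (\<lambda>x. x - a) ` K"
    proof
      fix x assume "x \<in> {x. \<phi> (x + a) \<noteq> 0}"
      then have "x + a \<in> K" using K(2) by auto
      then show "x \<in> (\<lambda>x. x - a) ` K" by (intro image_eqI[of _ _ "x + a"]) auto
    qed
  qed (use K' compact_imp_closed in auto)
  then have "compact_support (\<lambda>x. \<phi> (x + a))" unfolding compact_support_def
    using compact_Int_closed[OF K' closed_closure] by (metis Int_absorb1)
  then show ?thesis using C_class_translate[OF test_C_class[OF assms]] by (simp add: test_function_def smooth_def)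
qed

lemma laplacian_translate:
  assumes "test_function \<phi>" shows "laplacian (\<lambda>x. \<phi> (x + a)) x = laplacian \<phi> (x + a)"
proof -
  have "partial i (\<lambda>x. \<phi> (x + a)) = (\<lambda>x. partial i \<phi> (x + a))" for i
    using partial_translate[of \<phi> i a] test_C_class[OF assms, of 1] by (intro ext) simp
  moreover have "partial i (\<lambda>x. partial i \<phi> (x + a)) x = partial i (partial i \<phi>) (x + a)" for i
    using partial_translate[of "partial i \<phi>" i a] test_C_class[OF test_partial[OF assms], of 1] by simp
  ultimately show ?thesis by (simp add: laplacian_def)
qed

lemma test_laplacian_L2: assumes "test_function \<phi>" shows "laplacian \<phi> \<in> L2"
  unfolding laplacian_def[abs_def] by (intro L2_sum test_L2 test_partial assms)

section \<open>Translation groups and their generators\<close>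

lemma cls_scaleR: assumes "f \<in> L2" shows "cls (\<lambda>t. complex_of_real r * f t) = r *\<^sub>R cls f"
  unfolding scaleR_l2_def by (rule cls_cong, rule AE_mp[OF fn_cls[OF assms]]) auto

text \<open>Translation along a coordinate axis is a strongly continuous unitary group. Its generator is the partial
  derivative in the Sobolev sense, and \<open>gen i f g\<close> is the graph of that unbounded operator. The vector
  \<open>test_vec \<phi>\<close> carries a conjugation because the weak formulations pair functions bilinearly with \<open>\<phi>\<close>, whereas
  the inner product is sesquilinear.\<close>

definition transl :: "3 \<Rightarrow> real \<Rightarrow> l2 \<Rightarrow> l2" where "transl i s = shift (s *\<^sub>R axis i 1)"
definition gen :: "3 \<Rightarrow> l2 \<Rightarrow> l2 \<Rightarrow> bool" where
  "gen i f g \<longleftrightarrow> ((\<lambda>s. transl i s f) has_vector_derivative g) (at 0)"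
definition test_vec :: "(real^3 \<Rightarrow> complex) \<Rightarrow> l2" where "test_vec \<phi> = cls (\<lambda>x. cnj (\<phi> x))"

lemma test_line_derivative:
  assumes "test_function \<phi>"
  shows "((\<lambda>s. \<phi> (x + s *\<^sub>R axis i 1)) has_vector_derivative partial i \<phi> (x + s *\<^sub>R axis i 1)) (at s)"
proof -
  have "((\<lambda>s. x + s *\<^sub>R axis i 1) has_vector_derivative axis i 1) (at s)"
    by (auto intro!: derivative_eq_intros)
  from vector_derivative_diff_chain_within[OF this, of \<phi> "frechet_derivative \<phi> (at (x + s *\<^sub>R axis i 1))"]
  show ?thesis using test_has_derivative[OF assms, of "x + s *\<^sub>R axis i 1"]
    by (simp add: o_def partial_def has_derivative_at_withinI)
qed

text \<open>Near \<open>s = 0\<close> all difference quotients live on one compact set and are bounded by the mean value theorem, so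
  dominated convergence applies.\<close>

lemma gen_test_vec:
  assumes "test_function \<phi>" shows "gen i (test_vec \<phi>) (test_vec (partial i \<phi>))"
proof -
  let ?\<psi> = "partial i \<phi>"
  have t': "test_function ?\<psi>" by (rule test_partial[OF assms])
  obtain K where K: "compact K" "\<And>x. x \<notin> K \<Longrightarrow> \<phi> x = 0" "\<And>x. x \<notin> K \<Longrightarrow> ?\<psi> x = 0"
    using test_support[OF assms] by metis
  obtain B where B: "\<And>x. cmod (?\<psi> x) \<le> B" using test_bounded[OF t'] by metis
  have B0: "0 \<le> B" using B[of 0] norm_ge_zero order_trans by blast
  define K' where "K' = {x + y |x y. x \<in> K \<and> y \<in> cball (0::real^3) 1}"
  have K': "compact K'" unfolding K'_def by (intro compact_sums K(1) compact_cball)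
  define q where "q s x = (\<phi> (x + s *\<^sub>R axis i 1) - \<phi> x) /\<^sub>R s - ?\<psi> x" for s x
  have [measurable]: "\<phi> \<in> borel_measurable lebesgue" "?\<psi> \<in> borel_measurable lebesgue"
    using test_L2[OF assms] test_L2[OF t'] L2_measurable by auto
  have [measurable]: "(\<lambda>x. \<phi> (x + s *\<^sub>R axis i 1)) \<in> borel_measurable lebesgue" for s
    by (rule measurable_shift_lebesgue) measurable
  have qm [measurable]: "q s \<in> borel_measurable lebesgue" for s
    unfolding q_def by measurable
  have qb: "cmod (q s x) \<le> 2 * B" for s x
  proof -
    have "cmod (\<phi> (x + s *\<^sub>R axis i 1) - \<phi> (x + 0 *\<^sub>R axis i 1)) \<le> B * \<bar>s\<bar>"
      by (rule derivative_bound_const[OF test_line_derivative[OF assms]]) (rule B)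
    then have n: "cmod (\<phi> (x + s *\<^sub>R axis i 1) - \<phi> x) \<le> B * \<bar>s\<bar>" by simp
    have "cmod ((\<phi> (x + s *\<^sub>R axis i 1) - \<phi> x) /\<^sub>R s) \<le> B"
    proof (cases "s = 0")
      case False
      then have "cmod (\<phi> (x + s *\<^sub>R axis i 1) - \<phi> x) / \<bar>s\<bar> \<le> B"
        using n by (simp add: pos_divide_le_eq)
      then show ?thesis by (simp only: norm_scaleR abs_inverse) (simp add: field_simps)
    qed (use B0 in simp)
    then show ?thesis unfolding q_def using B[of x] norm_triangle_ineq4[of "(\<phi> (x + s *\<^sub>R axis i 1) - \<phi> x) /\<^sub>R s" "?\<psi> x"] by linarith
  qed
  have q0: "q s x = 0" if "x \<notin> K'" "\<bar>s\<bar> \<le> 1" for s x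
  proof -
    have "x \<notin> K"
    proof
      assume "x \<in> K" then have "x + 0 \<in> K'" unfolding K'_def by force
      with that show False by simp
    qed
    moreover have "x + s *\<^sub>R axis i 1 \<notin> K"
    proof
      assume *: "x + s *\<^sub>R axis i 1 \<in> K"
      have "(x + s *\<^sub>R axis i 1) + (- (s *\<^sub>R axis i 1)) \<in> K'"
        unfolding K'_def using * that(2)
        by (intro CollectI exI[of _ "x + s *\<^sub>R axis i 1"] exI[of _ "- (s *\<^sub>R axis i 1)"] conjI refl) (auto simp: norm_axis_1)
      with that show False by simp
    qed
    ultimately show ?thesis using K by (simp add: q_def)
  qed
  have qL: "q s \<in> L2" if "\<bar>s\<bar> \<le> 1" for s
    by (rule L2_bounded_compact[OF qm K']) (use q0 qb that in auto)
  have "((\<lambda>s. (transl i s (test_vec \<phi>) - transl i 0 (test_vec \<phi>)) /\<^sub>R (s - 0)) \<longlongrightarrow> test_vec ?\<psi>) (at 0 within {-1..1})"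
    unfolding tendsto_at_iff_sequentially o_def
  proof (intro allI impI)
    fix X :: "nat \<Rightarrow> real" assume X: "\<forall>k. X k \<in> {-1..1} - {0}" "X \<longlonglongrightarrow> 0"
    have X1: "\<bar>X k\<bar> \<le> 1" "X k \<noteq> 0" for k using X(1) by (auto simp: abs_le_iff)
    have "(\<lambda>k. LINT x|lebesgue. (cmod (q (X k) x))\<^sup>2) \<longlonglongrightarrow> (LINT x|(lebesgue::(real^3) measure). 0)"
    proof (rule integral_dominated_convergence[where w = "\<lambda>x. (2*B)\<^sup>2 * indicator K' x"])
      have "emeasure lebesgue K' < \<infinity>"
        using emeasure_compact_finite[OF K'] K' by (simp add: compact_imp_closed borel_closed)
      then show "integrable lebesgue (\<lambda>x. (2*B)\<^sup>2 * indicator K' x)"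
        using K' by (auto simp: integrable_indicator_iff compact_imp_closed borel_closed)
      have "(\<lambda>k. q (X k) x) \<longlonglongrightarrow> 0" for x
      proof -
        have "((\<lambda>s. (\<phi> (x + s *\<^sub>R axis i 1) - \<phi> x) /\<^sub>R s) \<longlongrightarrow> ?\<psi> x) (at 0)"
          using test_line_derivative[OF assms, of x i 0] unfolding vector_derivative_at_iff_tendsto by simp
        then have "(\<lambda>k. (\<phi> (x + X k *\<^sub>R axis i 1) - \<phi> x) /\<^sub>R X k) \<longlonglongrightarrow> ?\<psi> x"
          using X X1 unfolding tendsto_at_iff_sequentially o_def by blast
        then show ?thesis unfolding q_def by (simp add: LIM_zero)
      qed
      then have "(\<lambda>k. (cmod (q (X k) x))\<^sup>2) \<longlonglongrightarrow> 0" for x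
        using tendsto_power[OF tendsto_norm_zero, of "\<lambda>k. q (X k) x" sequentially 2] by simp
      then show "AE x in lebesgue. (\<lambda>k. (cmod (q (X k) x))\<^sup>2) \<longlonglongrightarrow> 0" by simp
      show "AE x in lebesgue. norm ((cmod (q (X k) x))\<^sup>2) \<le> (2*B)\<^sup>2 * indicator K' x" for k
      proof (rule AE_I2)
        fix x show "norm ((cmod (q (X k) x))\<^sup>2) \<le> (2*B)\<^sup>2 * indicator K' x"
          using q0[of x "X k"] X1(1)[of k] power_mono[OF qb[of "X k" x], of 2] by (auto simp: indicator_def)
      qed
    qed measurable
    moreover have "(LINT x|lebesgue. (cmod (q (X k) x))\<^sup>2) = (norm ((transl i (X k) (test_vec \<phi>) - transl i 0 (test_vec \<phi>)) /\<^sub>R (X k - 0) - test_vec ?\<psi>))\<^sup>2" for k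
    proof -
      note L = L2_cnj[OF test_L2[OF assms]] L2_cnj[OF test_L2[OF t']]
      have Ls: "(\<lambda>x. cnj (\<phi> (x + X k *\<^sub>R axis i 1))) \<in> L2" using L2_shift[OF L(1)] .
      have "(transl i (X k) (test_vec \<phi>) - transl i 0 (test_vec \<phi>)) /\<^sub>R (X k - 0) - test_vec ?\<psi> = cls (\<lambda>x. cnj (q (X k) x))"
      proof -
        have "(transl i (X k) (test_vec \<phi>) - transl i 0 (test_vec \<phi>)) /\<^sub>R (X k - 0) - test_vec ?\<psi>
            = cls (\<lambda>x. complex_of_real (inverse (X k)) * (cnj (\<phi> (x + X k *\<^sub>R axis i 1)) - cnj (\<phi> x)) - cnj (?\<psi> x))"
          unfolding transl_def test_vec_def shift_cls[OF L(1)]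
          by (simp add: cls_diff cls_scaleR L2_cmult L2_diff L Ls del: of_real_inverse)
        then show ?thesis by (simp add: q_def scaleR_conv_of_real)
      qed
      then show ?thesis using norm_cls[OF L2_cnj[OF qL[OF X1(1)[of k]]]] by (simp add: L2_norm_def)
    qed
    ultimately have "(\<lambda>k. (norm ((transl i (X k) (test_vec \<phi>) - transl i 0 (test_vec \<phi>)) /\<^sub>R (X k - 0) - test_vec ?\<psi>))\<^sup>2) \<longlonglongrightarrow> 0"
      by simp
    from tendsto_real_sqrt[OF this]
    show "(\<lambda>k. (transl i (X k) (test_vec \<phi>) - transl i 0 (test_vec \<phi>)) /\<^sub>R (X k - 0)) \<longlonglongrightarrow> test_vec ?\<psi>"
      by (simp add: tendsto_norm_zero_iff LIM_zero_iff)
  qed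
  then show ?thesis unfolding gen_def vector_derivative_at_iff_tendsto by (simp add: at_within_Icc_at)
qed

text \<open>The two components of the complex pairing are the real inner products with \<open>test_vec \<phi>\<close> and with \<open>J\<close> of it; this
  is how complex equations become pairs of real ones.\<close>

lemma pairing:
  assumes "\<phi> \<in> L2" shows "(LINT x|lebesgue. fn g x * \<phi> x) = Complex (inner g (test_vec \<phi>)) (inner g (J (test_vec \<phi>)))"
proof -
  have i: "integrable lebesgue (\<lambda>x. fn g x * \<phi> x)" by (rule L2_mult_integrable) (auto simp: assms)
  have "inner g (test_vec \<phi>) = (LINT x|lebesgue. Re (fn g x * \<phi> x))"
    using inner_cls[OF fn_L2[of g] L2_cnj[OF assms]] by (simp add: test_vec_def)
  moreover have "inner g (J (test_vec \<phi>)) = (LINT x|lebesgue. Re (fn g x * cnj (\<i> * cnj (\<phi> x))))"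
    using inner_cls[OF fn_L2[of g] L2_cmult[OF L2_cnj[OF assms], of \<i>]] by (simp add: test_vec_def J_cls[OF L2_cnj[OF assms]])
  moreover have "Re (fn g x * cnj (\<i> * cnj (\<phi> x))) = Im (fn g x * \<phi> x)" for x by simp
  ultimately show ?thesis using integral_Re[OF i] integral_Im[OF i] by (simp only: complex_eq_iff complex.sel)
qed

lemma integrable_box: "f \<in> L2 \<Longrightarrow> integrable lebesgue (\<lambda>x. f x * complex_of_real (indicator (box a b) x))"
proof (rule L2_mult_integrable, assumption, rule L2_bounded_compact[of _ "cbox a b" 1])
  have [measurable]: "box a b \<in> sets lebesgue" by simp
  show "(\<lambda>x. complex_of_real (indicator (box a b) x)) \<in> borel_measurable lebesgue" by measurable
qed (use box_subset_cbox[of a b] in \<open>auto simp: indicator_def\<close>)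

lemma box_Int_stable: "Int_stable (range (\<lambda>(a, b). box a b :: (real^3) set))"
proof (rule Int_stableI)
  fix A B assume "A \<in> range (\<lambda>(a, b). box a b :: (real^3) set)" "B \<in> range (\<lambda>(a, b). box a b :: (real^3) set)"
  then obtain a b c d where "A = box a b" "B = box c d" by auto
  then show "A \<inter> B \<in> range (\<lambda>(a, b). box a b :: (real^3) set)" by (auto simp: box_Int_box)
qed

lemma sigma_finite_lebesgue: "sigma_finite_measure (lebesgue :: (real^3) measure)"
proof
  from lborel.sigma_finite_countable obtain A :: "(real^3) set set"
    where A: "countable A" "A \<subseteq> sets lborel" "\<Union>A = space lborel" "\<forall>a\<in>A. emeasure lborel a \<noteq> \<infinity>" by blast
  show "\<exists>A::(real^3) set set. countable A \<and> A \<subseteq> sets lebesgue \<and> \<Union>A = space lebesgue \<and> (\<forall>a\<in>A. emeasure lebesgue a \<noteq> \<infinity>)"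
  proof (intro exI[of _ A] conjI ballI)
    show "A \<subseteq> sets lebesgue" using A(2) by (meson sets_completionI_sets subset_iff)
    show "emeasure lebesgue a \<noteq> \<infinity>" if "a \<in> A" for a
    proof -
      have "a \<in> sets lborel" using A(2) that by blast
      then show ?thesis using A(4) that by (simp add: emeasure_completion)
    qed
  qed (use A in auto)
qed

text \<open>Boxes are an intersection-stable generator of the Borel sets. Cutting \<open>f\<close> off to a large box first makes it
  integrable, so that complements and disjoint unions can be handled.\<close>

lemma null_if_box_integrals_null:
  assumes "f \<in> L2" and box0: "\<And>a b. (LINT x|lebesgue. f x * complex_of_real (indicator (box a b) x)) = 0"
  shows "AE x in lebesgue. f x = 0"
proof -
  let ?G = "range (\<lambda>(a, b). box a b :: (real^3) set)"
  have [measurable]: "f \<in> borel_measurable lebesgue" by (rule L2_measurable[OF assms(1)])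
  have G: "sigma_sets UNIV ?G = sets borel" by (subst borel_eq_box) simp
  define u where "u N = real N *\<^sub>R (1::real^3)" for N :: nat
  have "AE x in lebesgue. f x * complex_of_real (indicator (box (- u N) (u N)) x) = 0" for N
  proof -
    define h where "h x = f x * complex_of_real (indicator (box (- u N) (u N)) x)" for x
    have hi: "integrable lebesgue h" unfolding h_def by (rule integrable_box[OF assms(1)])
    have hb: "set_lebesgue_integral lebesgue A h = 0" if "A \<in> sigma_sets UNIV ?G" for A
    proof -
      have "?G \<subseteq> Pow UNIV" by simp
      from box_Int_stable this that show ?thesis
      proof (induct rule: sigma_sets_induct_disjoint)
        case (basic A)
        then obtain a b where A: "A = box a b" by auto
        obtain c d where "box a b \<inter> box (- u N) (u N) = box c d" using box_Int_box by blast
        moreover have "indicat_real (box a b) x *\<^sub>R h x = f x * complex_of_real (indicator (box a b \<inter> box (- u N) (u N)) x)" for x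
          by (simp add: h_def indicator_def)
        ultimately show ?case using box0[of c d] by (simp add: set_lebesgue_integral_def A)
      next
        case empty
        show ?case by (simp add: set_lebesgue_integral_def)
      next
        case (compl A)
        have A: "A \<in> sets lebesgue" using compl(1) G by auto
        have "indicat_real (UNIV - A) x *\<^sub>R h x = h x - indicat_real A x *\<^sub>R h x" for x
          by (simp add: indicator_def)
        then have "set_lebesgue_integral lebesgue (UNIV - A) h = integral\<^sup>L lebesgue h - set_lebesgue_integral lebesgue A h"
          unfolding set_lebesgue_integral_def using hi A by (simp add: integrable_mult_indicator)
        moreover have "integral\<^sup>L lebesgue h = 0" unfolding h_def by (rule box0)
        ultimately show ?case using compl(2) by simp
      next
        case (union A)
        have A: "A n \<in> sets lebesgue" for n using union(2) G by auto
        have "set_lebesgue_integral lebesgue (\<Union>n. A n) h = (\<Sum>n. set_lebesgue_integral lebesgue (A n) h)"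
        proof (rule lebesgue_integral_countable_add)
          show "A i \<inter> A j = {}" if "i \<noteq> j" for i j using union(1) that by (auto simp: disjoint_family_on_def)
          show "set_integrable lebesgue (\<Union>n. A n) h"
            unfolding set_integrable_def using A hi by (intro integrable_mult_indicator) auto
        qed (rule A)
        then show ?case using union(3) by simp
      qed
    qed
    have "AE x in lebesgue. h x = 0"
    proof (rule sigma_finite_measure.density_zero[OF sigma_finite_lebesgue hi])
      fix A :: "(real^3) set" assume "A \<in> sets lebesgue"
      then obtain S N' N'' where S: "A = S \<union> N'" "N'' \<in> null_sets lborel" "N' \<subseteq> N''" "S \<in> sets lborel"
        by (rule sets_completionE)
      have SL: "S \<in> sets lebesgue" using S(4) by simp
      have "AE x in lebesgue. x \<notin> N''" by (rule AE_not_in) (use S(2) in \<open>simp add: null_sets_completionI\<close>)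
      then have "AE x in lebesgue. indicat_real A x *\<^sub>R h x = indicat_real S x *\<^sub>R h x"
        by eventually_elim (use S in \<open>auto simp: indicator_def\<close>)
      then have "set_lebesgue_integral lebesgue A h = set_lebesgue_integral lebesgue S h"
        unfolding set_lebesgue_integral_def using hi \<open>A \<in> sets lebesgue\<close> SL
        by (intro integral_cong_AE) (auto intro!: borel_measurable_integrable integrable_mult_indicator)
      also have "\<dots> = 0"
        by (rule hb) (use S(4) G in simp)
      finally show "set_lebesgue_integral lebesgue A h = 0" .
    qed
    then show ?thesis by (simp add: h_def)
  qed
  then have "AE x in lebesgue. \<forall>N. f x * complex_of_real (indicator (box (- u N) (u N)) x) = 0"
    by (simp only: AE_all_countable) blast
  then show ?thesis
  proof eventually_elim
    case (elim x)
    obtain N :: nat where N: "norm x < real N" using reals_Archimedean2 by blast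
    have "\<bar>x $ i\<bar> < real N" for i using component_le_norm_cart[of x i] N by linarith
    then have "x \<in> box (- u N) (u N)" by (auto simp: mem_box_vec u_def abs_less_iff minus_less_iff)
    then show ?case using elim[rule_format, of N] by simp
  qed
qed

lemma test_functions_total:
  assumes "\<And>\<phi>. test_function \<phi> \<Longrightarrow> inner g (test_vec \<phi>) = 0" "\<And>\<phi>. test_function \<phi> \<Longrightarrow> inner g (J (test_vec \<phi>)) = 0"
  shows "g = 0"
proof (rule l2_eqI)
  have "(LINT x|lebesgue. fn g x * complex_of_real (indicator (box a b) x)) = 0" for a b
  proof -
    have "(\<lambda>n. LINT x|lebesgue. fn g x * complex_of_real (box_bump a b n x)) \<longlonglongrightarrow>
       (LINT x|lebesgue. fn g x * complex_of_real (indicator (box a b) x))"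
    proof (rule integral_dominated_convergence[where w = "\<lambda>x. cmod (fn g x * complex_of_real (indicator (box a b) x))"])
      show "integrable lebesgue (\<lambda>x. cmod (fn g x * complex_of_real (indicator (box a b) x)))"
        by (intro integrable_norm integrable_box fn_L2)
      show "(\<lambda>x. fn g x * complex_of_real (indicator (box a b) x)) \<in> borel_measurable lebesgue"
        by (intro borel_measurable_integrable integrable_box fn_L2)
      show "(\<lambda>x. fn g x * complex_of_real (box_bump a b n x)) \<in> borel_measurable lebesgue" for n
        by (intro borel_measurable_integrable L2_mult_integrable fn_L2 test_L2[OF test_function_box_bump])
      have "(\<lambda>n. fn g x * complex_of_real (box_bump a b n x)) \<longlonglongrightarrow> fn g x * complex_of_real (indicator (box a b) x)" for x
        by (intro tendsto_intros box_bump_tendsto)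
      then show "AE x in lebesgue. (\<lambda>n. fn g x * complex_of_real (box_bump a b n x)) \<longlonglongrightarrow> fn g x * complex_of_real (indicator (box a b) x)"
        by simp
      show "AE x in lebesgue. norm (fn g x * complex_of_real (box_bump a b n x)) \<le> cmod (fn g x * complex_of_real (indicator (box a b) x))" for n
        using box_bump_bounds[of a b n] box_bump_outside[of _ a b n]
        by (intro AE_I2) (auto simp: norm_mult indicator_def mult_left_le)
    qed
    moreover have "(LINT x|lebesgue. fn g x * complex_of_real (box_bump a b n x)) = 0" for n
      using pairing[OF test_L2[OF test_function_box_bump[of a b n]], of g] assms[OF test_function_box_bump[of a b n]]
      by (simp add: Complex_eq_0)
    ultimately show ?thesis by (simp add: LIMSEQ_const_iff)
  qed
  then have "AE x in lebesgue. fn g x = 0" by (intro null_if_box_integrals_null) simp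
  then show "AE t in lebesgue. fn g t = fn 0 t" using fn_zero by eventually_elim simp
qed


lemma transl_transl: "transl i s (transl j r x) = shift (s *\<^sub>R axis i 1 + r *\<^sub>R axis j 1) x"
  by (simp add: transl_def shift_shift)
lemma transl_add: "transl i s (transl i r x) = transl i (s + r) x"
  by (simp add: transl_def shift_shift scaleR_add_left)
lemma transl_0 [simp]: "transl i 0 x = x" by (simp add: transl_def)
lemma transl_commute: "transl i s (transl j r x) = transl j r (transl i s x)"
  by (simp add: transl_transl add.commute)
lemma norm_transl [simp]: "norm (transl i s x) = norm x" by (simp add: transl_def)
lemma inner_transl_transl [simp]: "inner (transl i s x) (transl i s y) = inner x y" by (simp add: transl_def)
lemma inner_transl_left: "inner (transl i s x) y = inner x (transl i (- s) y)"
  by (simp add: transl_def inner_shift_left)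
lemma bounded_linear_transl: "bounded_linear (transl i s)" unfolding transl_def by (rule bounded_linear_shift)
lemma linear_transl: "linear (transl i s)" by (rule bounded_linear.linear[OF bounded_linear_transl])
lemma transl_J: "transl i s (J x) = J (transl i s x)" by (simp add: transl_def shift_J)

lemma test_vec_mem_L2: "test_function \<phi> \<Longrightarrow> (\<lambda>x. cnj (\<phi> x)) \<in> L2" by (intro L2_cnj test_L2)

lemma transl_test_vec: "test_function \<phi> \<Longrightarrow> transl i s (test_vec \<phi>) = test_vec (\<lambda>x. \<phi> (x + s *\<^sub>R axis i 1))"
  by (simp add: transl_def test_vec_def shift_cls[OF test_vec_mem_L2])

text \<open>The vectors with this property form a closed subspace since translations are isometries, and it contains the
  test functions.\<close>

lemma transl_tendsto: "((\<lambda>s. transl i s x) \<longlongrightarrow> x) (at 0)"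
proof -
  define S where "S = {x. ((\<lambda>s. transl i s x) \<longlongrightarrow> x) (at 0)}"
  have "x \<in> S"
  proof (rule closed_subspace_eq_UNIV)
    show "closed S"
      unfolding closed_sequential_limits
    proof (intro allI impI)
      fix X l assume X: "(\<forall>n. X n \<in> S) \<and> X \<longlonglongrightarrow> l"
      have "((\<lambda>s. transl i s l) \<longlongrightarrow> l) (at 0)"
      proof (rule tendstoI)
        fix e :: real assume e: "0 < e"
        obtain n where n: "dist (X n) l < e / 3"
          using X e by (metis LIMSEQ_def divide_pos_pos zero_less_numeral le_refl)
        have "\<forall>\<^sub>F s in at 0. dist (transl i s (X n)) (X n) < e / 3"
          using X e by (intro tendstoD) (auto simp: S_def)
        then show "\<forall>\<^sub>F s in at 0. dist (transl i s l) l < e"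
        proof eventually_elim
          case (elim s)
          have "dist (transl i s l) (transl i s (X n)) = dist (X n) l"
            using linear_diff[OF linear_transl, of i s l "X n"] norm_transl[of i s "l - X n"] by (simp add: dist_norm norm_minus_commute)
          then show ?case using elim n
            using dist_triangle[of "transl i s l" l "transl i s (X n)"] dist_triangle[of "transl i s (X n)" l "X n"] by linarith
        qed
      qed
      then show "l \<in> S" by (simp add: S_def)
    qed
    show "subspace S"
      unfolding subspace_def S_def
      by (auto simp: linear_0[OF linear_transl] linear_add[OF linear_transl] linear_cmul[OF linear_transl] intro!: tendsto_intros)
    have tvS: "test_vec \<phi> \<in> S" if "test_function \<phi>" for \<phi>
      using has_vector_derivative_continuous[OF gen_test_vec[OF that, of i, unfolded gen_def]] by (simp add: S_def continuous_at)
    have "J (test_vec \<phi>) \<in> S" if "test_function \<phi>" for \<phi>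
      using tvS[OF that] bounded_linear.tendsto[OF bounded_linear_J] by (auto simp: S_def transl_J)
    then show "z = 0" if "\<And>s. s \<in> S \<Longrightarrow> inner z s = 0" for z
      using that tvS by (intro test_functions_total) auto
  qed
  then show ?thesis by (simp add: S_def)
qed

lemma transl_tendsto_at: "((\<lambda>s. transl i s x) \<longlongrightarrow> transl i r x) (at r)"
proof -
  have "((\<lambda>s. transl i r (transl i s x)) \<longlongrightarrow> transl i r x) (at 0)"
    by (rule bounded_linear.tendsto[OF bounded_linear_transl transl_tendsto])
  then show ?thesis by (subst LIM_offset_zero_iff) (simp_all add: transl_add)
qed

lemma continuous_transl: "continuous_on UNIV (\<lambda>s. transl i s x)"
  using transl_tendsto_at by (simp add: continuous_on_def)

lemma gen_at: assumes "gen i f g" shows "((\<lambda>s. transl i s f) has_vector_derivative transl i s g) (at s)"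
proof -
  have "((\<lambda>r. r - s) has_vector_derivative 1) (at s)" by (auto intro!: derivative_eq_intros)
  from vector_diff_chain_at[OF this, of "\<lambda>s. transl i s f" g]
  have "((\<lambda>r. transl i (r - s) f) has_vector_derivative g) (at s)" using assms by (simp add: gen_def o_def)
  from bounded_linear.has_vector_derivative[OF bounded_linear_transl this, of i s]
  show ?thesis by (simp add: transl_add)
qed

lemma gen_unique: "gen i f g \<Longrightarrow> gen i f h \<Longrightarrow> g = h"
  unfolding gen_def by (rule vector_derivative_unique_at)

lemma gen_map:
  assumes "bounded_linear A" "\<And>s x. A (transl i s x) = transl i s (A x)" "gen i f g"
  shows "gen i (A f) (A g)"
  using bounded_linear.has_vector_derivative[OF assms(1) assms(3)[unfolded gen_def]]
  by (simp add: gen_def assms(2))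

lemma gen_add: "gen i f g \<Longrightarrow> gen i h k \<Longrightarrow> gen i (f + h) (g + k)"
  unfolding gen_def by (simp add: linear_add[OF linear_transl] has_vector_derivative_add)
lemma gen_scaleR: "gen i f g \<Longrightarrow> gen i (c *\<^sub>R f) (c *\<^sub>R g)"
  by (rule gen_map[of "\<lambda>x. c *\<^sub>R x"]) (auto simp: linear_cmul[OF linear_transl] bounded_linear_scaleR_right)
lemma gen_J: "gen i f g \<Longrightarrow> gen i (J f) (J g)"
  by (rule gen_map) (auto simp: bounded_linear_J transl_J)

text \<open>Integration by parts is the infinitesimal form of the invariance of the inner product under translation.\<close>

lemma gen_antisymmetric:
  assumes "gen i f g" "gen i h k" shows "inner g h = - inner f k"
proof -
  have "((\<lambda>s. inner (transl i s f) (transl i s h)) has_real_derivative inner f k + inner g h) (at 0)"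
    using has_real_derivative_inner[OF gen_at[OF assms(1), of 0] gen_at[OF assms(2), of 0]] by simp
  then have "((\<lambda>s::real. inner f h) has_real_derivative inner f k + inner g h) (at 0)" by simp
  from DERIV_unique[OF this DERIV_const] show ?thesis by simp
qed

text \<open>The integrated form makes no reference to differentiability of \<open>f\<close>, so it can be tested against vectors.\<close>

lemma gen_iff_antiderivative:
  "gen i f g \<longleftrightarrow> (\<forall>s. transl i s f - f = antiderivative (\<lambda>r. transl i r g) s)"
proof
  assume g: "gen i f g"
  show "\<forall>s. transl i s f - f = antiderivative (\<lambda>r. transl i r g) s"
  proof
    fix s
    have "((\<lambda>s. transl i s f - f) has_vector_derivative transl i s g) (at s)" for s
      using has_vector_derivative_diff[OF gen_at[OF g, of s] has_vector_derivative_const[of f]] by simp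
    then show "transl i s f - f = antiderivative (\<lambda>r. transl i r g) s"
      by (rule antiderivative_unique[where f = "\<lambda>s. transl i s g"])
        (use antiderivative[OF continuous_transl] in auto)
  qed
next
  assume *: "\<forall>s. transl i s f - f = antiderivative (\<lambda>r. transl i r g) s"
  have "((\<lambda>s. f + antiderivative (\<lambda>r. transl i r g) s) has_vector_derivative 0 + transl i 0 g) (at 0)"
    by (intro has_vector_derivative_add antiderivative continuous_transl) auto
  moreover have "(\<lambda>s. f + antiderivative (\<lambda>r. transl i r g) s) = (\<lambda>s. transl i s f)"
    using * by (auto simp: algebra_simps)
  ultimately show "gen i f g" by (simp add: gen_def)
qed

text \<open>A weak derivative is a strong one. Translates of test functions are test functions, so the weak identity holds
  along the whole orbit \<open>transl i s \<phi>\<close>; integrating over \<open>s\<close> gives the integrated form of the claim tested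
  against \<open>\<phi>\<close>.\<close>

lemma weak_imp_gen:
  assumes "\<And>\<phi>. test_function \<phi> \<Longrightarrow> inner f (test_vec (partial i \<phi>)) = - inner g (test_vec \<phi>)"
    and "\<And>\<phi>. test_function \<phi> \<Longrightarrow> inner f (J (test_vec (partial i \<phi>))) = - inner g (J (test_vec \<phi>))"
  shows "gen i f g"
  unfolding gen_iff_antiderivative
proof
  fix s
  let ?F = "antiderivative (\<lambda>r. transl i r g)"
  have eq: "inner (transl i s f - f - ?F s) v = 0"
    if v: "gen i v v'" "\<And>r. inner f (transl i r v') = - inner g (transl i r v)" for v v' s
  proof -
    have d1: "((\<lambda>s. transl i (- s) v) has_vector_derivative - transl i (- s) v') (at s)" for s
    proof -
      have "(uminus has_vector_derivative -1) (at s)" by (auto intro!: derivative_eq_intros)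
      from vector_diff_chain_at[OF this gen_at[OF v(1)]] show ?thesis by (simp add: o_def)
    qed
    have "((\<lambda>s. inner f (transl i (- s) v) - inner (?F s) v) has_real_derivative
        (inner f (- transl i (- s) v') + inner 0 (transl i (- s) v)) - (inner (?F s) 0 + inner (transl i s g) v)) (at s)" for s
      by (intro DERIV_diff has_real_derivative_inner d1 antiderivative(2) continuous_transl) auto
    moreover have "(inner f (- transl i (- s) v') + inner 0 (transl i (- s) v)) - (inner (?F s) 0 + inner (transl i s g) v) = 0" for s
      by (simp add: v(2) inner_transl_left)
    ultimately have "((\<lambda>s. inner f (transl i (- s) v) - inner (?F s) v) has_real_derivative 0) (at s)" for s by simp
    then have "inner f (transl i (- s) v) - inner (?F s) v = inner f (transl i (- 0) v) - inner (?F 0) v"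
      using DERIV_isconst_all by blast
    then show ?thesis
      by (simp add: antiderivative(1)[OF continuous_transl] inner_diff_left inner_transl_left)
  qed
  have pt: "partial i (\<lambda>x. \<phi> (x + a)) = (\<lambda>x. partial i \<phi> (x + a))" if "test_function \<phi>" for \<phi> :: "real^3 \<Rightarrow> complex" and a
    using partial_translate test_C_class[OF that, of 1] by (intro ext) auto
  have "transl i s f - f - ?F s = 0"
  proof (rule test_functions_total)
    fix \<phi> :: "real^3 \<Rightarrow> complex" assume t: "test_function \<phi>"
    have tt: "test_function (\<lambda>x. \<phi> (x + r *\<^sub>R axis i 1))" for r by (rule test_translate[OF t])
    show "inner (transl i s f - f - ?F s) (test_vec \<phi>) = 0"
    proof (rule eq[OF gen_test_vec[OF t]])
      show "inner f (transl i r (test_vec (partial i \<phi>))) = - inner g (transl i r (test_vec \<phi>))" for r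
        using assms(1)[OF tt[of r]] by (simp add: transl_test_vec t test_partial pt)
    qed
    show "inner (transl i s f - f - ?F s) (J (test_vec \<phi>)) = 0"
    proof (rule eq[OF gen_J[OF gen_test_vec[OF t]]])
      show "inner f (transl i r (J (test_vec (partial i \<phi>)))) = - inner g (transl i r (J (test_vec \<phi>)))" for r
        using assms(2)[OF tt[of r]] by (simp add: transl_test_vec transl_J t test_partial pt)
    qed
  qed
  then show "transl i s f - f = ?F s" by simp
qed

text \<open>Bounds on derivatives survive strong limits of the functions: the derivatives have a weak limit by
  boundedness, and integration by parts identifies it.\<close>

lemma gen_weak_limit:
  assumes "f \<longlonglongrightarrow> f0" "\<And>n. gen i (f n) (g n)" "\<And>n. norm (g n) \<le> M"
  shows "\<exists>g0. gen i f0 g0 \<and> norm g0 \<le> M"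
proof -
  obtain c where c: "norm c \<le> M" "\<And>\<phi> L. (\<lambda>n. inner (g n) \<phi>) \<longlonglongrightarrow> L \<Longrightarrow> inner c \<phi> = L"
    using bounded_sequence_weak_limit[of g, OF assms(3)] by blast
  have w: "inner c v = - inner f0 v'" if "gen i v v'" for v v'
  proof (rule c(2))
    have "(\<lambda>n. - inner (f n) v') \<longlonglongrightarrow> - inner f0 v'" by (intro tendsto_intros assms)
    then show "(\<lambda>n. inner (g n) v) \<longlonglongrightarrow> - inner f0 v'"
      using gen_antisymmetric[OF assms(2) that] by simp
  qed
  have "gen i f0 c"
    by (rule weak_imp_gen) (simp_all add: w[OF gen_test_vec] w[OF gen_J[OF gen_test_vec]])
  with c(1) show ?thesis by blast
qed

lemma pairing_cls:
  assumes "f \<in> L2" "\<phi> \<in> L2"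
  shows "(LINT x|lebesgue. f x * \<phi> x) = Complex (inner (cls f) (test_vec \<phi>)) (inner (cls f) (J (test_vec \<phi>)))"
proof -
  have [measurable]: "f \<in> borel_measurable lebesgue" "\<phi> \<in> borel_measurable lebesgue"
    using assms by (auto simp: L2_def)
  have "(LINT x|lebesgue. f x * \<phi> x) = (LINT x|lebesgue. fn (cls f) x * \<phi> x)"
    by (rule integral_cong_AE) (measurable, rule AE_mp[OF fn_cls[OF assms(1)]], auto)
  then show ?thesis using pairing[OF assms(2)] by simp
qed

lemma is_weak_partial_iff_gen:
  assumes "f \<in> L2" "g \<in> L2" shows "is_weak_partial i f g \<longleftrightarrow> gen i (cls f) (cls g)"
proof
  assume w: "is_weak_partial i f g"
  have "Complex (inner (cls f) (test_vec (partial i \<phi>))) (inner (cls f) (J (test_vec (partial i \<phi>))))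
      = - Complex (inner (cls g) (test_vec \<phi>)) (inner (cls g) (J (test_vec \<phi>)))" if "test_function \<phi>" for \<phi>
    using w that pairing_cls[OF assms(1) test_L2[OF test_partial[OF that, of i]]] pairing_cls[OF assms(2) test_L2[OF that]]
    by (simp add: is_weak_partial_def)
  then show "gen i (cls f) (cls g)" by (intro weak_imp_gen) (auto simp: complex_eq_iff)
next
  assume g: "gen i (cls f) (cls g)"
  show "is_weak_partial i f g"
    unfolding is_weak_partial_def
  proof (intro allI impI)
    fix \<phi> :: "real^3 \<Rightarrow> complex" assume t: "test_function \<phi>"
    show "(LINT x|lebesgue. f x * partial i \<phi> x) = - (LINT x|lebesgue. g x * \<phi> x)"
      using gen_antisymmetric[OF g gen_test_vec[OF t]] gen_antisymmetric[OF g gen_J[OF gen_test_vec[OF t]]]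
      by (simp add: pairing_cls assms t test_L2 test_partial complex_eq_iff)
  qed
qed

lemma H1_iff_gen: "f \<in> H1 \<longleftrightarrow> f \<in> L2 \<and> (\<forall>i. \<exists>g. gen i (cls f) g)"
proof (cases "f \<in> L2")
  case True
  have "(\<exists>g\<in>L2. is_weak_partial i f g) \<longleftrightarrow> (\<exists>g. gen i (cls f) g)" for i
  proof
    assume "\<exists>g. gen i (cls f) g"
    then obtain g where "gen i (cls f) (cls (fn g))" by auto
    then show "\<exists>g\<in>L2. is_weak_partial i f g" using is_weak_partial_iff_gen[OF True fn_L2] fn_L2 by blast
  qed (use is_weak_partial_iff_gen[OF True] in blast)
  then show ?thesis using True by (simp add: H1_def)
qed (simp add: H1_def)

lemma H1_norm_gen:
  assumes "f \<in> L2" "\<And>i. gen i (cls f) (g i)"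
  shows "H1_norm f = sqrt ((norm (cls f))\<^sup>2 + (\<Sum>i\<in>UNIV. (norm (g i))\<^sup>2))"
proof -
  have "L2_norm (weak_partial i f) = norm (g i)" for i
  proof -
    have "gen i (cls f) (cls (fn (g i)))" using assms(2) by simp
    then have "\<exists>h. h \<in> L2 \<and> is_weak_partial i f h"
      using is_weak_partial_iff_gen[OF assms(1) fn_L2] fn_L2 by blast
    from someI_ex[OF this] have w: "weak_partial i f \<in> L2" "is_weak_partial i f (weak_partial i f)"
      by (auto simp: weak_partial_def)
    then have "gen i (cls f) (cls (weak_partial i f))" using is_weak_partial_iff_gen[OF assms(1)] by blast
    then have "cls (weak_partial i f) = g i" using gen_unique assms(2) by blast
    then show ?thesis using norm_cls[OF w(1)] by simp
  qed
  then show ?thesis by (simp add: H1_norm_def norm_cls[OF assms(1)])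
qed

section \<open>Averages over translations\<close>

text \<open>The mean \<open>avg i h\<close> of all translates by at most \<open>h\<close> in direction \<open>i\<close> is the mollifier of the whole development.
  Its derivative is the symmetric difference quotient \<open>dq i h\<close>, a bounded operator, and both commute with
  everything that commutes with translations.\<close>

definition tint :: "3 \<Rightarrow> l2 \<Rightarrow> real \<Rightarrow> l2" where "tint i x = antiderivative (\<lambda>r. transl i r x)"
definition avg :: "3 \<Rightarrow> real \<Rightarrow> l2 \<Rightarrow> l2" where "avg i h x = (1 / (2 * h)) *\<^sub>R (tint i x h - tint i x (- h))"
definition dq :: "3 \<Rightarrow> real \<Rightarrow> l2 \<Rightarrow> l2" where "dq i h x = (1 / (2 * h)) *\<^sub>R (transl i h x - transl i (- h) x)"

lemma tint_0 [simp]: "tint i x 0 = 0"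
  unfolding tint_def by (rule antiderivative(1)[OF continuous_transl])
lemma tint_derivative: "(tint i x has_vector_derivative transl i r x) (at r)"
  unfolding tint_def by (rule antiderivative(2)[OF continuous_transl])
lemma tint_eqI:
  assumes "\<And>r. (F has_vector_derivative transl i r x) (at r)" "F 0 = 0" shows "F r = tint i x r"
  by (rule antiderivative_unique[OF assms(1) tint_derivative]) (simp add: assms(2))

lemma tint_map:
  assumes "bounded_linear A" "\<And>s x. A (transl i s x) = transl i s (A x)"
  shows "tint i (A x) r = A (tint i x r)"
proof (rule tint_eqI[symmetric])
  show "((\<lambda>r. A (tint i x r)) has_vector_derivative transl i r (A x)) (at r)" for r
    using bounded_linear.has_vector_derivative[OF assms(1) tint_derivative, of i x r] by (simp add: assms(2))
qed (simp add: linear_0[OF bounded_linear.linear[OF assms(1)]])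

lemma avg_map:
  assumes "bounded_linear A" "\<And>s x. A (transl i s x) = transl i s (A x)"
  shows "avg i h (A x) = A (avg i h x)"
  by (simp add: avg_def tint_map[OF assms] linear_cmul[OF bounded_linear.linear[OF assms(1)]] linear_diff[OF bounded_linear.linear[OF assms(1)]])

lemma tint_add: "tint i (x + y) r = tint i x r + tint i y r"
proof (rule tint_eqI[symmetric])
  show "((\<lambda>r. tint i x r + tint i y r) has_vector_derivative transl i r (x + y)) (at r)" for r
    unfolding linear_add[OF linear_transl] by (intro has_vector_derivative_add tint_derivative)
qed simp

lemma norm_tint: "norm (tint i x r) \<le> norm x * \<bar>r\<bar>"
  using derivative_bound_const[OF tint_derivative[of i x], of r "norm x"] by simp

lemma norm_half_scale:
  fixes z :: "'a::real_normed_vector"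
  assumes "0 < h" "norm z \<le> e * h + e * h" shows "norm ((1 / (2 * h)) *\<^sub>R z) \<le> e"
proof -
  have "norm z / (2 * h) \<le> e" using assms by (simp add: pos_divide_le_eq algebra_simps)
  then show ?thesis using assms(1) by simp
qed

lemma norm_avg: assumes "0 < h" shows "norm (avg i h x) \<le> norm x"
proof -
  have "norm (tint i x h - tint i x (- h)) \<le> norm x * h + norm x * h"
  proof (rule order_trans[OF norm_triangle_ineq4 add_mono])
    show "norm (tint i x h) \<le> norm x * h" using norm_tint[of i x h] assms by simp
    show "norm (tint i x (- h)) \<le> norm x * h" using norm_tint[of i x "- h"] assms by simp
  qed
  then show ?thesis unfolding avg_def by (rule norm_half_scale[OF assms])
qed

lemma linear_avg: "linear (avg i h)"
proof (rule linearI)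
  show "avg i h (x + y) = avg i h x + avg i h y" for x y
    by (simp add: avg_def tint_add algebra_simps)
  show "avg i h (c *\<^sub>R x) = c *\<^sub>R avg i h x" for c x
    by (rule avg_map) (auto simp: bounded_linear_scaleR_right linear_cmul[OF linear_transl])
qed

lemma bounded_linear_avg: "0 < h \<Longrightarrow> bounded_linear (avg i h)"
  by (rule bounded_linear_intro[where K = 1]) (auto simp: linear_add[OF linear_avg] linear_cmul[OF linear_avg] norm_avg)

lemma bounded_linear_dq: "bounded_linear (dq i h)"
  unfolding dq_def[abs_def]
  by (intro bounded_linear_compose[OF bounded_linear_scaleR_right] bounded_linear_sub bounded_linear_transl)

lemma avg_transl: "avg i h (transl j s x) = transl j s (avg i h x)"
  by (rule avg_map) (auto simp: bounded_linear_transl transl_commute)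
lemma avg_avg: "0 < k \<Longrightarrow> avg i h (avg j k x) = avg j k (avg i h x)"
  by (rule avg_map) (auto simp: bounded_linear_avg avg_transl)
lemma dq_transl: "dq i h (transl j s x) = transl j s (dq i h x)"
  by (simp add: dq_def linear_cmul[OF linear_transl] linear_diff[OF linear_transl] transl_commute)
lemma inner_tint: "inner (tint i x h) y = - inner x (tint i y (- h))"
proof -
  have d: "((\<lambda>s. tint i y (- s)) has_vector_derivative - transl i (- s) y) (at s)" for s
  proof -
    have "(uminus has_vector_derivative -1) (at s)" by (auto intro!: derivative_eq_intros)
    from vector_diff_chain_at[OF this tint_derivative[of i y "- s"]] show ?thesis by (simp add: o_def)
  qed
  have "((\<lambda>h. inner (tint i x h) y + inner x (tint i y (- h))) has_real_derivative
     (inner (tint i x s) 0 + inner (transl i s x) y) + (inner x (- transl i (- s) y) + inner 0 (tint i y (- s)))) (at s)" for s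
    by (intro DERIV_add has_real_derivative_inner d tint_derivative) auto
  then have "((\<lambda>h. inner (tint i x h) y + inner x (tint i y (- h))) has_real_derivative 0) (at s)" for s
    by (simp add: inner_transl_left)
  then have "inner (tint i x h) y + inner x (tint i y (- h)) = inner (tint i x 0) y + inner x (tint i y (- 0))"
    using DERIV_isconst_all by blast
  then show ?thesis by simp
qed

lemma inner_avg: "inner (avg i h x) y = inner x (avg i h y)"
  using inner_tint[of i x h y] inner_tint[of i x "- h" y]
  by (simp add: avg_def inner_diff_left inner_diff_right)

lemma transl_tint: "transl i s (tint i x r) = tint i x (r + s) - tint i x s"
proof -
  have "tint i (transl i s x) r = transl i s (tint i x r)"
    by (rule tint_map) (auto simp: bounded_linear_transl transl_commute)
  moreover have "tint i x (r + s) - tint i x s = tint i (transl i s x) r"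
  proof (rule tint_eqI)
    fix r
    have "((\<lambda>r. r + s) has_vector_derivative 1) (at r)" by (auto intro!: derivative_eq_intros)
    from vector_diff_chain_at[OF this tint_derivative[of i x "r + s"]]
    have "((\<lambda>r. tint i x (r + s)) has_vector_derivative transl i (r + s) x) (at r)" by (simp add: o_def)
    from has_vector_derivative_diff[OF this has_vector_derivative_const[of "tint i x s"]]
    show "((\<lambda>r. tint i x (r + s) - tint i x s) has_vector_derivative transl i r (transl i s x)) (at r)"
      by (simp add: transl_add)
  qed simp
  ultimately show ?thesis by simp
qed

text \<open>The derivative of an average over a moving interval is the difference of the endpoint values.\<close>

lemma gen_avg: "gen i (avg i h x) (dq i h x)"
proof -
  have d: "((\<lambda>s. tint i x (r + s)) has_vector_derivative transl i r x) (at 0)" for r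
  proof -
    have "((\<lambda>s. r + s) has_vector_derivative 1) (at 0)" by (auto intro!: derivative_eq_intros)
    from vector_diff_chain_at[OF this, of "tint i x" "transl i r x"] tint_derivative[of i x r]
    show ?thesis by (simp add: o_def)
  qed
  have "((\<lambda>s. (1 / (2 * h)) *\<^sub>R (tint i x (h + s) - tint i x (- h + s))) has_vector_derivative
      (1 / (2 * h)) *\<^sub>R (transl i h x - transl i (- h) x)) (at 0)"
    by (intro bounded_linear.has_vector_derivative[OF bounded_linear_scaleR_right] has_vector_derivative_diff d)
  moreover have "transl i s (avg i h x) = (1 / (2 * h)) *\<^sub>R (tint i x (h + s) - tint i x (- h + s))" for s
    by (simp add: avg_def linear_cmul[OF linear_transl] linear_diff[OF linear_transl] transl_tint)
  ultimately show ?thesis by (simp add: gen_def dq_def)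
qed

lemma avg_error:
  assumes "0 < h" "\<And>r. \<bar>r\<bar> \<le> h \<Longrightarrow> norm (transl i r x - x) \<le> e" shows "norm (avg i h x - x) \<le> e"
proof -
  have b: "norm (tint i x r - r *\<^sub>R x) \<le> e * h" if "\<bar>r\<bar> = h" for r
  proof -
    have "((\<lambda>r. tint i x r - r *\<^sub>R x) has_vector_derivative transl i r x - x) (at r)" for r
      by (intro has_vector_derivative_diff tint_derivative)
        (simp add: has_vector_derivative_def bounded_linear_imp_has_derivative bounded_linear_scaleR_left)
    from derivative_bound_const[OF this, of r e] show ?thesis using assms that by simp
  qed
  have "avg i h x - x = (1 / (2 * h)) *\<^sub>R ((tint i x h - h *\<^sub>R x) - (tint i x (- h) - (- h) *\<^sub>R x))"
  proof -
    have two: "(2 * h) *\<^sub>R x = h *\<^sub>R x + h *\<^sub>R x" by (simp only: mult_2 scaleR_add_left)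
    have "(a - y) - (b - - y) = (a - b) - (y + y)" for a b y :: l2 by simp
    then have e: "(tint i x h - h *\<^sub>R x) - (tint i x (- h) - (- h) *\<^sub>R x) = (tint i x h - tint i x (- h)) - (2 * h) *\<^sub>R x"
      unfolding two scaleR_minus_left .
    have one: "(1 / (2 * h)) *\<^sub>R ((2 * h) *\<^sub>R x) = x" using assms(1) by simp
    show ?thesis
      unfolding e avg_def by (simp only: scaleR_diff_right[of _ "tint i x h - tint i x (- h)"] one)
  qed
  moreover have "norm ((tint i x h - h *\<^sub>R x) - (tint i x (- h) - (- h) *\<^sub>R x)) \<le> e * h + e * h"
    by (rule order_trans[OF norm_triangle_ineq4 add_mono]) (use b[of h] b[of "- h"] assms(1) in auto)
  ultimately show ?thesis using norm_half_scale[OF assms(1)] by (simp only:)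
qed

text \<open>Within the averaging window the multiplier changes by at most \<open>L * h\<close>.\<close>

lemma avg_Mul_commutator:
  assumes m: "bounded_mult m B" and L: "\<And>t r. \<bar>m (t + r *\<^sub>R axis i 1) - m t\<bar> \<le> L * \<bar>r\<bar>" and L0: "0 \<le> L" and h: "0 < h"
  shows "norm (avg i h (Mul m x) - Mul m (avg i h x)) \<le> L * h * norm x"
proof -
  have b: "norm (tint i (Mul m x) r - Mul m (tint i x r)) \<le> L * h * norm x * h" if "\<bar>r\<bar> = h" for r
  proof -
    have d: "((\<lambda>r. tint i (Mul m x) r - Mul m (tint i x r)) has_vector_derivative transl i r (Mul m x) - Mul m (transl i r x)) (at r)" for r
      by (intro has_vector_derivative_diff tint_derivative bounded_linear.has_vector_derivative[OF bounded_linear_Mul[OF m]])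
    have n: "norm (transl i r (Mul m x) - Mul m (transl i r x)) \<le> L * h * norm x" if "\<bar>r\<bar> \<le> h" for r
    proof -
      have "transl i r (Mul m x) - Mul m (transl i r x) = Mul (\<lambda>t. m (t + r *\<^sub>R axis i 1) - m t) (transl i r x)"
        unfolding transl_def by (simp add: shift_Mul[OF m] Mul_minus[OF bounded_mult_shift[OF m] m])
      moreover have "bounded_mult (\<lambda>t. m (t + r *\<^sub>R axis i 1) - m t) (L * h)"
      proof -
        have "L * \<bar>r\<bar> \<le> L * h" using L0 that by (rule mult_left_mono[rotated])
        then have "\<bar>m (t + r *\<^sub>R axis i 1) - m t\<bar> \<le> L * h" for t using L[of t r] by linarith
        then show ?thesis using bounded_mult_diff[OF bounded_mult_shift[OF m, of "r *\<^sub>R axis i 1"] m] by (simp add: bounded_mult_def)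
      qed
      ultimately show ?thesis using norm_Mul[of _ "L * h" "transl i r x"] by simp
    qed
    show ?thesis using derivative_bound_const[OF d, of r "L * h * norm x"] n that
      by (simp add: linear_0[OF bounded_linear.linear[OF bounded_linear_Mul[OF m]]])
  qed
  have "avg i h (Mul m x) - Mul m (avg i h x) = (1 / (2 * h)) *\<^sub>R
     ((tint i (Mul m x) h - Mul m (tint i x h)) - (tint i (Mul m x) (- h) - Mul m (tint i x (- h))))"
    by (simp add: avg_def linear_cmul[OF bounded_linear.linear[OF bounded_linear_Mul[OF m]]]
        linear_diff[OF bounded_linear.linear[OF bounded_linear_Mul[OF m]]] algebra_simps)
  moreover have "norm ((tint i (Mul m x) h - Mul m (tint i x h)) - (tint i (Mul m x) (- h) - Mul m (tint i x (- h)))) \<le> L * h * norm x * h + L * h * norm x * h"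
    by (rule order_trans[OF norm_triangle_ineq4 add_mono]) (use b[of h] b[of "- h"] h in auto)
  ultimately show ?thesis using norm_half_scale[OF h] by (simp only:)

qed


section \<open>Smoothing operators\<close>

lemma norm_triangle3: "norm (a + b + c) \<le> norm a + norm b + norm c" for a b c :: "'a::real_normed_vector"
  using norm_triangle_ineq[of "a + b" c] norm_triangle_ineq[of a b] by linarith
lemma norm_triangle4: "norm (a + b + c + d) \<le> norm a + norm b + norm c + norm d" for a b c d :: "'a::real_normed_vector"
  using norm_triangle_ineq[of "a + b + c" d] norm_triangle3[of a b c] by linarith

text \<open>Bounded operators commuting with translations. They map derivatives to derivatives and commute with the
  averages below, so the free evolution, the smoothing operators and \<open>J\<close> can be interchanged freely.\<close>

definition transl_inv :: "(l2 \<Rightarrow> l2) \<Rightarrow> bool" where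
  "transl_inv A \<longleftrightarrow> bounded_linear A \<and> (\<forall>i s x. A (transl i s x) = transl i s (A x))"

lemma transl_invD: assumes "transl_inv A" shows "bounded_linear A" "linear A" "A (transl i s x) = transl i s (A x)"
  using assms bounded_linear.linear by (auto simp: transl_inv_def)
lemma transl_inv_compose: "transl_inv A \<Longrightarrow> transl_inv B \<Longrightarrow> transl_inv (\<lambda>x. A (B x))"
  by (auto simp: transl_inv_def intro: bounded_linear_compose)
lemma transl_inv_transl: "transl_inv (transl i s)" by (auto simp: transl_inv_def bounded_linear_transl transl_commute)
lemma transl_inv_J: "transl_inv J" by (auto simp: transl_inv_def bounded_linear_J transl_J)
lemma transl_inv_avg: "0 < h \<Longrightarrow> transl_inv (avg i h)" by (auto simp: transl_inv_def bounded_linear_avg avg_transl)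
lemma transl_inv_dq: "transl_inv (dq i h)" by (auto simp: transl_inv_def bounded_linear_dq dq_transl)
lemma transl_inv_add: "transl_inv A \<Longrightarrow> transl_inv B \<Longrightarrow> transl_inv (\<lambda>x. A x + B x)"
  by (auto simp: transl_inv_def linear_add[OF linear_transl] intro: bounded_linear_add)
lemma transl_inv_diff: "transl_inv A \<Longrightarrow> transl_inv B \<Longrightarrow> transl_inv (\<lambda>x. A x - B x)"
  by (auto simp: transl_inv_def linear_diff[OF linear_transl] intro: bounded_linear_sub)
lemma transl_inv_scaleR: "transl_inv A \<Longrightarrow> transl_inv (\<lambda>x. c *\<^sub>R A x)"
  by (auto simp: transl_inv_def linear_cmul[OF linear_transl] intro: bounded_linear_compose[OF bounded_linear_scaleR_right])
lemma transl_inv_id: "transl_inv (\<lambda>x. x)" by (auto simp: transl_inv_def)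
lemma transl_inv_zero: "transl_inv (\<lambda>x. 0)" by (auto simp: transl_inv_def linear_0[OF linear_transl] bounded_linear_zero)
lemma transl_inv_sum: "(\<And>k. k \<in> K \<Longrightarrow> transl_inv (A k)) \<Longrightarrow> transl_inv (\<lambda>x. \<Sum>k\<in>K. A k x)"
  by (induction K rule: infinite_finite_induct) (auto intro: transl_inv_add transl_inv_zero)

lemma avg_transl_inv: "transl_inv A \<Longrightarrow> avg i h (A x) = A (avg i h x)"
  by (rule avg_map) (auto simp: transl_invD)
lemma dq_transl_inv: "transl_inv A \<Longrightarrow> dq i h (A x) = A (dq i h x)"
  by (simp add: dq_def transl_invD(3) linear_cmul[OF transl_invD(2)] linear_diff[OF transl_invD(2)])
lemma gen_transl_inv: "transl_inv A \<Longrightarrow> gen i f g \<Longrightarrow> gen i (A f) (A g)"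
  by (rule gen_map) (auto simp: transl_invD)

text \<open>Averaging in all three directions gains one derivative in each of them: \<open>E h i\<close> is the bounded operator
  \<open>\<partial>\<^sub>i Q h\<close>.\<close>

definition Q :: "real \<Rightarrow> l2 \<Rightarrow> l2" where "Q h x = avg 1 h (avg 2 h (avg 3 h x))"
definition E :: "real \<Rightarrow> 3 \<Rightarrow> l2 \<Rightarrow> l2" where
  "E h i x = (if i = 1 then dq 1 h (avg 2 h (avg 3 h x))
     else if i = 2 then dq 2 h (avg 1 h (avg 3 h x)) else dq 3 h (avg 1 h (avg 2 h x)))"

lemma transl_inv_Q: "0 < h \<Longrightarrow> transl_inv (Q h)"
  unfolding Q_def[abs_def] by (intro transl_inv_compose[OF transl_inv_avg] transl_inv_avg)
lemma transl_inv_E: "0 < h \<Longrightarrow> transl_inv (E h i)"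
  unfolding E_def[abs_def]
  by (cases "i = 1"; cases "i = 2") (simp_all, (intro transl_inv_compose[OF transl_inv_dq] transl_inv_compose[OF transl_inv_avg] transl_inv_avg; assumption)+)
lemma Q_transl_inv: "transl_inv A \<Longrightarrow> Q h (A x) = A (Q h x)" by (simp add: Q_def avg_transl_inv)
lemma E_transl_inv: "transl_inv A \<Longrightarrow> E h i (A x) = A (E h i x)" by (simp add: E_def avg_transl_inv dq_transl_inv)

lemma gen_Q: assumes "0 < h" shows "gen i (Q h x) (E h i x)"
proof -
  consider "i = 1" | "i = 2" | "i = 3" using exhaust_3 by blast
  then show ?thesis
  proof cases
    case 1
    then show ?thesis unfolding Q_def E_def by (simp add: gen_avg)
  next
    case 2
    have "Q h x = avg 2 h (avg 1 h (avg 3 h x))" using assms by (simp add: Q_def avg_avg)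
    then show ?thesis using 2 by (simp add: E_def gen_avg)
  next
    case 3
    have "Q h x = avg 3 h (avg 1 h (avg 2 h x))" using assms by (simp add: Q_def avg_avg)
    then show ?thesis using 3 by (simp add: E_def gen_avg)
  qed
qed

lemma norm_Q: "0 < h \<Longrightarrow> norm (Q h x) \<le> norm x"
  unfolding Q_def by (meson norm_avg order_trans)

lemma inner_Q: "0 < h \<Longrightarrow> inner (Q h x) y = inner x (Q h y)"
  by (simp add: Q_def inner_avg avg_avg)

lemma avg_tendsto: "(\<lambda>n. avg i (1 / Suc n) x) \<longlonglongrightarrow> x"
proof (rule LIMSEQ_I)
  fix e :: real assume e: "0 < e"
  then obtain d where d: "0 < d" "\<And>s. s \<noteq> 0 \<Longrightarrow> \<bar>s\<bar> < d \<Longrightarrow> norm (transl i s x - x) < e / 2"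
    using LIM_D[OF transl_tendsto[of i x], of "e / 2"] by auto
  obtain N where N: "1 / Suc N < d" using nat_approx_posE[OF d(1)] by auto
  show "\<exists>N. \<forall>n\<ge>N. norm (avg i (1 / Suc n) x - x) < e"
  proof (intro exI allI impI)
    fix n assume "N \<le> n"
    then have n: "1 / real (Suc n) \<le> 1 / Suc N" by (simp add: field_simps)
    have "norm (avg i (1 / Suc n) x - x) \<le> e / 2"
    proof (rule avg_error)
      fix r assume "\<bar>r\<bar> \<le> 1 / real (Suc n)"
      then have "\<bar>r\<bar> < d" using n N by linarith
      then show "norm (transl i r x - x) \<le> e / 2" using d(2)[of r] e by (cases "r = 0") (auto intro: less_imp_le)
    qed simp
    then show "norm (avg i (1 / Suc n) x - x) < e" using e by simp
  qed
qed

lemma Q_tendsto: assumes "x \<longlonglongrightarrow> y" shows "(\<lambda>n. Q (1 / Suc n) (x n)) \<longlonglongrightarrow> y"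
proof -
  have a: "(\<lambda>n. avg i (1 / Suc n) (x n)) \<longlonglongrightarrow> y" if "x \<longlonglongrightarrow> y" for i x y
    by (rule strongly_continuous_compose[where A = "\<lambda>n. avg i (1 / Suc n)" and C = 1, OF linear_avg _ avg_tendsto that])
      (simp add: norm_avg)
  show ?thesis unfolding Q_def by (intro a assms)
qed

text \<open>The three averages are commuted past the multiplier one at a time; each contributes at most
  \<open>L * h * norm x\<close> since the others do not increase norms.\<close>

lemma Q_Mul_commutator:
  assumes m: "bounded_mult m B" and L: "\<And>i t r. \<bar>m (t + r *\<^sub>R axis i 1) - m t\<bar> \<le> L * \<bar>r\<bar>" and L0: "0 \<le> L" and h: "0 < h"
  shows "norm (Q h (Mul m x) - Mul m (Q h x)) \<le> 3 * (L * h * norm x)"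
proof -
  have c: "norm (avg i h (Mul m y) - Mul m (avg i h y)) \<le> L * h * norm y" for i y
    by (rule avg_Mul_commutator[OF m L L0 h])
  have mono: "L * h * norm y \<le> L * h * norm x" if "norm y \<le> norm x" for y
    using that L0 h by (intro mult_left_mono) auto
  let ?a = "avg 3 h x" and ?b = "avg 2 h (avg 3 h x)"
  have na: "norm ?a \<le> norm x" by (rule norm_avg[OF h])
  have nb: "norm ?b \<le> norm x" using norm_avg[OF h, of 2 ?a] na by linarith
  have eq: "Q h (Mul m x) - Mul m (Q h x)
      = avg 1 h (avg 2 h (avg 3 h (Mul m x) - Mul m ?a))
      + avg 1 h (avg 2 h (Mul m ?a) - Mul m ?b) + (avg 1 h (Mul m ?b) - Mul m (avg 1 h ?b))"
    by (simp add: Q_def linear_diff[OF linear_avg])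
  have "norm (Q h (Mul m x) - Mul m (Q h x)) \<le> norm (avg 1 h (avg 2 h (avg 3 h (Mul m x) - Mul m ?a)))
      + norm (avg 1 h (avg 2 h (Mul m ?a) - Mul m ?b)) + norm (avg 1 h (Mul m ?b) - Mul m (avg 1 h ?b))"
    unfolding eq by (rule norm_triangle3)
  also have "\<dots> \<le> L * h * norm x + L * h * norm x + L * h * norm x"
  proof (intro add_mono)
    show "norm (avg 1 h (avg 2 h (avg 3 h (Mul m x) - Mul m ?a))) \<le> L * h * norm x"
      by (rule order_trans[OF norm_avg[OF h]], rule order_trans[OF norm_avg[OF h]], rule c)
    show "norm (avg 1 h (avg 2 h (Mul m ?a) - Mul m ?b)) \<le> L * h * norm x"
      by (rule order_trans[OF norm_avg[OF h]], rule order_trans[OF c], rule mono[OF na])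
    show "norm (avg 1 h (Mul m ?b) - Mul m (avg 1 h ?b)) \<le> L * h * norm x"
      by (rule order_trans[OF c mono[OF nb]])
  qed
  finally show ?thesis by simp
qed

section \<open>The Laplacian\<close>

definition has_lap :: "l2 \<Rightarrow> l2 \<Rightarrow> bool" where
  "has_lap f g \<longleftrightarrow> (\<exists>a b. (\<forall>i. gen i f (a i) \<and> gen i (a i) (b i)) \<and> g = (\<Sum>i\<in>UNIV. b i))"

lemma has_lap_transl_inv: assumes "transl_inv A" "has_lap f g" shows "has_lap (A f) (A g)"
proof -
  obtain a b where ab: "\<And>i. gen i f (a i)" "\<And>i. gen i (a i) (b i)" "g = (\<Sum>i\<in>UNIV. b i)"
    using assms(2) by (auto simp: has_lap_def)
  then show ?thesis unfolding has_lap_def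
    using assms(1) by (intro exI[of _ "\<lambda>i. A (a i)"] exI[of _ "\<lambda>i. A (b i)"])
      (auto intro: gen_transl_inv simp: linear_sum[OF transl_invD(2)])
qed

lemma has_lap_QQ: assumes h: "0 < h" shows "has_lap (Q h (Q h y)) (\<Sum>i\<in>UNIV. E h i (E h i y))"
proof -
  have "gen i (Q h (Q h y)) (Q h (E h i y))" for i
    using gen_Q[OF h, of i "Q h y"] by (simp add: E_transl_inv[OF transl_inv_Q[OF h]])
  moreover have "gen i (Q h (E h i y)) (E h i (E h i y))" for i
    by (rule gen_Q[OF h])
  ultimately show ?thesis unfolding has_lap_def
    by (intro exI[of _ "\<lambda>i. Q h (E h i y)"] exI[of _ "\<lambda>i. E h i (E h i y)"]) simp
qed

lemma has_lap_test_vec: assumes "test_function \<phi>" shows "has_lap (test_vec \<phi>) (test_vec (laplacian \<phi>))"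
proof -
  have "test_vec (laplacian \<phi>) = (\<Sum>i\<in>UNIV. test_vec (partial i (partial i \<phi>)))"
    unfolding test_vec_def laplacian_def cnj_sum
    by (rule cls_sum) (auto intro!: test_vec_mem_L2 test_partial assms)
  then show ?thesis unfolding has_lap_def
    using gen_test_vec[OF assms] gen_test_vec[OF test_partial[OF assms]]
    by (intro exI[of _ "\<lambda>i. test_vec (partial i \<phi>)"] exI[of _ "\<lambda>i. test_vec (partial i (partial i \<phi>))"]) simp
qed

lemma has_lap_dense: "\<exists>f g. has_lap f g \<and> norm (f - x) < e" if "0 < e"
proof -
  have "(\<lambda>n. Q (1 / Suc n) (Q (1 / Suc n) x)) \<longlonglongrightarrow> x"
    by (intro Q_tendsto tendsto_const)
  from LIMSEQ_D[OF this that] obtain n where n: "norm (Q (1 / Suc n) (Q (1 / Suc n) x) - x) < e"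
    by (meson order_refl)
  have "0 < 1 / real (Suc n)" by simp
  from has_lap_QQ[OF this] n show ?thesis by blast
qed

text \<open>Second differences with step \<open>1 / (n + 1)\<close> replace the Laplacian by bounded operators that commute with
  translations and are symmetric.\<close>

definition diff_lap :: "nat \<Rightarrow> l2 \<Rightarrow> l2" where
  "diff_lap n x = (\<Sum>i\<in>UNIV. (real (Suc n))\<^sup>2 *\<^sub>R (transl i (1 / Suc n) x - 2 *\<^sub>R x + transl i (- (1 / Suc n)) x))"

lemma transl_inv_diff_lap: "transl_inv (diff_lap n)"
  unfolding diff_lap_def[abs_def]
  by (intro transl_inv_sum transl_inv_scaleR transl_inv_add transl_inv_diff transl_inv_transl transl_inv_id)

lemma diff_lap_transl_inv: "transl_inv A \<Longrightarrow> diff_lap n (A x) = A (diff_lap n x)"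
  by (simp add: diff_lap_def linear_sum[OF transl_invD(2)] linear_cmul[OF transl_invD(2)] linear_add[OF transl_invD(2)] linear_diff[OF transl_invD(2)] transl_invD(3))

lemma norm_diff_lap: "norm (diff_lap n x) \<le> (12 * (real (Suc n))\<^sup>2) * norm x"
proof -
  have "norm (transl i (1 / Suc n) x - 2 *\<^sub>R x + transl i (- (1 / Suc n)) x) \<le> 4 * norm x" for i
  proof -
    have "norm (transl i (1 / Suc n) x - 2 *\<^sub>R x + transl i (- (1 / Suc n)) x)
        \<le> norm (transl i (1 / Suc n) x) + norm (2 *\<^sub>R x) + norm (transl i (- (1 / Suc n)) x)"
      using norm_triangle3[of "transl i (1 / Suc n) x" "- (2 *\<^sub>R x)" "transl i (- (1 / Suc n)) x"] by simp
    then show ?thesis by simp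
  qed
  then have "norm ((real (Suc n))\<^sup>2 *\<^sub>R (transl i (1 / Suc n) x - 2 *\<^sub>R x + transl i (- (1 / Suc n)) x)) \<le> (real (Suc n))\<^sup>2 * (4 * norm x)" for i
    by (simp only: norm_scaleR abs_power2) (intro mult_left_mono, auto)
  then have "norm (diff_lap n x) \<le> (\<Sum>i\<in>(UNIV::3 set). (real (Suc n))\<^sup>2 * (4 * norm x))"
    unfolding diff_lap_def by (intro sum_norm_le) auto
  then show ?thesis by simp
qed

text \<open>Opposite translations are adjoint to each other and commute with \<open>J\<close>, so second differences are symmetric and
  become antisymmetric on multiplication by \<open>J\<close>.\<close>

lemma diff_lap_skew: "inner (J (diff_lap n x)) x = 0"
proof -
  have "inner (J (transl i s x)) x + inner (J (transl i (- s) x)) x = 0" for i s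
    using inner_transl_left[of i "- s" "J x" x] inner_J_left[of x "transl i s x"]
    by (simp add: transl_J inner_commute)
  then have "inner (J ((real (Suc n))\<^sup>2 *\<^sub>R (transl i (1 / Suc n) x - 2 *\<^sub>R x + transl i (- (1 / Suc n)) x))) x = 0" for i
    by (simp add: linear_cmul[OF transl_invD(2)[OF transl_inv_J]] linear_add[OF transl_invD(2)[OF transl_inv_J]]
        linear_diff[OF transl_invD(2)[OF transl_inv_J]] inner_simps)
  then show ?thesis by (simp add: diff_lap_def linear_sum[OF transl_invD(2)[OF transl_inv_J]] inner_sum_left)
qed

text \<open>Taylor expansion to second order, with the oscillation of the second derivative \<open>b\<close> under small translations as
  remainder; it is obtained by bounding first the derivative \<open>p1\<close> of the remainder \<open>p\<close>.\<close>

lemma second_difference: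
  assumes f: "gen i f a" and a: "gen i a b" and d: "\<And>s. \<bar>s\<bar> \<le> h \<Longrightarrow> norm (transl i s b - b) \<le> e" and h: "0 < h"
  shows "norm (transl i h f - 2 *\<^sub>R f + transl i (- h) f - h\<^sup>2 *\<^sub>R b) \<le> 2 * e * h\<^sup>2"
proof -
  have neg: "((\<lambda>s. transl i (- s) x) has_vector_derivative - transl i (- s) y) (at s)" if "gen i x y" for x y s
  proof -
    have "(uminus has_vector_derivative -1) (at s)" by (auto intro!: derivative_eq_intros)
    from vector_diff_chain_at[OF this gen_at[OF that]] show ?thesis by (simp add: o_def)
  qed
  define p1 where "p1 s = transl i s a - transl i (- s) a - (2 * s) *\<^sub>R b" for s
  have "((\<lambda>s. (2 * s) *\<^sub>R b) has_vector_derivative 2 *\<^sub>R b) (at s)" for s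
    using has_vector_derivative_scaleR[OF DERIV_cmult[OF DERIV_ident, of 2] has_vector_derivative_const[of b], of s] by simp
  then have p1d: "(p1 has_vector_derivative transl i s b - (- transl i (- s) b) - 2 *\<^sub>R b) (at s)" for s
    unfolding p1_def[abs_def] by (intro has_vector_derivative_diff gen_at[OF a] neg[OF a])
  have p1: "norm (p1 s) \<le> 2 * e * h" if "\<bar>s\<bar> \<le> h" for s
  proof -
    have e0: "0 \<le> e" using d[of 0] h by simp
    have "norm (p1 s - p1 0) \<le> 2 * e * \<bar>s\<bar>"
    proof (rule derivative_bound_const[OF p1d])
      fix r assume "\<bar>r\<bar> \<le> \<bar>s\<bar>"
      then have "norm ((transl i r b - b) + (transl i (- r) b - b)) \<le> e + e"
        using d[of r] d[of "- r"] that by (intro order_trans[OF norm_triangle_ineq] add_mono) auto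
      moreover have "transl i r b - (- transl i (- r) b) - 2 *\<^sub>R b = (transl i r b - b) + (transl i (- r) b - b)"
        by (simp add: scaleR_2)
      ultimately show "norm (transl i r b - (- transl i (- r) b) - 2 *\<^sub>R b) \<le> 2 * e" by (simp only: mult_2)
    qed
    also have "\<dots> \<le> 2 * e * h" using that e0 by (intro mult_left_mono) auto
    finally show ?thesis by (simp add: p1_def)
  qed
  define p where "p s = transl i s f + transl i (- s) f - s\<^sup>2 *\<^sub>R b" for s
  have "((\<lambda>s. s\<^sup>2 *\<^sub>R b) has_vector_derivative (2 * s) *\<^sub>R b) (at s)" for s
    using has_vector_derivative_scaleR[OF DERIV_power[OF DERIV_ident, of 2] has_vector_derivative_const[of b], of s] by simp
  then have "(p has_vector_derivative transl i s a + (- transl i (- s) a) - (2 * s) *\<^sub>R b) (at s)" for s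
    unfolding p_def[abs_def] by (intro has_vector_derivative_diff has_vector_derivative_add gen_at[OF f] neg[OF f])
  then have "(p has_vector_derivative p1 s) (at s)" for s by (simp add: p1_def)
  from derivative_bound_const[OF this, of h "2 * e * h"] have "norm (p h - p 0) \<le> 2 * e * h * h"
    using p1 h by simp
  then show ?thesis by (simp add: p_def power2_eq_square scaleR_2 algebra_simps)
qed

lemma diff_lap_tendsto: assumes "has_lap f g" shows "(\<lambda>n. diff_lap n f) \<longlonglongrightarrow> g"
proof -
  obtain a b where ab: "\<And>i. gen i f (a i)" "\<And>i. gen i (a i) (b i)" "g = (\<Sum>i\<in>UNIV. b i)"
    using assms by (auto simp: has_lap_def)
  have "(\<lambda>n. (real (Suc n))\<^sup>2 *\<^sub>R (transl i (1 / Suc n) f - 2 *\<^sub>R f + transl i (- (1 / Suc n)) f)) \<longlonglongrightarrow> b i" for i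
  proof (rule LIMSEQ_I)
    fix e :: real assume e: "0 < e"
    then obtain d where d: "0 < d" "\<And>s. s \<noteq> 0 \<Longrightarrow> \<bar>s\<bar> < d \<Longrightarrow> norm (transl i s (b i) - b i) < e / 4"
      using LIM_D[OF transl_tendsto[of i "b i"], of "e / 4"] by auto
    obtain N where N: "1 / Suc N < d" using nat_approx_posE[OF d(1)] by auto
    show "\<exists>N. \<forall>n\<ge>N. norm ((real (Suc n))\<^sup>2 *\<^sub>R (transl i (1 / Suc n) f - 2 *\<^sub>R f + transl i (- (1 / Suc n)) f) - b i) < e"
    proof (intro exI allI impI)
      fix n assume "N \<le> n"
      then have n: "1 / real (Suc n) \<le> 1 / Suc N" by (simp add: field_simps)
      define h where "h = 1 / real (Suc n)"
      have h: "0 < h" by (simp add: h_def)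
      have s: "(real (Suc n))\<^sup>2 = 1 / h\<^sup>2" by (simp add: h_def power_divide)
      have "norm (transl i h f - 2 *\<^sub>R f + transl i (- h) f - h\<^sup>2 *\<^sub>R b i) \<le> 2 * (e / 4) * h\<^sup>2"
      proof (rule second_difference[OF ab(1,2) _ h])
        fix r assume "\<bar>r\<bar> \<le> h"
        then have "\<bar>r\<bar> < d" using n N by (simp add: h_def)
        then show "norm (transl i r (b i) - b i) \<le> e / 4" using d(2)[of r] e by (cases "r = 0") (auto intro: less_imp_le)
      qed
      then have "norm ((1 / h\<^sup>2) *\<^sub>R (transl i h f - 2 *\<^sub>R f + transl i (- h) f - h\<^sup>2 *\<^sub>R b i)) \<le> e / 2"
        using h by (simp only: norm_scaleR) (simp add: field_simps)
      moreover have "(1 / h\<^sup>2) *\<^sub>R (transl i h f - 2 *\<^sub>R f + transl i (- h) f - h\<^sup>2 *\<^sub>R b i)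
          = (1 / h\<^sup>2) *\<^sub>R (transl i h f - 2 *\<^sub>R f + transl i (- h) f) - b i"
        using h by (simp only: scaleR_diff_right[of _ _ "h\<^sup>2 *\<^sub>R b i"]) simp
      ultimately show "norm ((real (Suc n))\<^sup>2 *\<^sub>R (transl i (1 / Suc n) f - 2 *\<^sub>R f + transl i (- (1 / Suc n)) f) - b i) < e"
        using e unfolding s by (simp only: h_def[symmetric])
    qed
  qed
  then show ?thesis unfolding diff_lap_def ab(3) by (intro tendsto_sum)
qed

section \<open>The free evolution\<close>

text \<open>The free group is the limit of the groups \<open>Ua n\<close> generated by the bounded operators \<open>(1/2) J diff_lap n\<close>, which
  exist by Picard iteration. All operators involved commute, which makes the comparison of two approximants
  elementary.\<close>

definition Usol :: "nat \<Rightarrow> l2 \<Rightarrow> (real \<Rightarrow> l2) \<Rightarrow> bool" where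
  "Usol n x y \<longleftrightarrow> y 0 = x \<and> (\<forall>t. (y has_vector_derivative (1/2) *\<^sub>R J (diff_lap n (y t))) (at t))"
definition Ua :: "nat \<Rightarrow> real \<Rightarrow> l2 \<Rightarrow> l2" where "Ua n t x = (SOME y. Usol n x y) t"

lemma transl_inv_hJdl: "transl_inv (\<lambda>x. (1/2) *\<^sub>R J (diff_lap n x))"
  by (intro transl_inv_scaleR transl_inv_compose[OF transl_inv_J] transl_inv_diff_lap)

lemma Usol_exists: "\<exists>y. Usol n x y"
  unfolding Usol_def
proof (rule linear_ode_exists[where C = "\<lambda>t x. (1/2) *\<^sub>R J (diff_lap n x)" and M = "6 * (real (Suc n))\<^sup>2"])
  show "linear (\<lambda>x. (1/2) *\<^sub>R J (diff_lap n x))" by (rule transl_invD(2)[OF transl_inv_hJdl])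
  show "norm ((1/2) *\<^sub>R J (diff_lap n x)) \<le> 6 * (real (Suc n))\<^sup>2 * norm x" for x
    using norm_diff_lap[of n x] by simp
qed auto

lemma Ua_Usol: "Usol n x (\<lambda>t. Ua n t x)"
  using someI_ex[OF Usol_exists[of n x]] by (simp add: Ua_def)

lemma Usol_norm: assumes "Usol n x y" shows "norm (y t) = norm x"
proof -
  have "norm (y t) = norm (y 0)"
    by (rule skew_norm_constant[where y' = "\<lambda>t. (1/2) *\<^sub>R J (diff_lap n (y t))"])
      (use assms diff_lap_skew in \<open>auto simp: Usol_def inner_commute\<close>)
  then show ?thesis using assms by (simp add: Usol_def)
qed

lemma Usol_diff: assumes "Usol n x y" "Usol n x' y'" shows "Usol n (x - x') (\<lambda>t. y t - y' t)"
  using assms unfolding Usol_def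
  by (auto intro!: has_vector_derivative_eq_rhs[OF has_vector_derivative_diff]
      simp: linear_diff[OF transl_invD(2)[OF transl_inv_hJdl], simplified])

lemma Usol_unique: assumes "Usol n x y" shows "y t = Ua n t x"
  using Usol_norm[OF Usol_diff[OF assms Ua_Usol[of n x]], of t] by simp

lemma Ua_0 [simp]: "Ua n 0 x = x" using Ua_Usol[of n x] by (simp add: Usol_def)
lemma norm_Ua [simp]: "norm (Ua n t x) = norm x" by (rule Usol_norm[OF Ua_Usol])
lemma Ua_derivative: "((\<lambda>t. Ua n t x) has_vector_derivative (1/2) *\<^sub>R J (diff_lap n (Ua n t x))) (at t)"
  using Ua_Usol[of n x] by (simp add: Usol_def)

lemma linear_Ua: "linear (Ua n t)"
proof (rule linearI)
  fix x y :: l2 and c :: real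
  have "Usol n (x + y) (\<lambda>t. Ua n t x + Ua n t y)"
    using Ua_Usol[of n x] Ua_Usol[of n y] unfolding Usol_def
    by (auto intro!: has_vector_derivative_eq_rhs[OF has_vector_derivative_add]
        simp: linear_add[OF transl_invD(2)[OF transl_inv_hJdl], simplified])
  from Usol_unique[OF this] show "Ua n t (x + y) = Ua n t x + Ua n t y" by simp
  have "Usol n (c *\<^sub>R x) (\<lambda>t. c *\<^sub>R Ua n t x)"
    using Ua_Usol[of n x] unfolding Usol_def
    by (auto intro!: has_vector_derivative_eq_rhs[OF bounded_linear.has_vector_derivative[OF bounded_linear_scaleR_right]]
        simp: linear_cmul[OF transl_invD(2)[OF transl_inv_diff_lap]] linear_cmul[OF transl_invD(2)[OF transl_inv_J]])
  from Usol_unique[OF this] show "Ua n t (c *\<^sub>R x) = c *\<^sub>R Ua n t x" by simp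
qed

lemma Ua_map: assumes "transl_inv A" "\<And>x. A (J x) = J (A x)" shows "A (Ua n t x) = Ua n t (A x)"
proof (rule Usol_unique)
  show "Usol n (A x) (\<lambda>t. A (Ua n t x))"
    unfolding Usol_def
    by (auto intro!: has_vector_derivative_eq_rhs[OF bounded_linear.has_vector_derivative[OF transl_invD(1)[OF assms(1)] Ua_derivative]]
        simp: linear_cmul[OF transl_invD(2)[OF assms(1)]] assms diff_lap_transl_inv)
qed

lemma diff_lap_J: "diff_lap n (J x) = J (diff_lap n x)" by (rule diff_lap_transl_inv[OF transl_inv_J])
lemma diff_lap_Ua: "diff_lap m (Ua n t x) = Ua n t (diff_lap m x)" by (rule Ua_map[OF transl_inv_diff_lap diff_lap_J])
lemma J_Ua: "J (Ua n t x) = Ua n t (J x)" by (rule Ua_map[OF transl_inv_J refl])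

lemma Ua_Ua: "Ua n s (Ua n t x) = Ua n (s + t) x"
proof -
  have "Usol n (Ua n t x) (\<lambda>s. Ua n (s + t) x)"
    unfolding Usol_def
  proof (intro conjI allI)
    fix s
    have "((\<lambda>s. s + t) has_vector_derivative 1) (at s)" by (auto intro!: derivative_eq_intros)
    from vector_diff_chain_at[OF this Ua_derivative[of n x "s + t"]]
    show "((\<lambda>s. Ua n (s + t) x) has_vector_derivative (1/2) *\<^sub>R J (diff_lap n (Ua n (s + t) x))) (at s)"
      by (simp add: o_def)
  qed simp
  from Usol_unique[OF this, of s] show ?thesis by simp
qed

text \<open>Duhamel: the derivative of \<open>Ua n (-s) (Ua m s x)\<close> is a unitary operator applied to half the difference of the
  two discrete Laplacians of \<open>x\<close>.\<close>

lemma Ua_compare: "norm (Ua n t x - Ua m t x) \<le> 1/2 * norm (diff_lap n x - diff_lap m x) * \<bar>t\<bar>"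
proof -
  have d: "((\<lambda>s. Ua n (- s) (Ua m s x)) has_vector_derivative
     - ((1/2) *\<^sub>R J (diff_lap n (Ua n (- s) (Ua m s x)))) + Ua n (- s) ((1/2) *\<^sub>R J (diff_lap m (Ua m s x)))) (at s)" for s
  proof (rule strong_product_rule[where A = "\<lambda>r. Ua n (- r)" and C = 1])
    have neg: "((\<lambda>r. Ua n (- r) y) has_vector_derivative - ((1/2) *\<^sub>R J (diff_lap n (Ua n (- s) y)))) (at s)" for y s
    proof -
      have "(uminus has_vector_derivative -1) (at s)" by (auto intro!: derivative_eq_intros)
      from vector_diff_chain_at[OF this Ua_derivative[of n y "- s"]] show ?thesis by (simp add: o_def)
    qed
    show "((\<lambda>r. Ua n (- r) (Ua m s x)) has_vector_derivative - ((1/2) *\<^sub>R J (diff_lap n (Ua n (- s) (Ua m s x))))) (at s)"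
      by (rule neg)
    show "(\<lambda>r. Ua n (- r) ((1/2) *\<^sub>R J (diff_lap m (Ua m s x)))) \<midarrow>s\<rightarrow> Ua n (- s) ((1/2) *\<^sub>R J (diff_lap m (Ua m s x)))"
      using has_vector_derivative_continuous[OF neg[of "(1/2) *\<^sub>R J (diff_lap m (Ua m s x))" s]] by (simp add: continuous_at)
  qed (simp_all add: linear_Ua Ua_derivative)
  have n: "norm (- ((1/2) *\<^sub>R J (diff_lap n (Ua n (- s) (Ua m s x)))) + Ua n (- s) ((1/2) *\<^sub>R J (diff_lap m (Ua m s x)))) \<le> 1/2 * norm (diff_lap n x - diff_lap m x)" for s
  proof -
    have "- ((1/2) *\<^sub>R J (diff_lap n (Ua n (- s) (Ua m s x)))) + Ua n (- s) ((1/2) *\<^sub>R J (diff_lap m (Ua m s x)))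
        = - ((1/2) *\<^sub>R J (Ua n (- s) (Ua m s (diff_lap n x - diff_lap m x))))"
      by (simp add: diff_lap_Ua linear_cmul[OF linear_Ua] linear_diff[OF linear_Ua] linear_diff[OF transl_invD(2)[OF transl_inv_J]] J_Ua scaleR_diff_right)
    then show ?thesis by simp
  qed
  have "norm (Ua n (- t) (Ua m t x) - Ua n (- 0) (Ua m 0 x)) \<le> 1/2 * norm (diff_lap n x - diff_lap m x) * \<bar>t\<bar>"
    by (rule derivative_bound_const[OF d]) (rule n)
  moreover have "Ua n (- t) (Ua m t x) - x = Ua n (- t) (Ua m t x - Ua n t x)"
    by (simp add: linear_diff[OF linear_Ua] Ua_Ua)
  ultimately show ?thesis by (simp add: norm_minus_commute)
qed

lemma Ua_move: "norm (Ua n t x - x) \<le> 1/2 * norm (diff_lap n x) * \<bar>t\<bar>"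
proof -
  have "norm ((1/2) *\<^sub>R J (diff_lap n (Ua n s x))) \<le> 1/2 * norm (diff_lap n x)" for s by (simp add: diff_lap_Ua)
  from derivative_bound_const[OF Ua_derivative this] show ?thesis by simp
qed

definition U :: "real \<Rightarrow> l2 \<Rightarrow> l2" where "U t x = lim (\<lambda>n. Ua n t x)"

text \<open>On vectors with a Laplacian the approximants are Cauchy by the comparison estimate; such vectors are dense, and
  the approximants are isometries.\<close>

lemma U_limit: "(\<lambda>n. Ua n t x) \<longlonglongrightarrow> U t x"
proof -
  have "Cauchy (\<lambda>n. Ua n t x)"
  proof (rule metric_CauchyI)
    fix e :: real assume e: "0 < e"
    then obtain f g where f: "has_lap f g" "norm (f - x) < e / 4" using has_lap_dense[of "e/4" x] by auto
    have "Cauchy (\<lambda>n. diff_lap n f)" using diff_lap_tendsto[OF f(1)] LIMSEQ_imp_Cauchy by blast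
    moreover have "0 < e / (\<bar>t\<bar> + 1)" using e by (simp add: add_nonneg_pos)
    ultimately obtain N where N: "\<And>m n. m \<ge> N \<Longrightarrow> n \<ge> N \<Longrightarrow> dist (diff_lap m f) (diff_lap n f) < e / (\<bar>t\<bar> + 1)"
      unfolding Cauchy_def by blast
    show "\<exists>M. \<forall>m\<ge>M. \<forall>n\<ge>M. dist (Ua m t x) (Ua n t x) < e"
    proof (intro exI allI impI)
      fix m n assume mn: "N \<le> m" "N \<le> n"
      have "norm (diff_lap m f - diff_lap n f) * \<bar>t\<bar> \<le> e / (\<bar>t\<bar> + 1) * \<bar>t\<bar>"
        using N[OF mn] by (intro mult_right_mono) (auto simp: dist_norm)
      also have "\<dots> \<le> e" using e by (simp add: field_simps)
      finally have 1: "norm (Ua m t f - Ua n t f) \<le> e / 2" using Ua_compare[of m t f n] by linarith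
      have 2: "norm (Ua k t x - Ua k t f) < e / 4" for k
        using f(2) norm_Ua[of k t "x - f"] by (simp add: linear_diff[OF linear_Ua] norm_minus_commute)
      have "Ua m t x - Ua n t x = (Ua m t x - Ua m t f) + (Ua m t f - Ua n t f) - (Ua n t x - Ua n t f)" by simp
      then have "norm (Ua m t x - Ua n t x) \<le> norm (Ua m t x - Ua m t f) + norm (Ua m t f - Ua n t f) + norm (Ua n t x - Ua n t f)"
        using norm_triangle3[of "Ua m t x - Ua m t f" "Ua m t f - Ua n t f" "- (Ua n t x - Ua n t f)"]
        by (simp add: norm_minus_commute)
      then show "dist (Ua m t x) (Ua n t x) < e" using 1 2[of m] 2[of n] by (simp add: dist_norm)
    qed
  qed
  then show ?thesis unfolding U_def by (simp add: Cauchy_convergent_iff convergent_LIMSEQ_iff)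
qed

lemma norm_U [simp]: "norm (U t x) = norm x"
  using tendsto_norm[OF U_limit[of t x]] by (simp add: LIMSEQ_const_iff)

lemma U_0 [simp]: "U 0 x = x" using U_limit[of 0 x] by (simp add: LIMSEQ_const_iff)

lemma linear_U: "linear (U t)"
proof (rule linearI)
  fix x y :: l2 and c :: real
  have "(\<lambda>n. Ua n t (x + y)) \<longlonglongrightarrow> U t x + U t y"
    unfolding linear_add[OF linear_Ua] by (intro tendsto_intros U_limit)
  then show "U t (x + y) = U t x + U t y" using U_limit LIMSEQ_unique by blast
  have "(\<lambda>n. Ua n t (c *\<^sub>R x)) \<longlonglongrightarrow> c *\<^sub>R U t x"
    unfolding linear_cmul[OF linear_Ua] by (intro tendsto_intros U_limit)
  then show "U t (c *\<^sub>R x) = c *\<^sub>R U t x" using U_limit LIMSEQ_unique by blast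
qed

lemma bounded_linear_U: "bounded_linear (U t)"
  by (rule bounded_linear_intro[where K = 1]) (auto simp: linear_add[OF linear_U] linear_cmul[OF linear_U])

lemma U_map: assumes "transl_inv A" "\<And>x. A (J x) = J (A x)" shows "A (U t x) = U t (A x)"
proof -
  have "(\<lambda>n. A (Ua n t x)) \<longlonglongrightarrow> A (U t x)" by (rule bounded_linear.tendsto[OF transl_invD(1)[OF assms(1)] U_limit])
  then show ?thesis using U_limit[of t "A x"] LIMSEQ_unique by (simp add: Ua_map[OF assms])
qed

lemma U_J: "U t (J x) = J (U t x)" by (rule U_map[OF transl_inv_J refl, symmetric])
lemma U_transl: "U t (transl i s x) = transl i s (U t x)" by (rule U_map[OF transl_inv_transl transl_J, symmetric])

lemma U_U: "U s (U t x) = U (s + t) x"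
proof -
  have "(\<lambda>n. Ua n s (Ua n t x)) \<longlonglongrightarrow> U s (U t x)"
    by (rule strongly_continuous_compose[where A = "\<lambda>n. Ua n s" and C = 1 and ?u0.0 = "U t x"])
      (auto simp: linear_Ua U_limit)
  then show ?thesis using U_limit[of "s + t" x] LIMSEQ_unique by (simp add: Ua_Ua)
qed

lemma transl_inv_U: "transl_inv (U t)" by (simp add: transl_inv_def bounded_linear_U U_transl)

lemma inner_U_U: "inner (U t x) (U t y) = inner x y"
proof -
  have "inner x y = ((norm (x + y))\<^sup>2 - (norm x)\<^sup>2 - (norm y)\<^sup>2) / 2" for x y :: l2
    by (simp add: power2_norm_eq_inner inner_simps inner_commute)
  then show ?thesis by (metis linear_add[OF linear_U] norm_U)
qed

lemma inner_U_left: "inner (U t x) y = inner x (U (- t) y)"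
  using inner_U_U[of t x "U (- t) y"] by (simp add: U_U)

lemma U_move: assumes "has_lap f g" shows "norm (U t f - f) \<le> 1/2 * norm g * \<bar>t\<bar>"
proof (rule tendsto_le[OF sequentially_bot])
  show "(\<lambda>n. norm (Ua n t f - f)) \<longlonglongrightarrow> norm (U t f - f)" by (intro tendsto_intros U_limit)
  show "(\<lambda>n. 1/2 * norm (diff_lap n f) * \<bar>t\<bar>) \<longlonglongrightarrow> 1/2 * norm g * \<bar>t\<bar>"
    by (intro tendsto_intros diff_lap_tendsto assms)
qed (intro always_eventually allI Ua_move)

lemma U_compare: assumes "has_lap f g" shows "norm (Ua n t f - U t f) \<le> 1/2 * norm (diff_lap n f - g) * \<bar>t\<bar>"
proof (rule tendsto_le[OF sequentially_bot])
  show "(\<lambda>m. norm (Ua n t f - Ua m t f)) \<longlonglongrightarrow> norm (Ua n t f - U t f)" by (intro tendsto_intros U_limit)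
  show "(\<lambda>m. 1/2 * norm (diff_lap n f - diff_lap m f) * \<bar>t\<bar>) \<longlonglongrightarrow> 1/2 * norm (diff_lap n f - g) * \<bar>t\<bar>"
    by (intro tendsto_intros diff_lap_tendsto assms)
qed (intro always_eventually allI Ua_compare)

lemma U_tendsto: "((\<lambda>s. U s x) \<longlongrightarrow> U t x) (at t)"
proof -
  have "((\<lambda>s. U s y) \<longlongrightarrow> y) (at (0::real))" for y :: l2
  proof (rule LIM_I)
    fix e :: real assume e: "0 < e"
    then obtain f g where f: "has_lap f g" "norm (f - y) < e / 4" using has_lap_dense[of "e/4" y] by auto
    show "\<exists>d>0. \<forall>s. s \<noteq> 0 \<and> norm (s - 0) < d \<longrightarrow> norm (U s y - y) < e"
    proof (intro exI conjI allI impI)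
      show "0 < e / (norm g + 1)" using e by (simp add: add_nonneg_pos)
      fix s :: real assume "s \<noteq> 0 \<and> norm (s - 0) < e / (norm g + 1)"
      then have "norm g * \<bar>s\<bar> \<le> norm g * (e / (norm g + 1))" by (intro mult_left_mono) auto
      also have "\<dots> \<le> (norm g + 1) * (e / (norm g + 1))"
        using e by (intro mult_right_mono) (auto simp: add_nonneg_nonneg)
      also have "\<dots> = e" using add_nonneg_pos[OF norm_ge_zero zero_less_one, of g] by simp
      finally have 1: "norm (U s f - f) \<le> e / 2" using U_move[OF f(1), of s] by linarith
      have 2: "norm (U s y - U s f) < e / 4"
        using f(2) norm_U[of s "y - f"] by (simp add: linear_diff[OF linear_U] norm_minus_commute)
      have "U s y - y = (U s y - U s f) + (U s f - f) + (f - y)" by simp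
      then have "norm (U s y - y) \<le> norm (U s y - U s f) + norm (U s f - f) + norm (f - y)"
        using norm_triangle3[of "U s y - U s f" "U s f - f" "f - y"] by simp
      then show "norm (U s y - y) < e" using 1 2 f(2) by linarith
    qed
  qed
  then have "((\<lambda>s. U s (U t x)) \<longlongrightarrow> U t x) (at 0)" .
  then show ?thesis by (subst LIM_offset_zero_iff) (simp_all add: U_U add.commute)
qed

lemma continuous_U: "continuous_on UNIV (\<lambda>t. U t x)"
  using U_tendsto by (simp add: continuous_on_def)

text \<open>The integrated equation passes to the limit \<open>n \<longlongrightarrow> \<infinity>\<close>. The vector \<open>g\<close> has no Laplacian in general, so the
  convergence \<open>Ua n s g \<longlongrightarrow> U s g\<close> uniformly in \<open>s\<close> is obtained from a nearby vector \<open>f'\<close> that has one.\<close>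

lemma U_derivative:
  assumes "has_lap f g" shows "((\<lambda>t. U t f) has_vector_derivative U t ((1/2) *\<^sub>R J g)) (at t)"
proof -
  have cont: "continuous_on UNIV (\<lambda>r. U r ((1/2) *\<^sub>R J g))" by (rule continuous_U)
  let ?F = "antiderivative (\<lambda>r. U r ((1/2) *\<^sub>R J g))"
  have eq: "U t f - f = ?F t" for t
  proof -
    have b: "norm (Ua n t f - f - ?F t) \<le> 1/2 * (norm (diff_lap n f - g) + 2 * norm (g - f') + 1/2 * norm (diff_lap n f' - g') * \<bar>t\<bar>) * \<bar>t\<bar>"
      if f': "has_lap f' g'" for n f' g'
    proof -
      have d: "((\<lambda>s. Ua n s f - f - ?F s) has_vector_derivative (1/2) *\<^sub>R J (diff_lap n (Ua n s f)) - 0 - U s ((1/2) *\<^sub>R J g)) (at s)" for s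
        by (intro has_vector_derivative_diff Ua_derivative antiderivative(2)[OF cont] has_vector_derivative_const)
      have "norm ((1/2) *\<^sub>R J (diff_lap n (Ua n s f)) - 0 - U s ((1/2) *\<^sub>R J g))
          \<le> 1/2 * (norm (diff_lap n f - g) + 2 * norm (g - f') + 1/2 * norm (diff_lap n f' - g') * \<bar>t\<bar>)" if s: "\<bar>s\<bar> \<le> \<bar>t\<bar>" for s
      proof -
        have "(1/2) *\<^sub>R J (diff_lap n (Ua n s f)) - 0 - U s ((1/2) *\<^sub>R J g) = (1/2) *\<^sub>R J (Ua n s (diff_lap n f) - U s g)"
          by (simp add: diff_lap_Ua linear_cmul[OF linear_U] U_J linear_diff[OF transl_invD(2)[OF transl_inv_J]] scaleR_diff_right)
        then have "norm ((1/2) *\<^sub>R J (diff_lap n (Ua n s f)) - 0 - U s ((1/2) *\<^sub>R J g)) = 1/2 * norm (Ua n s (diff_lap n f) - U s g)"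
          by simp
        also have "Ua n s (diff_lap n f) - U s g = Ua n s (diff_lap n f - g) + Ua n s (g - f') + (Ua n s f' - U s f') + U s (f' - g)"
          by (simp add: linear_diff[OF linear_U] linear_diff[OF linear_Ua])
        also have "norm \<dots> \<le> norm (Ua n s (diff_lap n f - g)) + norm (Ua n s (g - f')) + norm (Ua n s f' - U s f') + norm (U s (f' - g))"
          by (rule norm_triangle4)
        also have "\<dots> \<le> norm (diff_lap n f - g) + norm (g - f') + 1/2 * norm (diff_lap n f' - g') * \<bar>t\<bar> + norm (g - f')"
        proof -
          have "1/2 * norm (diff_lap n f' - g') * \<bar>s\<bar> \<le> 1/2 * norm (diff_lap n f' - g') * \<bar>t\<bar>"
            using s by (intro mult_left_mono) auto
          then have "norm (Ua n s f' - U s f') \<le> 1/2 * norm (diff_lap n f' - g') * \<bar>t\<bar>"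
            using U_compare[OF f', of n s] by linarith
          then show ?thesis by (simp add: norm_minus_commute[of f' g])
        qed
        finally show ?thesis by simp
      qed
      from derivative_bound_const[OF d this] show ?thesis by (simp add: antiderivative(1)[OF cont])
    qed
    have lim: "norm (U t f - f - ?F t) \<le> norm (g - f') * \<bar>t\<bar>" if f': "has_lap f' g'" for f' g'
    proof (rule tendsto_le[OF sequentially_bot])
      show "(\<lambda>n. norm (Ua n t f - f - ?F t)) \<longlonglongrightarrow> norm (U t f - f - ?F t)" by (intro tendsto_intros U_limit)
      have "(\<lambda>n. 1/2 * (norm (diff_lap n f - g) + 2 * norm (g - f') + 1/2 * norm (diff_lap n f' - g') * \<bar>t\<bar>) * \<bar>t\<bar>) \<longlonglongrightarrow>
         1/2 * (norm (g - g) + 2 * norm (g - f') + 1/2 * norm (g' - g') * \<bar>t\<bar>) * \<bar>t\<bar>"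
        by (intro tendsto_intros diff_lap_tendsto assms f')
      then show "(\<lambda>n. 1/2 * (norm (diff_lap n f - g) + 2 * norm (g - f') + 1/2 * norm (diff_lap n f' - g') * \<bar>t\<bar>) * \<bar>t\<bar>) \<longlonglongrightarrow> norm (g - f') * \<bar>t\<bar>"
        by simp
    qed (intro always_eventually allI b[OF f'])
    have "norm (U t f - f - ?F t) \<le> e" if e: "0 < e" for e
    proof -
      have "0 < e / (\<bar>t\<bar> + 1)" using e by (simp add: add_nonneg_pos)
      then obtain f' g' where f': "has_lap f' g'" "norm (f' - g) < e / (\<bar>t\<bar> + 1)" using has_lap_dense by blast
      have "norm (g - f') * \<bar>t\<bar> \<le> e / (\<bar>t\<bar> + 1) * \<bar>t\<bar>"
        using f'(2) by (intro mult_right_mono) (auto simp: norm_minus_commute)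
      also have "\<dots> \<le> e" using e by (simp add: field_simps)
      finally show ?thesis using lim[OF f'(1)] by linarith
    qed
    then have "norm (U t f - f - ?F t) \<le> 0" by (rule field_le_epsilon) simp
    then show ?thesis by simp
  qed
  have "((\<lambda>t. f + ?F t) has_vector_derivative 0 + U t ((1/2) *\<^sub>R J g)) (at t)"
    by (intro has_vector_derivative_add has_vector_derivative_const antiderivative(2)[OF cont])
  moreover have "(\<lambda>t. f + ?F t) = (\<lambda>t. U t f)" by (rule ext) (simp flip: eq)
  ultimately show ?thesis by simp
qed


lemma reflect_derivative:
  assumes "(f has_vector_derivative d) (at (\<kappa> * t))"
  shows "((\<lambda>s. f (\<kappa> * s)) has_vector_derivative \<kappa> *\<^sub>R d) (at t)"
proof -
  have "((\<lambda>s. \<kappa> * s) has_vector_derivative \<kappa>) (at t)"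
    by (auto intro!: derivative_eq_intros simp flip: has_real_derivative_iff_has_vector_derivative)
  from vector_diff_chain_at[OF this assms] show ?thesis by (simp add: o_def)
qed

section \<open>Evolution with bounded potentials\<close>

lemma continuous_transl_uminus: "continuous_on UNIV (\<lambda>t. transl i (- t) x)"
  by (rule continuous_on_compose2[OF continuous_transl]) (auto intro: continuous_intros)

text \<open>Bounded symmetric complex-linear perturbations, strongly continuous in time. Both the actual potentials and
  their smoothed versions are of this kind.\<close>

definition admissible :: "(real \<Rightarrow> l2 \<Rightarrow> l2) \<Rightarrow> real \<Rightarrow> bool" where
  "admissible B M \<longleftrightarrow> 0 < M \<and> (\<forall>t. linear (B t)) \<and> (\<forall>t x. norm (B t x) \<le> M * norm x)
     \<and> (\<forall>t x. B t (J x) = J (B t x)) \<and> (\<forall>t x y. inner (B t x) y = inner x (B t y))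
     \<and> (\<forall>x. continuous_on UNIV (\<lambda>t. B t x))"

lemma admissibleD:
  assumes "admissible B M"
  shows "0 < M" "linear (B t)" "norm (B t x) \<le> M * norm x" "B t (J x) = J (B t x)"
    "inner (B t x) y = inner x (B t y)" "continuous_on UNIV (\<lambda>t. B t x)"
  using assms by (auto simp: admissible_def)

lemma continuous_on_strong_compose:
  fixes A :: "real \<Rightarrow> l2 \<Rightarrow> l2"
  assumes "\<And>r. linear (A r)" "\<And>r x. norm (A r x) \<le> C * norm x" "\<And>x. continuous_on UNIV (\<lambda>r. A r x)"
    "continuous_on UNIV u"
  shows "continuous_on UNIV (\<lambda>r. A r (u r))"
proof -
  have "((\<lambda>r. A r (u r)) \<longlongrightarrow> A t (u t)) (at t)" for t
    by (rule strongly_continuous_compose[OF assms(1,2)])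
      (use assms(3)[of "u t"] assms(4) in \<open>auto simp: continuous_on_def\<close>)
  then show ?thesis by (auto simp: continuous_on_def)
qed

text \<open>In the interaction picture \<open>y t = U (-t) (\<psi> t)\<close> the equation has a bounded right-hand side, so no domain
  questions arise and solutions exist and are unique for all initial data.\<close>

definition interaction :: "(real \<Rightarrow> l2 \<Rightarrow> l2) \<Rightarrow> real \<Rightarrow> l2 \<Rightarrow> l2" where
  "interaction B t x = - U (- t) (J (B t (U t x)))"

lemma continuous_U_uminus: "continuous_on UNIV (\<lambda>t. U (- t) x)"
  by (rule continuous_on_compose2[OF continuous_U]) (auto intro: continuous_intros)

lemma interaction_properties:
  assumes "admissible B M"
  shows "linear (interaction B t)" "norm (interaction B t x) \<le> M * norm x"
    "continuous_on UNIV (\<lambda>t. interaction B t x)" "inner x (interaction B t x) = 0"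
proof -
  note B = admissibleD[OF assms]
  have "linear (\<lambda>x. - U (- t) (J (B t (U t x))))"
    by (rule linearI)
      (simp_all add: linear_add[OF linear_U] linear_add[OF B(2)] linear_add[OF transl_invD(2)[OF transl_inv_J]]
        linear_cmul[OF linear_U] linear_cmul[OF B(2)] linear_cmul[OF transl_invD(2)[OF transl_inv_J]])
  then show "linear (interaction B t)" by (simp add: interaction_def[abs_def])
  show "norm (interaction B t x) \<le> M * norm x"
    using B(3)[of t "U t x"] by (simp add: interaction_def)
  have "continuous_on UNIV (\<lambda>t. B t (U t x))"
    by (rule continuous_on_strong_compose[OF B(2,3,6) continuous_U])
  then have c: "continuous_on UNIV (\<lambda>t. J (B t (U t x)))"
    by (rule bounded_linear.continuous_on[OF bounded_linear_J])
  have "continuous_on UNIV (\<lambda>t. U (- t) (J (B t (U t x))))"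
    by (rule continuous_on_strong_compose[where A = "\<lambda>t. U (- t)" and C = 1, OF _ _ _ c])
      (simp_all add: linear_U continuous_U_uminus)
  then show "continuous_on UNIV (\<lambda>t. interaction B t x)"
    unfolding interaction_def by (rule continuous_on_minus)
  have "inner (U t x) (J (B t (U t x))) = 0"
    using inner_J_left[of "U t x" "B t (U t x)"] B(5)[of t "J (U t x)" "U t x"] B(4)[of t "U t x"]
    by (simp add: inner_commute)
  then show "inner x (interaction B t x) = 0"
    using inner_U_left[of t x "J (B t (U t x))"] by (simp add: interaction_def)
qed

definition mild :: "(real \<Rightarrow> l2 \<Rightarrow> l2) \<Rightarrow> l2 \<Rightarrow> (real \<Rightarrow> l2) \<Rightarrow> bool" where
  "mild B x y \<longleftrightarrow> y 0 = x \<and> (\<forall>t. (y has_vector_derivative interaction B t (y t)) (at t))"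

lemma mild_exists: assumes "admissible B M" shows "\<exists>y. mild B x y"
  unfolding mild_def
  by (rule linear_ode_exists[where M = M]) (use interaction_properties[OF assms] admissibleD(1)[OF assms] in auto)

lemma mild_norm: assumes "admissible B M" "mild B x y" shows "norm (y t) = norm x"
proof -
  have "norm (y t) = norm (y 0)"
    by (rule skew_norm_constant[where y' = "\<lambda>t. interaction B t (y t)"])
      (use assms interaction_properties(4)[OF assms(1)] in \<open>auto simp: mild_def\<close>)
  then show ?thesis using assms by (simp add: mild_def)
qed

lemma mild_unique: assumes "admissible B M" "mild B x y" "mild B x z" shows "y t = z t"
proof -
  have "mild B (x - x) (\<lambda>t. y t - z t)"
    unfolding mild_def linear_diff[OF interaction_properties(1)[OF assms(1)]]
    using assms(2,3) by (auto simp: mild_def intro: has_vector_derivative_diff)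
  from mild_norm[OF assms(1) this, of t] show ?thesis by simp
qed

lemma mild_continuous: "mild B x y \<Longrightarrow> continuous_on UNIV y"
  unfolding mild_def by (auto intro: has_vector_derivative_imp_continuous_on)

lemma mild_solution_continuous:
  assumes "mild B x y" shows "continuous_on UNIV (\<lambda>t. U t (y t))"
  by (rule continuous_on_strong_compose[where A = U and C = 1]) (simp_all add: linear_U continuous_U mild_continuous[OF assms])

lemma U_uminus_derivative:
  assumes "has_lap f g" shows "((\<lambda>t. U (- t) f) has_vector_derivative - U (- t) ((1/2) *\<^sub>R J g)) (at t)"
  using reflect_derivative[of "\<lambda>t. U t f" _ "-1" t] U_derivative[OF assms, of "- t"] by simp

text \<open>Moving \<open>U\<close> to the fixed vector \<open>v\<close> turns the derivative of the unbounded group into one that exists because \<open>v\<close>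
  has a Laplacian.\<close>

lemma mild_imp_weak:
  assumes B: "admissible B M" and y: "mild B x y" and v: "has_lap v v'"
  shows "((\<lambda>s. inner (U s (y s)) v) has_real_derivative
     inner (U t (y t)) (- (1/2) *\<^sub>R J v') - inner (J (B t (U t (y t)))) v) (at t)"
proof -
  have "((\<lambda>s. inner (y s) (U (- s) v)) has_real_derivative
     inner (y t) (- U (- t) ((1/2) *\<^sub>R J v')) + inner (interaction B t (y t)) (U (- t) v)) (at t)"
    by (rule has_real_derivative_inner[OF _ U_uminus_derivative[OF v]]) (use y in \<open>simp add: mild_def\<close>)
  moreover have "inner (y t) (- U (- t) ((1/2) *\<^sub>R J v')) = inner (U t (y t)) (- (1/2) *\<^sub>R J v')"
    by (simp add: inner_U_left linear_cmul[OF linear_U])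
  moreover have "inner (interaction B t (y t)) (U (- t) v) = - inner (J (B t (U t (y t)))) v"
    by (simp add: interaction_def inner_U_U)
  moreover have "(\<lambda>s. inner (U s (y s)) v) = (\<lambda>s. inner (y s) (U (- s) v))"
    by (simp add: inner_U_left)
  ultimately show ?thesis by (simp only: add_uminus_conv_diff)
qed

lemma has_lap_symmetric: assumes "has_lap f g" "has_lap h k" shows "inner g h = inner f k"
proof -
  obtain a b where ab: "\<And>i. gen i f (a i)" "\<And>i. gen i (a i) (b i)" "g = (\<Sum>i\<in>UNIV. b i)"
    using assms(1) by (auto simp: has_lap_def)
  obtain c d where cd: "\<And>i. gen i h (c i)" "\<And>i. gen i (c i) (d i)" "k = (\<Sum>i\<in>UNIV. d i)"
    using assms(2) by (auto simp: has_lap_def)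
  have "inner (b i) h = inner f (d i)" for i
    using gen_antisymmetric[OF ab(2) cd(1), of i] gen_antisymmetric[OF ab(1) cd(2), of i] by simp
  then show ?thesis by (simp add: ab(3) cd(3) inner_sum_left inner_sum_right)
qed

lemma has_lap_J: "has_lap f g \<Longrightarrow> has_lap (J f) (J g)" by (rule has_lap_transl_inv[OF transl_inv_J])

text \<open>The bounded operator \<open>\<Delta> (Q h)\<^sup>2\<close>.\<close>

definition lapQQ :: "real \<Rightarrow> l2 \<Rightarrow> l2" where "lapQQ h x = (\<Sum>i\<in>UNIV. E h i (E h i x))"

lemma transl_inv_lapQQ: assumes "0 < h" shows "transl_inv (lapQQ h)"
  unfolding lapQQ_def[abs_def] by (rule transl_inv_sum) (rule transl_inv_compose[OF transl_inv_E[OF assms] transl_inv_E[OF assms]])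

lemma lapQQ_transl_inv: "transl_inv A \<Longrightarrow> lapQQ h (A x) = A (lapQQ h x)"
  by (simp add: lapQQ_def E_transl_inv linear_sum[OF transl_invD(2)])

lemma has_lap_lapQQ: "0 < h \<Longrightarrow> has_lap (Q h (Q h x)) (lapQQ h x)"
  unfolding lapQQ_def by (rule has_lap_QQ)

text \<open>An identity between functionals that holds along all translates of a vector also holds for averages of
  translates.\<close>

lemma avg_functional:
  assumes "\<And>a. inner p (shift a v) = inner q (shift a v')"
  shows "inner p (shift a (avg i h v)) = inner q (shift a (avg i h v'))"
proof -
  have eq: "inner p (tint i (shift a v) r) = inner q (tint i (shift a v') r)" for r
  proof -
    have "((\<lambda>r. inner p (tint i (shift a v) r) - inner q (tint i (shift a v') r)) has_real_derivative
       (inner p (transl i r (shift a v)) + inner 0 (tint i (shift a v) r)) - (inner q (transl i r (shift a v')) + inner 0 (tint i (shift a v') r))) (at r)" for r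
      by (intro DERIV_diff has_real_derivative_inner tint_derivative) auto
    moreover have "inner p (transl i r (shift a v)) = inner q (transl i r (shift a v'))" for r
      unfolding transl_def shift_shift by (rule assms)
    ultimately have "((\<lambda>r. inner p (tint i (shift a v) r) - inner q (tint i (shift a v') r)) has_real_derivative 0) (at r)" for r
      by simp
    from DERIV_isconst_all[OF allI[OF this], of r 0] show ?thesis by simp
  qed
  have s: "shift a (avg i h x) = avg i h (shift a x)" for x
    by (rule avg_map[symmetric]) (auto simp: bounded_linear_shift transl_def shift_shift add.commute)
  show ?thesis unfolding s by (simp add: avg_def inner_diff_right eq)
qed

lemma Q_functional:
  assumes "\<And>a. inner p (shift a v) = inner q (shift a v')"
  shows "inner p (shift a (Q h v)) = inner q (shift a (Q h v'))"
  unfolding Q_def by (intro avg_functional assms)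

text \<open>Distributional identities \<open>p = \<Delta> q\<close> become identities in the Hilbert space after two smoothings. Smoothing is
  moved onto the test function, where it is an average over translates, and the Laplacian is moved back by
  symmetry.\<close>

lemma smoothed_weak_identity:
  assumes h: "0 < h"
    and w: "\<And>\<phi>. test_function \<phi> \<Longrightarrow> inner p (test_vec \<phi>) = inner q (test_vec (laplacian \<phi>))"
    and wJ: "\<And>\<phi>. test_function \<phi> \<Longrightarrow> inner p (J (test_vec \<phi>)) = inner q (J (test_vec (laplacian \<phi>)))"
  shows "Q h (Q h p) = lapQQ h q"
proof -
  have sh: "shift a (test_vec \<phi>) = test_vec (\<lambda>x. \<phi> (x + a))" "shift a (test_vec (laplacian \<phi>)) = test_vec (laplacian (\<lambda>x. \<phi> (x + a)))"
    if t: "test_function \<phi>" for \<phi> a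
  proof -
    show "shift a (test_vec \<phi>) = test_vec (\<lambda>x. \<phi> (x + a))" by (simp add: test_vec_def shift_cls test_vec_mem_L2 t)
    have "(\<lambda>x. cnj (laplacian \<phi> x)) \<in> L2" by (intro L2_cnj test_laplacian_L2 t)
    then show "shift a (test_vec (laplacian \<phi>)) = test_vec (laplacian (\<lambda>x. \<phi> (x + a)))"
      by (simp add: test_vec_def shift_cls laplacian_translate[OF t])
  qed
  have key: "inner (Q h (Q h p) - lapQQ h q) v = 0"
    if "has_lap v v'" "\<And>a. inner p (shift a v) = inner q (shift a v')" for v v'
  proof -
    have "inner p (shift 0 (Q h (Q h v))) = inner q (shift 0 (Q h (Q h v')))"
      by (intro Q_functional that(2))
    then have "inner (Q h (Q h p)) v = inner (Q h (Q h q)) v'" by (simp add: inner_Q[OF h])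
    also have "\<dots> = inner (lapQQ h q) v" using has_lap_symmetric[OF has_lap_lapQQ[OF h] that(1)] by simp
    finally show ?thesis by (simp add: inner_diff_left)
  qed
  have "Q h (Q h p) - lapQQ h q = 0"
  proof (rule test_functions_total)
    fix \<phi> :: "real^3 \<Rightarrow> complex" assume t: "test_function \<phi>"
    show "inner (Q h (Q h p) - lapQQ h q) (test_vec \<phi>) = 0"
      by (rule key[OF has_lap_test_vec[OF t]]) (simp add: sh[OF t] w[OF test_translate[OF t]])
    show "inner (Q h (Q h p) - lapQQ h q) (J (test_vec \<phi>)) = 0"
      by (rule key[OF has_lap_J[OF has_lap_test_vec[OF t]]]) (simp add: shift_J sh[OF t] wJ[OF test_translate[OF t]])
  qed
  then show ?thesis by simp
qed

text \<open>Uniqueness of distributional solutions. The equation is integrated in time, so that it has the form treated in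
  the preceding lemma, with the antiderivative of the solution under the Laplacian. The smoothed solution then
  satisfies the equation with bounded operators and can be differentiated in the interaction picture; letting the
  smoothing width tend to 0 in the integrated equation gives the claim for the solution itself.\<close>

lemma weak_imp_mild:
  assumes B: "admissible B M" and wc: "continuous_on UNIV w"
    and w: "\<And>\<phi> t. test_function \<phi> \<Longrightarrow> ((\<lambda>s. inner (w s) (test_vec \<phi>)) has_real_derivative
        inner (w t) (- (1/2) *\<^sub>R J (test_vec (laplacian \<phi>))) - inner (J (B t (w t))) (test_vec \<phi>)) (at t)"
    and wJ: "\<And>\<phi> t. test_function \<phi> \<Longrightarrow> ((\<lambda>s. inner (w s) (J (test_vec \<phi>))) has_real_derivative
        inner (w t) (- (1/2) *\<^sub>R J (J (test_vec (laplacian \<phi>)))) - inner (J (B t (w t))) (J (test_vec \<phi>))) (at t)"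
  shows "mild B (w 0) (\<lambda>t. U (- t) (w t))"
proof -
  note Bp = admissibleD[OF B]
  have bc: "continuous_on UNIV (\<lambda>t. J (B t (w t)))"
    by (rule bounded_linear.continuous_on[OF bounded_linear_J continuous_on_strong_compose[OF Bp(2,3,6) wc]])
  define A where "A = antiderivative w"
  define N where "N = antiderivative (\<lambda>t. J (B t (w t)))"
  have A: "A 0 = 0" "(A has_vector_derivative w t) (at t)" for t
    unfolding A_def by (rule antiderivative[OF wc])+
  have N: "N 0 = 0" "(N has_vector_derivative J (B t (w t))) (at t)" for t
    unfolding N_def by (rule antiderivative[OF bc])+
  have integrated: "inner (w t - w 0 + N t) v = inner ((1/2) *\<^sub>R J (A t)) v'"
    if "\<And>t. ((\<lambda>s. inner (w s) v) has_real_derivative inner (w t) (- (1/2) *\<^sub>R J v') - inner (J (B t (w t))) v) (at t)" for v v' t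
  proof -
    have JA: "((\<lambda>s. (1/2) *\<^sub>R J (A s)) has_vector_derivative (1/2) *\<^sub>R J (w t)) (at t)" for t
      by (intro bounded_linear.has_vector_derivative[OF bounded_linear_scaleR_right] bounded_linear.has_vector_derivative[OF bounded_linear_J] A)
    have "((\<lambda>s. inner (w s) v + inner (N s) v - inner ((1/2) *\<^sub>R J (A s)) v') has_real_derivative
       (inner (w t) (- (1/2) *\<^sub>R J v') - inner (J (B t (w t))) v) + (inner (N t) 0 + inner (J (B t (w t))) v)
        - (inner ((1/2) *\<^sub>R J (A t)) 0 + inner ((1/2) *\<^sub>R J (w t)) v')) (at t)" for t
      by (intro DERIV_diff DERIV_add has_real_derivative_inner that N JA) auto
    moreover have "(inner (w t) (- (1/2) *\<^sub>R J v') - inner (J (B t (w t))) v) + (inner (N t) 0 + inner (J (B t (w t))) v)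
        - (inner ((1/2) *\<^sub>R J (A t)) 0 + inner ((1/2) *\<^sub>R J (w t)) v') = 0" for t
      by (simp add: inner_J_left)
    ultimately have "((\<lambda>s. inner (w s) v + inner (N s) v - inner ((1/2) *\<^sub>R J (A s)) v') has_real_derivative 0) (at t)" for t
      by (simp only:)
    from DERIV_isconst_all[OF allI[OF this], of t 0] show ?thesis
      by (simp add: A N linear_0[OF transl_invD(2)[OF transl_inv_J]] inner_add_left inner_diff_left)
  qed
  define z where "z t = U (- t) (w t)" for t
  have zc: "continuous_on UNIV z"
    unfolding z_def
    by (rule continuous_on_strong_compose[where A = "\<lambda>t. U (- t)" and C = 1]) (simp_all add: linear_U continuous_U_uminus wc)
  have ic: "continuous_on UNIV (\<lambda>t. interaction B t (z t))"
    by (rule continuous_on_strong_compose[OF interaction_properties(1-3)[OF B] zc])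
  have smooth: "((\<lambda>t. Q h (Q h (z t))) has_vector_derivative Q h (Q h (interaction B t (z t)))) (at t)" if h: "0 < h" for h t
  proof -
    have QQ: "transl_inv (\<lambda>x. Q h (Q h x))" by (rule transl_inv_compose[OF transl_inv_Q[OF h] transl_inv_Q[OF h]])
    have eq: "Q h (Q h (w t)) = Q h (Q h (w 0)) - Q h (Q h (N t)) + (1/2) *\<^sub>R J (lapQQ h (A t))" for t
    proof -
      have "Q h (Q h (w t - w 0 + N t)) = lapQQ h ((1/2) *\<^sub>R J (A t))"
        by (rule smoothed_weak_identity[OF h]) (rule integrated, erule w, rule integrated, erule wJ)
      then have "Q h (Q h (w t)) - Q h (Q h (w 0)) + Q h (Q h (N t)) = (1/2) *\<^sub>R J (lapQQ h (A t))"
        using linear_add[OF transl_invD(2)[OF QQ]] linear_diff[OF transl_invD(2)[OF QQ]]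
        by (simp add: lapQQ_transl_inv[OF transl_inv_J] linear_cmul[OF transl_invD(2)[OF transl_inv_lapQQ[OF h]]])
      then show ?thesis by (simp add: algebra_simps)
    qed
    have "((\<lambda>t. Q h (Q h (w 0)) - Q h (Q h (N t)) + (1/2) *\<^sub>R J (lapQQ h (A t))) has_vector_derivative
       0 - Q h (Q h (J (B t (w t)))) + (1/2) *\<^sub>R J (lapQQ h (w t))) (at t)"
      by (intro has_vector_derivative_add has_vector_derivative_diff has_vector_derivative_const
          bounded_linear.has_vector_derivative[OF transl_invD(1)[OF QQ]] bounded_linear.has_vector_derivative[OF bounded_linear_scaleR_right]
          bounded_linear.has_vector_derivative[OF bounded_linear_J] bounded_linear.has_vector_derivative[OF transl_invD(1)[OF transl_inv_lapQQ[OF h]]] A N)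
    then have d: "((\<lambda>t. Q h (Q h (w t))) has_vector_derivative - Q h (Q h (J (B t (w t)))) + (1/2) *\<^sub>R J (lapQQ h (w t))) (at t)"
      by (simp add: eq[symmetric])
    have "((\<lambda>r. U (- r) (Q h (Q h (w r)))) has_vector_derivative
        - U (- t) ((1/2) *\<^sub>R J (lapQQ h (w t))) + U (- t) (- Q h (Q h (J (B t (w t)))) + (1/2) *\<^sub>R J (lapQQ h (w t)))) (at t)"
    proof (rule strong_product_rule[where A = "\<lambda>r. U (- r)" and C = 1, OF _ _ U_uminus_derivative[OF has_lap_lapQQ[OF h]] _ d])
      show "(\<lambda>r. U (- r) x) \<midarrow>t\<rightarrow> U (- t) x" for x
        using continuous_U_uminus[of x] by (simp add: continuous_on_def)
    qed (auto simp: linear_U)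
    moreover have "U (- r) (Q h (Q h (w r))) = Q h (Q h (z r))" for r
      by (simp add: z_def Q_transl_inv[OF transl_inv_U])
    moreover have "- U (- t) ((1/2) *\<^sub>R J (lapQQ h (w t))) + U (- t) (- Q h (Q h (J (B t (w t)))) + (1/2) *\<^sub>R J (lapQQ h (w t)))
        = - U (- t) (Q h (Q h (J (B t (w t)))))"
      by (simp add: linear_add[OF linear_U] linear_diff[OF linear_U])
    moreover have "- U (- t) (Q h (Q h (J (B t (w t))))) = Q h (Q h (interaction B t (z t)))"
      by (simp add: interaction_def z_def U_U Q_transl_inv[OF transl_inv_U] linear_neg[OF transl_invD(2)[OF transl_inv_Q[OF h]]])
    ultimately show ?thesis by simp
  qed
  let ?F = "antiderivative (\<lambda>t. interaction B t (z t))"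
  have "z t = z 0 + ?F t" for t
  proof -
    have z: "Q h (Q h (z t - z 0 - ?F t)) = 0" if h: "0 < h" for h
    proof -
      have QQ: "transl_inv (\<lambda>x. Q h (Q h x))" by (rule transl_inv_compose[OF transl_inv_Q[OF h] transl_inv_Q[OF h]])
      have "Q h (Q h (z t)) - Q h (Q h (z 0)) = Q h (Q h (?F t))"
      proof (rule antiderivative_unique[where f = "\<lambda>t. Q h (Q h (interaction B t (z t)))"])
        show "((\<lambda>t. Q h (Q h (z t)) - Q h (Q h (z 0))) has_vector_derivative Q h (Q h (interaction B s (z s)))) (at s)" for s
          using has_vector_derivative_diff[OF smooth[OF h] has_vector_derivative_const] by fastforce
        show "((\<lambda>t. Q h (Q h (?F t))) has_vector_derivative Q h (Q h (interaction B s (z s)))) (at s)" for s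
          by (intro bounded_linear.has_vector_derivative[OF transl_invD(1)[OF QQ]] antiderivative ic)
      qed (simp add: antiderivative(1)[OF ic] linear_0[OF transl_invD(2)[OF transl_inv_Q[OF h]]])
      then show ?thesis using linear_diff[OF transl_invD(2)[OF QQ]] by simp
    qed
    have "(\<lambda>n. Q (1 / Suc n) (Q (1 / Suc n) (z t - z 0 - ?F t))) \<longlonglongrightarrow> z t - z 0 - ?F t"
      by (intro Q_tendsto tendsto_const)
    then have "z t - z 0 - ?F t = 0" by (simp add: z LIMSEQ_const_iff)
    then show ?thesis by (simp add: algebra_simps)
  qed
  then have zF: "z = (\<lambda>t. z 0 + ?F t)" by (rule ext)
  have "((\<lambda>t. z 0 + ?F t) has_vector_derivative 0 + interaction B t (z t)) (at t)" for t
    by (intro has_vector_derivative_add has_vector_derivative_const antiderivative ic)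
  then have "(z has_vector_derivative interaction B t (z t)) (at t)" for t
    using zF by (metis add_0)
  moreover have "z 0 = w 0" by (simp add: z_def)
  ultimately show ?thesis unfolding mild_def z_def[symmetric] by simp
qed

section \<open>The charge transfer model\<close>

lemma e1_axis: "e1 = axis 1 1"
  unfolding e1_def by (simp add: vec_eq_iff forall_3 axis_def)

text \<open>The moving potential is the conjugate of a fixed multiplication operator by translations, so its
  strong continuity in time is that of the translations.\<close>

definition pot :: "(real^3 \<Rightarrow> real) \<Rightarrow> (real^3 \<Rightarrow> real) \<Rightarrow> real \<Rightarrow> l2 \<Rightarrow> l2" where
  "pot V1 V2 t x = Mul V1 x + transl 1 (- t) (Mul V2 (transl 1 t x))"

lemma linear_Mul: "bounded_mult m B \<Longrightarrow> linear (Mul m)"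
  by (rule bounded_linear.linear[OF bounded_linear_Mul])

lemma admissible_pot:
  assumes V: "bounded_mult V1 M" "bounded_mult V2 M" and M: "0 < M"
  shows "admissible (pot V1 V2) (2 * M)"
  unfolding admissible_def
proof (intro conjI allI)
  fix t x y
  show "0 < 2 * M" using M by simp
  show "linear (pot V1 V2 t)"
    by (rule linearI)
      (simp_all add: pot_def linear_add[OF linear_transl] linear_cmul[OF linear_transl] linear_add[OF linear_Mul[OF V(1)]]
        linear_add[OF linear_Mul[OF V(2)]] linear_cmul[OF linear_Mul[OF V(1)]] linear_cmul[OF linear_Mul[OF V(2)]] scaleR_add_right)
  have "norm (pot V1 V2 t x) \<le> M * norm x + M * norm x"
    unfolding pot_def
  proof (rule order_trans[OF norm_triangle_ineq add_mono])
    show "norm (Mul V1 x) \<le> M * norm x" by (rule norm_Mul[OF V(1)])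
    show "norm (transl 1 (- t) (Mul V2 (transl 1 t x))) \<le> M * norm x" using norm_Mul[OF V(2), of "transl 1 t x"] by simp
  qed
  then show "norm (pot V1 V2 t x) \<le> 2 * M * norm x" by simp
  show "pot V1 V2 t (J x) = J (pot V1 V2 t x)"
    by (simp add: pot_def Mul_J[OF V(1)] Mul_J[OF V(2)] transl_J J_add)
  show "inner (pot V1 V2 t x) y = inner x (pot V1 V2 t y)"
    by (simp add: pot_def inner_add_left inner_add_right inner_Mul_left[OF V(1)] inner_Mul_left[OF V(2)] inner_transl_left)
  have "continuous_on UNIV (\<lambda>t. Mul V2 (transl 1 t x))"
    by (rule bounded_linear.continuous_on[OF bounded_linear_Mul[OF V(2)] continuous_transl])
  then have "continuous_on UNIV (\<lambda>t. transl 1 (- t) (Mul V2 (transl 1 t x)))"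
    by (rule continuous_on_strong_compose[where A = "\<lambda>t. transl 1 (- t)" and C = 1, rotated 3])
      (simp_all add: linear_transl continuous_transl_uminus)
  then show "continuous_on UNIV (\<lambda>t. pot V1 V2 t x)"
    unfolding pot_def by (intro continuous_intros)
qed

lemma pot_cls:
  assumes V: "bounded_mult V1 M" "bounded_mult V2 M" and f: "f \<in> L2" and \<phi>: "\<phi> \<in> L2"
  shows "(LINT x|lebesgue. of_real (V1 x) * f x * \<phi> x) + (LINT x|lebesgue. of_real (V2 (x - t *\<^sub>R e1)) * f x * \<phi> x)
    = Complex (inner (pot V1 V2 t (cls f)) (test_vec \<phi>)) (inner (pot V1 V2 t (cls f)) (J (test_vec \<phi>)))"
proof -
  have m: "bounded_mult (\<lambda>x. V2 (x - t *\<^sub>R e1)) M" using bounded_mult_shift[OF V(2), of "- (t *\<^sub>R e1)"] by simp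
  have "(LINT x|lebesgue. of_real (V1 x) * f x * \<phi> x) =
     Complex (inner (Mul V1 (cls f)) (test_vec \<phi>)) (inner (Mul V1 (cls f)) (J (test_vec \<phi>)))"
    using pairing_cls[OF bounded_mult_L2[OF V(1) f] \<phi>] by (simp add: Mul_cls[OF f])
  moreover have "(LINT x|lebesgue. of_real (V2 (x - t *\<^sub>R e1)) * f x * \<phi> x) =
     Complex (inner (Mul (\<lambda>x. V2 (x - t *\<^sub>R e1)) (cls f)) (test_vec \<phi>)) (inner (Mul (\<lambda>x. V2 (x - t *\<^sub>R e1)) (cls f)) (J (test_vec \<phi>)))"
    using pairing_cls[OF bounded_mult_L2[OF m f] \<phi>] by (simp add: Mul_cls[OF f])
  moreover have "Mul (\<lambda>x. V2 (x - t *\<^sub>R e1)) (cls f) = transl 1 (- t) (Mul V2 (transl 1 t (cls f)))"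
    by (simp add: transl_def shift_Mul[OF V(2)] shift_shift e1_axis)
  ultimately show ?thesis by (simp add: pot_def inner_add_left complex_eq_iff)
qed

text \<open>The complex equation tested with \<open>\<phi>\<close> is split into real and imaginary part.\<close>

lemma charge_transfer_equation_iff:
  assumes V: "bounded_mult V1 M" "bounded_mult V2 M" and f: "\<And>t. \<psi> t \<in> L2" and \<phi>: "test_function \<phi>"
  shows "(\<exists>D. ((\<lambda>s. LINT x|lebesgue. \<psi> s x * \<phi> x) has_vector_derivative D) (at t) \<and>
        (1 / \<i>) * D - (1/2) * (LINT x|lebesgue. \<psi> t x * laplacian \<phi> x)
          + (LINT x|lebesgue. of_real (V1 x) * \<psi> t x * \<phi> x)
          + (LINT x|lebesgue. of_real (V2 (x - t *\<^sub>R e1)) * \<psi> t x * \<phi> x) = 0)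
    \<longleftrightarrow> ((\<lambda>s. inner (cls (\<psi> s)) (test_vec \<phi>)) has_real_derivative
        inner (cls (\<psi> t)) (- (1/2) *\<^sub>R J (test_vec (laplacian \<phi>))) - inner (J (pot V1 V2 t (cls (\<psi> t)))) (test_vec \<phi>)) (at t)
      \<and> ((\<lambda>s. inner (cls (\<psi> s)) (J (test_vec \<phi>))) has_real_derivative
        inner (cls (\<psi> t)) (- (1/2) *\<^sub>R J (J (test_vec (laplacian \<phi>)))) - inner (J (pot V1 V2 t (cls (\<psi> t)))) (J (test_vec \<phi>))) (at t)"
    (is "?L \<longleftrightarrow> ?R")
proof -
  let ?w = "\<lambda>t. cls (\<psi> t)"
  have P: "(LINT x|lebesgue. \<psi> s x * \<phi> x) = Complex (inner (?w s) (test_vec \<phi>)) (inner (?w s) (J (test_vec \<phi>)))" for s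
    by (rule pairing_cls[OF f test_L2[OF \<phi>]])
  have PL: "(LINT x|lebesgue. \<psi> t x * laplacian \<phi> x) = Complex (inner (?w t) (test_vec (laplacian \<phi>))) (inner (?w t) (J (test_vec (laplacian \<phi>))))"
    by (rule pairing_cls[OF f test_laplacian_L2[OF \<phi>]])
  define D0 where "D0 = Complex (inner (?w t) (- (1/2) *\<^sub>R J (test_vec (laplacian \<phi>))) - inner (J (pot V1 V2 t (?w t))) (test_vec \<phi>))
     (inner (?w t) (- (1/2) *\<^sub>R J (J (test_vec (laplacian \<phi>)))) - inner (J (pot V1 V2 t (?w t))) (J (test_vec \<phi>)))"
  have eq: "(1 / \<i>) * D - (1/2) * (LINT x|lebesgue. \<psi> t x * laplacian \<phi> x)
          + (LINT x|lebesgue. of_real (V1 x) * \<psi> t x * \<phi> x)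
          + (LINT x|lebesgue. of_real (V2 (x - t *\<^sub>R e1)) * \<psi> t x * \<phi> x) = 0 \<longleftrightarrow> D = D0" for D
  proof -
    have "1 / \<i> = - \<i>" by (simp add: field_simps)
    then show ?thesis
      unfolding add.assoc pot_cls[OF V f test_L2[OF \<phi>]] PL D0_def
      by (auto simp: complex_eq_iff inner_J_left)
  qed
  have "?L \<longleftrightarrow> ((\<lambda>s. LINT x|lebesgue. \<psi> s x * \<phi> x) has_vector_derivative D0) (at t)"
    unfolding eq by blast
  also have "\<dots> \<longleftrightarrow> ?R"
    unfolding P has_vector_derivative_complex_iff by (simp add: D0_def has_real_derivative_iff_has_vector_derivative)
  finally show ?thesis .
qed

text \<open>The evolution operator is specified by an arbitrary choice among the solutions. The interaction picture provides
  a solution, so the chosen function is one, and by uniqueness all solutions lie in the class of the mild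
  solution at each time.\<close>

lemma evolution_mild:
  assumes V: "bounded_mult V1 M" "bounded_mult V2 M" and M: "0 < M" and \<psi>0: "\<psi>0 \<in> L2"
    and y: "mild (pot V1 V2) (cls \<psi>0) y"
  shows "evolution V1 V2 t 0 \<psi>0 \<in> L2" "cls (evolution V1 V2 t 0 \<psi>0) = U t (y t)"
proof -
  note B = admissible_pot[OF V M]
  \<comment> \<open>the initial value is prescribed as a function, not merely as a class\<close>
  define \<Psi> where "\<Psi> t = (if t = 0 then \<psi>0 else fn (U t (y t)))" for t
  have \<Psi>: "\<Psi> t \<in> L2" "cls (\<Psi> t) = U t (y t)" for t
    using \<psi>0 y by (auto simp: \<Psi>_def mild_def)
  have norm_eq: "L2_norm (\<lambda>x. \<psi> s x - \<psi> t x) = norm (cls (\<psi> s) - cls (\<psi> t))" if "\<And>t. \<psi> t \<in> L2" for \<psi> s t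
    using that by (simp add: norm_cls[OF L2_diff, symmetric] cls_diff)
  have "charge_transfer_solution V1 V2 \<Psi>"
    unfolding charge_transfer_solution_def
  proof (intro conjI allI impI)
    fix t
    show "\<Psi> t \<in> L2" by (rule \<Psi>)
    have "((\<lambda>s. U s (y s)) \<longlongrightarrow> U t (y t)) (at t)"
      using mild_solution_continuous[OF y] by (simp add: continuous_on_def)
    then show "((\<lambda>s. L2_norm (\<lambda>x. \<Psi> s x - \<Psi> t x)) \<longlongrightarrow> 0) (at t)"
      by (simp add: norm_eq \<Psi> tendsto_norm_zero_iff LIM_zero_iff)
  next
    fix \<phi> t assume t: "test_function \<phi>"
    show "\<exists>D. ((\<lambda>s. LINT x|lebesgue. \<Psi> s x * \<phi> x) has_vector_derivative D) (at t) \<and>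
        (1 / \<i>) * D - (1/2) * (LINT x|lebesgue. \<Psi> t x * laplacian \<phi> x)
          + (LINT x|lebesgue. of_real (V1 x) * \<Psi> t x * \<phi> x)
          + (LINT x|lebesgue. of_real (V2 (x - t *\<^sub>R e1)) * \<Psi> t x * \<phi> x) = 0"
    proof (rule iffD2[OF charge_transfer_equation_iff[where \<psi> = \<Psi>, OF V \<Psi>(1) t]], unfold \<Psi>(2))
    qed (intro conjI mild_imp_weak[OF B y] has_lap_test_vec has_lap_J t)
  qed
  then have "\<exists>\<psi>. charge_transfer_solution V1 V2 \<psi> \<and> \<psi> 0 = \<psi>0"
    by (intro exI[of _ \<Psi>]) (simp add: \<Psi>_def)
  from someI_ex[OF this] obtain \<psi> where \<psi>: "charge_transfer_solution V1 V2 \<psi>" "\<psi> 0 = \<psi>0"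
    and ev: "\<And>t. evolution V1 V2 t 0 \<psi>0 = \<psi> t"
    by (auto simp: evolution_def)
  have L: "\<psi> t \<in> L2" for t using \<psi>(1) by (simp add: charge_transfer_solution_def)
  have W: "((\<lambda>s. inner (cls (\<psi> s)) (test_vec \<phi>)) has_real_derivative
        inner (cls (\<psi> t)) (- (1/2) *\<^sub>R J (test_vec (laplacian \<phi>))) - inner (J (pot V1 V2 t (cls (\<psi> t)))) (test_vec \<phi>)) (at t)
      \<and> ((\<lambda>s. inner (cls (\<psi> s)) (J (test_vec \<phi>))) has_real_derivative
        inner (cls (\<psi> t)) (- (1/2) *\<^sub>R J (J (test_vec (laplacian \<phi>)))) - inner (J (pot V1 V2 t (cls (\<psi> t)))) (J (test_vec \<phi>))) (at t)"
    if "test_function \<phi>" for \<phi> t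
    by (rule iffD1[OF charge_transfer_equation_iff[where \<psi> = \<psi>, OF V L that]])
      (use \<psi>(1) that in \<open>unfold charge_transfer_solution_def, blast\<close>)
  have "mild (pot V1 V2) (cls (\<psi> 0)) (\<lambda>t. U (- t) (cls (\<psi> t)))"
  proof (rule weak_imp_mild[OF B])
    have n: "(\<lambda>s. L2_norm (\<lambda>x. \<psi> s x - \<psi> t x)) = (\<lambda>s. norm (cls (\<psi> s) - cls (\<psi> t)))" for t
      by (rule ext, rule norm_eq, rule L)
    have "((\<lambda>s. L2_norm (\<lambda>x. \<psi> s x - \<psi> t x)) \<longlongrightarrow> 0) (at t)" for t
      using \<psi>(1) unfolding charge_transfer_solution_def by blast
    then show "continuous_on UNIV (\<lambda>t. cls (\<psi> t))"
      unfolding n by (simp add: continuous_on_def tendsto_norm_zero_iff LIM_zero_iff)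
  qed (use W in blast)+
  from mild_unique[OF B this[unfolded \<psi>(2)] y] have "U (- t) (cls (\<psi> t)) = y t" for t .
  then have "cls (\<psi> t) = U t (y t)" for t by (metis U_U U_0 add.right_inverse)
  then show "evolution V1 V2 t 0 \<psi>0 \<in> L2" "cls (evolution V1 V2 t 0 \<psi>0) = U t (y t)"
    using L by (auto simp: ev)
qed


section \<open>Multipliers depending on one coordinate\<close>

text \<open>The velocity profile is \<open>v = st0 (clamp z)\<close>, the quintic step from 0 to 1 whose first and second derivatives
  \<open>st1\<close> and \<open>st2\<close> vanish at both ends. Consequently \<open>v\<close> is twice continuously differentiable, \<open>v\<close> and \<open>v'\<close> are
  \<open>O(z\<^sup>2)\<close> at 0, and \<open>1 - v\<close> and \<open>v'\<close> are \<open>O((1 - z)\<^sup>2)\<close> at 1. The function \<open>leg\<close> is the integral of \<open>z v'\<close>, that is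
  \<open>z v - \<integral> v\<close>.\<close>

definition clamp :: "real \<Rightarrow> real" where "clamp y = max 0 (min 1 y)"
definition st0 :: "real \<Rightarrow> real" where "st0 z = 10 * z^3 - 15 * z^4 + 6 * z^5"
definition st1 :: "real \<Rightarrow> real" where "st1 z = 30 * z^2 - 60 * z^3 + 30 * z^4"
definition st2 :: "real \<Rightarrow> real" where "st2 z = 60 * z - 180 * z^2 + 120 * z^3"
definition leg :: "real \<Rightarrow> real" where "leg z = 15/2 * z^4 - 12 * z^5 + 5 * z^6"

lemma clamp_bounds: "0 \<le> clamp y" "clamp y \<le> 1" by (auto simp: clamp_def)

lemma st1_eq: "st1 z = 30 * (z * (1 - z))\<^sup>2"
  by (simp add: st1_def power2_eq_square power3_eq_cube power4_eq_xxxx algebra_simps)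
lemma st2_eq: "st2 z = 60 * (z * (1 - z)) * (1 - 2 * z)"
  by (simp add: st2_def power2_eq_square power3_eq_cube algebra_simps)

lemma st0_derivative: "(st0 has_real_derivative st1 z) (at z)"
  unfolding st0_def[abs_def] st1_def by (auto intro!: derivative_eq_intros)
lemma st1_derivative: "(st1 has_real_derivative st2 z) (at z)"
  unfolding st1_def[abs_def] st2_def by (auto intro!: derivative_eq_intros)
lemma leg_derivative: "(leg has_real_derivative z * st1 z) (at z)"
  unfolding leg_def[abs_def] st1_def
  by (auto intro!: derivative_eq_intros simp: algebra_simps power2_eq_square power3_eq_cube power4_eq_xxxx eval_nat_numeral)

lemma st_ends: "st1 0 = 0" "st1 1 = 0" "st2 0 = 0" "st2 1 = 0"
  by (auto simp: st1_def st2_def)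

lemma unit_prod: "0 \<le> z \<Longrightarrow> z \<le> 1 \<Longrightarrow> 0 \<le> z * (1 - z) \<and> z * (1 - z) \<le> (1::real)"
  by (auto intro: mult_le_one)

lemma st1_bounds:
  assumes "0 \<le> z" "z \<le> 1"
  shows "0 \<le> st1 z" "st1 z \<le> 30" "st1 z \<le> 30 * z\<^sup>2" "st1 z \<le> 30 * (1 - z)\<^sup>2"
proof -
  have u: "0 \<le> z * (1 - z)" "z * (1 - z) \<le> 1" "z * (1 - z) \<le> z" "z * (1 - z) \<le> 1 - z"
    using unit_prod[OF assms] assms by (auto simp: mult_left_le mult_left_le_one_le)
  show "0 \<le> st1 z" by (simp add: st1_eq)
  show "st1 z \<le> 30 * z\<^sup>2" "st1 z \<le> 30 * (1 - z)\<^sup>2"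
    unfolding st1_eq by (auto intro!: power_mono u)
  show "st1 z \<le> 30" unfolding st1_eq using power_mono[OF u(2,1), of 2] by simp
qed

lemma st2_bound: assumes "0 \<le> z" "z \<le> 1" shows "\<bar>st2 z\<bar> \<le> 60"
proof -
  have "\<bar>1 - 2 * z\<bar> \<le> 1" using assms by (auto simp: abs_le_iff)
  then have "\<bar>z * (1 - z)\<bar> * \<bar>1 - 2 * z\<bar> \<le> 1" using unit_prod[OF assms] by (intro mult_le_one) auto
  then show ?thesis by (simp add: st2_eq abs_mult)
qed

lemma st0_reflect: "1 - st0 z = st0 (1 - z)"
proof -
  have "(1 - z)^3 = 1 - 3*z + 3*z^2 - z^3" "(1 - z)^4 = 1 - 4*z + 6*z^2 - 4*z^3 + z^4"
    "(1 - z)^5 = 1 - 5*z + 10*z^2 - 10*z^3 + 5*z^4 - z^5"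
    by (simp_all add: eval_nat_numeral algebra_simps)
  then show ?thesis unfolding st0_def by (simp add: algebra_simps)
qed

lemma st0_low: assumes "0 \<le> z" "z \<le> 1" shows "0 \<le> st0 z" "st0 z \<le> 10 * z\<^sup>2"
proof -
  have e: "st0 z = z^3 * (10 - z * (15 - 6 * z))"
    by (simp add: st0_def eval_nat_numeral algebra_simps)
  have "10 - z * (15 - 6 * z) = 1 + 3 * ((1 - z) * (3 - 2 * z))" by (simp add: algebra_simps)
  moreover have "0 \<le> (1 - z) * (3 - 2 * z)" using assms by (intro mult_nonneg_nonneg) auto
  ultimately have p: "0 \<le> 10 - z * (15 - 6 * z)" by linarith
  then show "0 \<le> st0 z" unfolding e using assms by (intro mult_nonneg_nonneg) auto
  have "0 \<le> z * (15 - 6 * z)" using assms by (intro mult_nonneg_nonneg) auto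
  then have "st0 z \<le> z^3 * 10" unfolding e using assms by (intro mult_left_mono) auto
  also have "\<dots> \<le> z^2 * 10" using assms by (intro mult_right_mono power_decreasing) auto
  finally show "st0 z \<le> 10 * z\<^sup>2" by simp
qed

lemma st0_bounds:
  assumes "0 \<le> z" "z \<le> 1"
  shows "0 \<le> st0 z" "st0 z \<le> 1" "st0 z \<le> 10 * z\<^sup>2" "1 - st0 z \<le> 10 * (1 - z)\<^sup>2" "0 \<le> 1 - st0 z"
  using st0_low[OF assms] st0_low[of "1 - z"] assms st0_reflect[of z] by auto

lemma leg_bound: assumes "0 \<le> z" "z \<le> 1" shows "\<bar>leg z\<bar> \<le> 25"
proof -
  have "0 \<le> z^4" "z^4 \<le> 1" "0 \<le> z^5" "z^5 \<le> 1" "0 \<le> z^6" "z^6 \<le> 1"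
    using assms by (auto intro: power_le_one)
  then show ?thesis unfolding leg_def abs_le_iff by (intro conjI) linarith+
qed

text \<open>At the two corners the one-sided derivatives of \<open>clamp\<close> differ, but the derivative of \<open>F\<close> vanishes there.\<close>

lemma clamp_chain:
  assumes F: "\<And>z. (F has_real_derivative F' z) (at z)" and ends: "F' 0 = 0" "F' 1 = 0"
  shows "((\<lambda>y. F (clamp y)) has_real_derivative F' (clamp y)) (at y)"
proof -
  consider "y < 0" | "y = 0" | "0 < y" "y < 1" | "y = 1" | "1 < y" by linarith
  then show ?thesis
  proof cases
    case 1
    have "((\<lambda>y. F 0) has_real_derivative 0) (at y)" by simp
    then have "((\<lambda>y. F (clamp y)) has_real_derivative 0) (at y)"
      by (rule has_field_derivative_transform_within_open[where S = "{..<0}"]) (use 1 in \<open>auto simp: clamp_def\<close>)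
    then show ?thesis using 1 ends by (simp add: clamp_def)
  next
    case 5
    have "((\<lambda>y. F 1) has_real_derivative 0) (at y)" by simp
    then have "((\<lambda>y. F (clamp y)) has_real_derivative 0) (at y)"
      by (rule has_field_derivative_transform_within_open[where S = "{1<..}"]) (use 5 in \<open>auto simp: clamp_def\<close>)
    then show ?thesis using 5 ends by (simp add: clamp_def)
  next
    case 3
    have "((\<lambda>y. F (clamp y)) has_real_derivative F' y) (at y)"
      by (rule has_field_derivative_transform_within_open[OF F, where S = "{0<..<1}"]) (use 3 in \<open>auto simp: clamp_def\<close>)
    then show ?thesis using 3 by (simp add: clamp_def)
  next
    case 2
    have "((\<lambda>h. (F (clamp (0 + h)) - F (clamp 0)) / h) \<longlongrightarrow> 0) (at 0)"
    proof (rule Lim_null_comparison)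
      have "((\<lambda>h. (F (0 + h) - F 0) / h) \<longlongrightarrow> F' 0) (at 0)" using F[of 0] by (simp add: DERIV_def)
      then show "((\<lambda>h. \<bar>(F (0 + h) - F 0) / h\<bar>) \<longlongrightarrow> 0) (at 0)"
        using ends by (intro tendsto_rabs_zero) simp
      show "\<forall>\<^sub>F h in at 0. norm ((F (clamp (0 + h)) - F (clamp 0)) / h) \<le> \<bar>(F (0 + h) - F 0) / h\<bar>"
        unfolding eventually_at by (rule exI[of _ 1]) (auto simp: clamp_def dist_real_def max_def min_def)
    qed
    then show ?thesis using 2 ends by (simp add: DERIV_def clamp_def)
  next
    case 4
    have "((\<lambda>h. (F (clamp (1 + h)) - F (clamp 1)) / h) \<longlongrightarrow> 0) (at 0)"
    proof (rule Lim_null_comparison)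
      have "((\<lambda>h. (F (1 + h) - F 1) / h) \<longlongrightarrow> F' 1) (at 0)" using F[of 1] by (simp add: DERIV_def)
      then show "((\<lambda>h. \<bar>(F (1 + h) - F 1) / h\<bar>) \<longlongrightarrow> 0) (at 0)"
        using ends by (intro tendsto_rabs_zero) simp
      show "\<forall>\<^sub>F h in at 0. norm ((F (clamp (1 + h)) - F (clamp 1)) / h) \<le> \<bar>(F (1 + h) - F 1) / h\<bar>"
        unfolding eventually_at by (rule exI[of _ 1]) (auto simp: clamp_def dist_real_def max_def min_def)
    qed
    then show ?thesis using 4 ends by (simp add: DERIV_def clamp_def)
  qed
qed

text \<open>A function of the coordinate \<open>z = \<kappa> x\<^sub>1 / (1 + t)\<close>. Starting the clock at 1 avoids the singularity at \<open>t = 0\<close>;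
  the sign \<open>\<kappa>\<close> is the direction of time.\<close>

definition profile :: "real \<Rightarrow> (real \<Rightarrow> real) \<Rightarrow> real \<Rightarrow> real^3 \<Rightarrow> real" where
  "profile \<kappa> F t x = F (clamp (\<kappa> / (1 + t) * x $ 1))"

lemma bounded_mult_profile:
  assumes "continuous_on UNIV F" "\<And>z. 0 \<le> z \<Longrightarrow> z \<le> 1 \<Longrightarrow> \<bar>F z\<bar> \<le> B"
  shows "bounded_mult (profile \<kappa> F t) B"
proof -
  have "continuous_on UNIV (\<lambda>x::real^3. clamp (\<kappa> / (1 + t) * x $ 1))"
    unfolding clamp_def by (intro continuous_intros)
  then have "continuous_on UNIV (profile \<kappa> F t)"
    unfolding profile_def using continuous_on_compose2[OF assms(1)] by blast
  then show ?thesis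
    using assms(2) clamp_bounds by (auto simp: bounded_mult_def profile_def intro: continuous_measurable_lebesgue)
qed

text \<open>The difference quotients of the multiplier converge pointwise and are bounded by the mean value theorem. They
  are set to 0 away from \<open>t\<close>, because the derivative is controlled only near \<open>t\<close>.\<close>

lemma Mul_derivative:
  fixes m m' :: "real \<Rightarrow> real^3 \<Rightarrow> real"
  assumes m: "\<And>r. bounded_mult (m r) B" and m': "bounded_mult (m' t) B'" and \<delta>: "0 < \<delta>"
    and b: "\<And>r x. \<bar>r - t\<bar> < \<delta> \<Longrightarrow> \<bar>m' r x\<bar> \<le> B'"
    and d: "\<And>r x. \<bar>r - t\<bar> < \<delta> \<Longrightarrow> ((\<lambda>r. m r x) has_real_derivative m' r x) (at r)"
  shows "((\<lambda>r. Mul (m r) f) has_vector_derivative Mul (m' t) f) (at t)"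
proof -
  define q where "q r x = (if \<bar>r - t\<bar> < \<delta> then (1 / (r - t)) * (m r x - m t x) else 0)" for r x
  have B'0: "0 \<le> B'" by (rule bounded_mult_bound_nonneg[OF m'])
  have qb: "\<bar>q r x\<bar> \<le> B'" for r x
  proof (cases "\<bar>r - t\<bar> < \<delta> \<and> r \<noteq> t")
    case True
    have "norm (m r x - m t x) \<le> B' * norm (r - t)"
    proof (rule field_differentiable_bound[where S = "{t - \<delta><..<t + \<delta>}" and f' = "\<lambda>r. m' r x"])
      show "((\<lambda>r. m r x) has_field_derivative m' z x) (at z within {t - \<delta><..<t + \<delta>})" if "z \<in> {t - \<delta><..<t + \<delta>}" for z
        using d[of z x] that by (auto intro: has_field_derivative_at_within simp: abs_less_iff)
      show "norm (m' z x) \<le> B'" if "z \<in> {t - \<delta><..<t + \<delta>}" for z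
        using b[of z x] that by (auto simp: abs_less_iff)
    qed (use True \<delta> in \<open>auto simp: abs_less_iff\<close>)
    then show ?thesis using True by (simp add: q_def abs_mult field_simps)
  qed (auto simp: q_def B'0)
  have qm: "bounded_mult (q r) B'" for r
  proof -
    have "q r \<in> borel_measurable lebesgue"
    proof (cases "\<bar>r - t\<bar> < \<delta>")
      case True
      then have "q r = (\<lambda>x. (1 / (r - t)) * (m r x - m t x))" by (auto simp: q_def)
      then show ?thesis using bounded_mult_cmult[OF bounded_mult_diff[OF m[of r] m[of t]], of "1 / (r - t)"] by (simp add: bounded_mult_def)
    next
      case False
      then have "q r = (\<lambda>x. 0)" by (auto simp: q_def)
      then show ?thesis by simp
    qed
    then show ?thesis using qb by (simp add: bounded_mult_def)
  qed
  have "((\<lambda>r. Mul (q r) f) \<longlongrightarrow> Mul (m' t) f) (at t)"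
  proof (rule Mul_tendsto_at[OF qm m'])
    fix x
    have "((\<lambda>r. (m r x - m t x) /\<^sub>R (r - t)) \<longlongrightarrow> m' t x) (at t)"
      using d[of t x] \<delta> by (simp add: has_real_derivative_iff_has_vector_derivative vector_derivative_at_iff_tendsto)
    moreover have "\<forall>\<^sub>F r in at t. (m r x - m t x) /\<^sub>R (r - t) = q r x"
      unfolding eventually_at by (rule exI[of _ \<delta>]) (use \<delta> in \<open>auto simp: q_def dist_real_def field_simps\<close>)
    ultimately show "((\<lambda>r. q r x) \<longlongrightarrow> m' t x) (at t)" by (rule Lim_transform_eventually)
  qed
  moreover have "\<forall>\<^sub>F r in at t. Mul (q r) f = (Mul (m r) f - Mul (m t) f) /\<^sub>R (r - t)"
    unfolding eventually_at
  proof (rule exI[of _ \<delta>], intro conjI ballI impI \<delta>)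
    fix r assume "r \<noteq> t \<and> dist r t < \<delta>"
    then have "q r = (\<lambda>x. (1 / (r - t)) * (m r x - m t x))" by (auto simp: q_def dist_real_def)
    then show "Mul (q r) f = (Mul (m r) f - Mul (m t) f) /\<^sub>R (r - t)"
      using Mul_cmult[OF bounded_mult_diff[OF m[of r] m[of t]], of "1 / (r - t)" f] Mul_minus[OF m[of r] m[of t], of f]
      by (simp add: divide_inverse)
  qed
  ultimately have "((\<lambda>r. (Mul (m r) f - Mul (m t) f) /\<^sub>R (r - t)) \<longlongrightarrow> Mul (m' t) f) (at t)"
    by (rule Lim_transform_eventually)
  then show ?thesis by (simp add: vector_derivative_at_iff_tendsto)
qed

lemma gen_Mul:
  assumes m: "bounded_mult m B" and m': "bounded_mult m' B'"
    and d: "\<And>x r. ((\<lambda>r. m (x + r *\<^sub>R axis i 1)) has_real_derivative m' (x + r *\<^sub>R axis i 1)) (at r)"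
    and f: "gen i f g"
  shows "gen i (Mul m f) (Mul m g + Mul m' f)"
proof -
  have D: "((\<lambda>r. Mul (\<lambda>x. m (x + r *\<^sub>R axis i 1)) y) has_vector_derivative Mul m' y) (at 0)" for y
    using Mul_derivative[where m = "\<lambda>r x. m (x + r *\<^sub>R axis i 1)" and m' = "\<lambda>r x. m' (x + r *\<^sub>R axis i 1)" and t = 0 and \<delta> = 1 and B = B and B' = B' and f = y]
      bounded_mult_shift[OF m] bounded_mult_shift[OF m'] m' d
    by (auto simp: bounded_mult_def)
  have "((\<lambda>r. Mul (\<lambda>x. m (x + r *\<^sub>R axis i 1)) (transl i r f)) has_vector_derivative Mul m' f + Mul (\<lambda>x. m (x + 0 *\<^sub>R axis i 1)) g) (at 0)"
  proof (rule strong_product_rule[where A = "\<lambda>r. Mul (\<lambda>x. m (x + r *\<^sub>R axis i 1))" and C = B])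
    show "linear (Mul (\<lambda>x. m (x + r *\<^sub>R axis i 1)))" for r by (rule linear_Mul[OF bounded_mult_shift[OF m]])
    show "norm (Mul (\<lambda>x. m (x + r *\<^sub>R axis i 1)) x) \<le> B * norm x" for r x by (rule norm_Mul[OF bounded_mult_shift[OF m]])
    show "(\<lambda>r. Mul (\<lambda>x. m (x + r *\<^sub>R axis i 1)) g) \<midarrow>0\<rightarrow> Mul (\<lambda>x. m (x + 0 *\<^sub>R axis i 1)) g"
      using has_vector_derivative_continuous[OF D[of g]] by (simp add: continuous_at)
    show "((\<lambda>r. Mul (\<lambda>x. m (x + r *\<^sub>R axis i 1)) (transl i 0 f)) has_vector_derivative Mul m' f) (at 0)" using D[of f] by simp
    show "((\<lambda>r. transl i r f) has_vector_derivative g) (at 0)" using f by (simp add: gen_def)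
  qed
  then show ?thesis unfolding gen_def transl_def shift_Mul[OF m] by (simp add: add.commute)
qed

lemma axis_component: "axis i (1::real) $ (1::3) = (if i = 1 then 1 else 0)"
  by (auto simp: axis_def)

lemma gen_profile:
  assumes F: "\<And>z. (F has_real_derivative F' z) (at z)" and ends: "F' 0 = 0" "F' 1 = 0"
    and F'c: "continuous_on UNIV F'"
    and b: "\<And>z. 0 \<le> z \<Longrightarrow> z \<le> 1 \<Longrightarrow> \<bar>F z\<bar> \<le> B" and b': "\<And>z. 0 \<le> z \<Longrightarrow> z \<le> 1 \<Longrightarrow> \<bar>F' z\<bar> \<le> B'"
    and f: "gen i f g"
  shows "gen i (Mul (profile \<kappa> F t) f) (Mul (profile \<kappa> F t) g + (if i = 1 then \<kappa> / (1 + t) else 0) *\<^sub>R Mul (profile \<kappa> F' t) f)"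
proof -
  have Fc: "continuous_on UNIV F"
    using F by (meson DERIV_continuous_on has_field_derivative_at_within)
  define c where "c = (if i = 1 then \<kappa> / (1 + t) else 0)"
  have m': "bounded_mult (profile \<kappa> F' t) B'" by (rule bounded_mult_profile[OF F'c b'])
  have "gen i (Mul (profile \<kappa> F t) f) (Mul (profile \<kappa> F t) g + Mul (\<lambda>x. c * profile \<kappa> F' t x) f)"
  proof (rule gen_Mul[OF bounded_mult_profile[OF Fc b] bounded_mult_cmult[OF m'] _ f])
    fix x r
    have "((\<lambda>r. \<kappa> / (1 + t) * (x + r *\<^sub>R axis i 1) $ 1) has_real_derivative c) (at r)"
    proof -
      have "((\<lambda>r. x $ 1 + r * axis i (1::real) $ 1) has_real_derivative axis i 1 $ 1) (at r)"
        by (auto intro!: derivative_eq_intros)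
      from DERIV_cmult[OF this, of "\<kappa> / (1 + t)"] show ?thesis
        by (simp add: c_def axis_component split: if_splits)
    qed
    from DERIV_chain2[OF clamp_chain[OF F ends] this]
    show "((\<lambda>r. profile \<kappa> F t (x + r *\<^sub>R axis i 1)) has_real_derivative c * profile \<kappa> F' t (x + r *\<^sub>R axis i 1)) (at r)"
      by (simp add: profile_def mult.commute)
  qed
  then show ?thesis by (simp add: Mul_cmult[OF m'] c_def)
qed

text \<open>Outside the unit interval both sides vanish; this allows the unbounded factor \<open>z\<close> from the time derivative of
  \<open>z = \<kappa> x\<^sub>1 / (1 + t)\<close> to be replaced by its bounded truncation.\<close>

lemma clamp_absorb: "F' 0 = 0 \<Longrightarrow> F' 1 = 0 \<Longrightarrow> y * F' (clamp y) = clamp y * F' (clamp y)" for F' :: "real \<Rightarrow> real"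
  by (auto simp: clamp_def max_def min_def)

lemma profile_time_derivative:
  assumes F: "\<And>z. (F has_real_derivative F' z) (at z)" and ends: "F' 0 = 0" "F' 1 = 0"
    and F'c: "continuous_on UNIV F'"
    and b: "\<And>z. 0 \<le> z \<Longrightarrow> z \<le> 1 \<Longrightarrow> \<bar>F z\<bar> \<le> B" and b': "\<And>z. 0 \<le> z \<Longrightarrow> z \<le> 1 \<Longrightarrow> \<bar>z * F' z\<bar> \<le> B'"
    and t: "0 \<le> t"
  shows "((\<lambda>r. Mul (profile \<kappa> F r) f) has_vector_derivative - (1 / (1 + t)) *\<^sub>R Mul (profile \<kappa> (\<lambda>z. z * F' z) t) f) (at t)"
proof -
  have Fc: "continuous_on UNIV F"
    using F by (meson DERIV_continuous_on has_field_derivative_at_within)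
  have zc: "continuous_on UNIV (\<lambda>z. z * F' z)" by (intro continuous_intros F'c)
  have B'0: "0 \<le> B'" using b'[of 0] by simp
  have m': "bounded_mult (profile \<kappa> (\<lambda>z. z * F' z) r) B'" for r by (rule bounded_mult_profile[OF zc b'])
  have "((\<lambda>r. Mul (profile \<kappa> F r) f) has_vector_derivative Mul (\<lambda>x. - (1 / (1 + t)) * profile \<kappa> (\<lambda>z. z * F' z) t x) f) (at t)"
  proof (rule Mul_derivative[where \<delta> = "1/2" and B = B and B' = "2 * B'" and m' = "\<lambda>r x. - (1 / (1 + r)) * profile \<kappa> (\<lambda>z. z * F' z) r x"])
    show "bounded_mult (profile \<kappa> F r) B" for r by (rule bounded_mult_profile[OF Fc b])
    have bb: "\<bar>- (1 / (1 + r)) * profile \<kappa> (\<lambda>z. z * F' z) r x\<bar> \<le> 2 * B'" if "\<bar>r - t\<bar> < 1/2" for r x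
    proof -
      have r: "1/2 \<le> 1 + r" using that t unfolding abs_less_iff by linarith
      then have "\<bar>1 / (1 + r)\<bar> \<le> 2" by (simp add: field_simps)
      moreover have "\<bar>profile \<kappa> (\<lambda>z. z * F' z) r x\<bar> \<le> B'" using m'[of r] by (simp add: bounded_mult_def)
      ultimately show ?thesis unfolding abs_mult abs_minus_cancel by (intro mult_mono) auto
    qed
    then show "\<bar>- (1 / (1 + r)) * profile \<kappa> (\<lambda>z. z * F' z) r x\<bar> \<le> 2 * B'" if "\<bar>r - t\<bar> < 1/2" for r x
      using that by blast
    show "bounded_mult (\<lambda>x. - (1 / (1 + t)) * profile \<kappa> (\<lambda>z. z * F' z) t x) (2 * B')"
      using bounded_mult_cmult[OF m'[of t], of "- (1 / (1 + t))"] bb[of t] by (simp add: bounded_mult_def)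
    show "((\<lambda>r. profile \<kappa> F r x) has_real_derivative - (1 / (1 + r)) * profile \<kappa> (\<lambda>z. z * F' z) r x) (at r)" if "\<bar>r - t\<bar> < 1/2" for r x
    proof -
      have r: "1 + r \<noteq> 0" using that t unfolding abs_less_iff by linarith
      define y where "y = \<kappa> / (1 + r) * x $ 1"
      have "((\<lambda>r. \<kappa> / (1 + r) * x $ 1) has_real_derivative - (1 / (1 + r)) * y) (at r)"
        unfolding y_def using r by (auto intro!: derivative_eq_intros simp: field_simps power2_eq_square)
      from DERIV_chain2[OF clamp_chain[OF F ends] this]
      have "((\<lambda>r. profile \<kappa> F r x) has_real_derivative F' (clamp y) * (- (1 / (1 + r)) * y)) (at r)"
        by (simp add: profile_def y_def)
      moreover have "F' (clamp y) * (- (1 / (1 + r)) * y) = - (1 / (1 + r)) * (clamp y * F' (clamp y))"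
        using clamp_absorb[OF ends, of y] by (simp add: mult_ac)
      ultimately show ?thesis by (simp add: profile_def y_def)
    qed
  qed simp
  then show ?thesis using Mul_cmult[OF m'[of t], of "- (1 / (1 + t))" f] by simp
qed

lemma profile_Lipschitz:
  assumes F: "\<And>z. (F has_real_derivative F' z) (at z)" and ends: "F' 0 = 0" "F' 1 = 0"
    and b': "\<And>z. 0 \<le> z \<Longrightarrow> z \<le> 1 \<Longrightarrow> \<bar>F' z\<bar> \<le> L" and \<kappa>: "\<bar>\<kappa>\<bar> = 1" and t: "0 \<le> t"
  shows "\<bar>profile \<kappa> F t (x + r *\<^sub>R axis i 1) - profile \<kappa> F t x\<bar> \<le> L * \<bar>r\<bar>"
proof -
  have L0: "0 \<le> L" using b'[of 0] abs_ge_zero order_trans by fastforce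
  let ?y = "\<kappa> / (1 + t) * (x + r *\<^sub>R axis i 1) $ 1" and ?y' = "\<kappa> / (1 + t) * x $ 1"
  have "norm (F (clamp ?y) - F (clamp ?y')) \<le> L * norm (?y - ?y')"
    by (rule field_differentiable_bound[where S = UNIV and f' = "\<lambda>y. F' (clamp y)"])
      (use clamp_chain[OF F ends] b' clamp_bounds in auto)
  moreover have "L * norm (?y - ?y') \<le> L * \<bar>r\<bar>"
  proof -
    have k: "\<bar>\<kappa> / (1 + t)\<bar> \<le> 1" using \<kappa> t by (simp add: abs_divide)
    have r: "\<bar>r * axis i 1 $ (1::3)\<bar> \<le> \<bar>r\<bar>" by (simp add: axis_component)
    have eq: "?y - ?y' = \<kappa> / (1 + t) * (r * axis i 1 $ 1)" by (simp add: algebra_simps)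
    have "norm (?y - ?y') = \<bar>\<kappa> / (1 + t)\<bar> * \<bar>r * axis i 1 $ (1::3)\<bar>"
      unfolding eq real_norm_def by (rule abs_mult)
    also have "\<dots> \<le> 1 * \<bar>r\<bar>" using k r by (intro mult_mono) auto
    finally show ?thesis by (intro mult_left_mono[OF _ L0]) simp
  qed
  ultimately show ?thesis unfolding profile_def by simp
qed

lemma st_continuous: "continuous_on UNIV st0" "continuous_on UNIV st1" "continuous_on UNIV st2" "continuous_on UNIV leg"
  "continuous_on UNIV (\<lambda>z. z * st1 z)" "continuous_on UNIV (\<lambda>z. z * (z * st1 z))"
  unfolding st0_def st1_def st2_def leg_def by (intro continuous_intros)+


section \<open>The regularised evolution and its energy\<close>

text \<open>Three smoothings, because the energy identity differentiates the solution three times: \<open>lapQQ h (Q h x)\<close> is the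
  Laplacian of \<open>Reg h x\<close>, and one further derivative of it remains available.\<close>

definition Reg :: "real \<Rightarrow> l2 \<Rightarrow> l2" where "Reg h x = Q h (Q h (Q h x))"

lemma transl_inv_Reg: assumes "0 < h" shows "transl_inv (Reg h)"
  unfolding Reg_def[abs_def] by (rule transl_inv_compose[OF transl_inv_Q[OF assms] transl_inv_compose[OF transl_inv_Q[OF assms] transl_inv_Q[OF assms]]])
lemma Reg_transl_inv: "transl_inv A \<Longrightarrow> Reg h (A x) = A (Reg h x)" by (simp add: Reg_def Q_transl_inv)
lemma norm_Reg: "0 < h \<Longrightarrow> norm (Reg h x) \<le> norm x"
  unfolding Reg_def by (meson norm_Q order_trans)
lemma inner_Reg: "0 < h \<Longrightarrow> inner (Reg h x) y = inner x (Reg h y)" by (simp add: Reg_def inner_Q)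

lemma Reg_Mul_commutator:
  assumes m: "bounded_mult m B" and L: "\<And>i t r. \<bar>m (t + r *\<^sub>R axis i 1) - m t\<bar> \<le> L * \<bar>r\<bar>" and L0: "0 \<le> L" and h: "0 < h"
  shows "norm (Reg h (Mul m x) - Mul m (Reg h x)) \<le> 9 * (L * h * norm x)"
proof -
  have c: "norm (Q h (Mul m y) - Mul m (Q h y)) \<le> 3 * (L * h * norm x)" if "norm y \<le> norm x" for y
  proof -
    have "L * h * norm y \<le> L * h * norm x" using that L0 h by (intro mult_left_mono) auto
    then show ?thesis using Q_Mul_commutator[OF m L L0 h, of y] by linarith
  qed
  have n1: "norm (Q h x) \<le> norm x" by (rule norm_Q[OF h])
  have n2: "norm (Q h (Q h x)) \<le> norm x" using norm_Q[OF h, of "Q h x"] n1 by linarith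
  have eq: "Reg h (Mul m x) - Mul m (Reg h x)
      = Q h (Q h (Q h (Mul m x) - Mul m (Q h x))) + Q h (Q h (Mul m (Q h x)) - Mul m (Q h (Q h x)))
      + (Q h (Mul m (Q h (Q h x))) - Mul m (Q h (Q h (Q h x))))"
    by (simp add: Reg_def linear_diff[OF transl_invD(2)[OF transl_inv_Q[OF h]]])
  have "norm (Reg h (Mul m x) - Mul m (Reg h x)) \<le> norm (Q h (Q h (Q h (Mul m x) - Mul m (Q h x))))
     + norm (Q h (Q h (Mul m (Q h x)) - Mul m (Q h (Q h x)))) + norm (Q h (Mul m (Q h (Q h x))) - Mul m (Q h (Q h (Q h x))))"
    unfolding eq by (rule norm_triangle3)
  moreover have "norm (Q h (Q h (Q h (Mul m x) - Mul m (Q h x)))) \<le> 3 * (L * h * norm x)"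
    by (rule order_trans[OF norm_Q[OF h]], rule order_trans[OF norm_Q[OF h]], rule c) simp
  moreover have "norm (Q h (Q h (Mul m (Q h x)) - Mul m (Q h (Q h x)))) \<le> 3 * (L * h * norm x)"
    by (rule order_trans[OF norm_Q[OF h]], rule c[OF n1])
  moreover have "norm (Q h (Mul m (Q h (Q h x))) - Mul m (Q h (Q h (Q h x)))) \<le> 3 * (L * h * norm x)"
    by (rule c[OF n2])
  ultimately show ?thesis by linarith
qed

lemma inner_bound: "\<bar>inner (Mul m x) y\<bar> \<le> B * (norm x * norm y)" if "bounded_mult m B" for m B x y
proof -
  have "\<bar>inner (Mul m x) y\<bar> \<le> norm (Mul m x) * norm y" by (rule Cauchy_Schwarz_ineq2)
  also have "\<dots> \<le> (B * norm x) * norm y" by (intro mult_right_mono norm_Mul[OF that]) auto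
  finally show ?thesis by (simp add: mult.assoc)
qed

text \<open>Here \<open>z\<close> solves the equation with potential \<open>Reg h V(t) Reg h\<close> in the interaction picture, with one factor
  \<open>Reg h\<close> split off: the solution proper is \<open>Reg h\<close> applied to \<open>z\<close>, which exhibits its smoothness. For
  \<open>\<kappa> = -1\<close> time runs backwards; the second potential then moves with velocity \<open>-1\<close> and \<open>I\<close> takes the role of \<open>J\<close>,
  so both directions obey the same equation \<open>u' = - I H u\<close> for positive times.\<close>

locale regularised =
  fixes \<kappa> h M :: real and V1 V2 :: "real^3 \<Rightarrow> real" and z :: "real \<Rightarrow> l2"
  assumes \<kappa>: "\<kappa> = 1 \<or> \<kappa> = -1" and h: "0 < h" and M: "0 < M"
    and V1: "bounded_mult V1 M" and V2: "bounded_mult V2 M"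
    and decay1: "\<And>x. (1 + norm x)\<^sup>2 * \<bar>V1 x\<bar> \<le> M" and decay2: "\<And>x. (1 + norm x)\<^sup>2 * \<bar>V2 x\<bar> \<le> M"
    and z: "\<And>t. (z has_vector_derivative - U (- t) (J (pot V1 V2 t (Reg h (U t (Reg h (z t))))))) (at t)"
begin

text \<open>Write \<open>R\<close> for \<open>Reg h\<close>. The paths are the solution \<open>u = R zt\<close>, its partial derivatives \<open>ud\<close>, the derivative \<open>ue\<close> in
  the direction of motion of the second potential, the unsmoothed potential term \<open>f = V R u\<close>, the Laplacian
  \<open>Lu\<close> of \<open>u\<close>, the Hamiltonian applied to \<open>u\<close>, and the time derivatives of \<open>u\<close> and \<open>ud\<close>.\<close>

definition I :: "l2 \<Rightarrow> l2" where "I x = \<kappa> *\<^sub>R J x"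
definition zt :: "real \<Rightarrow> l2" where "zt t = U (\<kappa> * t) (z (\<kappa> * t))"
definition u :: "real \<Rightarrow> l2" where "u t = Reg h (zt t)"
definition ud :: "3 \<Rightarrow> real \<Rightarrow> l2" where "ud j t = Q h (Q h (E h j (zt t)))"
definition ue :: "real \<Rightarrow> l2" where "ue t = \<kappa> *\<^sub>R ud 1 t"
definition f :: "real \<Rightarrow> l2" where "f t = pot V1 V2 (\<kappa> * t) (Reg h (u t))"
definition Lu :: "real \<Rightarrow> l2" where "Lu t = lapQQ h (Q h (zt t))"
definition H :: "real \<Rightarrow> l2" where "H t = - (1/2) *\<^sub>R Lu t + Reg h (f t)"
definition u' :: "real \<Rightarrow> l2" where "u' t = - I (H t)"
definition ud' :: "3 \<Rightarrow> real \<Rightarrow> l2" where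
  "ud' j t = - I (- (1/2) *\<^sub>R lapQQ h (E h j (zt t)) + Q h (Q h (E h j (f t))))"

lemma \<kappa>2: "\<kappa> * \<kappa> = 1" "\<bar>\<kappa>\<bar> = 1" using \<kappa> by auto
lemma transl_inv_I: "transl_inv I" unfolding I_def[abs_def] by (intro transl_inv_scaleR transl_inv_J)
lemma linear_I: "linear I" by (rule transl_invD(2)[OF transl_inv_I])
lemma I_I: "I (I x) = - x" by (simp add: I_def linear_cmul[OF transl_invD(2)[OF transl_inv_J]] \<kappa>2)
lemma inner_I_left: "inner (I x) y = - inner x (I y)" by (simp add: I_def inner_J_left)
lemma inner_I_I: "inner (I x) (I y) = inner x y" by (simp add: inner_I_left I_I)
lemma inner_I_self: "inner (I x) x = 0" "inner x (I x) = 0" by (simp_all add: I_def)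
lemma norm_I: "norm (I x) = norm x" using \<kappa>2 by (simp add: I_def)
lemma Mul_I: "bounded_mult m B \<Longrightarrow> Mul m (I x) = I (Mul m x)"
  by (simp add: I_def Mul_scaleR Mul_J)

text \<open>All paths above are bounded translation-invariant operators applied to \<open>zt\<close>, so one computation provides all
  time derivatives.\<close>

lemma path_derivative:
  assumes A: "transl_inv A" and A': "transl_inv A'" and l: "\<And>x. has_lap (A x) (A' x)"
    and cA: "\<And>B x. transl_inv B \<Longrightarrow> A (B x) = B (A x)" and cA': "\<And>B x. transl_inv B \<Longrightarrow> A' (B x) = B (A' x)"
  shows "((\<lambda>t. A (zt t)) has_vector_derivative - I (- (1/2) *\<^sub>R A' (zt t) + A (f t))) (at t)"
proof -
  define P where "P s = pot V1 V2 s (Reg h (U s (Reg h (z s))))" for s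
  have "((\<lambda>s. U s (A (z s))) has_vector_derivative U s ((1/2) *\<^sub>R J (A' (z s))) + U s (A (- U (- s) (J (P s))))) (at s)" for s
  proof (rule strong_product_rule[where A = U and C = 1, OF linear_U _ U_derivative[OF l] U_tendsto])
    show "((\<lambda>s. A (z s)) has_vector_derivative A (- U (- s) (J (P s)))) (at s)"
      unfolding P_def by (rule bounded_linear.has_vector_derivative[OF transl_invD(1)[OF A] z])
  qed simp
  from reflect_derivative[OF this, of \<kappa> t]
  have "((\<lambda>t. A (zt t)) has_vector_derivative \<kappa> *\<^sub>R (U (\<kappa> * t) ((1/2) *\<^sub>R J (A' (z (\<kappa> * t)))) + U (\<kappa> * t) (A (- U (- (\<kappa> * t)) (J (P (\<kappa> * t))))))) (at t)"
    by (simp add: zt_def cA[OF transl_inv_U])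
  moreover have "U (\<kappa> * t) ((1/2) *\<^sub>R J (A' (z (\<kappa> * t)))) = (1/2) *\<^sub>R J (A' (zt t))"
    by (simp add: linear_cmul[OF linear_U] U_J zt_def cA'[OF transl_inv_U])
  moreover have "U (\<kappa> * t) (A (- U (- (\<kappa> * t)) (J (P (\<kappa> * t))))) = - J (A (f t))"
  proof -
    have "U (\<kappa> * t) (A (- U (- (\<kappa> * t)) (J (P (\<kappa> * t))))) = - A (U (\<kappa> * t) (U (- (\<kappa> * t)) (J (P (\<kappa> * t)))))"
      by (simp add: linear_neg[OF transl_invD(2)[OF A]] linear_neg[OF linear_U] cA[OF transl_inv_U])
    also have "\<dots> = - J (A (P (\<kappa> * t)))" by (simp add: U_U cA[OF transl_inv_J])
    also have "- J (A (P (\<kappa> * t))) = - J (A (f t))" by (simp add: P_def f_def u_def zt_def Reg_transl_inv[OF transl_inv_U])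
    finally show ?thesis .
  qed
  moreover have "\<kappa> *\<^sub>R ((1/2) *\<^sub>R J (A' (zt t)) + - J (A (f t))) = - I (- (1/2) *\<^sub>R A' (zt t) + A (f t))"
    by (simp add: I_def linear_add[OF transl_invD(2)[OF transl_inv_J]] linear_diff[OF transl_invD(2)[OF transl_inv_J]] linear_cmul[OF transl_invD(2)[OF transl_inv_J]] linear_neg[OF transl_invD(2)[OF transl_inv_J]] algebra_simps)
  ultimately show ?thesis by simp
qed

lemma u_derivative: "(u has_vector_derivative u' t) (at t)"
proof -
  have "((\<lambda>t. Reg h (zt t)) has_vector_derivative - I (- (1/2) *\<^sub>R lapQQ h (Q h (zt t)) + Reg h (f t))) (at t)"
  proof (rule path_derivative)
    show "transl_inv (Reg h)" by (rule transl_inv_Reg[OF h])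
    show "transl_inv (\<lambda>x. lapQQ h (Q h x))" by (rule transl_inv_compose[OF transl_inv_lapQQ[OF h] transl_inv_Q[OF h]])
    show "has_lap (Reg h x) (lapQQ h (Q h x))" for x unfolding Reg_def by (rule has_lap_lapQQ[OF h])
  qed (simp_all add: Reg_transl_inv lapQQ_transl_inv Q_transl_inv)
  then show ?thesis by (simp add: u_def[abs_def] u'_def H_def Lu_def)
qed

lemma ud_derivative: "(ud j has_vector_derivative ud' j t) (at t)"
proof -
  have "((\<lambda>t. Q h (Q h (E h j (zt t)))) has_vector_derivative - I (- (1/2) *\<^sub>R lapQQ h (E h j (zt t)) + Q h (Q h (E h j (f t))))) (at t)"
  proof (rule path_derivative)
    show "transl_inv (\<lambda>x. Q h (Q h (E h j x)))"
      by (rule transl_inv_compose[OF transl_inv_Q[OF h] transl_inv_compose[OF transl_inv_Q[OF h] transl_inv_E[OF h]]])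
    show "transl_inv (\<lambda>x. lapQQ h (E h j x))" by (rule transl_inv_compose[OF transl_inv_lapQQ[OF h] transl_inv_E[OF h]])
    show "has_lap (Q h (Q h (E h j x))) (lapQQ h (E h j x))" for x by (rule has_lap_lapQQ[OF h])
  qed (simp_all add: lapQQ_transl_inv Q_transl_inv E_transl_inv)
  then show ?thesis by (simp add: ud_def[abs_def] ud'_def)
qed

lemma gen_u: "gen j (u t) (ud j t)"
  using gen_Q[OF h, of j "Q h (Q h (zt t))"]
  by (simp add: u_def Reg_def ud_def E_transl_inv[OF transl_inv_Q[OF h]])

lemma gen_uminus: "gen i x y \<Longrightarrow> gen i (- x) (- y)"
  using gen_scaleR[of i x y "-1"] by simp

lemma gen_I: "gen i x y \<Longrightarrow> gen i (I x) (I y)" by (rule gen_transl_inv[OF transl_inv_I])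

lemma gen_u': "gen j (u' t) (ud' j t)"
proof -
  have "gen j (lapQQ h (Q h (zt t))) (lapQQ h (E h j (zt t)))" by (rule gen_transl_inv[OF transl_inv_lapQQ[OF h] gen_Q[OF h]])
  moreover have "gen j (Reg h (f t)) (Q h (Q h (E h j (f t))))"
    using gen_Q[OF h, of j "Q h (Q h (f t))"] by (simp add: Reg_def E_transl_inv[OF transl_inv_Q[OF h]])
  ultimately show ?thesis unfolding u'_def ud'_def H_def Lu_def
    by (intro gen_uminus gen_I gen_add gen_scaleR)
qed

text \<open>The mixed second derivatives with one index in the direction of motion.\<close>

definition udd :: "3 \<Rightarrow> real \<Rightarrow> l2" where "udd j t = E h 1 (E h j (Q h (zt t)))"

lemma gen_udd: "gen 1 (ud j t) (udd j t)" "gen j (ud 1 t) (udd j t)"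
proof -
  show "gen 1 (ud j t) (udd j t)"
    using gen_Q[OF h, of 1 "Q h (E h j (zt t))"] by (simp add: ud_def udd_def E_transl_inv[OF transl_inv_Q[OF h]])
  have "E h j (E h 1 (Q h (zt t))) = E h 1 (E h j (Q h (zt t)))" by (rule E_transl_inv[OF transl_inv_E[OF h]])
  then show "gen j (ud 1 t) (udd j t)"
    using gen_Q[OF h, of j "Q h (E h 1 (zt t))"] by (simp add: ud_def udd_def E_transl_inv[OF transl_inv_Q[OF h]])
qed

lemma inner_Lu:
  assumes "\<And>j. gen j x (xj j)" shows "inner (Lu t) x = - (\<Sum>j\<in>UNIV. inner (ud j t) (xj j))"
proof -
  have "gen j (ud j t) (E h j (E h j (Q h (zt t))))" for j
    using gen_Q[OF h, of j "Q h (E h j (zt t))"] by (simp add: ud_def E_transl_inv[OF transl_inv_Q[OF h]])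
  from gen_antisymmetric[OF this assms]
  have "inner (E h j (E h j (Q h (zt t)))) x = - inner (ud j t) (xj j)" for j .
  then show ?thesis by (simp add: Lu_def lapQQ_def inner_sum_left sum_negf)
qed

text \<open>Kinetic and potential part of \<open>H\<close> are symmetric and commute with \<open>I\<close>.\<close>

lemma norm_u: "norm (u t) = norm (u 0)"
proof (rule skew_norm_constant[OF u_derivative])
  fix t
  have "inner (Lu t) (I (u t)) = - (\<Sum>j\<in>UNIV. inner (ud j t) (I (ud j t)))"
    by (rule inner_Lu) (rule gen_I[OF gen_u])
  then have "inner (Lu t) (I (u t)) = 0" by (simp add: inner_I_self)
  then have 1: "inner (u t) (I (Lu t)) = 0"
    using inner_I_left[of "Lu t" "u t"] by (simp add: inner_commute)
  note B = admissibleD[OF admissible_pot[OF V1 V2 M]]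
  have "inner (u t) (I (Reg h (f t))) = inner (Reg h (u t)) (I (f t))"
    by (simp add: inner_Reg[OF h] Reg_transl_inv[OF transl_inv_I])
  also have "\<dots> = \<kappa> * inner (Reg h (u t)) (pot V1 V2 (\<kappa> * t) (J (Reg h (u t))))"
    by (simp add: I_def f_def B(4))
  also have "\<dots> = 0"
    using B(5)[of "\<kappa> * t" "Reg h (u t)" "J (Reg h (u t))"] B(4)[of "\<kappa> * t" "Reg h (u t)"]
      inner_J_left[of "Reg h (u t)" "pot V1 V2 (\<kappa> * t) (Reg h (u t))"]
    by (simp add: inner_commute)
  finally have 2: "inner (u t) (I (Reg h (f t))) = 0" .
  show "inner (u t) (u' t) = 0"
    using 1 2 by (simp add: u'_def H_def linear_add[OF linear_I] linear_diff[OF linear_I] linear_cmul[OF linear_I] linear_neg[OF linear_I] inner_simps)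
qed

subsection \<open>The energy\<close>

abbreviation mul :: "(real \<Rightarrow> real) \<Rightarrow> real \<Rightarrow> l2 \<Rightarrow> l2" where "mul F t \<equiv> Mul (profile \<kappa> F t)"

lemma b0: "bounded_mult (profile \<kappa> st0 t) 1" by (rule bounded_mult_profile) (use st0_bounds in \<open>auto simp: st_continuous abs_of_nonneg\<close>)
lemma b1: "bounded_mult (profile \<kappa> st1 t) 30" by (rule bounded_mult_profile) (use st1_bounds in \<open>auto simp: st_continuous abs_of_nonneg\<close>)
lemma b2: "bounded_mult (profile \<kappa> st2 t) 60" by (rule bounded_mult_profile) (use st2_bound in \<open>auto simp: st_continuous\<close>)
lemma bg: "bounded_mult (profile \<kappa> leg t) 25" by (rule bounded_mult_profile) (use leg_bound in \<open>auto simp: st_continuous\<close>)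
lemma z_st1: "0 \<le> y \<Longrightarrow> y \<le> 1 \<Longrightarrow> \<bar>y * st1 y\<bar> \<le> 30" for y :: real
  using st1_bounds[of y] mult_mono[of "\<bar>y\<bar>" 1 "\<bar>st1 y\<bar>" 30] by (simp add: abs_mult)
lemma zz_st1: "0 \<le> y \<Longrightarrow> y \<le> 1 \<Longrightarrow> \<bar>y * (y * st1 y)\<bar> \<le> 30" for y :: real
  using z_st1[of y] mult_mono[of "\<bar>y\<bar>" 1 "\<bar>y * st1 y\<bar>" 30] by (simp add: abs_mult)
lemma bc1: "bounded_mult (profile \<kappa> (\<lambda>z. z * st1 z) t) 30" by (rule bounded_mult_profile[OF st_continuous(5) z_st1])
lemma bcc1: "bounded_mult (profile \<kappa> (\<lambda>z. z * (z * st1 z)) t) 30" by (rule bounded_mult_profile[OF st_continuous(6) zz_st1])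
lemma bc: "bounded_mult (profile \<kappa> (\<lambda>z. z) t) 1" by (rule bounded_mult_profile) auto

text \<open>The derivative of \<open>\<kappa> x\<^sub>1 / (1 + t)\<close> in direction \<open>j\<close>.\<close>

definition cf :: "3 \<Rightarrow> real \<Rightarrow> real" where "cf j t = (if j = 1 then \<kappa> / (1 + t) else 0)"

lemma gen_mul0: "gen j x y \<Longrightarrow> gen j (mul st0 t x) (mul st0 t y + cf j t *\<^sub>R mul st1 t x)"
  unfolding cf_def
  by (rule gen_profile[OF st0_derivative st_ends(1,2) st_continuous(2), where B = 1 and B' = 30])
     (use st0_bounds st1_bounds in \<open>auto simp: abs_of_nonneg\<close>)
lemma gen_mul1: "gen j x y \<Longrightarrow> gen j (mul st1 t x) (mul st1 t y + cf j t *\<^sub>R mul st2 t x)"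
  unfolding cf_def
  by (rule gen_profile[OF st1_derivative st_ends(3,4) st_continuous(3), where B = 30 and B' = 60])
     (use st1_bounds st2_bound in \<open>auto simp: abs_of_nonneg\<close>)
lemma gen_mulg: "gen j x y \<Longrightarrow> gen j (mul leg t x) (mul leg t y + cf j t *\<^sub>R mul (\<lambda>z. z * st1 z) t x)"
  unfolding cf_def
  by (rule gen_profile[OF leg_derivative _ _ st_continuous(5), where B = 25 and B' = 30])
     (use leg_bound z_st1 in \<open>auto simp: st_ends\<close>)

lemma mul0_time: "0 \<le> t \<Longrightarrow> ((\<lambda>r. mul st0 r x) has_vector_derivative - (1 / (1 + t)) *\<^sub>R mul (\<lambda>z. z * st1 z) t x) (at t)"
  by (rule profile_time_derivative[OF st0_derivative st_ends(1,2) st_continuous(2), where B = 1 and B' = 30])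
     (use st0_bounds z_st1 in \<open>auto simp: abs_of_nonneg\<close>)
lemma mulg_time: "0 \<le> t \<Longrightarrow> ((\<lambda>r. mul leg r x) has_vector_derivative - (1 / (1 + t)) *\<^sub>R mul (\<lambda>z. z * (z * st1 z)) t x) (at t)"
  by (rule profile_time_derivative[OF leg_derivative _ _ st_continuous(5), where B = 25 and B' = 30])
     (use leg_bound zz_st1 in \<open>auto simp: st_ends\<close>)

text \<open>With \<open>p = - I \<partial>\<close>, where \<open>\<partial>\<close> is the derivative in the direction of motion, this is the expectation of
  \<open>H - (v p + p v) / 2 + g\<close>; taking real parts symmetrises \<open>v p\<close> automatically.\<close>

definition K :: "real \<Rightarrow> real" where
  "K t = 1/2 * (\<Sum>j\<in>UNIV. inner (ud j t) (ud j t)) + inner (f t) (Reg h (u t))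
     - inner (mul st0 t (ue t)) (I (u t)) + inner (mul leg t (u t)) (u t)"

text \<open>The moving potential separately, since it is the only explicitly time-dependent part of \<open>H\<close>.\<close>

definition W2 :: "real \<Rightarrow> l2 \<Rightarrow> l2" where "W2 t x = transl 1 (- (\<kappa> * t)) (Mul V2 (transl 1 (\<kappa> * t) x))"

lemma f_eq: "f t = Mul V1 (Reg h (u t)) + W2 t (Reg h (u t))"
  by (simp add: f_def pot_def W2_def)

lemma mul_path:
  assumes m: "\<And>r. bounded_mult (profile \<kappa> F r) B" and d: "\<And>x. ((\<lambda>r. mul F r x) has_vector_derivative D x) (at t)"
    and x: "(x has_vector_derivative x') (at t)"
  shows "((\<lambda>r. mul F r (x r)) has_vector_derivative D (x t) + mul F t x') (at t)"
proof (rule strong_product_rule[where A = "mul F" and C = B, OF linear_Mul[OF m] norm_Mul[OF m] d _ x])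
  show "(\<lambda>r. mul F r x') \<midarrow>t\<rightarrow> mul F t x'"
    using has_vector_derivative_continuous[OF d[of x']] by (simp add: continuous_at)
qed

text \<open>The derivative of the energy as the product rule produces it, term by term in the order of \<open>K\<close>.\<close>

definition D :: "real \<Rightarrow> real" where
  "D t = - inner (Lu t) (u' t) + (2 * inner (f t) (Reg h (u' t)) + 2 * inner (W2 t (Reg h (u t))) (Reg h (ue t)))
    - (inner (mul st0 t (ue t)) (I (u' t))
       + inner (- (1 / (1 + t)) *\<^sub>R mul (\<lambda>z. z * st1 z) t (ue t) + mul st0 t (\<kappa> *\<^sub>R ud' 1 t)) (I (u t)))
    + (inner (mul leg t (u t)) (u' t)
       + inner (- (1 / (1 + t)) *\<^sub>R mul (\<lambda>z. z * (z * st1 z)) t (u t) + mul leg t (u' t)) (u t))"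

text \<open>The moving potential is a translation conjugate of a fixed one, so its time derivative is expressed by
  derivatives of \<open>u\<close> instead of derivatives of \<open>V2\<close>.\<close>

lemma K_derivative: assumes t: "0 \<le> t" shows "(K has_real_derivative D t) (at t)"
proof -
  have ue': "(ue has_vector_derivative \<kappa> *\<^sub>R ud' 1 t) (at t)"
    unfolding ue_def[abs_def] by (rule bounded_linear.has_vector_derivative[OF bounded_linear_scaleR_right ud_derivative])
  have Iu': "((\<lambda>t. I (u t)) has_vector_derivative I (u' t)) (at t)"
    by (rule bounded_linear.has_vector_derivative[OF transl_invD(1)[OF transl_inv_I] u_derivative])
  have kin: "((\<lambda>t. 1/2 * (\<Sum>j\<in>UNIV. inner (ud j t) (ud j t))) has_real_derivative - inner (Lu t) (u' t)) (at t)"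
  proof -
    have "((\<lambda>t. 1/2 * (\<Sum>j\<in>UNIV. inner (ud j t) (ud j t))) has_real_derivative
       1/2 * (\<Sum>j\<in>UNIV. inner (ud j t) (ud' j t) + inner (ud' j t) (ud j t))) (at t)"
      by (intro DERIV_cmult DERIV_sum has_real_derivative_inner ud_derivative)
    moreover have "1/2 * (\<Sum>j\<in>UNIV. inner (ud j t) (ud' j t) + inner (ud' j t) (ud j t)) = - inner (Lu t) (u' t)"
      by (simp add: inner_Lu[OF gen_u'] sum_distrib_left inner_commute)
    ultimately show ?thesis by simp
  qed
  have pot: "((\<lambda>t. inner (f t) (Reg h (u t))) has_real_derivative
     2 * inner (f t) (Reg h (u' t)) + 2 * inner (W2 t (Reg h (u t))) (Reg h (ue t))) (at t)"
  proof -
    have \<phi>: "((\<lambda>t. Reg h (u t)) has_vector_derivative Reg h (u' t)) (at t)"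
      by (rule bounded_linear.has_vector_derivative[OF transl_invD(1)[OF transl_inv_Reg[OF h]] u_derivative])
    define X where "X = transl 1 (\<kappa> * t) (Reg h (ue t) + Reg h (u' t))"
    have T: "((\<lambda>r. transl 1 (\<kappa> * r) (Reg h (u r))) has_vector_derivative X) (at t)"
    proof -
      have "gen 1 (Reg h (u t)) (Reg h (ud 1 t))" by (rule gen_transl_inv[OF transl_inv_Reg[OF h] gen_u])
      from reflect_derivative[OF gen_at[OF this]]
      have d: "((\<lambda>r. transl 1 (\<kappa> * r) (Reg h (u t))) has_vector_derivative \<kappa> *\<^sub>R transl 1 (\<kappa> * t) (Reg h (ud 1 t))) (at t)" .
      have "((\<lambda>r. transl 1 (\<kappa> * r) (Reg h (u r))) has_vector_derivative \<kappa> *\<^sub>R transl 1 (\<kappa> * t) (Reg h (ud 1 t)) + transl 1 (\<kappa> * t) (Reg h (u' t))) (at t)"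
      proof (rule strong_product_rule[where A = "\<lambda>r. transl 1 (\<kappa> * r)" and C = 1, OF linear_transl _ d _ \<phi>])
        have "continuous_on UNIV (\<lambda>r. transl 1 (\<kappa> * r) (Reg h (u' t)))"
          by (rule continuous_on_compose2[OF continuous_transl]) (auto intro: continuous_intros)
        then show "(\<lambda>r. transl 1 (\<kappa> * r) (Reg h (u' t))) \<midarrow>t\<rightarrow> transl 1 (\<kappa> * t) (Reg h (u' t))"
          by (simp add: continuous_on_def)
      qed simp
      then show ?thesis
        by (simp add: X_def linear_add[OF linear_transl] ue_def linear_cmul[OF transl_invD(2)[OF transl_inv_Reg[OF h]]] linear_cmul[OF linear_transl])
    qed
    have "((\<lambda>t. inner (Mul V1 (Reg h (u t))) (Reg h (u t)) + inner (Mul V2 (transl 1 (\<kappa> * t) (Reg h (u t)))) (transl 1 (\<kappa> * t) (Reg h (u t)))) has_real_derivative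
       (inner (Mul V1 (Reg h (u t))) (Reg h (u' t)) + inner (Mul V1 (Reg h (u' t))) (Reg h (u t)))
       + (inner (Mul V2 (transl 1 (\<kappa> * t) (Reg h (u t)))) X + inner (Mul V2 X) (transl 1 (\<kappa> * t) (Reg h (u t))))) (at t)"
      by (intro DERIV_add has_real_derivative_inner \<phi> T
          bounded_linear.has_vector_derivative[OF bounded_linear_Mul[OF V1]] bounded_linear.has_vector_derivative[OF bounded_linear_Mul[OF V2]])
    moreover have "inner (Mul V1 (Reg h (u s))) (Reg h (u s)) + inner (Mul V2 (transl 1 (\<kappa> * s) (Reg h (u s)))) (transl 1 (\<kappa> * s) (Reg h (u s)))
        = inner (f s) (Reg h (u s))" for s
      by (simp add: f_eq W2_def inner_add_left inner_transl_left)
    moreover have "inner (Mul V1 (Reg h (u' t))) (Reg h (u t)) = inner (Mul V1 (Reg h (u t))) (Reg h (u' t))"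
      by (simp add: inner_Mul_left[OF V1] inner_commute)
    moreover have "inner (Mul V2 X) (transl 1 (\<kappa> * t) (Reg h (u t))) = inner (Mul V2 (transl 1 (\<kappa> * t) (Reg h (u t)))) X"
      by (simp add: inner_Mul_left[OF V2] inner_commute)
    moreover have "inner (Mul V2 (transl 1 (\<kappa> * t) (Reg h (u t)))) X = inner (W2 t (Reg h (u t))) (Reg h (ue t)) + inner (W2 t (Reg h (u t))) (Reg h (u' t))"
      by (simp add: X_def W2_def inner_transl_left inner_add_right linear_add[OF linear_transl])
    ultimately show ?thesis by (simp add: f_eq inner_add_left algebra_simps)
  qed
  have v: "((\<lambda>t. inner (mul st0 t (ue t)) (I (u t))) has_real_derivative
     inner (mul st0 t (ue t)) (I (u' t))
       + inner (- (1 / (1 + t)) *\<^sub>R mul (\<lambda>z. z * st1 z) t (ue t) + mul st0 t (\<kappa> *\<^sub>R ud' 1 t)) (I (u t))) (at t)"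
    by (rule has_real_derivative_inner[OF mul_path[OF b0 mul0_time[OF t] ue'] Iu'])
  have g: "((\<lambda>t. inner (mul leg t (u t)) (u t)) has_real_derivative
     inner (mul leg t (u t)) (u' t)
       + inner (- (1 / (1 + t)) *\<^sub>R mul (\<lambda>z. z * (z * st1 z)) t (u t) + mul leg t (u' t)) (u t)) (at t)"
    by (rule has_real_derivative_inner[OF mul_path[OF bg mulg_time[OF t] u_derivative] u_derivative])
  show ?thesis unfolding K_def[abs_def] D_def
    by (intro DERIV_add DERIV_diff kin pot v g)
qed


subsection \<open>The sign of the free part of the energy derivative\<close>

lemma sum_cf: "(\<Sum>j\<in>UNIV. cf j t * X j) = cf 1 t * X 1"
proof -
  have "(\<Sum>j\<in>UNIV. cf j t * X j) = (\<Sum>j\<in>(UNIV::3 set). if j = 1 then cf 1 t * X 1 else 0)"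
    by (rule sum.cong) (auto simp: cf_def)
  then show ?thesis by simp
qed

lemma cf_ud: "cf 1 t * inner (ud 1 t) x = (1 / (1 + t)) * inner (ue t) x"
  by (simp add: cf_def ue_def)

lemma gen_ue: "gen j (ue t) (\<kappa> *\<^sub>R udd j t)"
  unfolding ue_def by (rule gen_scaleR[OF gen_udd(2)])

lemma u'_mul: "bounded_mult (profile \<kappa> F t) B \<Longrightarrow> inner (u' t) (mul F t (I x)) = - inner (H t) (mul F t x)"
  by (simp add: u'_def Mul_I inner_I_I)

lemma inner_Mul_I: assumes "bounded_mult m B" shows "inner (Mul m x) (I x) = 0"
proof -
  have "inner (Mul m x) (I x) = inner (I (Mul m x)) x"
    using inner_Mul_left[OF assms, of x "I x"] Mul_I[OF assms, of x] by (simp add: inner_commute)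
  then show ?thesis using inner_I_left[of "Mul m x" x] by simp
qed

lemma kappa_cf: "\<kappa> * cf 1 t = 1 / (1 + t)"
  by (simp add: cf_def \<kappa>2)

text \<open>Integration by parts moves the derivative off \<open>ud'\<close>; the divergence of the velocity field is the second term.\<close>

lemma velocity_term:
  "inner (mul st0 t (ue t)) (I (u' t)) + inner (mul st0 t (\<kappa> *\<^sub>R ud' 1 t)) (I (u t))
     = 2 * inner (H t) (mul st0 t (ue t)) + (1 / (1 + t)) * inner (H t) (mul st1 t (u t))"
proof -
  have "inner (ud' 1 t) (mul st0 t (I (u t))) = - inner (u' t) (mul st0 t (I (ud 1 t)) + cf 1 t *\<^sub>R mul st1 t (I (u t)))"
    by (rule gen_antisymmetric[OF gen_u' gen_mul0[OF gen_I[OF gen_u]]])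
  also have "\<dots> = inner (H t) (mul st0 t (ud 1 t)) + cf 1 t * inner (H t) (mul st1 t (u t))"
    by (simp add: inner_add_right u'_mul[OF b0] u'_mul[OF b1])
  finally have 1: "inner (ud' 1 t) (mul st0 t (I (u t))) = inner (H t) (mul st0 t (ud 1 t)) + cf 1 t * inner (H t) (mul st1 t (u t))" .
  have "inner (mul st0 t (\<kappa> *\<^sub>R ud' 1 t)) (I (u t)) = \<kappa> * inner (ud' 1 t) (mul st0 t (I (u t)))"
    by (simp add: Mul_scaleR[OF b0] inner_Mul_left[OF b0])
  also have "\<dots> = inner (H t) (mul st0 t (ue t)) + (\<kappa> * cf 1 t) * inner (H t) (mul st1 t (u t))"
    by (simp add: 1 ue_def Mul_scaleR[OF b0] algebra_simps)
  finally have 2: "inner (mul st0 t (\<kappa> *\<^sub>R ud' 1 t)) (I (u t)) = inner (H t) (mul st0 t (ue t)) + (1 / (1 + t)) * inner (H t) (mul st1 t (u t))"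
    by (simp only: kappa_cf)
  have "inner (mul st0 t (ue t)) (I (u' t)) = - inner (u' t) (mul st0 t (I (ue t)))"
    using inner_I_left[of "mul st0 t (ue t)" "u' t"] by (simp add: Mul_I[OF b0] inner_commute)
  then have "inner (mul st0 t (ue t)) (I (u' t)) = inner (H t) (mul st0 t (ue t))"
    by (simp add: u'_mul[OF b0])
  with 2 show ?thesis by simp
qed

text \<open>The commutator of \<open>p\<^sup>2 / 2\<close> with the velocity field: its principal part is \<open>p v' p / (1 + t)\<close>. The terms
  collected in \<open>q\<close>, with \<open>v'\<close> between the full gradients, cancel between the two contributions of the symmetrised
  field, and besides the principal part only a term with two factors \<open>1 / (1 + t)\<close> remains.\<close>

lemma kinetic_term:
  "- (1/2) * (2 * inner (Lu t) (mul st0 t (ue t)) + (1 / (1 + t)) * inner (Lu t) (mul st1 t (u t)))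
     = (1 / (1 + t)) * inner (ue t) (mul st1 t (ue t)) + 1/2 * (1 / (1 + t))\<^sup>2 * inner (ue t) (mul st2 t (u t))"
proof -
  define k where "k = 1 / (1 + t)"
  define q where "q = (\<Sum>j\<in>UNIV. inner (ud j t) (mul st1 t (ud j t)))"
  have A: "inner (ud j t) (mul st0 t (\<kappa> *\<^sub>R udd j t)) = - (1/2) * k * inner (ud j t) (mul st1 t (ud j t))" for j
  proof -
    have "inner (udd j t) (mul st0 t (ud j t)) = - inner (ud j t) (mul st0 t (udd j t) + cf 1 t *\<^sub>R mul st1 t (ud j t))"
      by (rule gen_antisymmetric[OF gen_udd(1) gen_mul0[OF gen_udd(1)]])
    moreover have "inner (udd j t) (mul st0 t (ud j t)) = inner (ud j t) (mul st0 t (udd j t))"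
      using inner_Mul_left[OF b0, of t "udd j t" "ud j t"] by (simp add: inner_commute)
    ultimately have "2 * inner (ud j t) (mul st0 t (udd j t)) = - cf 1 t * inner (ud j t) (mul st1 t (ud j t))"
      by (simp add: inner_add_right)
    then have "\<kappa> * (2 * inner (ud j t) (mul st0 t (udd j t))) = - (\<kappa> * cf 1 t) * inner (ud j t) (mul st1 t (ud j t))"
      by simp
    then have "2 * (\<kappa> * inner (ud j t) (mul st0 t (udd j t))) = - k * inner (ud j t) (mul st1 t (ud j t))"
      unfolding kappa_cf k_def[symmetric] by (simp only: mult.left_commute)
    then have "\<kappa> * inner (ud j t) (mul st0 t (udd j t)) = - (1/2) * k * inner (ud j t) (mul st1 t (ud j t))"
      by simp
    then show ?thesis by (simp only: Mul_scaleR[OF b0] inner_scaleR_right)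
  qed
  have "inner (Lu t) (mul st0 t (ue t)) = - (\<Sum>j\<in>UNIV. inner (ud j t) (mul st0 t (\<kappa> *\<^sub>R udd j t) + cf j t *\<^sub>R mul st1 t (ue t)))"
    by (rule inner_Lu) (rule gen_mul0[OF gen_ue])
  also have "\<dots> = - (\<Sum>j\<in>UNIV. - (1/2) * k * inner (ud j t) (mul st1 t (ud j t)) + cf j t * inner (ud j t) (mul st1 t (ue t)))"
    by (simp only: inner_add_right A inner_scaleR_right)
  also have "\<dots> = 1/2 * k * q - k * inner (ue t) (mul st1 t (ue t))"
    unfolding sum.distrib sum_cf cf_ud by (simp add: q_def sum_distrib_left k_def sum_negf)
  finally have 1: "inner (Lu t) (mul st0 t (ue t)) = 1/2 * k * q - k * inner (ue t) (mul st1 t (ue t))" .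
  have "inner (Lu t) (mul st1 t (u t)) = - (\<Sum>j\<in>UNIV. inner (ud j t) (mul st1 t (ud j t) + cf j t *\<^sub>R mul st2 t (u t)))"
    by (rule inner_Lu) (rule gen_mul1[OF gen_u])
  also have "\<dots> = - (\<Sum>j\<in>UNIV. inner (ud j t) (mul st1 t (ud j t)) + cf j t * inner (ud j t) (mul st2 t (u t)))"
    by (simp only: inner_add_right inner_scaleR_right)
  also have "\<dots> = - q - k * inner (ue t) (mul st2 t (u t))"
    unfolding sum.distrib sum_cf cf_ud by (simp add: q_def k_def)
  finally have 2: "inner (Lu t) (mul st1 t (u t)) = - q - k * inner (ue t) (mul st2 t (u t))" .
  show ?thesis unfolding 1 2 k_def[symmetric] by (simp add: algebra_simps power2_eq_square)
qed

text \<open>The commutator of \<open>p\<^sup>2 / 2\<close> with \<open>g\<close> is the mixed term \<open>z v' p / (1 + t)\<close>.\<close>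

lemma legendre_term:
  "inner (mul leg t (u t)) (u' t) + inner (mul leg t (u' t)) (u t)
     = (1 / (1 + t)) * inner (ue t) (mul (\<lambda>z. z * st1 z) t (I (u t))) - 2 * inner (mul leg t (u t)) (I (Reg h (f t)))"
proof -
  have "inner (mul leg t (u' t)) (u t) = inner (mul leg t (u t)) (u' t)"
    using inner_Mul_left[OF bg, of t "u' t" "u t"] by (simp add: inner_commute)
  moreover have "u' t = (1/2) *\<^sub>R I (Lu t) - I (Reg h (f t))"
    by (simp add: u'_def H_def linear_add[OF linear_I] linear_diff[OF linear_I] linear_cmul[OF linear_I] linear_neg[OF linear_I])
  ultimately have 1: "inner (mul leg t (u t)) (u' t) + inner (mul leg t (u' t)) (u t)
     = inner (mul leg t (u t)) (I (Lu t)) - 2 * inner (mul leg t (u t)) (I (Reg h (f t)))"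
    by (simp add: inner_diff_right)
  have "inner (mul leg t (u t)) (I (Lu t)) = - inner (Lu t) (mul leg t (I (u t)))"
    using inner_I_left[of "mul leg t (u t)" "Lu t"] by (simp add: Mul_I[OF bg] inner_commute)
  also have "\<dots> = (\<Sum>j\<in>UNIV. inner (ud j t) (mul leg t (I (ud j t)) + cf j t *\<^sub>R mul (\<lambda>z. z * st1 z) t (I (u t))))"
    using inner_Lu[OF gen_mulg[OF gen_I[OF gen_u]], of t t t] by simp
  also have "\<dots> = (\<Sum>j\<in>UNIV. cf j t * inner (ud j t) (mul (\<lambda>z. z * st1 z) t (I (u t))))"
  proof (rule sum.cong[OF refl])
    fix j :: 3
    have "inner (ud j t) (mul leg t (I (ud j t))) = 0"
      using inner_Mul_I[OF bg, of t "ud j t"] inner_Mul_left[OF bg, of t "ud j t" "I (ud j t)"] by simp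
    then show "inner (ud j t) (mul leg t (I (ud j t)) + cf j t *\<^sub>R mul (\<lambda>z. z * st1 z) t (I (u t)))
        = cf j t * inner (ud j t) (mul (\<lambda>z. z * st1 z) t (I (u t)))"
      by (simp add: inner_add_right)
  qed
  also have "\<dots> = (1 / (1 + t)) * inner (ue t) (mul (\<lambda>z. z * st1 z) t (I (u t)))"
    unfolding sum_cf cf_ud ..
  finally show ?thesis using 1 by simp
qed

text \<open>The quadratic form \<open>(p - z) v' (p - z)\<close> is nonnegative because \<open>v\<close> is nondecreasing. It vanishes on particles
  moving freely from the origin, for which \<open>p = z\<close>.\<close>

lemma square_term:
  "0 \<le> inner (ue t) (mul st1 t (ue t)) - 2 * inner (ue t) (mul (\<lambda>z. z * st1 z) t (I (u t)))
      + inner (mul (\<lambda>z. z * (z * st1 z)) t (u t)) (u t)"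
proof -
  let ?c = "mul (\<lambda>z. z) t (I (u t))"
  have m1: "mul st1 t ?c = mul (\<lambda>z. z * st1 z) t (I (u t))"
  proof -
    have "(\<lambda>x. profile \<kappa> st1 t x * profile \<kappa> (\<lambda>z. z) t x) = profile \<kappa> (\<lambda>z. z * st1 z) t"
      by (rule ext) (simp add: profile_def)
    then show ?thesis by (simp only: Mul_Mul[OF b1 bc])
  qed
  have m2: "mul (\<lambda>z. z) t (mul st1 t ?c) = mul (\<lambda>z. z * (z * st1 z)) t (I (u t))"
  proof -
    have "(\<lambda>x. profile \<kappa> (\<lambda>z. z) t x * profile \<kappa> (\<lambda>z. z * st1 z) t x) = profile \<kappa> (\<lambda>z. z * (z * st1 z)) t"
      by (rule ext) (simp add: profile_def)
    then show ?thesis unfolding m1 by (simp only: Mul_Mul[OF bc bc1])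
  qed
  have "0 \<le> inner (mul st1 t (ue t - ?c)) (ue t - ?c)"
    by (rule inner_Mul_nonneg[OF b1]) (auto simp: profile_def intro!: st1_bounds clamp_bounds)
  also have "\<dots> = inner (mul st1 t (ue t)) (ue t) - inner (mul st1 t (ue t)) ?c - inner (mul st1 t ?c) (ue t) + inner (mul st1 t ?c) ?c"
    by (simp add: linear_diff[OF linear_Mul[OF b1]] inner_diff_left inner_diff_right)
  also have "inner (mul st1 t (ue t)) (ue t) = inner (ue t) (mul st1 t (ue t))" by (rule inner_commute)
  also have "inner (mul st1 t (ue t)) ?c = inner (ue t) (mul (\<lambda>z. z * st1 z) t (I (u t)))"
    by (simp add: inner_Mul_left[OF b1] m1)
  also have "inner (mul st1 t ?c) (ue t) = inner (ue t) (mul (\<lambda>z. z * st1 z) t (I (u t)))"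
    unfolding m1 by (rule inner_commute)
  also have "inner (mul st1 t ?c) ?c = inner (mul (\<lambda>z. z) t (mul st1 t ?c)) (I (u t))"
    by (rule inner_Mul_left[OF bc, symmetric])
  also have "\<dots> = inner (mul (\<lambda>z. z * (z * st1 z)) t (u t)) (u t)"
    unfolding m2 Mul_I[OF bcc1] by (rule inner_I_I)
  finally show ?thesis by simp
qed

text \<open>The free part of the derivative is \<open>-1 / (1 + t)\<close> times the preceding square plus the term with \<open>v''\<close>: the cross
  terms come in equal parts from the time derivative of \<open>v\<close> and from the commutator with \<open>g\<close>, the term with
  \<open>z\<^sup>2 v'\<close> from the time derivative of \<open>g\<close>.\<close>

lemma D_le:
  assumes t: "0 \<le> t"
  shows "D t \<le> 2 * inner (W2 t (Reg h (u t))) (Reg h (ue t)) - 1/2 * (1 / (1 + t))\<^sup>2 * inner (ue t) (mul st2 t (u t))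
     - 2 * inner (Reg h (f t)) (mul st0 t (ue t)) - (1 / (1 + t)) * inner (Reg h (f t)) (mul st1 t (u t))
     - 2 * inner (mul leg t (u t)) (I (Reg h (f t)))"
proof -
  define k where "k = 1 / (1 + t)"
  have k0: "0 \<le> k" using t by (simp add: k_def)
  define c where "c = inner (ue t) (mul (\<lambda>z. z * st1 z) t (I (u t)))"
  define a1 where "a1 = inner (ue t) (mul st1 t (ue t))"
  define a2 where "a2 = inner (ue t) (mul st2 t (u t))"
  define d where "d = inner (mul (\<lambda>z. z * (z * st1 z)) t (u t)) (u t)"
  define fA where "fA = inner (Reg h (f t)) (mul st0 t (ue t))"
  define fB where "fB = inner (Reg h (f t)) (mul st1 t (u t))"
  define gf where "gf = inner (mul leg t (u t)) (I (Reg h (f t)))"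
  define P where "P = inner (W2 t (Reg h (u t))) (Reg h (ue t))"
  have F1: "- inner (Lu t) (u' t) + 2 * inner (f t) (Reg h (u' t)) = 0"
  proof -
    have "- inner (Lu t) (u' t) + 2 * inner (f t) (Reg h (u' t)) = 2 * inner (H t) (u' t)"
      by (simp add: inner_Reg[OF h, symmetric] H_def inner_add_left inner_diff_left)
    then show ?thesis by (simp add: u'_def inner_I_self)
  qed
  have HX: "inner (H t) x = - (1/2) * inner (Lu t) x + inner (Reg h (f t)) x" for x
    by (simp add: H_def inner_add_left inner_diff_left)
  have X: "inner (mul st0 t (ue t)) (I (u' t)) + inner (mul st0 t (\<kappa> *\<^sub>R ud' 1 t)) (I (u t)) = k * a1 + 1/2 * k\<^sup>2 * a2 + 2 * fA + k * fB"
    using kinetic_term[of t] unfolding velocity_term HX k_def[symmetric] a1_def a2_def fA_def fB_def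
    by (simp add: algebra_simps)
  have Y: "inner (- (1 / (1 + t)) *\<^sub>R mul (\<lambda>z. z * st1 z) t (ue t)) (I (u t)) = - k * c"
    by (simp add: k_def c_def inner_Mul_left[OF bc1])
  have G: "inner (mul leg t (u t)) (u' t) + inner (mul leg t (u' t)) (u t) = k * c - 2 * gf"
    unfolding legendre_term k_def c_def gf_def ..
  have Z: "inner (- (1 / (1 + t)) *\<^sub>R mul (\<lambda>z. z * (z * st1 z)) t (u t)) (u t) = - k * d"
    by (simp add: k_def d_def)
  have "D t = 2 * P - (- k * c + (k * a1 + 1/2 * k\<^sup>2 * a2 + 2 * fA + k * fB)) + (- k * d + (k * c - 2 * gf))"
    using F1 X Y G Z unfolding D_def P_def inner_add_left by linarith
  moreover have "0 \<le> k * (a1 - 2 * c + d)"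
    using square_term[of t] k0 by (intro mult_nonneg_nonneg) (auto simp: a1_def c_def d_def)
  ultimately have "D t \<le> 2 * P - 1/2 * k\<^sup>2 * a2 - 2 * fA - k * fB - 2 * gf"
    by (simp add: algebra_simps)
  then show ?thesis by (simp only: P_def k_def a2_def fA_def fB_def gf_def)
qed

subsection \<open>Decay of the potential terms\<close>

definition V2t :: "real \<Rightarrow> real^3 \<Rightarrow> real" where "V2t t x = V2 (x - (\<kappa> * t) *\<^sub>R axis 1 1)"

lemma bV2t: "bounded_mult (V2t t) M"
  using bounded_mult_shift[OF V2, of "- ((\<kappa> * t) *\<^sub>R axis 1 1)"] by (simp add: V2t_def[abs_def])

lemma W2_Mul: "W2 t x = Mul (V2t t) x"
  by (simp add: W2_def transl_def shift_Mul[OF V2] shift_shift V2t_def[abs_def])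

lemma clamp_le: "clamp y \<le> \<bar>y\<bar>" "1 - clamp y \<le> \<bar>1 - y\<bar>" by (auto simp: clamp_def)

text \<open>The truncation \<open>clamp z\<close> is at most \<open>norm x / (1 + t)\<close>: quadratic vanishing of the
  profile meets quadratic decay of the potential.\<close>

lemma decay_at_rest:
  assumes t: "0 \<le> t" shows "(clamp (\<kappa> / (1 + t) * x $ 1))\<^sup>2 * \<bar>V1 x\<bar> \<le> M * (1 / (1 + t))\<^sup>2"
proof -
  have "clamp (\<kappa> / (1 + t) * x $ 1) \<le> (1 / (1 + t)) * (1 + norm x)"
  proof -
    have "clamp (\<kappa> / (1 + t) * x $ 1) \<le> \<bar>\<kappa> / (1 + t) * x $ 1\<bar>" by (rule clamp_le)
    also have "\<dots> = (1 / (1 + t)) * \<bar>x $ 1\<bar>" using \<kappa>2(2) t by (simp add: abs_mult abs_divide)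
    also have "\<dots> \<le> (1 / (1 + t)) * (1 + norm x)"
      using t component_le_norm_cart[of x 1] by (intro mult_left_mono) auto
    finally show ?thesis .
  qed
  then have "(clamp (\<kappa> / (1 + t) * x $ 1))\<^sup>2 \<le> ((1 / (1 + t)) * (1 + norm x))\<^sup>2"
    by (intro power_mono clamp_bounds)
  then have "(clamp (\<kappa> / (1 + t) * x $ 1))\<^sup>2 * \<bar>V1 x\<bar> \<le> ((1 / (1 + t)) * (1 + norm x))\<^sup>2 * \<bar>V1 x\<bar>"
    by (intro mult_right_mono) auto
  also have "\<dots> = (1 / (1 + t))\<^sup>2 * ((1 + norm x)\<^sup>2 * \<bar>V1 x\<bar>)" by (simp only: power_mult_distrib mult.assoc)
  also have "\<dots> \<le> (1 / (1 + t))\<^sup>2 * M" by (intro mult_left_mono decay1) auto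
  finally show ?thesis by (simp only: mult.commute)
qed

text \<open>In the frame of the moving potential \<open>1 - z = (1 + t - \<kappa> x\<^sub>1) / (1 + t)\<close> and
  \<open>\<bar>1 + t - \<kappa> x\<^sub>1\<bar> \<le> 1 + norm (x - \<kappa> t e\<^sub>1)\<close>. The summand 1 comes from starting the clock at 1.\<close>

lemma decay_moving:
  assumes t: "0 \<le> t" shows "(1 - clamp (\<kappa> / (1 + t) * x $ 1))\<^sup>2 * \<bar>V2t t x\<bar> \<le> M * (1 / (1 + t))\<^sup>2"
proof -
  define y where "y = x - (\<kappa> * t) *\<^sub>R axis 1 (1::real)"
  have "1 - clamp (\<kappa> / (1 + t) * x $ 1) \<le> (1 / (1 + t)) * (1 + norm y)"
  proof -
    have y1: "y $ 1 = x $ 1 - \<kappa> * t" by (simp add: y_def axis_component)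
    have "1 - clamp (\<kappa> / (1 + t) * x $ 1) \<le> \<bar>1 - \<kappa> / (1 + t) * x $ 1\<bar>" by (rule clamp_le)
    also have "1 - \<kappa> / (1 + t) * x $ 1 = (1 / (1 + t)) * (1 - \<kappa> * y $ 1)"
      unfolding y1 using t \<kappa> by (auto simp: field_simps)
    also have "\<bar>(1 / (1 + t)) * (1 - \<kappa> * y $ 1)\<bar> = (1 / (1 + t)) * \<bar>1 - \<kappa> * y $ 1\<bar>" using t by (simp add: abs_mult)
    also have "\<dots> \<le> (1 / (1 + t)) * (1 + norm y)"
    proof (rule mult_left_mono)
      have "\<bar>\<kappa> * y $ 1\<bar> \<le> norm y" using component_le_norm_cart[of y 1] \<kappa>2(2) by (simp add: abs_mult)
      then show "\<bar>1 - \<kappa> * y $ 1\<bar> \<le> 1 + norm y" by linarith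
    qed (use t in simp)
    finally show ?thesis .
  qed
  then have "(1 - clamp (\<kappa> / (1 + t) * x $ 1))\<^sup>2 \<le> ((1 / (1 + t)) * (1 + norm y))\<^sup>2"
    using clamp_bounds(2) by (intro power_mono) auto
  then have "(1 - clamp (\<kappa> / (1 + t) * x $ 1))\<^sup>2 * \<bar>V2 y\<bar> \<le> ((1 / (1 + t)) * (1 + norm y))\<^sup>2 * \<bar>V2 y\<bar>"
    by (intro mult_right_mono) auto
  also have "\<dots> = (1 / (1 + t))\<^sup>2 * ((1 + norm y)\<^sup>2 * \<bar>V2 y\<bar>)" by (simp only: power_mult_distrib mult.assoc)
  also have "\<dots> \<le> (1 / (1 + t))\<^sup>2 * M" by (intro mult_left_mono decay2) auto
  finally show ?thesis by (simp only: mult.commute V2t_def y_def)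
qed

lemma bounded_mult_tighten: "bounded_mult m B \<Longrightarrow> (\<And>x. \<bar>m x\<bar> \<le> B') \<Longrightarrow> bounded_mult m B'" by (simp add: bounded_mult_def)

lemma product_bound: "\<bar>a\<bar> \<le> c * q \<Longrightarrow> q * \<bar>v\<bar> \<le> e \<Longrightarrow> 0 \<le> c \<Longrightarrow> \<bar>a * v\<bar> \<le> c * e" for a c q v e :: real
proof -
  assume a: "\<bar>a\<bar> \<le> c * q" "q * \<bar>v\<bar> \<le> e" "0 \<le> c"
  have "\<bar>a * v\<bar> \<le> (c * q) * \<bar>v\<bar>" unfolding abs_mult by (rule mult_right_mono[OF a(1)]) simp
  also have "\<dots> \<le> c * e" unfolding mult.assoc by (rule mult_left_mono[OF a(2,3)])
  finally show ?thesis .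
qed

lemma small_multipliers:
  assumes t: "0 \<le> t"
  defines "k \<equiv> 1 / (1 + t)"
  shows "bounded_mult (\<lambda>x. profile \<kappa> st0 t x * V1 x) (10 * (M * k\<^sup>2))" (is ?a)
    "bounded_mult (\<lambda>x. V2t t x - profile \<kappa> st0 t x * V2t t x) (10 * (M * k\<^sup>2))" (is ?b)
    "bounded_mult (\<lambda>x. profile \<kappa> st1 t x * V1 x) (30 * (M * k\<^sup>2))" (is ?c)
    "bounded_mult (\<lambda>x. profile \<kappa> st1 t x * V2t t x) (30 * (M * k\<^sup>2))" (is ?d)
proof -
  note cb = clamp_bounds
  show ?a
  proof (rule bounded_mult_tighten[OF bounded_mult_mult[OF b0 V1]])
    show "\<bar>profile \<kappa> st0 t x * V1 x\<bar> \<le> 10 * (M * k\<^sup>2)" for x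
      by (rule product_bound[OF _ decay_at_rest[OF t, of x, folded k_def]])
        (use st0_bounds[OF cb, of "\<kappa> / (1 + t) * x $ 1"] in \<open>auto simp: profile_def\<close>)
  qed
  show ?c
  proof (rule bounded_mult_tighten[OF bounded_mult_mult[OF b1 V1]])
    show "\<bar>profile \<kappa> st1 t x * V1 x\<bar> \<le> 30 * (M * k\<^sup>2)" for x
      by (rule product_bound[OF _ decay_at_rest[OF t, of x, folded k_def]])
        (use st1_bounds[OF cb, of "\<kappa> / (1 + t) * x $ 1"] in \<open>auto simp: profile_def\<close>)
  qed
  show ?d
  proof (rule bounded_mult_tighten[OF bounded_mult_mult[OF b1 bV2t]])
    show "\<bar>profile \<kappa> st1 t x * V2t t x\<bar> \<le> 30 * (M * k\<^sup>2)" for x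
      by (rule product_bound[OF _ decay_moving[OF t, of x, folded k_def]])
        (use st1_bounds[OF cb, of "\<kappa> / (1 + t) * x $ 1"] in \<open>auto simp: profile_def\<close>)
  qed
  show ?b
  proof (rule bounded_mult_tighten[OF bounded_mult_diff[OF bV2t bounded_mult_mult[OF b0 bV2t]]])
    fix x
    have "\<bar>(1 - profile \<kappa> st0 t x) * V2t t x\<bar> \<le> 10 * (M * k\<^sup>2)"
      by (rule product_bound[OF _ decay_moving[OF t, of x, folded k_def]])
        (use st0_bounds[OF cb, of "\<kappa> / (1 + t) * x $ 1"] in \<open>auto simp: profile_def\<close>)
    then show "\<bar>V2t t x - profile \<kappa> st0 t x * V2t t x\<bar> \<le> 10 * (M * k\<^sup>2)" by (simp add: algebra_simps)
  qed
qed

definition N :: "real \<Rightarrow> real" where "N t = (norm (u t))\<^sup>2 + (\<Sum>j\<in>UNIV. (norm (ud j t))\<^sup>2)"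

lemma norm_ue: "norm (ue t) = norm (ud 1 t)" using \<kappa>2(2) by (simp add: ue_def)

lemma N_bounds: "norm (u t) * norm (ue t) \<le> N t" "norm (u t) * norm (u t) \<le> N t" "0 \<le> N t"
  "(norm (ue t))\<^sup>2 \<le> (\<Sum>j\<in>UNIV. (norm (ud j t))\<^sup>2)"
proof -
  show e: "(norm (ue t))\<^sup>2 \<le> (\<Sum>j\<in>UNIV. (norm (ud j t))\<^sup>2)"
    unfolding norm_ue by (rule member_le_sum[of 1 UNIV "\<lambda>j. (norm (ud j t))\<^sup>2"]) auto
  have s: "0 \<le> (\<Sum>j\<in>(UNIV::3 set). (norm (ud j t))\<^sup>2)" by (rule sum_nonneg) simp
  show "0 \<le> N t" using s by (simp add: N_def)
  show "norm (u t) * norm (u t) \<le> N t" using s by (simp add: N_def power2_eq_square)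
  have "2 * (norm (u t) * norm (ue t)) \<le> (norm (u t))\<^sup>2 + (norm (ue t))\<^sup>2"
    using sum_squares_bound[of "norm (u t)" "norm (ue t)"] by (simp add: mult.assoc)
  moreover have "0 \<le> norm (u t) * norm (ue t)" by simp
  ultimately show "norm (u t) * norm (ue t) \<le> N t" using e unfolding N_def by linarith
qed

lemma norm_f: "norm (f t) \<le> 2 * M * norm (u t)"
proof -
  have "norm (f t) \<le> 2 * M * norm (Reg h (u t))"
    unfolding f_def by (rule admissibleD(3)[OF admissible_pot[OF V1 V2 M]])
  also have "\<dots> \<le> 2 * M * norm (u t)" using M norm_Reg[OF h] by (intro mult_left_mono) auto
  finally show ?thesis .
qed

lemma f_error: assumes "norm e \<le> b * norm x" "0 \<le> b" shows "\<bar>inner (f t) e\<bar> \<le> 2 * M * b * (norm (u t) * norm x)"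
proof -
  have "\<bar>inner (f t) e\<bar> \<le> norm (f t) * norm e" by (rule Cauchy_Schwarz_ineq2)
  also have "\<dots> \<le> (2 * M * norm (u t)) * (b * norm x)" using M assms by (intro mult_mono norm_f) auto
  finally show ?thesis by (simp add: mult_ac)
qed

text \<open>Every potential term carries either two factors \<open>1 / (1 + t)\<close>, by decay, or a factor \<open>h\<close>, from commuting the
  profile with the smoothing.\<close>

lemma D_bound:
  assumes t: "0 \<le> t" shows "D t \<le> (30 + 3240 * M) * ((1 / (1 + t))\<^sup>2 + h) * N t"
proof -
  define k where "k = 1 / (1 + t)"
  have k: "0 \<le> k" "k \<le> 1" using t by (auto simp: k_def)
  define \<phi> where "\<phi> = Reg h (u t)"
  define \<psi> where "\<psi> = Reg h (ue t)"
  have n\<phi>: "norm \<phi> \<le> norm (u t)" and n\<psi>: "norm \<psi> \<le> norm (ue t)"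
    by (auto simp: \<phi>_def \<psi>_def norm_Reg[OF h])
  have feq: "f t = Mul V1 \<phi> + Mul (V2t t) \<phi>" by (simp add: f_eq W2_Mul \<phi>_def)
  have nn: "norm \<phi> * norm \<psi> \<le> N t" "norm \<phi> * norm \<phi> \<le> N t"
    using mult_mono[OF n\<phi> n\<psi>] mult_mono[OF n\<phi> n\<phi>] N_bounds[of t] by auto
  have bound: "\<bar>inner (Mul m x) y\<bar> \<le> B * N t" if "bounded_mult m B" "norm x * norm y \<le> N t" for m B x y
    using inner_bound[OF that(1), of x y] mult_left_mono[OF that(2) bounded_mult_bound_nonneg[OF that(1)]] by linarith
  have comm: "norm (Reg h (Mul (profile \<kappa> F t) x) - mul F t (Reg h x)) \<le> 9 * (L * h * norm x)"
    if "bounded_mult (profile \<kappa> F t) B" "\<And>z. (F has_real_derivative F' z) (at z)" "F' 0 = 0" "F' 1 = 0"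
      "\<And>z. 0 \<le> z \<Longrightarrow> z \<le> 1 \<Longrightarrow> \<bar>F' z\<bar> \<le> L" for F F' L B x
  proof (rule Reg_Mul_commutator[OF that(1) _ _ h])
    show "\<bar>profile \<kappa> F t (y + r *\<^sub>R axis i 1) - profile \<kappa> F t y\<bar> \<le> L * \<bar>r\<bar>" for i y r
      by (rule profile_Lipschitz[OF that(2-5) \<kappa>2(2) t])
    show "0 \<le> L" using that(5)[of 0] abs_ge_zero order_trans by fastforce
  qed
  \<comment> \<open>the term with \<open>v''\<close>, which decays quadratically by itself\<close>
  have T1: "\<bar>1/2 * k\<^sup>2 * inner (ue t) (mul st2 t (u t))\<bar> \<le> 30 * k\<^sup>2 * N t"
  proof -
    have "\<bar>inner (mul st2 t (u t)) (ue t)\<bar> \<le> 60 * N t" by (rule bound[OF b2 N_bounds(1)])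
    then have "k\<^sup>2 * \<bar>inner (ue t) (mul st2 t (u t))\<bar> \<le> k\<^sup>2 * (60 * N t)"
      by (intro mult_left_mono) (auto simp: inner_commute)
    then show ?thesis by (simp add: abs_mult)
  qed
  \<comment> \<open>potentials against the velocity field: up to the commutator \<open>e1\<close> only the first potential keeps the
    factor \<open>v\<close>, and the second keeps \<open>1 - v\<close> once the time derivative of the moving potential is subtracted\<close>
  define e1 where "e1 = Reg h (mul st0 t (ue t)) - mul st0 t \<psi>"
  have e1: "\<bar>inner (f t) e1\<bar> \<le> 540 * M * h * N t"
  proof -
    have "norm e1 \<le> 270 * h * norm (ue t)"
      using comm[OF b0 st0_derivative st_ends(1,2), of 30 "ue t"] st1_bounds by (simp add: e1_def \<psi>_def)
    from f_error[OF this] have "\<bar>inner (f t) e1\<bar> \<le> 540 * M * h * (norm (u t) * norm (ue t))" using h by (simp add: mult_ac)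
    also have "\<dots> \<le> 540 * M * h * N t" using M h by (intro mult_left_mono N_bounds) auto
    finally show ?thesis .
  qed
  have fA: "inner (Reg h (f t)) (mul st0 t (ue t)) = inner (Mul (\<lambda>x. profile \<kappa> st0 t x * V1 x) \<phi>) \<psi>
      + inner (Mul (V2t t) \<phi>) \<psi> - inner (Mul (\<lambda>x. V2t t x - profile \<kappa> st0 t x * V2t t x) \<phi>) \<psi> + inner (f t) e1"
  proof -
    have "inner (Reg h (f t)) (mul st0 t (ue t)) = inner (f t) (mul st0 t \<psi>) + inner (f t) e1"
      by (simp add: inner_Reg[OF h] e1_def inner_diff_right)
    also have "inner (f t) (mul st0 t \<psi>) = inner (Mul (\<lambda>x. profile \<kappa> st0 t x * V1 x) \<phi>) \<psi> + inner (Mul (\<lambda>x. profile \<kappa> st0 t x * V2t t x) \<phi>) \<psi>"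
      by (simp add: inner_Mul_left[OF b0, symmetric] feq Mul_add[OF b0] inner_add_left Mul_Mul[OF b0 V1] Mul_Mul[OF b0 bV2t])
    finally show ?thesis by (simp add: Mul_minus[OF bV2t bounded_mult_mult[OF b0 bV2t]] inner_diff_left)
  qed
  have T2: "\<bar>inner (Mul (\<lambda>x. profile \<kappa> st0 t x * V1 x) \<phi>) \<psi>\<bar> \<le> 10 * (M * k\<^sup>2) * N t"
    "\<bar>inner (Mul (\<lambda>x. V2t t x - profile \<kappa> st0 t x * V2t t x) \<phi>) \<psi>\<bar> \<le> 10 * (M * k\<^sup>2) * N t"
    unfolding k_def by (intro bound[OF small_multipliers(1)[OF t] nn(1)] bound[OF small_multipliers(2)[OF t] nn(1)])+
  \<comment> \<open>potentials against the divergence \<open>v' / (1 + t)\<close> of the velocity field; \<open>v'\<close> vanishes quadratically at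
    both ends, so it is small wherever either potential is not\<close>
  define e2 where "e2 = Reg h (mul st1 t (u t)) - mul st1 t \<phi>"
  have e2: "\<bar>inner (f t) e2\<bar> \<le> 1080 * M * h * N t"
  proof -
    have "norm e2 \<le> 540 * h * norm (u t)"
      using comm[OF b1 st1_derivative st_ends(3,4), of 60 "u t"] st2_bound by (simp add: e2_def \<phi>_def)
    from f_error[OF this] have "\<bar>inner (f t) e2\<bar> \<le> 1080 * M * h * (norm (u t) * norm (u t))" using h by (simp add: mult_ac)
    also have "\<dots> \<le> 1080 * M * h * N t" using M h by (intro mult_left_mono N_bounds) auto
    finally show ?thesis .
  qed
  have fB: "inner (Reg h (f t)) (mul st1 t (u t)) = inner (Mul (\<lambda>x. profile \<kappa> st1 t x * V1 x) \<phi>) \<phi>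
      + inner (Mul (\<lambda>x. profile \<kappa> st1 t x * V2t t x) \<phi>) \<phi> + inner (f t) e2"
  proof -
    have "inner (Reg h (f t)) (mul st1 t (u t)) = inner (f t) (mul st1 t \<phi>) + inner (f t) e2"
      by (simp add: inner_Reg[OF h] e2_def inner_diff_right)
    also have "inner (f t) (mul st1 t \<phi>) = inner (Mul (\<lambda>x. profile \<kappa> st1 t x * V1 x) \<phi>) \<phi> + inner (Mul (\<lambda>x. profile \<kappa> st1 t x * V2t t x) \<phi>) \<phi>"
      by (simp add: inner_Mul_left[OF b1, symmetric] feq Mul_add[OF b1] inner_add_left Mul_Mul[OF b1 V1] Mul_Mul[OF b1 bV2t])
    finally show ?thesis by simp
  qed
  have T3: "\<bar>inner (Mul (\<lambda>x. profile \<kappa> st1 t x * V1 x) \<phi>) \<phi>\<bar> \<le> 30 * (M * k\<^sup>2) * N t"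
    "\<bar>inner (Mul (\<lambda>x. profile \<kappa> st1 t x * V2t t x) \<phi>) \<phi>\<bar> \<le> 30 * (M * k\<^sup>2) * N t"
    unfolding k_def by (intro bound[OF small_multipliers(3)[OF t] nn(2)] bound[OF small_multipliers(4)[OF t] nn(2)])+
  have kB: "\<bar>k * inner (Reg h (f t)) (mul st1 t (u t))\<bar> \<le> 60 * (M * k\<^sup>2) * N t + 1080 * M * h * N t"
  proof -
    have "\<bar>inner (Reg h (f t)) (mul st1 t (u t))\<bar> \<le> 60 * (M * k\<^sup>2) * N t + 1080 * M * h * N t"
      unfolding fB using T3 e2 by linarith
    moreover have "\<bar>k * inner (Reg h (f t)) (mul st1 t (u t))\<bar> \<le> \<bar>inner (Reg h (f t)) (mul st1 t (u t))\<bar>"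
      unfolding abs_mult using k by (intro mult_left_le_one_le) auto
    ultimately show ?thesis by linarith
  qed
  \<comment> \<open>\<open>g\<close> commutes with both potentials, so the \<open>g\<close> term reduces to the commutator of \<open>g\<close> with the smoothing\<close>
  define e3 where "e3 = Reg h (mul leg t (u t)) - mul leg t \<phi>"
  have gf: "\<bar>inner (mul leg t (u t)) (I (Reg h (f t)))\<bar> \<le> 540 * M * h * N t"
  proof -
    have "norm e3 \<le> 270 * h * norm (u t)"
      using comm[OF bg leg_derivative, of 30 "u t"] z_st1 by (simp add: e3_def \<phi>_def st_ends)
    from f_error[of "I e3", unfolded norm_I, OF this] have "\<bar>inner (f t) (I e3)\<bar> \<le> 540 * M * h * (norm (u t) * norm (u t))" using h by (simp add: mult_ac)
    also have "\<dots> \<le> 540 * M * h * N t" using M h by (intro mult_left_mono N_bounds) auto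
    finally have e: "\<bar>inner (f t) (I e3)\<bar> \<le> 540 * M * h * N t" .
    have z: "inner (mul leg t \<phi>) (I (f t)) = 0"
    proof -
      have "inner (mul leg t \<phi>) (Mul m (I \<phi>)) = 0" if m: "bounded_mult m B" for m B
      proof -
        have "inner (mul leg t \<phi>) (Mul m (I \<phi>)) = inner (Mul (\<lambda>x. m x * profile \<kappa> leg t x) \<phi>) (I \<phi>)"
          by (simp add: inner_Mul_left[OF m, symmetric] Mul_Mul[OF m bg])
        then show ?thesis using inner_Mul_I[OF bounded_mult_mult[OF m bg]] by simp
      qed
      from this[OF V1] this[OF bV2t] show ?thesis
        by (simp add: feq linear_add[OF linear_I] inner_add_right Mul_I[OF V1, symmetric] Mul_I[OF bV2t, symmetric])
    qed
    have "inner (mul leg t (u t)) (I (Reg h (f t))) = inner (Reg h (mul leg t (u t))) (I (f t))"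
      by (simp add: Reg_transl_inv[OF transl_inv_I, symmetric] inner_Reg[OF h])
    also have "\<dots> = inner e3 (I (f t))" using z by (simp add: e3_def inner_diff_left)
    also have "\<dots> = - inner (f t) (I e3)" using inner_I_left[of e3 "f t"] by (simp add: inner_commute)
    finally show ?thesis using e by simp
  qed
  have "D t \<le> 30 * k\<^sup>2 * N t + 40 * (M * k\<^sup>2) * N t + 1080 * M * h * N t + 60 * (M * k\<^sup>2) * N t + 1080 * M * h * N t + 1080 * M * h * N t"
    using D_le[OF t] T1 T2 e1 fA kB gf unfolding k_def[symmetric] \<phi>_def[symmetric] \<psi>_def[symmetric] W2_Mul
    by linarith
  also have "\<dots> = (30 + 100 * M) * (k\<^sup>2 * N t) + 3240 * M * (h * N t)" by (simp add: algebra_simps)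
  also have "\<dots> \<le> (30 + 3240 * M) * (k\<^sup>2 * N t) + (30 + 3240 * M) * (h * N t)"
    using M h N_bounds(3)[of t] by (intro add_mono mult_right_mono) auto
  finally show ?thesis by (simp add: k_def algebra_simps)
qed

text \<open>The velocity term is absorbed by a quarter of the kinetic energy and \<open>norm u\<^sup>2\<close>. The added constant is
  \<open>2 M\<close> for the potentials, 1 for this absorption, 25 for \<open>g\<close>, and 1 in reserve for the norm itself.\<close>

lemma energy_bounds:
  "N t \<le> 4 * (K t + (2 * M + 27) * (norm (u t))\<^sup>2)"
  "K t + (2 * M + 27) * (norm (u t))\<^sup>2 \<le> (4 * M + 53) * N t"
proof -
  define n where "n = (norm (u t))\<^sup>2"
  define S where "S = (\<Sum>j\<in>UNIV. (norm (ud j t))\<^sup>2)"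
  have S0: "0 \<le> S" unfolding S_def by (rule sum_nonneg) simp
  have n0: "0 \<le> n" by (simp add: n_def)
  have kin: "(\<Sum>j\<in>UNIV. inner (ud j t) (ud j t)) = S" by (simp add: S_def power2_norm_eq_inner)
  have pot: "\<bar>inner (f t) (Reg h (u t))\<bar> \<le> 2 * (M * n)"
  proof -
    have "norm (Reg h (u t)) \<le> 1 * norm (u t)" using norm_Reg[OF h] by simp
    from f_error[OF this, of t] show ?thesis by (simp add: n_def power2_eq_square)
  qed
  have v: "\<bar>inner (mul st0 t (ue t)) (I (u t))\<bar> \<le> 1/4 * S + n"
  proof -
    have "\<bar>inner (mul st0 t (ue t)) (I (u t))\<bar> \<le> norm (ue t) * norm (u t)"
      using inner_bound[OF b0, of t "ue t" "I (u t)"] by (simp add: norm_I)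
    also have "\<dots> \<le> (norm (ue t))\<^sup>2 / 4 + (norm (u t))\<^sup>2"
      using sum_squares_bound[of "norm (ue t) / 2" "norm (u t)"] by (simp add: power_divide)
    also have "\<dots> \<le> 1/4 * S + n" using N_bounds(4)[of t] by (simp add: S_def n_def)
    finally show ?thesis .
  qed
  have g: "\<bar>inner (mul leg t (u t)) (u t)\<bar> \<le> 25 * n"
    using inner_bound[OF bg, of t "u t" "u t"] by (simp add: n_def power2_eq_square)
  have Kt: "K t = 1/2 * S + inner (f t) (Reg h (u t)) - inner (mul st0 t (ue t)) (I (u t)) + inner (mul leg t (u t)) (u t)"
    by (simp add: K_def kin)
  have Nt: "N t = n + S" by (simp add: N_def n_def S_def)
  have ml: "(2 * M + 27) * n = 2 * (M * n) + 27 * n" by (simp add: algebra_simps)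
  have mu: "(4 * M + 53) * (n + S) = 4 * (M * n) + 53 * n + (4 * M + 53) * S" by (simp add: algebra_simps)
  have "0 \<le> M * S" using M S0 by simp
  then have mS: "S \<le> (4 * M + 53) * S" using S0 by (simp add: algebra_simps)
  have Mn0: "0 \<le> M * n" using M n0 by simp
  note ab = pot[unfolded abs_le_iff] v[unfolded abs_le_iff] g[unfolded abs_le_iff]
  have "n + S \<le> 4 * (1/2 * S + a - b + c + (2 * m + 27 * n))"
    if "- a \<le> 2 * m" "b \<le> 1/4 * S + n" "- c \<le> 25 * n" for a b c m
    using that n0 by argo
  then show "N t \<le> 4 * (K t + (2 * M + 27) * (norm (u t))\<^sup>2)"
    unfolding Kt Nt n_def[symmetric] ml using ab by blast
  have "1/2 * S + a - b + c + (2 * m + 27 * n) \<le> 4 * m + 53 * n + S'"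
    if "a \<le> 2 * m" "- b \<le> 1/4 * S + n" "c \<le> 25 * n" "S \<le> S'" for a b c m S'
    using that n0 S0 by linarith
  then show "K t + (2 * M + 27) * (norm (u t))\<^sup>2 \<le> (4 * M + 53) * N t"
    unfolding Kt Nt n_def[symmetric] ml mu using ab mS by blast
qed

text \<open>Gronwall with the rate \<open>1 / (1 + t)\<^sup>2 + h\<close>, whose integral over \<open>[0, t]\<close> is at most \<open>1 + h t\<close>. Hence the bound is
  uniform in \<open>t\<close> as long as \<open>h \<le> 1 / t\<close>. The added multiple of \<open>norm u\<^sup>2\<close> makes the
  energy nonnegative and, as that norm is conserved, leaves its derivative unchanged.\<close>

theorem regularised_energy_estimate:
  assumes t: "0 \<le> t"
  defines "C \<equiv> 30 + 3240 * M"
  shows "N t \<le> 4 * (4 * M + 53) * exp (4 * C * (1 + h * t)) * N 0"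
proof -
  define L where "L s = K s + (2 * M + 27) * (norm (u s))\<^sup>2" for s
  \<comment> \<open>up to a constant the exponent is minus the integral of \<open>4 C\<close> times the rate\<close>
  define G where "G s = L s * exp (4 * C * (1 / (1 + s)) - 4 * C * h * s)" for s
  have C: "0 < C" using M by (simp add: C_def)
  have L': "(L has_real_derivative D s) (at s)" if "0 \<le> s" for s
  proof -
    have "L = (\<lambda>s. K s + (2 * M + 27) * (norm (u 0))\<^sup>2)"
    proof
      fix s show "L s = K s + (2 * M + 27) * (norm (u 0))\<^sup>2"
        using norm_u[of s] by (simp only: L_def)
    qed
    then show ?thesis using DERIV_add[OF K_derivative[OF that] DERIV_const] by simp
  qed
  have "G t \<le> G 0"
  proof (rule DERIV_nonpos_imp_nonincreasing[OF t])
    fix s assume s: "0 \<le> s" "s \<le> t"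
    define e where "e = exp (4 * C * (1 / (1 + s)) - 4 * C * h * s)"
    have "((\<lambda>s. exp (4 * C * (1 / (1 + s)) - 4 * C * h * s)) has_real_derivative e * (4 * C * (- (1 / (1 + s))\<^sup>2) - 4 * C * h)) (at s)"
      unfolding e_def using s by (auto intro!: derivative_eq_intros simp: power2_eq_square field_simps)
    from DERIV_mult[OF L'[OF s(1)] this]
    have "(G has_real_derivative D s * e + e * (4 * C * (- (1 / (1 + s))\<^sup>2) - 4 * C * h) * L s) (at s)"
      by (simp add: G_def[abs_def] e_def)
    moreover have "D s * e + e * (4 * C * (- (1 / (1 + s))\<^sup>2) - 4 * C * h) * L s \<le> 0"
    proof -
      have "D s \<le> C * ((1 / (1 + s))\<^sup>2 + h) * N s" unfolding C_def by (rule D_bound[OF s(1)])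
      also have "\<dots> \<le> C * ((1 / (1 + s))\<^sup>2 + h) * (4 * L s)"
        using C h energy_bounds(1)[of s] by (intro mult_left_mono) (auto simp: L_def)
      finally have "e * (D s - C * ((1 / (1 + s))\<^sup>2 + h) * (4 * L s)) \<le> e * 0"
        by (intro mult_left_mono) (auto simp: e_def)
      then show ?thesis by (simp add: algebra_simps)
    qed
    ultimately show "\<exists>y. DERIV G s :> y \<and> y \<le> 0" by blast
  qed
  then have G: "L t * exp (4 * C * (1 / (1 + t)) - 4 * C * h * t) \<le> L 0 * exp (4 * C)" by (simp add: G_def)
  have L0: "0 \<le> L s" for s using energy_bounds(1)[of s] N_bounds(3)[of s] by (simp add: L_def)
  have "L t = L t * exp (4 * C * (1 / (1 + t)) - 4 * C * h * t) * exp (4 * C * h * t - 4 * C * (1 / (1 + t)))"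
    by (simp add: mult.assoc flip: exp_add)
  also have "\<dots> \<le> L 0 * exp (4 * C) * exp (4 * C * h * t - 4 * C * (1 / (1 + t)))"
    by (intro mult_right_mono G) simp
  also have "\<dots> \<le> L 0 * exp (4 * C) * exp (4 * C * h * t)"
    using C t L0[of 0] by (intro mult_left_mono) auto
  also have "\<dots> = L 0 * exp (4 * C * (1 + h * t))" by (simp add: mult.assoc algebra_simps flip: exp_add)
  finally have "L t \<le> L 0 * exp (4 * C * (1 + h * t))" .
  moreover have "L 0 * exp (4 * C * (1 + h * t)) \<le> (4 * M + 53) * N 0 * exp (4 * C * (1 + h * t))"
    using energy_bounds(2)[of 0] by (intro mult_right_mono) (auto simp: L_def)
  moreover have "N t \<le> 4 * L t" using energy_bounds(1)[of t] by (simp add: L_def)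
  ultimately have "N t \<le> 4 * ((4 * M + 53) * N 0 * exp (4 * C * (1 + h * t)))" by linarith
  then show ?thesis by (simp only: mult.assoc mult.commute mult.left_commute)
qed

end


section \<open>Removing the regularisation\<close>

lemma Reg_tendsto: assumes "x \<longlonglongrightarrow> y" shows "(\<lambda>n. Reg (1 / Suc n) (x n)) \<longlonglongrightarrow> y"
  unfolding Reg_def by (intro Q_tendsto assms)

definition reg :: "real \<Rightarrow> (real \<Rightarrow> l2 \<Rightarrow> l2) \<Rightarrow> real \<Rightarrow> l2 \<Rightarrow> l2" where
  "reg h B t x = Reg h (B t (Reg h x))"

lemma admissible_reg: assumes B: "admissible B M" and h: "0 < h" shows "admissible (reg h B) M"
  unfolding admissible_def
proof (intro conjI allI)
  note Bp = admissibleD[OF B]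
  note lR = transl_invD(2)[OF transl_inv_Reg[OF h]]
  fix t x y
  show "0 < M" by (rule Bp(1))
  show "linear (reg h B t)"
    by (rule linearI) (simp_all add: reg_def linear_add[OF lR] linear_cmul[OF lR] linear_add[OF Bp(2)] linear_cmul[OF Bp(2)])
  have "norm (reg h B t x) \<le> norm (B t (Reg h x))" unfolding reg_def by (rule norm_Reg[OF h])
  also have "\<dots> \<le> M * norm (Reg h x)" by (rule Bp(3))
  also have "\<dots> \<le> M * norm x" using norm_Reg[OF h] Bp(1) by (intro mult_left_mono) auto
  finally show "norm (reg h B t x) \<le> M * norm x" .
  show "reg h B t (J x) = J (reg h B t x)" by (simp add: reg_def Reg_transl_inv[OF transl_inv_J] Bp(4))
  show "inner (reg h B t x) y = inner x (reg h B t y)" by (simp add: reg_def inner_Reg[OF h] Bp(5))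
  show "continuous_on UNIV (\<lambda>t. reg h B t x)"
    unfolding reg_def by (rule bounded_linear.continuous_on[OF transl_invD(1)[OF transl_inv_Reg[OF h]] Bp(6)])
qed

text \<open>Solving for \<open>z\<close> instead of the smoothed solution itself keeps \<open>Reg h\<close> as the outermost operator.\<close>

lemma smoothed_data_exists:
  assumes B: "admissible B M" and h: "0 < h"
  shows "\<exists>z. z 0 = x \<and> (\<forall>t. (z has_vector_derivative - U (- t) (J (B t (Reg h (U t (Reg h (z t))))))) (at t))"
proof (rule linear_ode_exists[where M = M])
  note Bp = admissibleD[OF B]
  note lR = transl_invD(2)[OF transl_inv_Reg[OF h]]
  show "0 < M" by (rule Bp(1))
  show "linear (\<lambda>x. - U (- t) (J (B t (Reg h (U t (Reg h x))))))" for t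
    by (rule linearI)
      (simp_all add: linear_add[OF linear_U] linear_add[OF Bp(2)] linear_add[OF transl_invD(2)[OF transl_inv_J]] linear_add[OF lR]
        linear_cmul[OF linear_U] linear_cmul[OF Bp(2)] linear_cmul[OF transl_invD(2)[OF transl_inv_J]] linear_cmul[OF lR])
  show "norm (- U (- t) (J (B t (Reg h (U t (Reg h x)))))) \<le> M * norm x" for t x
  proof -
    have "norm (- U (- t) (J (B t (Reg h (U t (Reg h x)))))) \<le> M * norm (Reg h (U t (Reg h x)))"
      using Bp(3)[of t "Reg h (U t (Reg h x))"] by simp
    also have "norm (Reg h (U t (Reg h x))) \<le> norm x"
      using norm_Reg[OF h, of "U t (Reg h x)"] norm_Reg[OF h, of x] by simp
    then have "M * norm (Reg h (U t (Reg h x))) \<le> M * norm x" using Bp(1) by (intro mult_left_mono) auto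
    finally show ?thesis .
  qed
  fix x
  have "continuous_on UNIV (\<lambda>t. Reg h (U t (Reg h x)))"
    by (rule bounded_linear.continuous_on[OF transl_invD(1)[OF transl_inv_Reg[OF h]] continuous_U])
  then have "continuous_on UNIV (\<lambda>t. B t (Reg h (U t (Reg h x))))"
    by (rule continuous_on_strong_compose[OF Bp(2,3,6)])
  then have c: "continuous_on UNIV (\<lambda>t. J (B t (Reg h (U t (Reg h x)))))"
    by (rule bounded_linear.continuous_on[OF bounded_linear_J])
  have "continuous_on UNIV (\<lambda>t. U (- t) (J (B t (Reg h (U t (Reg h x))))))"
    by (rule continuous_on_strong_compose[where A = "\<lambda>t. U (- t)" and C = 1, OF _ _ _ c])
      (simp_all add: linear_U continuous_U_uminus)
  then show "continuous_on UNIV (\<lambda>t. - U (- t) (J (B t (Reg h (U t (Reg h x))))))"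
    by (rule continuous_on_minus)
qed

lemma smoothed_data_mild:
  assumes h: "0 < h" and z: "z 0 = x"
    "\<And>t. (z has_vector_derivative - U (- t) (J (B t (Reg h (U t (Reg h (z t))))))) (at t)"
  shows "mild (reg h B) (Reg h x) (\<lambda>t. Reg h (z t))"
  unfolding mild_def
proof (intro conjI allI)
  fix t
  have "((\<lambda>t. Reg h (z t)) has_vector_derivative Reg h (- U (- t) (J (B t (Reg h (U t (Reg h (z t)))))))) (at t)"
    by (rule bounded_linear.has_vector_derivative[OF transl_invD(1)[OF transl_inv_Reg[OF h]] z(2)])
  moreover have "Reg h (- U (- t) (J (B t (Reg h (U t (Reg h (z t))))))) = interaction (reg h B) t (Reg h (z t))"
    by (simp add: interaction_def reg_def linear_neg[OF transl_invD(2)[OF transl_inv_Reg[OF h]]] Reg_transl_inv[OF transl_inv_U] Reg_transl_inv[OF transl_inv_J])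
  ultimately show "((\<lambda>t. Reg h (z t)) has_vector_derivative interaction (reg h B) t (Reg h (z t))) (at t)" by simp
qed (simp add: z)

text \<open>Both evolutions conserve norms, so the difference \<open>e\<close> of the two solutions changes only through the difference of
  the potentials applied to the fixed limit solution. That tends to 0 pointwise in time and is bounded, hence
  its time integral tends to 0.\<close>

lemma regularised_convergence:
  assumes B: "admissible B M" and y: "mild B x y" and \<kappa>: "\<bar>\<kappa>\<bar> = 1" and t: "0 \<le> t"
    and yn: "\<And>n. mild (reg (1 / Suc n) B) (Reg (1 / Suc n) x) (yn n)"
  shows "(\<lambda>n. yn n (\<kappa> * t)) \<longlonglongrightarrow> y (\<kappa> * t)"
proof -
  have hn: "0 < 1 / real (Suc n)" for n by simp
  define \<Psi> where "\<Psi> s = U s (y s)" for s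
  have \<Psi>c: "continuous_on UNIV \<Psi>" unfolding \<Psi>_def by (rule mild_solution_continuous[OF y])
  have \<Psi>n: "norm (\<Psi> s) = norm x" for s unfolding \<Psi>_def by (simp add: mild_norm[OF B y])
  define g where "g n s = norm (reg (1 / Suc n) B (\<kappa> * s) (\<Psi> (\<kappa> * s)) - B (\<kappa> * s) (\<Psi> (\<kappa> * s)))" for n s
  have cB: "continuous_on UNIV (\<lambda>s. B' (\<kappa> * s) (\<Psi> (\<kappa> * s)))" if "admissible B' M" for B'
  proof -
    have "continuous_on UNIV (\<lambda>s. B' s (\<Psi> s))"
      by (rule continuous_on_strong_compose[OF admissibleD(2,3,6)[OF that] \<Psi>c])
    then show ?thesis
      by (rule continuous_on_compose2[where f = "\<lambda>s. \<kappa> * s"]) (auto intro: continuous_intros)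
  qed
  have gc: "continuous_on UNIV (g n)" for n
    unfolding g_def by (intro continuous_on_norm continuous_on_diff cB B admissible_reg[OF B hn])
  have gb: "\<bar>g n s\<bar> \<le> 2 * M * norm x" for n s
  proof -
    have "norm (reg (1 / Suc n) B (\<kappa> * s) (\<Psi> (\<kappa> * s))) \<le> M * norm x"
      using admissibleD(3)[OF admissible_reg[OF B hn[of n]], of "\<kappa> * s" "\<Psi> (\<kappa> * s)"] by (simp add: \<Psi>n)
    moreover have "norm (B (\<kappa> * s) (\<Psi> (\<kappa> * s))) \<le> M * norm x"
      using admissibleD(3)[OF B, of "\<kappa> * s" "\<Psi> (\<kappa> * s)"] by (simp add: \<Psi>n)
    ultimately show ?thesis
      using norm_triangle_ineq4[of "reg (1 / Suc n) B (\<kappa> * s) (\<Psi> (\<kappa> * s))" "B (\<kappa> * s) (\<Psi> (\<kappa> * s))"]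
      unfolding g_def by simp
  qed
  have glim: "(\<lambda>n. g n s) \<longlonglongrightarrow> 0" for s
  proof -
    have "bounded_linear (B (\<kappa> * s))"
      by (rule bounded_linear_intro[where K = M])
        (auto simp: linear_add[OF admissibleD(2)[OF B]] linear_cmul[OF admissibleD(2)[OF B]] admissibleD(3)[OF B] mult.commute)
    then have "(\<lambda>n. B (\<kappa> * s) (Reg (1 / Suc n) (\<Psi> (\<kappa> * s)))) \<longlonglongrightarrow> B (\<kappa> * s) (\<Psi> (\<kappa> * s))"
      by (rule bounded_linear.tendsto) (rule Reg_tendsto[OF tendsto_const])
    from Reg_tendsto[OF this]
    have "(\<lambda>n. reg (1 / Suc n) B (\<kappa> * s) (\<Psi> (\<kappa> * s)) - B (\<kappa> * s) (\<Psi> (\<kappa> * s))) \<longlonglongrightarrow> 0"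
      unfolding reg_def by (simp add: LIM_zero)
    then show ?thesis unfolding g_def by (rule tendsto_norm_zero)
  qed
  have int: "(\<lambda>n. integral {0..t} (g n)) \<longlonglongrightarrow> 0"
  proof -
    have "(\<lambda>n. integral {0..t} (g n)) \<longlonglongrightarrow> integral {0..t} (\<lambda>s. 0::real)"
    proof (rule dominated_convergence(2)[where h = "\<lambda>s. 2 * M * norm x"])
      show "g n integrable_on {0..t}" for n
        by (rule integrable_continuous_real) (use gc continuous_on_subset in blast)
      show "(\<lambda>s. 2 * M * norm x) integrable_on {0..t}" by (rule integrable_const_ivl)
    qed (use gb glim in auto)
    then show ?thesis by simp
  qed
  define e where "e n s = yn n (\<kappa> * s) - y (\<kappa> * s)" for n s
  have en: "norm (e n s) \<le> 2 * norm x" for n s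
  proof -
    have "norm (yn n (\<kappa> * s)) \<le> norm x"
      using mild_norm[OF admissible_reg[OF B hn] yn, of n "\<kappa> * s"] norm_Reg[OF hn, of n x] by simp
    then show ?thesis
      using norm_triangle_ineq4[of "yn n (\<kappa> * s)" "y (\<kappa> * s)"] mild_norm[OF B y, of "\<kappa> * s"] by (simp add: e_def)
  qed
  have bound: "(norm (e n t))\<^sup>2 \<le> (norm (e n 0))\<^sup>2 + 4 * norm x * integral {0..t} (g n)" for n
  proof -
    let ?B = "reg (1 / Suc n) B"
    note Bn = admissible_reg[OF B hn[of n]]
    let ?F = "antiderivative (g n)"
    have F: "?F t = integral {0..t} (g n)"
    proof -
      have "((g n) has_integral (?F t - ?F 0)) {0..t}"
        by (rule fundamental_theorem_of_calculus[OF t]) (auto intro: has_vector_derivative_at_within antiderivative(2)[OF gc])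
      then show ?thesis by (simp add: antiderivative(1)[OF gc] integral_unique)
    qed
    define e' where "e' s = \<kappa> *\<^sub>R (interaction ?B (\<kappa> * s) (yn n (\<kappa> * s)) - interaction B (\<kappa> * s) (y (\<kappa> * s)))" for s
    have e': "(e n has_vector_derivative e' s) (at s)" for s
      unfolding e_def[abs_def] e'_def scaleR_diff_right
      by (intro has_vector_derivative_diff reflect_derivative) (use yn[of n] y in \<open>auto simp: mild_def\<close>)
    have le: "inner (e n s) (e' s) \<le> 2 * norm x * g n s" for s
    proof -
      define v where "v = interaction ?B (\<kappa> * s) (y (\<kappa> * s)) - interaction B (\<kappa> * s) (y (\<kappa> * s))"
      have "e' s = \<kappa> *\<^sub>R (interaction ?B (\<kappa> * s) (e n s) + v)"
        using linear_diff[OF interaction_properties(1)[OF Bn], of "\<kappa> * s" "yn n (\<kappa> * s)" "y (\<kappa> * s)"]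
        by (simp add: e'_def v_def e_def)
      then have "inner (e n s) (e' s) = \<kappa> * inner (e n s) v"
        using interaction_properties(4)[OF Bn, of "e n s" "\<kappa> * s"] by (simp add: inner_add_right del: of_nat_Suc)
      also have "\<dots> \<le> norm (e n s) * norm v"
        using Cauchy_Schwarz_ineq2[of "e n s" v] \<kappa> abs_ge_self[of "\<kappa> * inner (e n s) v"] by (simp add: abs_mult)
      also have "norm v = g n s"
      proof -
        have "v = - U (- (\<kappa> * s)) (J (?B (\<kappa> * s) (\<Psi> (\<kappa> * s)) - B (\<kappa> * s) (\<Psi> (\<kappa> * s))))"
          by (simp add: v_def interaction_def \<Psi>_def linear_diff[OF linear_U] linear_diff[OF transl_invD(2)[OF transl_inv_J]])
        then show ?thesis by (simp add: g_def)
      qed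
      also have "norm (e n s) * g n s \<le> 2 * norm x * g n s"
        by (rule mult_right_mono[OF en]) (simp add: g_def)
      finally show ?thesis .
    qed
    have "inner (e n t) (e n t) - 4 * norm x * ?F t \<le> inner (e n 0) (e n 0) - 4 * norm x * ?F 0"
    proof (rule DERIV_nonpos_imp_nonincreasing[OF t])
      fix s
      have "((\<lambda>s. inner (e n s) (e n s) - 4 * norm x * ?F s) has_real_derivative
          (inner (e n s) (e' s) + inner (e' s) (e n s)) - 4 * norm x * g n s) (at s)"
        by (intro DERIV_diff has_real_derivative_inner DERIV_cmult e')
          (use antiderivative(2)[OF gc, of n s] in \<open>simp add: has_real_derivative_iff_has_vector_derivative\<close>)
      moreover have "(inner (e n s) (e' s) + inner (e' s) (e n s)) - 4 * norm x * g n s \<le> 0"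
        using le[of s] by (simp add: inner_commute)
      ultimately show "\<exists>d. DERIV (\<lambda>s. inner (e n s) (e n s) - 4 * norm x * ?F s) s :> d \<and> d \<le> 0" by blast
    qed
    then show ?thesis by (simp add: F antiderivative(1)[OF gc] power2_norm_eq_inner)
  qed
  have "(\<lambda>n. (norm (e n t))\<^sup>2) \<longlonglongrightarrow> 0"
  proof (rule real_tendsto_sandwich[where f = "\<lambda>n. 0" and h = "\<lambda>n. (norm (e n 0))\<^sup>2 + 4 * norm x * integral {0..t} (g n)"])
    have "(\<lambda>n. Reg (1 / Suc n) x - x) \<longlonglongrightarrow> 0" by (rule LIM_zero[OF Reg_tendsto[OF tendsto_const]])
    moreover have "e n 0 = Reg (1 / Suc n) x - x" for n using yn[of n] y by (simp add: e_def mild_def)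
    ultimately have "(\<lambda>n. norm (e n 0)) \<longlonglongrightarrow> 0" by (simp add: tendsto_norm_zero)
    then have "(\<lambda>n. (norm (e n 0))\<^sup>2 + 4 * norm x * integral {0..t} (g n)) \<longlonglongrightarrow> 0\<^sup>2 + 4 * norm x * 0"
      by (intro tendsto_intros int)
    then show "(\<lambda>n. (norm (e n 0))\<^sup>2 + 4 * norm x * integral {0..t} (g n)) \<longlonglongrightarrow> 0" by simp
  qed (use bound in auto)
  from tendsto_real_sqrt[OF this] have "(\<lambda>n. norm (e n t)) \<longlonglongrightarrow> 0" by simp
  then show ?thesis by (simp add: e_def tendsto_norm_zero_iff LIM_zero_iff)
qed

text \<open>The energy estimate with \<open>h t \<le> 1\<close>.\<close>

definition growth :: "real \<Rightarrow> real" where "growth M = 4 * (4 * M + 53) * exp (8 * (30 + 3240 * M))"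

text \<open>For fixed \<open>t\<close> the smoothing widths \<open>1 / (n + 1)\<close> with \<open>n > t\<close> satisfy \<open>h t \<le> 1\<close>, which gives bounds on the
  derivatives independent of \<open>n\<close>; these pass to the limit weakly. Smoothing does not increase the norms of the
  initial data.\<close>

lemma solution_derivative_bound:
  assumes \<kappa>: "\<kappa> = 1 \<or> \<kappa> = -1" and t: "0 \<le> t" and M: "0 < M" and V: "bounded_mult V1 M" "bounded_mult V2 M"
    and decay: "\<And>x. (1 + norm x)\<^sup>2 * \<bar>V1 x\<bar> \<le> M" "\<And>x. (1 + norm x)\<^sup>2 * \<bar>V2 x\<bar> \<le> M"
    and x: "\<And>j. gen j x (g j)" and y: "mild (pot V1 V2) x y"
  shows "\<exists>G. gen j (U (\<kappa> * t) (y (\<kappa> * t))) G \<and> (norm G)\<^sup>2 \<le> growth M * ((norm x)\<^sup>2 + (\<Sum>j\<in>UNIV. (norm (g j))\<^sup>2))"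
proof -
  note B = admissible_pot[OF V M]
  have hn: "0 < 1 / real (Suc n)" for n by simp
  have "\<exists>z. \<forall>n. z n 0 = x \<and> (\<forall>t. (z n has_vector_derivative
      - U (- t) (J (pot V1 V2 t (Reg (1 / Suc n) (U t (Reg (1 / Suc n) (z n t))))))) (at t))"
    by (rule choice) (use smoothed_data_exists[OF B hn] in blast)
  then obtain z where z0: "\<And>n. z n 0 = x" and z: "\<And>n t. (z n has_vector_derivative
      - U (- t) (J (pot V1 V2 t (Reg (1 / Suc n) (U t (Reg (1 / Suc n) (z n t))))))) (at t)"
    by blast
  have loc: "regularised \<kappa> (1 / Suc n) M V1 V2 (z n)" for n
    by (rule regularised.intro) (use \<kappa> M V decay z in auto)
  define N0 where "N0 = (norm x)\<^sup>2 + (\<Sum>j\<in>UNIV. (norm (g j))\<^sup>2)"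
  have N00: "0 \<le> N0" unfolding N0_def by (intro add_nonneg_nonneg sum_nonneg) auto
  define un where "un n = U (\<kappa> * t) (Reg (1 / Suc n) (z n (\<kappa> * t)))" for n
  have "mild (reg (1 / Suc n) (pot V1 V2)) (Reg (1 / Suc n) x) (\<lambda>t. Reg (1 / Suc n) (z n t))" for n
    by (rule smoothed_data_mild[where z = "z n", OF hn z0]) (rule z)
  then have "(\<lambda>n. Reg (1 / Suc n) (z n (\<kappa> * t))) \<longlonglongrightarrow> y (\<kappa> * t)"
    using \<kappa> by (intro regularised_convergence[OF B y _ t]) auto
  then have lim: "un \<longlonglongrightarrow> U (\<kappa> * t) (y (\<kappa> * t))"
    unfolding un_def by (rule bounded_linear.tendsto[OF bounded_linear_U])
  obtain n0 where n0: "t < real n0" using reals_Archimedean2 by blast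
  have ex: "\<exists>d. gen j (un n) d \<and> norm d \<le> sqrt (growth M * N0)" if n: "n0 \<le> n" for n
  proof -
    define h where "h = 1 / real (Suc n)"
    have h: "0 < h" by (simp add: h_def)
    have ht: "h * t \<le> 1" using n0 n by (simp add: h_def field_simps)
    interpret regularised \<kappa> h M V1 V2 "z n" unfolding h_def by (rule loc)
    have zt0: "zt 0 = x" by (simp add: zt_def z0)
    have "un n = U (\<kappa> * t) (Reg h (z n (\<kappa> * t)))" by (simp only: un_def h_def)
    then have ut: "u t = un n" by (simp add: u_def zt_def Reg_transl_inv[OF transl_inv_U])
    have N0le: "N 0 \<le> N0"
      unfolding N_def N0_def
    proof (intro add_mono sum_mono power_mono norm_ge_zero)
      show "norm (u 0) \<le> norm x" unfolding u_def zt0 by (rule norm_Reg[OF h])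
      show "norm (ud i 0) \<le> norm (g i)" for i
      proof -
        have "gen i (u 0) (Reg h (g i))" unfolding u_def zt0 by (rule gen_transl_inv[OF transl_inv_Reg[OF h] x])
        then have "ud i 0 = Reg h (g i)" using gen_u gen_unique by blast
        then show ?thesis using norm_Reg[OF h] by simp
      qed
    qed
    have "(norm (ud j t))\<^sup>2 \<le> (\<Sum>j\<in>UNIV. (norm (ud j t))\<^sup>2)"
      by (rule member_le_sum[of j UNIV "\<lambda>j. (norm (ud j t))\<^sup>2"]) auto
    also have "\<dots> \<le> N t" by (simp add: N_def)
    also have "\<dots> \<le> 4 * (4 * M + 53) * exp (4 * (30 + 3240 * M) * (1 + h * t)) * N 0"
      by (rule regularised_energy_estimate[OF t])
    also have "\<dots> \<le> growth M * N0"
    proof (intro mult_mono N0le)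
      have "4 * (30 + 3240 * M) * (1 + h * t) \<le> 4 * (30 + 3240 * M) * 2"
        using ht M by (intro mult_left_mono) auto
      then have "exp (4 * (30 + 3240 * M) * (1 + h * t)) \<le> exp (8 * (30 + 3240 * M))" by simp
      then show "4 * (4 * M + 53) * exp (4 * (30 + 3240 * M) * (1 + h * t)) \<le> growth M"
        unfolding growth_def using M by (intro mult_left_mono) auto
    qed (use M N_bounds in \<open>auto simp: growth_def\<close>)
    finally have "norm (ud j t) \<le> sqrt (growth M * N0)" by (rule real_le_rsqrt)
    with gen_u[of j t] show ?thesis unfolding ut by blast
  qed
  then have "\<exists>d. \<forall>n. gen j (un (n + n0)) (d n) \<and> norm (d n) \<le> sqrt (growth M * N0)"
    by (intro choice) simp
  then obtain d where d: "\<And>n. gen j (un (n + n0)) (d n)" "\<And>n. norm (d n) \<le> sqrt (growth M * N0)" by blast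
  from gen_weak_limit[OF LIMSEQ_ignore_initial_segment[OF lim] d]
  obtain G where G: "gen j (U (\<kappa> * t) (y (\<kappa> * t))) G" "norm G \<le> sqrt (growth M * N0)" by blast
  have "(norm G)\<^sup>2 \<le> (sqrt (growth M * N0))\<^sup>2" by (rule power_mono[OF G(2)]) simp
  also have "\<dots> = growth M * N0"
    using M N00 by (intro real_sqrt_pow2 mult_nonneg_nonneg) (auto simp: growth_def)
  finally show ?thesis using G(1) unfolding N0_def by blast
qed

section \<open>Uniform bound for the charge transfer evolution\<close>

text \<open>Negative times are covered by \<open>\<kappa> = -1\<close>.\<close>

lemma evolution_H1_bound:
  assumes M: "0 < M" and V: "bounded_mult V1 M" "bounded_mult V2 M"
    and decay: "\<And>x. (1 + norm x)\<^sup>2 * \<bar>V1 x\<bar> \<le> M" "\<And>x. (1 + norm x)\<^sup>2 * \<bar>V2 x\<bar> \<le> M"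
    and \<psi>0: "\<psi>0 \<in> H1"
  shows "evolution V1 V2 t 0 \<psi>0 \<in> H1"
    "H1_norm (evolution V1 V2 t 0 \<psi>0) \<le> sqrt (1 + 3 * growth M) * H1_norm \<psi>0"
proof -
  have L: "\<psi>0 \<in> L2" using \<psi>0 by (simp add: H1_def)
  have "\<exists>g. \<forall>j. gen j (cls \<psi>0) (g j)" by (rule choice) (use \<psi>0 in \<open>simp add: H1_iff_gen\<close>)
  then obtain g where g: "\<And>j. gen j (cls \<psi>0) (g j)" by blast
  obtain y where y: "mild (pot V1 V2) (cls \<psi>0) y" using mild_exists[OF admissible_pot[OF V M]] by blast
  note ev = evolution_mild[OF V M L y, of t]
  define \<kappa> where "\<kappa> = (if 0 \<le> t then 1 else -1 :: real)"
  have \<kappa>: "\<kappa> = 1 \<or> \<kappa> = -1" "\<kappa> * \<bar>t\<bar> = t" by (auto simp: \<kappa>_def)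
  define N0 where "N0 = (norm (cls \<psi>0))\<^sup>2 + (\<Sum>j\<in>UNIV. (norm (g j))\<^sup>2)"
  have "\<exists>G. gen j (U t (y t)) G \<and> (norm G)\<^sup>2 \<le> growth M * N0" for j
    using solution_derivative_bound[OF \<kappa>(1) abs_ge_zero[of t] M V decay g y, of j] by (simp only: \<kappa>(2) N0_def)
  then have "\<exists>G. \<forall>j. gen j (U t (y t)) (G j) \<and> (norm (G j))\<^sup>2 \<le> growth M * N0" by (intro choice) blast
  then obtain G where G: "\<And>j. gen j (U t (y t)) (G j)" "\<And>j. (norm (G j))\<^sup>2 \<le> growth M * N0" by blast
  show "evolution V1 V2 t 0 \<psi>0 \<in> H1" using ev G by (auto simp: H1_iff_gen)
  have n: "norm (y t) = norm (cls \<psi>0)" using mild_norm[OF admissible_pot[OF V M] y] .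
  have "H1_norm (evolution V1 V2 t 0 \<psi>0) = sqrt ((norm (cls \<psi>0))\<^sup>2 + (\<Sum>j\<in>UNIV. (norm (G j))\<^sup>2))"
    using H1_norm_gen[OF ev(1), of G] G(1) by (simp add: ev(2) n)
  also have "\<dots> \<le> sqrt ((1 + 3 * growth M) * N0)"
  proof (rule real_sqrt_le_mono)
    have "(\<Sum>j\<in>(UNIV::3 set). (norm (G j))\<^sup>2) \<le> (\<Sum>j\<in>(UNIV::3 set). growth M * N0)" by (rule sum_mono) (rule G)
    then have "(\<Sum>j\<in>(UNIV::3 set). (norm (G j))\<^sup>2) \<le> 3 * growth M * N0" by simp
    moreover have "(norm (cls \<psi>0))\<^sup>2 \<le> N0" unfolding N0_def by (simp add: sum_nonneg)
    ultimately show "(norm (cls \<psi>0))\<^sup>2 + (\<Sum>j\<in>UNIV. (norm (G j))\<^sup>2) \<le> (1 + 3 * growth M) * N0"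
      by (simp add: algebra_simps)
  qed
  also have "\<dots> = sqrt (1 + 3 * growth M) * H1_norm \<psi>0"
    using H1_norm_gen[OF L g] by (simp add: real_sqrt_mult N0_def)
  finally show "H1_norm (evolution V1 V2 t 0 \<psi>0) \<le> sqrt (1 + 3 * growth M) * H1_norm \<psi>0" .
qed

lemma exponential_decay_quadratic:
  assumes "exponentially_decaying V" shows "\<exists>M. \<forall>x. (1 + norm x)\<^sup>2 * \<bar>V x\<bar> \<le> M"
proof -
  obtain C c where c: "0 < c" "\<And>x. \<bar>V x\<bar> \<le> C * exp (- c * norm x)"
    using assms by (auto simp: exponentially_decaying_def)
  define k where "k = max 1 (2 / c)"
  have k: "1 \<le> k" "1 \<le> k * (c / 2)" using c(1) by (auto simp: k_def max_def field_simps)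
  have "(1 + norm x)\<^sup>2 * \<bar>V x\<bar> \<le> k\<^sup>2 * C" for x
  proof -
    have "1 + norm x \<le> k + (k * (c / 2)) * norm x"
      using k mult_right_mono[OF k(2) norm_ge_zero[of x]] by simp
    also have "\<dots> = k * (1 + c / 2 * norm x)" by (simp add: algebra_simps)
    also have "\<dots> \<le> k * exp (c / 2 * norm x)"
      using k(1) by (intro mult_left_mono exp_ge_add_one_self) auto
    finally have "(1 + norm x)\<^sup>2 \<le> (k * exp (c / 2 * norm x))\<^sup>2" by (intro power_mono) auto
    also have "\<dots> = k\<^sup>2 * exp (c * norm x)" by (simp add: power_mult_distrib flip: exp_double)
    finally have "(1 + norm x)\<^sup>2 * \<bar>V x\<bar> \<le> (k\<^sup>2 * exp (c * norm x)) * (C * exp (- c * norm x))"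
      by (intro mult_mono c(2)) auto
    also have "\<dots> = k\<^sup>2 * C" by (simp add: exp_minus)
    finally show ?thesis .
  qed
  then show ?thesis by blast
qed

lemma compact_support_quadratic:
  fixes V :: "real^3 \<Rightarrow> real"
  assumes "continuous_on UNIV V" "compact_support V"
  shows "\<exists>M. \<forall>x. (1 + norm x)\<^sup>2 * \<bar>V x\<bar> \<le> M"
proof -
  let ?K = "closure {x. V x \<noteq> 0}" and ?F = "\<lambda>x. (1 + norm x)\<^sup>2 * \<bar>V x\<bar>"
  have "compact (?F ` ?K)"
    using assms unfolding compact_support_def
    by (intro compact_continuous_image continuous_intros) (auto intro: continuous_on_subset)
  then have "bounded (?F ` ?K)" by (rule compact_imp_bounded)
  then obtain b where b: "\<And>x. x \<in> ?K \<Longrightarrow> norm (?F x) \<le> b" by (auto simp: bounded_iff)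
  have "?F x \<le> max b 0" for x
  proof (cases "x \<in> ?K")
    case True
    then show ?thesis using b[of x] by (simp add: le_max_iff_disj)
  next
    case False
    then have "V x = 0" using closure_subset[of "{x. V x \<noteq> 0}"] by auto
    then show ?thesis by simp
  qed
  then show ?thesis by blast
qed

lemma potential_decay:
  assumes "smooth V" "exponentially_decaying V \<or> compact_support V"
  shows "V \<in> borel_measurable lebesgue" "\<exists>M. \<forall>x. (1 + norm x)\<^sup>2 * \<bar>V x\<bar> \<le> M"
proof -
  have "C_class 0 V" using assms(1) by (simp only: smooth_def)
  then have c: "continuous_on UNIV V" by simp
  then show "V \<in> borel_measurable lebesgue" by (rule continuous_measurable_lebesgue)
  show "\<exists>M. \<forall>x. (1 + norm x)\<^sup>2 * \<bar>V x\<bar> \<le> M"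
    using assms(2) exponential_decay_quadratic compact_support_quadratic[OF c] by blast
qed

lemma bounded_mult_of_decay:
  assumes "V \<in> borel_measurable lebesgue" "\<And>x. (1 + norm x)\<^sup>2 * \<bar>V x\<bar> \<le> M" shows "bounded_mult V M"
proof -
  have "\<bar>V x\<bar> \<le> M" for x
  proof -
    have "1 \<le> (1 + norm x)\<^sup>2" by simp
    then have "1 * \<bar>V x\<bar> \<le> (1 + norm x)\<^sup>2 * \<bar>V x\<bar>" by (intro mult_right_mono) auto
    then show ?thesis using assms(2)[of x] by simp
  qed
  then show ?thesis using assms(1) by (simp add: bounded_mult_def)
qed

theorem theorem1p4:
  fixes V1 V2 :: "real^3 \<Rightarrow> real"
  assumes "smooth V1" and "smooth V2"
    and "exponentially_decaying V1 \<or> compact_support V1"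
    and "exponentially_decaying V2 \<or> compact_support V2"
    and "\<not> is_eigenvalue V1 0" and "\<not> is_eigenvalue V2 0"
    and "\<nexists>\<psi>. is_zero_resonance V1 \<psi>" and "\<nexists>\<psi>. is_zero_resonance V2 \<psi>"
  shows "\<exists>C::real. C \<ge> 0 \<and> (\<forall>\<psi>0\<in>H1.
           (\<forall>t. evolution V1 V2 t 0 \<psi>0 \<in> H1) \<and>
           (SUP t. ennreal (H1_norm (evolution V1 V2 t 0 \<psi>0))) \<le> ennreal (C * H1_norm \<psi>0))"
proof -
  obtain M1 where M1: "\<And>x. (1 + norm x)\<^sup>2 * \<bar>V1 x\<bar> \<le> M1" using potential_decay(2)[OF assms(1,3)] by blast
  obtain M2 where M2: "\<And>x. (1 + norm x)\<^sup>2 * \<bar>V2 x\<bar> \<le> M2" using potential_decay(2)[OF assms(2,4)] by blast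
  define M where "M = max 1 (max M1 M2)"
  have M: "0 < M" by (simp add: M_def)
  have d1: "(1 + norm x)\<^sup>2 * \<bar>V1 x\<bar> \<le> M" for x using M1[of x] by (simp add: M_def)
  have d2: "(1 + norm x)\<^sup>2 * \<bar>V2 x\<bar> \<le> M" for x using M2[of x] by (simp add: M_def)
  have V: "bounded_mult V1 M" "bounded_mult V2 M"
    using bounded_mult_of_decay potential_decay(1) assms(1-4) d1 d2 by blast+
  note bound = evolution_H1_bound[OF M V d1 d2]
  show ?thesis
  proof (intro exI[of _ "sqrt (1 + 3 * growth M)"] conjI ballI allI)
    have "0 \<le> growth M" using M by (simp add: growth_def)
    then show "0 \<le> sqrt (1 + 3 * growth M)" by simp
  qed (auto intro!: SUP_least ennreal_leI bound)
qed


end
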